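(* Consider two samples $X_i(t)=\mu(t)+\varepsilon_i(t)$, $1\le i\le N$, and $X^*_j(t)=\mu^*(t)+\varepsilon^*_j(t)$, $1\le j\le M$, $t\in[0,1]$, with $\mu,\mu^*\in L^2([0,1])$. Suppose $(\varepsilon_i)$ satisfies: $\varepsilon_i=f(\delta_i,\delta_{i-1},\ldots)$ with $(\delta_i)$ i.i.d. in a measurable space $S$ and $f:S^\infty\to L^2$ measurable; $\sum_{m\ge1}(E\int_0^1(\varepsilon_i(t)-\varepsilon_{i,m}(t))^2dt)^{1/2}<\infty$, where $\varepsilon_{i,m}=f(\delta_i,\ldots,\delta_{i-m+1},\delta^{(m)}_{i,i-m},\delta^{(m)}_{i,i-m-1},\ldots)$ with $(\delta^{(m)}_{i,k})_k$ independent copies of $(\delta_k)$; $E\varepsilon_0=0$ in $L^2$; $\int_0^1E\varepsilon_0^2(t)dt<\infty$. Suppose $(\varepsilon^*_j)$ satisfies the same conditions (with its own i.i.d. sequence and function $f^*$). Suppose $\{\varepsilon_i,1\le i\le N\}$ and $\{\varepsilon^*_j,1\le j\le M\}$ are independent, that $H_0:\mu=\mu^*$ (in $L^2$) holds, and that $N/(N+M)\to\theta$ for some $0\le\theta\le1$ as $\min(M,N)\to\infty$. Let $\bar X_N=N^{-1}\sum_{i=1}^NX_i$, $\bar X^*_M=M^{-1}\sum_{j=1}^MX^*_j$ and $$U_{N,M}=\frac{NM}{N+M}\int_0^1(\bar X_N(t)-\bar X^*_M(t))^2dt.$$ Then $U_{N,M}\to\int_0^1\Gamma^2(t)dt$ in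 distribution as $\min(M,N)\to\infty$, where $\{\Gamma(t),0\le t\le1\}$ is a mean zero Gaussian process with $E[\Gamma(t)\Gamma(s)]=d(t,s):=(1-\theta)c(t,s)+\theta c^*(t,s)$, with $c(t,s)=E\varepsilon_0(t)\varepsilon_0(s)+\sum_{i\ge1}E\varepsilon_0(t)\varepsilon_i(s)+\sum_{i\ge1}E\varepsilon_0(s)\varepsilon_i(t)$ and $c^*$ defined identically in terms of the $\varepsilon^*_j$.
   Context: $L^2=L^2([0,1])$. Equality $\mu=\mu^*$ means $\int_0^1(\mu(t)-\mu^*(t))^2dt=0$. *)

theory Defs
  imports "HOL-Probability.Probability"
begin

text \<open>Square-integrable (Borel) functions on [0,1]; elements of L^2([0,1]) are represented
  by such functions, equality in L^2 being a.e. equality.\<close>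
definition L2 :: "(real \<Rightarrow> real) set" where
  "L2 = {g. g \<in> borel_measurable borel \<and> set_integrable lborel {0..1} (\<lambda>t. (g t)^2)}"

definition bernoulli_shift ::
  "'a measure \<Rightarrow> 's measure \<Rightarrow> (int \<Rightarrow> 'a \<Rightarrow> 's) \<Rightarrow> ((nat \<Rightarrow> 's) \<Rightarrow> real \<Rightarrow> real)
     \<Rightarrow> (int \<Rightarrow> 'a \<Rightarrow> real \<Rightarrow> real) \<Rightarrow> bool" where
  "bernoulli_shift M S \<delta> f eps \<longleftrightarrow>
     prob_space.indep_vars M (\<lambda>_. S) \<delta> UNIV \<and>
     (\<forall>i. distr M S (\<delta> i) = distr M S (\<delta> 0)) \<and>
     (\<lambda>(x, t). f x t) \<in> borel_measurable (PiM UNIV (\<lambda>_. S) \<Otimes>\<^sub>M lborel) \<and>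
     (\<forall>x \<in> space (PiM UNIV (\<lambda>_. S)). f x \<in> L2) \<and>
     (\<forall>i. \<forall>\<omega>\<in>space M. eps i \<omega> = f (\<lambda>k. \<delta> (i - int k) \<omega>))"

text \<open>E int_0^1 (eps_i(t) - eps_{i,m}(t))^2 dt, where eps_{i,m} replaces
  delta_{i-m}, delta_{i-m-1}, ... by an independent copy.  Since the delta's are i.i.d.
  with law P and the copy is independent, this expectation is the integral below
  (x k plays delta_{i-k}, y k plays the copy delta^{(m)}_{i,i-k}).\<close>
definition approx_err :: "'s measure \<Rightarrow> ((nat \<Rightarrow> 's) \<Rightarrow> real \<Rightarrow> real) \<Rightarrow> nat \<Rightarrow> ennreal" where
  "approx_err P f m =
     (\<integral>\<^sup>+ x. \<integral>\<^sup>+ y. \<integral>\<^sup>+ t. indicator {0..1} t *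
         ennreal ((f x t - f (\<lambda>k. if k < m then x k else y k) t)^2) \<partial>lborel
       \<partial>PiM UNIV (\<lambda>_. P) \<partial>PiM UNIV (\<lambda>_. P))"

definition error_assumptions ::
  "'a measure \<Rightarrow> 's measure \<Rightarrow> (int \<Rightarrow> 'a \<Rightarrow> 's) \<Rightarrow> ((nat \<Rightarrow> 's) \<Rightarrow> real \<Rightarrow> real)
     \<Rightarrow> (int \<Rightarrow> 'a \<Rightarrow> real \<Rightarrow> real) \<Rightarrow> bool" where
  "error_assumptions M S \<delta> f eps \<longleftrightarrow>
     bernoulli_shift M S \<delta> f eps \<and>
     (\<forall>m\<ge>1. approx_err (distr M S (\<delta> 0)) f m < \<infinity>) \<and>
     summable (\<lambda>m. sqrt (enn2real (approx_err (distr M S (\<delta> 0)) f (Suc m)))) \<and>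
     (AE t in lborel. t \<in> {0..1} \<longrightarrow> (\<integral>\<omega>. eps 0 \<omega> t \<partial>M) = 0) \<and>
     (\<integral>\<^sup>+ t. indicator {0..1} t * (\<integral>\<^sup>+ \<omega>. ennreal ((eps 0 \<omega> t)^2) \<partial>M) \<partial>lborel) < \<infinity>"

definition lrcov :: "'a measure \<Rightarrow> (int \<Rightarrow> 'a \<Rightarrow> real \<Rightarrow> real) \<Rightarrow> real \<Rightarrow> real \<Rightarrow> real" where
  "lrcov M eps t s =
     (\<integral>\<omega>. eps 0 \<omega> t * eps 0 \<omega> s \<partial>M)
     + (\<Sum>i. \<integral>\<omega>. eps 0 \<omega> t * eps (int i + 1) \<omega> s \<partial>M)
     + (\<Sum>i. \<integral>\<omega>. eps 0 \<omega> s * eps (int i + 1) \<omega> t \<partial>M)"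

text \<open>Mean zero Gaussian process on [0,1] (jointly measurable) with covariance d:
  every finite linear combination of values is centred normal (characteristic function
  exp(-u^2 v/2), v its second moment; v = 0 allowed), and E G(t)G(s) = d(t,s) for almost
  every (t,s) in [0,1]^2 (d is a kernel in L^2, defined only almost everywhere).\<close>
definition gaussian_process :: "'b measure \<Rightarrow> ('b \<Rightarrow> real \<Rightarrow> real) \<Rightarrow> (real \<Rightarrow> real \<Rightarrow> real) \<Rightarrow> bool" where
  "gaussian_process \<Omega> G d \<longleftrightarrow>
     prob_space \<Omega> \<and>
     (\<lambda>(\<omega>, t). G \<omega> t) \<in> borel_measurable (\<Omega> \<Otimes>\<^sub>M lborel) \<and>
     (\<forall>n (T :: nat \<Rightarrow> real) (a :: nat \<Rightarrow> real). (\<forall>k<n. T k \<in> {0..1}) \<longrightarrow>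
        integrable \<Omega> (\<lambda>\<omega>. (\<Sum>k<n. a k * G \<omega> (T k))^2) \<and>
        (\<integral>\<omega>. (\<Sum>k<n. a k * G \<omega> (T k)) \<partial>\<Omega>) = 0 \<and>
        (\<forall>u. char (distr \<Omega> borel (\<lambda>\<omega>. \<Sum>k<n. a k * G \<omega> (T k))) u =
              complex_of_real (exp (- (u^2 * (\<integral>\<omega>. (\<Sum>k<n. a k * G \<omega> (T k))^2 \<partial>\<Omega>)) / 2)))) \<and>
     (AE t in lborel. AE s in lborel. t \<in> {0..1} \<longrightarrow> s \<in> {0..1} \<longrightarrow>
        (\<integral>\<omega>. G \<omega> t * G \<omega> s \<partial>\<Omega>) = d t s)"

definition U_stat :: "(int \<Rightarrow> 'a \<Rightarrow> real \<Rightarrow> real) \<Rightarrow> (int \<Rightarrow> 'a \<Rightarrow> real \<Rightarrow> real) \<Rightarrow> nat \<Rightarrow> nat \<Rightarrow> 'a \<Rightarrow> real" where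
  "U_stat X Xs N K \<omega> =
     (real N * real K / (real N + real K)) *
     (LINT t:{0..1}|lborel. ((\<Sum>i=1..int N. X i \<omega> t) / real N - (\<Sum>j=1..int K. Xs j \<omega> t) / real K)^2)"

end

theory Submission
  imports Defs
begin

text \<open>
  Expand the normalised difference of the sample means in the Haar basis \<open>haar j\<close>.

  For a scalar functional of an i.i.d. sequence, write the \<open>i\<close>-th term as the telescoping sum of its
  averages over all but the last \<open>l\<close> innovations. For fixed \<open>l\<close> the increments are orthogonal in
  \<open>i\<close>, and their norms are bounded by the coupling errors \<open>err\<close>. This bounds the variance of sums by
  \<open>N\<close> times a constant, allows replacing the sequence by an \<open>m\<close>-dependent one, and big blocks reduce the
  central limit theorem to the i.i.d. case. Applied to the inner products with \<open>haar j\<close>, it also bounds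
  the variances of the coordinates by a summable sequence, uniformly in the sample sizes.

  The Laplace transform of a squared Euclidean norm is an average of one-dimensional characteristic
  functions, taken at a Gaussian random direction. So the one-dimensional central limit theorem gives the limit of the Laplace
  transform of finitely many squared coordinates, and the summable variances allow passing to all
  coordinates. Convergence of Laplace transforms at the natural numbers implies weak convergence.

  For an arbitrary Gaussian process with the limiting covariance, inner products with bounded
  functions are Gaussian because they are limits of random quadratures.
\<close>

section \<open>Square-integrable functions\<close>

text \<open>Two features of the setting shape the proof. Independence of the samples is available
  only for inner products with functions in \<open>L2\<close>, and the kernel \<open>d\<close> is
  fixed only almost everywhere on the square. So paths are tested against functions, and covariances
  enter through the bilinear forms \<open>kform\<close>. Conditional expectations become plain
  integrals over an independent copy (\<open>avg\<close>) on the product \<open>Qz\<close>, which is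
  the law of the whole innovation sequence; estimates proved there are carried back along
  \<open>D\<close>. Haar functions are used because they are bounded, as the random quadrature
  requires, and because Parseval's identity for them reduces to dyadic averages. The central
  constants are \<open>\<tau> j\<close>, the square of the sum over \<open>l\<close> of
  \<open>err l + err (l + 1)\<close> for the inner product with \<open>haar j\<close>; Minkowski's
  inequality for square-summable sequences makes them summable in \<open>j\<close>. They do three
  jobs: they bound the tail of the statistic uniformly, they bound the trace of \<open>d\<close>,
  and through the trace they make every Gaussian process with kernel \<open>d\<close> square
  integrable over time.\<close>

definition sqint :: "'a measure \<Rightarrow> ('a \<Rightarrow> real) \<Rightarrow> bool" where
  "sqint N f \<longleftrightarrow> f \<in> borel_measurable N \<and> integrable N (\<lambda>x. (f x)\<^sup>2)"

definition l2norm :: "'a measure \<Rightarrow> ('a \<Rightarrow> real) \<Rightarrow> real" where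
  "l2norm N f = sqrt (\<integral>x. (f x)\<^sup>2 \<partial>N)"

lemma sqint_measurable[measurable_dest]: "sqint N f \<Longrightarrow> f \<in> borel_measurable N"
  and sqint_integrable_square: "sqint N f \<Longrightarrow> integrable N (\<lambda>x. (f x)\<^sup>2)"
  by (auto simp: sqint_def)

lemma l2norm_nonneg[simp]: "0 \<le> l2norm N f"
  by (simp add: l2norm_def)

lemma l2norm_square: "(l2norm N f)\<^sup>2 = (\<integral>x. (f x)\<^sup>2 \<partial>N)"
  by (simp add: l2norm_def)

lemma l2norm_abs[simp]: "l2norm N (\<lambda>x. \<bar>f x\<bar>) = l2norm N f"
  by (simp add: l2norm_def)

lemma sqint_abs: "sqint N f \<Longrightarrow> sqint N (\<lambda>x. \<bar>f x\<bar>)"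
  by (auto simp: sqint_def)

lemma sqint_integrable_mult:
  assumes "sqint N f" "sqint N g" shows "integrable N (\<lambda>x. f x * g x)"
proof (rule Bochner_Integration.integrable_bound)
  show "integrable N (\<lambda>x. (f x)\<^sup>2 + (g x)\<^sup>2)"
    using assms by (auto simp: sqint_def)
  have "\<bar>a * b\<bar> \<le> a\<^sup>2 + b\<^sup>2" for a b :: real
    using sum_squares_bound[of "\<bar>a\<bar>" "\<bar>b\<bar>"] mult_nonneg_nonneg[of "\<bar>a\<bar>" "\<bar>b\<bar>"]
    unfolding abs_mult power2_abs by linarith
  then show "AE x in N. norm (f x * g x) \<le> norm ((f x)\<^sup>2 + (g x)\<^sup>2)" by auto
qed (use assms in \<open>auto simp: sqint_def\<close>)

lemma sqint_add: "sqint N f \<Longrightarrow> sqint N g \<Longrightarrow> sqint N (\<lambda>x. f x + g x)"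
  using sqint_integrable_mult[of N f g] unfolding sqint_def
  by (auto simp: power2_sum mult.assoc)

lemma sqint_cmult: "sqint N f \<Longrightarrow> sqint N (\<lambda>x. c * f x)"
  by (auto simp: sqint_def power_mult_distrib)

lemma sqint_diff: "sqint N f \<Longrightarrow> sqint N g \<Longrightarrow> sqint N (\<lambda>x. f x - g x)"
  using sqint_add[of N f "\<lambda>x. (-1) * g x"] sqint_cmult[of N g "-1"] by simp

lemma sqint_zero[simp]: "sqint N (\<lambda>x. 0)"
  by (simp add: sqint_def)

lemma sqint_sum: "(\<And>i. i \<in> A \<Longrightarrow> sqint N (f i)) \<Longrightarrow> sqint N (\<lambda>x. \<Sum>i\<in>A. f i x)"
  by (induct A rule: infinite_finite_induct) (auto intro: sqint_add)

lemma (in finite_measure) sqint_const: "sqint M (\<lambda>x. c)"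
  by (simp add: sqint_def)

lemma (in finite_measure) sqint_integrable: "sqint M f \<Longrightarrow> integrable M f"
  using square_integrable_imp_integrable by (auto simp: sqint_def)

lemma sqint_bound:
  assumes "sqint N g" "f \<in> borel_measurable N" "AE x in N. \<bar>f x\<bar> \<le> \<bar>g x\<bar>"
  shows "sqint N f" "l2norm N f \<le> l2norm N g"
proof -
  have le: "AE x in N. (f x)\<^sup>2 \<le> (g x)\<^sup>2"
    using assms(3) by eventually_elim (simp add: abs_le_square_iff)
  have "integrable N (\<lambda>x. (f x)\<^sup>2)"
    by (rule Bochner_Integration.integrable_bound[OF sqint_integrable_square[OF assms(1)]])
       (use assms(2) le in auto)
  then show "sqint N f" using assms by (simp add: sqint_def)
  then show "l2norm N f \<le> l2norm N g" unfolding l2norm_def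
    using le assms(1) by (intro real_sqrt_le_mono integral_mono_AE) (auto simp: sqint_def)
qed

lemma l2norm_cmult: "l2norm N (\<lambda>x. c * f x) = \<bar>c\<bar> * l2norm N f"
  by (simp add: l2norm_def power_mult_distrib real_sqrt_mult)

lemma l2norm_zero[simp]: "l2norm N (\<lambda>x. 0) = 0"
  by (simp add: l2norm_def)

lemma Cauchy_Schwarz_l2norm:
  assumes f: "sqint N f" and g: "sqint N g"
  shows "\<bar>\<integral>x. f x * g x \<partial>N\<bar> \<le> l2norm N f * l2norm N g"
proof -
  define a where "a = (\<integral>x. (f x)\<^sup>2 \<partial>N)"
  define b where "b = (\<integral>x. f x * g x \<partial>N)"
  define c where "c = (\<integral>x. (g x)\<^sup>2 \<partial>N)"
  note [simp] = sqint_integrable_mult[OF f g] sqint_integrable_square[OF f] sqint_integrable_square[OF g]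
  have a0: "0 \<le> a" and c0: "0 \<le> c" unfolding a_def c_def by simp_all
  have quad: "0 \<le> s\<^sup>2 * a + 2 * s * t * b + t\<^sup>2 * c" for s t
  proof -
    have "0 \<le> (\<integral>x. (s * f x + t * g x)\<^sup>2 \<partial>N)" by simp
    also have "\<dots> = (\<integral>x. s\<^sup>2 * (f x)\<^sup>2 + 2 * s * t * (f x * g x) + t\<^sup>2 * (g x)\<^sup>2 \<partial>N)"
      by (intro Bochner_Integration.integral_cong) (auto simp: power2_eq_square algebra_simps)
    also have "\<dots> = s\<^sup>2 * a + 2 * s * t * b + t\<^sup>2 * c"
      by (simp add: a_def b_def c_def)
    finally show ?thesis .
  qed
  have "b\<^sup>2 \<le> a * c"
  proof (cases "c = 0")
    case True
    show ?thesis
    proof (rule ccontr)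
      assume "\<not> ?thesis"
      then have "b \<noteq> 0" using True by auto
      \<comment> \<open>For \<open>c = 0\<close> the form is linear in \<open>t\<close>, and this
        choice gives it the value \<open>-1\<close>.\<close>
      with quad[of 1 "- (a + 1) / (2 * b)"] True show False by (simp add: field_simps)
    qed
  next
    case False
    \<comment> \<open>At \<open>s = c\<close>, \<open>t = - b\<close>, the minimum up to scaling,
      the form equals \<open>c\<close> times the wanted difference.\<close>
    then have "0 \<le> c * (a * c - b\<^sup>2)"
      using quad[of c "- b"] by (simp add: power2_eq_square algebra_simps)
    then show ?thesis using False c0 by (simp add: zero_le_mult_iff)
  qed
  then have "\<bar>b\<bar> \<le> sqrt (a * c)" by (simp add: real_le_rsqrt)
  then show ?thesis by (simp add: l2norm_def a_def b_def c_def real_sqrt_mult)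
qed

lemma l2norm_add_le:
  assumes f: "sqint N f" and g: "sqint N g"
  shows "l2norm N (\<lambda>x. f x + g x) \<le> l2norm N f + l2norm N g"
proof (rule power2_le_imp_le)
  note [simp] = sqint_integrable_mult[OF f g] sqint_integrable_square[OF f] sqint_integrable_square[OF g]
  have "(l2norm N (\<lambda>x. f x + g x))\<^sup>2 = (\<integral>x. (f x)\<^sup>2 + (g x)\<^sup>2 + 2 * (f x * g x) \<partial>N)"
    unfolding l2norm_square by (intro Bochner_Integration.integral_cong) (auto simp: power2_sum)
  also have "\<dots> = (l2norm N f)\<^sup>2 + (l2norm N g)\<^sup>2 + 2 * (\<integral>x. f x * g x \<partial>N)"
    by (simp add: l2norm_square)
  also have "\<dots> \<le> (l2norm N f)\<^sup>2 + (l2norm N g)\<^sup>2 + 2 * (l2norm N f * l2norm N g)"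
    using Cauchy_Schwarz_l2norm[OF f g] by simp
  finally show "(l2norm N (\<lambda>x. f x + g x))\<^sup>2 \<le> (l2norm N f + l2norm N g)\<^sup>2"
    by (simp add: power2_sum)
qed simp

lemma l2norm_uminus: "l2norm N (\<lambda>x. - f x) = l2norm N f"
  by (simp add: l2norm_def)

lemma l2norm_minus_commute: "l2norm N (\<lambda>x. f x - g x) = l2norm N (\<lambda>x. g x - f x)"
  by (simp add: l2norm_def power2_commute)

lemma l2norm_diff_le:
  assumes f: "sqint N f" and g: "sqint N g"
  shows "l2norm N (\<lambda>x. f x - g x) \<le> l2norm N f + l2norm N g"
  using l2norm_add_le[OF f sqint_cmult[OF g, of "-1"]] by (simp add: l2norm_uminus)

lemma l2norm_diff_ge:
  assumes f: "sqint N f" and g: "sqint N g"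
  shows "\<bar>l2norm N f - l2norm N g\<bar> \<le> l2norm N (\<lambda>x. f x - g x)"
  using l2norm_add_le[OF g sqint_diff[OF f g]] l2norm_add_le[OF f sqint_diff[OF g f]]
  by (simp add: l2norm_minus_commute[of N g f])

lemma l2norm_sum_le:
  assumes "\<And>i. i \<in> A \<Longrightarrow> sqint N (f i)"
  shows "l2norm N (\<lambda>x. \<Sum>i\<in>A. f i x) \<le> (\<Sum>i\<in>A. l2norm N (f i))"
  using assms
proof (induct A rule: infinite_finite_induct)
  case (insert a A)
  then show ?case
    using l2norm_add_le[of N "f a" "\<lambda>x. \<Sum>i\<in>A. f i x"] sqint_sum[of A N f] by auto
qed auto

lemma l2norm_cong_AE:
  assumes "f \<in> borel_measurable N" "g \<in> borel_measurable N" "AE x in N. f x = g x"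
  shows "l2norm N f = l2norm N g"
proof -
  have "(\<integral>x. (f x)\<^sup>2 \<partial>N) = (\<integral>x. (g x)\<^sup>2 \<partial>N)"
    using assms by (intro integral_cong_AE) auto
  then show ?thesis by (simp add: l2norm_def)
qed

lemma nn_integral_square_eq_l2norm: "sqint N f \<Longrightarrow> (\<integral>\<^sup>+x. ennreal ((f x)\<^sup>2) \<partial>N) = ennreal ((l2norm N f)\<^sup>2)"
  by (subst nn_integral_eq_integral) (auto simp: sqint_def l2norm_square)

lemma sqint_I_nn:
  assumes "f \<in> borel_measurable N" "(\<integral>\<^sup>+x. ennreal ((f x)\<^sup>2) \<partial>N) \<le> ennreal (C\<^sup>2)" "0 \<le> C"
  shows "sqint N f" "l2norm N f \<le> C"
proof -
  have "integrable N (\<lambda>x. (f x)\<^sup>2)"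
    using assms by (intro integrableI_nonneg) (auto simp: order_le_less_trans)
  then show *: "sqint N f" using assms by (simp add: sqint_def)
  show "l2norm N f \<le> C"
    using assms(2,3) by (subst (asm) nn_integral_square_eq_l2norm[OF *]) (auto simp: power_mono_iff)
qed

lemma l2norm_abs_int_le:
  assumes "prob_space N" "sqint N f"
  shows "(\<integral>x. \<bar>f x\<bar> \<partial>N) \<le> l2norm N f"
proof -
  interpret prob_space N by fact
  show ?thesis
    using Cauchy_Schwarz_l2norm[OF sqint_abs[OF assms(2)] sqint_const[of 1]]
    by (simp add: l2norm_def prob_space)
qed

section \<open>Series and mean-square limits of square-integrable functions\<close>

text \<open>Minkowski's inequality bounds the partial sums of absolute values, and monotone
  convergence of their squares carries the bound to the supremum. Finiteness of that integral gives
  absolute convergence almost everywhere. The measure is left general because the lemma also serves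
  sequences, with \<open>N\<close> a counting measure.\<close>

lemma infinite_Minkowski:
  fixes \<phi> :: "nat \<Rightarrow> 'a \<Rightarrow> real"
  assumes \<phi>: "\<And>l. sqint N (\<phi> l)" and sm: "summable (\<lambda>l. l2norm N (\<phi> l))"
  shows "AE x in N. summable (\<lambda>l. \<bar>\<phi> l x\<bar>)"
    and "sqint N (\<lambda>x. \<Sum>l. \<phi> l x)"
    and "l2norm N (\<lambda>x. \<Sum>l. \<phi> l x) \<le> (\<Sum>l. l2norm N (\<phi> l))"
proof -
  have [measurable]: "\<phi> l \<in> borel_measurable N" for l
    using \<phi> by auto
  define C where "C = (\<Sum>l. l2norm N (\<phi> l))"
  have C0: "0 \<le> C" unfolding C_def by (intro suminf_nonneg sm) simp
  define g where "g n x = ennreal ((\<Sum>l<n. \<bar>\<phi> l x\<bar>)\<^sup>2)" for n x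
  have [measurable]: "g n \<in> borel_measurable N" for n unfolding g_def by measurable
  have "incseq g" unfolding g_def incseq_def le_fun_def
    by (intro allI impI ennreal_leI power_mono sum_mono2 sum_nonneg) auto
  then have "(\<integral>\<^sup>+x. (SUP n. g n x) \<partial>N) = (SUP n. \<integral>\<^sup>+x. g n x \<partial>N)"
    by (intro nn_integral_monotone_convergence_SUP) auto
  also have "\<dots> \<le> ennreal (C\<^sup>2)"
  proof (rule SUP_least)
    fix n
    have s: "sqint N (\<lambda>x. \<Sum>l<n. \<bar>\<phi> l x\<bar>)"
      by (intro sqint_sum sqint_abs \<phi>)
    have "l2norm N (\<lambda>x. \<Sum>l<n. \<bar>\<phi> l x\<bar>) \<le> (\<Sum>l<n. l2norm N (\<lambda>x. \<bar>\<phi> l x\<bar>))"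
      by (intro l2norm_sum_le sqint_abs \<phi>)
    also have "\<dots> \<le> C" unfolding C_def
      using sum_le_suminf[OF sm, of "{..<n}"] by simp
    finally have "(l2norm N (\<lambda>x. \<Sum>l<n. \<bar>\<phi> l x\<bar>))\<^sup>2 \<le> C\<^sup>2" by (intro power_mono) auto
    then show "(\<integral>\<^sup>+x. g n x \<partial>N) \<le> ennreal (C\<^sup>2)"
      unfolding g_def nn_integral_square_eq_l2norm[OF s] by (intro ennreal_leI)
  qed
  finally have int: "(\<integral>\<^sup>+x. (SUP n. g n x) \<partial>N) \<le> ennreal (C\<^sup>2)" .
  then have "(\<integral>\<^sup>+x. (SUP n. g n x) \<partial>N) \<noteq> \<infinity>"
    by (auto simp: top_unique)
  then have fin: "AE x in N. (SUP n. g n x) \<noteq> \<infinity>"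
    by (intro nn_integral_noteq_infinite) auto
  have key: "summable (\<lambda>l. \<bar>\<phi> l x\<bar>) \<and> ennreal ((\<Sum>l. \<phi> l x)\<^sup>2) \<le> (SUP n. g n x)"
    if fx: "(SUP n. g n x) \<noteq> \<infinity>" for x
  proof -
    obtain r where r: "(SUP n. g n x) = ennreal r" "0 \<le> r"
      using fx by (metis ennreal_cases infinity_ennreal_def)
    have b: "(\<Sum>l<n. \<bar>\<phi> l x\<bar>)\<^sup>2 \<le> r" for n
    proof -
      have "g n x \<le> (SUP n. g n x)" by (intro SUP_upper) auto
      then show ?thesis using r unfolding g_def by simp
    qed
    have "(\<Sum>l<n. \<bar>\<phi> l x\<bar>) \<le> sqrt r" for n
      using b[of n] by (simp add: real_le_rsqrt)
    then have s: "summable (\<lambda>l. \<bar>\<phi> l x\<bar>)"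
      by (intro summableI_nonneg_bounded) auto
    have "\<bar>\<Sum>l. \<phi> l x\<bar> \<le> (\<Sum>l. \<bar>\<phi> l x\<bar>)" using s by (intro summable_rabs)
    also have "\<dots> \<le> sqrt r"
      using \<open>\<And>n. (\<Sum>l<n. \<bar>\<phi> l x\<bar>) \<le> sqrt r\<close> by (intro suminf_le_const s) auto
    finally have "\<bar>\<Sum>l. \<phi> l x\<bar>\<^sup>2 \<le> (sqrt r)\<^sup>2" by (intro power_mono) auto
    then show ?thesis using s r by (auto intro!: ennreal_leI)
  qed
  show "AE x in N. summable (\<lambda>l. \<bar>\<phi> l x\<bar>)"
    using fin key by (auto elim: eventually_mono)
  have "(\<integral>\<^sup>+x. ennreal ((\<Sum>l. \<phi> l x)\<^sup>2) \<partial>N) \<le> (\<integral>\<^sup>+x. (SUP n. g n x) \<partial>N)"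
    using fin key by (intro nn_integral_mono_AE) (auto elim: eventually_mono)
  also note int
  finally have "(\<integral>\<^sup>+x. ennreal ((\<Sum>l. \<phi> l x)\<^sup>2) \<partial>N) \<le> ennreal (C\<^sup>2)" .
  from sqint_I_nn[OF _ this C0]
  show "sqint N (\<lambda>x. \<Sum>l. \<phi> l x)" "l2norm N (\<lambda>x. \<Sum>l. \<phi> l x) \<le> (\<Sum>l. l2norm N (\<phi> l))"
    by (auto simp: C_def)
qed

lemma infinite_Minkowski_tail:
  fixes \<phi> :: "nat \<Rightarrow> 'a \<Rightarrow> real"
  assumes \<phi>: "\<And>l. sqint N (\<phi> l)" and sm: "summable (\<lambda>l. l2norm N (\<phi> l))"
  shows "(\<lambda>n. l2norm N (\<lambda>x. (\<Sum>l. \<phi> l x) - (\<Sum>l<n. \<phi> l x))) \<longlonglongrightarrow> 0"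
proof (rule tendsto_sandwich[OF _ _ tendsto_const])
  have [measurable]: "\<phi> l \<in> borel_measurable N" for l
    using \<phi> by auto
  have "l2norm N (\<lambda>x. (\<Sum>l. \<phi> l x) - (\<Sum>l<n. \<phi> l x)) \<le> (\<Sum>l. l2norm N (\<phi> (l + n)))" for n
  proof -
    have "l2norm N (\<lambda>x. (\<Sum>l. \<phi> l x) - (\<Sum>l<n. \<phi> l x)) = l2norm N (\<lambda>x. \<Sum>l. \<phi> (l + n) x)"
    proof (rule l2norm_cong_AE)
      show "AE x in N. (\<Sum>l. \<phi> l x) - (\<Sum>l<n. \<phi> l x) = (\<Sum>l. \<phi> (l + n) x)"
        using infinite_Minkowski(1)[OF \<phi> sm]
      proof eventually_elim
        case (elim x)
        from suminf_minus_initial_segment[OF summable_rabs_cancel[OF elim], of n] show ?case by simp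
      qed
    qed auto
    also have "\<dots> \<le> (\<Sum>l. l2norm N (\<phi> (l + n)))"
      using summable_ignore_initial_segment[OF sm, of n]
      by (intro infinite_Minkowski(3) \<phi>)
    finally show ?thesis .
  qed
  then show "\<forall>\<^sub>F n in sequentially. l2norm N (\<lambda>x. (\<Sum>l. \<phi> l x) - (\<Sum>l<n. \<phi> l x)) \<le> (\<Sum>l. l2norm N (\<phi> (l + n)))"
    by auto
  have "(\<lambda>n. (\<Sum>l. l2norm N (\<phi> l)) - (\<Sum>l<n. l2norm N (\<phi> l))) \<longlonglongrightarrow> (\<Sum>l. l2norm N (\<phi> l)) - (\<Sum>l. l2norm N (\<phi> l))"
    using summable_LIMSEQ[OF sm] by (intro tendsto_intros)
  then show "(\<lambda>n. \<Sum>l. l2norm N (\<phi> (l + n))) \<longlonglongrightarrow> 0"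
    using suminf_minus_initial_segment[OF sm] by simp
qed auto

text \<open>Since \<open>|exp (i a) - exp (i b)| \<le> |a - b|\<close> and the first absolute moment
  is at most the \<open>L^2\<close> norm, mean-square approximation transfers to characteristic
  functions at a linear rate. Truncation and blocking errors enter the limit theorem through this
  bound.\<close>

lemma char_diff_le_l2norm:
  assumes "prob_space N" and [measurable]: "X \<in> borel_measurable N" "Y \<in> borel_measurable N"
    and s: "sqint N (\<lambda>x. X x - Y x)"
  shows "cmod (char (distr N borel X) u - char (distr N borel Y) u) \<le> \<bar>u\<bar> * l2norm N (\<lambda>x. X x - Y x)"
proof -
  interpret prob_space N by fact
  have i: "integrable N (\<lambda>x. iexp (u * Z x))" if [measurable]: "Z \<in> borel_measurable N" for Z :: "'a \<Rightarrow> real"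
    by (rule integrable_const_bound[of _ 1]) auto
  have "char (distr N borel X) u - char (distr N borel Y) u = (CLINT x|N. iexp (u * X x) - iexp (u * Y x))"
    using Bochner_Integration.integral_diff[OF i[OF assms(2)] i[OF assms(3)]]
    by (simp add: char_def integral_distr)
  also have "cmod \<dots> \<le> (\<integral>x. cmod (iexp (u * X x) - iexp (u * Y x)) \<partial>N)"
    by (rule integral_norm_bound)
  also have "\<dots> \<le> (\<integral>x. \<bar>u\<bar> * \<bar>X x - Y x\<bar> \<partial>N)"
  proof (rule integral_mono)
    show "integrable N (\<lambda>x. cmod (iexp (u * X x) - iexp (u * Y x)))"
      by (intro integrable_norm Bochner_Integration.integrable_diff i) auto
    show "integrable N (\<lambda>x. \<bar>u\<bar> * \<bar>X x - Y x\<bar>)"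
      using sqint_integrable[OF s] by auto
    fix x
    have "iexp (u * X x) - iexp (u * Y x) = iexp (u * Y x) * (iexp (u * X x - u * Y x) - 1)"
      by (simp add: exp_diff right_diff_distrib)
    then have "cmod (iexp (u * X x) - iexp (u * Y x)) = cmod (iexp (u * X x - u * Y x) - 1)"
      by (simp add: norm_mult)
    also have "\<dots> \<le> \<bar>u * X x - u * Y x\<bar>"
      using iexp_approx1[of "u * X x - u * Y x" 0] by simp
    finally show "cmod (iexp (u * X x) - iexp (u * Y x)) \<le> \<bar>u\<bar> * \<bar>X x - Y x\<bar>"
      by (simp add: abs_mult right_diff_distrib[symmetric])
  qed
  also have "\<dots> \<le> \<bar>u\<bar> * l2norm N (\<lambda>x. X x - Y x)"
    using l2norm_abs_int_le[OF assms(1) s] by (simp add: mult_left_mono)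
  finally show ?thesis .
qed

lemma char_L2_limit:
  assumes N: "prob_space N" and X: "\<And>r. sqint N (X r)" and Y: "sqint N Y"
    and lim: "(\<lambda>r. l2norm N (\<lambda>x. X r x - Y x)) \<longlonglongrightarrow> 0"
  shows "(\<lambda>r. char (distr N borel (X r)) u) \<longlonglongrightarrow> char (distr N borel Y) u"
    and "(\<lambda>r. l2norm N (X r)) \<longlonglongrightarrow> l2norm N Y"
proof -
  have "(\<lambda>r. char (distr N borel (X r)) u - char (distr N borel Y) u) \<longlonglongrightarrow> 0"
  proof (rule Lim_null_comparison)
    show "\<forall>\<^sub>F r in sequentially. cmod (char (distr N borel (X r)) u - char (distr N borel Y) u)
       \<le> \<bar>u\<bar> * l2norm N (\<lambda>x. X r x - Y x)"
      using X Y by (intro always_eventually allI char_diff_le_l2norm N sqint_diff) auto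
    show "(\<lambda>r. \<bar>u\<bar> * l2norm N (\<lambda>x. X r x - Y x)) \<longlonglongrightarrow> 0"
      using tendsto_mult_left[OF lim, of "\<bar>u\<bar>"] by simp
  qed
  then show "(\<lambda>r. char (distr N borel (X r)) u) \<longlonglongrightarrow> char (distr N borel Y) u"
    by (simp add: LIM_zero_iff)
  have "(\<lambda>r. l2norm N (X r) - l2norm N Y) \<longlonglongrightarrow> 0"
    by (rule Lim_null_comparison[OF _ lim]) (use l2norm_diff_ge[OF X Y] in auto)
  then show "(\<lambda>r. l2norm N (X r)) \<longlonglongrightarrow> l2norm N Y"
    by (simp add: LIM_zero_iff)
qed

text \<open>Mean-square limits carry both the characteristic function and the second moment along,
  so the formula with matching variance survives; degenerate laws are included.\<close>

lemma gaussian_L2_limit: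
  assumes N: "prob_space N" and X: "\<And>r. sqint N (X r)" and Y: "sqint N Y"
    and lim: "(\<lambda>r. l2norm N (\<lambda>x. X r x - Y x)) \<longlonglongrightarrow> 0"
    and ch: "\<And>r u. char (distr N borel (X r)) u = complex_of_real (exp (- (u\<^sup>2 * (l2norm N (X r))\<^sup>2) / 2))"
  shows "char (distr N borel Y) u = complex_of_real (exp (- (u\<^sup>2 * (l2norm N Y)\<^sup>2) / 2))"
proof (rule LIMSEQ_unique)
  show "(\<lambda>r. char (distr N borel (X r)) u) \<longlonglongrightarrow> char (distr N borel Y) u"
    by (rule char_L2_limit(1)[OF N X Y lim])
  show "(\<lambda>r. char (distr N borel (X r)) u) \<longlonglongrightarrow> complex_of_real (exp (- (u\<^sup>2 * (l2norm N Y)\<^sup>2) / 2))"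
    unfolding ch by (intro tendsto_intros char_L2_limit(2)[OF N X Y lim]) auto
qed

section \<open>Averaging out coordinates of a product measure\<close>

text \<open>Integrating out a probability variable contracts the \<open>L^2\<close> norm:
  Cauchy-Schwarz against the constant 1 on almost every section, then Fubini.\<close>

lemma (in prob_space) sqint_integral_fst:
  fixes \<Phi> :: "'b \<times> 'a \<Rightarrow> real"
  assumes N: "sigma_finite_measure N" and \<Phi>: "sqint (N \<Otimes>\<^sub>M M) \<Phi>"
  shows "sqint N (\<lambda>x. \<integral>y. \<Phi> (x, y) \<partial>M)" "l2norm N (\<lambda>x. \<integral>y. \<Phi> (x, y) \<partial>M) \<le> l2norm (N \<Otimes>\<^sub>M M) \<Phi>"
proof -
  interpret N: sigma_finite_measure N by fact
  interpret NM: pair_sigma_finite N M ..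
  have [measurable]: "\<Phi> \<in> borel_measurable (N \<Otimes>\<^sub>M M)" using \<Phi> by auto
  have "AE x in N. (\<integral>y. \<Phi> (x, y) \<partial>M)\<^sup>2 \<le> (\<integral>y. (\<Phi> (x, y))\<^sup>2 \<partial>M)"
    using NM.AE_integrable_fst'[OF sqint_integrable_square[OF \<Phi>]]
      AE_space[of N]
  proof eventually_elim
    case (elim x)
    then have s: "sqint M (\<lambda>y. \<Phi> (x, y))" by (auto simp: sqint_def)
    have "\<bar>\<integral>y. \<Phi> (x, y) \<partial>M\<bar> \<le> l2norm M (\<lambda>y. \<Phi> (x, y))"
      using Cauchy_Schwarz_l2norm[OF s sqint_const[of 1]] by (simp add: l2norm_def prob_space)
    then have "\<bar>\<integral>y. \<Phi> (x, y) \<partial>M\<bar>\<^sup>2 \<le> (l2norm M (\<lambda>y. \<Phi> (x, y)))\<^sup>2" by (intro power_mono) auto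
    then show ?case by (simp add: l2norm_square)
  qed
  note le = this
  have i: "integrable N (\<lambda>x. \<integral>y. (\<Phi> (x, y))\<^sup>2 \<partial>M)"
    using NM.integrable_fst'[OF sqint_integrable_square[OF \<Phi>]] by simp
  have "integrable N (\<lambda>x. (\<integral>y. \<Phi> (x, y) \<partial>M)\<^sup>2)"
    by (rule Bochner_Integration.integrable_bound[OF i]) (use le in auto)
  then show "sqint N (\<lambda>x. \<integral>y. \<Phi> (x, y) \<partial>M)" by (simp add: sqint_def)
  have "(\<integral>x. (\<integral>y. \<Phi> (x, y) \<partial>M)\<^sup>2 \<partial>N) \<le> (\<integral>x. (\<integral>y. (\<Phi> (x, y))\<^sup>2 \<partial>M) \<partial>N)"
    by (rule integral_mono_AE) (use le i \<open>integrable N (\<lambda>x. (\<integral>y. \<Phi> (x, y) \<partial>M)\<^sup>2)\<close> in auto)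
  also have "\<dots> = (\<integral>z. (\<Phi> z)\<^sup>2 \<partial>(N \<Otimes>\<^sub>M M))"
    using NM.integral_fst'[OF sqint_integrable_square[OF \<Phi>]] by simp
  finally show "l2norm N (\<lambda>x. \<integral>y. \<Phi> (x, y) \<partial>M) \<le> l2norm (N \<Otimes>\<^sub>M M) \<Phi>"
    by (simp add: l2norm_def)
qed

lemma sqint_distr:
  assumes "T \<in> N \<rightarrow>\<^sub>M N'" "sqint (distr N N' T) F"
  shows "sqint N (\<lambda>x. F (T x))" "l2norm N (\<lambda>x. F (T x)) = l2norm (distr N N' T) F"
proof -
  have F: "F \<in> borel_measurable N'" using assms by (auto simp: sqint_def)
  note [measurable] = F assms(1)
  show "sqint N (\<lambda>x. F (T x))" "l2norm N (\<lambda>x. F (T x)) = l2norm (distr N N' T) F"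
    using assms by (auto simp: sqint_def l2norm_def integral_distr integrable_distr_eq)
qed

definition mrg :: "'i set \<Rightarrow> ('i \<Rightarrow> 's) \<Rightarrow> ('i \<Rightarrow> 's) \<Rightarrow> 'i \<Rightarrow> 's" where
  "mrg J x y = (\<lambda>i. if i \<in> J then x i else y i)"

text \<open>A version of the conditional expectation of \<open>F\<close> given the coordinates in
  \<open>J\<close> under the product law. It is defined at every point, but where the section is not
  integrable the Bochner integral is 0, so linear identities for it are obtained only almost
  everywhere.\<close>

definition avg :: "'s measure \<Rightarrow> 'i set \<Rightarrow> (('i \<Rightarrow> 's) \<Rightarrow> real) \<Rightarrow> ('i \<Rightarrow> 's) \<Rightarrow> real" where
  "avg P J F x = (\<integral>y. F (mrg J x y) \<partial>PiM UNIV (\<lambda>_. P))"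

text \<open>Dependence is expressed pointwise rather than by a sub-sigma-algebra, so that it is
  checked by comparing arguments.\<close>

definition depends_on :: "'i set \<Rightarrow> (('i \<Rightarrow> 's) \<Rightarrow> real) \<Rightarrow> bool" where
  "depends_on J H \<longleftrightarrow> (\<forall>x y. (\<forall>i\<in>J. x i = y i) \<longrightarrow> H x = H y)"

lemma measurable_PiM_UNIV:
  assumes "\<And>i. (\<lambda>w. X w i) \<in> N \<rightarrow>\<^sub>M P"
  shows "X \<in> N \<rightarrow>\<^sub>M PiM UNIV (\<lambda>_. P)"
  using assms by (intro measurable_PiM_single') (auto dest: measurable_space simp: PiE_iff)

lemma measurable_mrg[measurable (raw)]:
  assumes [measurable]: "X \<in> N \<rightarrow>\<^sub>M PiM UNIV (\<lambda>_. P)" "Y \<in> N \<rightarrow>\<^sub>M PiM UNIV (\<lambda>_. P)"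
  shows "(\<lambda>w. mrg J (X w) (Y w)) \<in> N \<rightarrow>\<^sub>M PiM UNIV (\<lambda>_. P)"
proof (rule measurable_PiM_UNIV)
  fix i
  have [measurable]: "(\<lambda>w. X w i) \<in> N \<rightarrow>\<^sub>M P" "(\<lambda>w. Y w i) \<in> N \<rightarrow>\<^sub>M P"
    by (auto intro!: measurable_component_singleton[THEN measurable_compose[rotated]])
  show "(\<lambda>w. mrg J (X w) (Y w) i) \<in> N \<rightarrow>\<^sub>M P"
    unfolding mrg_def by (cases "i \<in> J") auto
qed

lemma depends_on_avg: "depends_on J (avg P J F)"
  unfolding depends_on_def avg_def mrg_def by (auto intro!: Bochner_Integration.integral_cong arg_cong[where f=F])

lemma depends_on_mono: "depends_on J H \<Longrightarrow> J \<subseteq> K \<Longrightarrow> depends_on K H"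
  unfolding depends_on_def by blast

lemma depends_on_diff: "depends_on J F \<Longrightarrow> depends_on J G \<Longrightarrow> depends_on J (\<lambda>x. F x - G x)"
  unfolding depends_on_def by metis

context prob_space
begin

lemma prob_space_PiM_UNIV: "prob_space (PiM UNIV (\<lambda>_. M))"
  by (intro prob_space_PiM prob_space_axioms)

lemma avg_empty: "avg M {} F x = (\<integral>y. F y \<partial>PiM UNIV (\<lambda>_. M))"
  by (simp add: avg_def mrg_def)

lemma avg_depends:
  assumes "depends_on J F" "J \<subseteq> K"
  shows "avg M K F x = F x"
proof -
  interpret Q: prob_space "PiM UNIV (\<lambda>_. M)" by (rule prob_space_PiM_UNIV)
  have "F (mrg K x y) = F x" for y
    by (rule assms(1)[unfolded depends_on_def, rule_format]) (use assms(2) in \<open>auto simp: mrg_def\<close>)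
  then show ?thesis by (simp add: avg_def Q.prob_space)
qed

text \<open>Cylinders suffice. The preimage of a cylinder over \<open>L\<close> is the product of
  the cylinders over \<open>L \<inter> J\<close> and \<open>L - J\<close>, and the marginal
  probabilities over these two pieces multiply to those over \<open>L\<close>.\<close>

lemma distr_mrg:
  fixes J :: "'i set"
  defines "Q \<equiv> PiM (UNIV::'i set) (\<lambda>_. M)"
  shows "distr (Q \<Otimes>\<^sub>M Q) Q (\<lambda>p. mrg J (fst p) (snd p)) = Q"
  unfolding Q_def
proof (rule product_prob_space.PiM_eq)
  show "product_prob_space (\<lambda>_::'i. M)" 
    unfolding product_prob_space_def product_prob_space_axioms_def product_sigma_finite_def
    by (auto intro: prob_space_axioms sigma_finite_measure_axioms)
  interpret Q: prob_space Q unfolding Q_def by (rule prob_space_PiM_UNIV)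
  fix L :: "'i set" and A assume L: "finite L" and A: "\<And>j. j \<in> L \<Longrightarrow> A j \<in> sets M"
  have emb: "emeasure Q (prod_emb UNIV (\<lambda>_. M) L' (Pi\<^sub>E L' A)) = (\<Prod>j\<in>L'. emeasure M (A j))"
    if "L' \<subseteq> L" for L'
    unfolding Q_def using that L A
    by (intro emeasure_PiM_emb prob_space_axioms) (auto intro: finite_subset)
  have m: "prod_emb UNIV (\<lambda>_. M) L' (Pi\<^sub>E L' A) \<in> sets Q" if "L' \<subseteq> L" for L'
    unfolding Q_def using that L A by (intro sets_PiM_I) (auto intro: finite_subset)
  have "(\<lambda>p. mrg J (fst p) (snd p)) -` prod_emb UNIV (\<lambda>_. M) L (Pi\<^sub>E L A) \<inter> space (Q \<Otimes>\<^sub>M Q)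
    = prod_emb UNIV (\<lambda>_. M) (L \<inter> J) (Pi\<^sub>E (L \<inter> J) A) \<times> prod_emb UNIV (\<lambda>_. M) (L - J) (Pi\<^sub>E (L - J) A)"
  proof (rule set_eqI)
    fix p :: "('i \<Rightarrow> 'a) \<times> ('i \<Rightarrow> 'a)"
    have e: "x \<in> prod_emb UNIV (\<lambda>_. M) L' (Pi\<^sub>E L' A) \<longleftrightarrow> (\<forall>i. x i \<in> space M) \<and> (\<forall>i\<in>L'. x i \<in> A i)" for x L'
      by (auto simp: prod_emb_def space_PiM PiE_iff)
    have s: "p \<in> space (Q \<Otimes>\<^sub>M Q) \<longleftrightarrow> (\<forall>i. fst p i \<in> space M) \<and> (\<forall>i. snd p i \<in> space M)"
      by (cases p) (auto simp: space_pair_measure Q_def space_PiM PiE_iff)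
    show "p \<in> (\<lambda>p. mrg J (fst p) (snd p)) -` prod_emb UNIV (\<lambda>_. M) L (Pi\<^sub>E L A) \<inter> space (Q \<Otimes>\<^sub>M Q) \<longleftrightarrow>
      p \<in> prod_emb UNIV (\<lambda>_. M) (L \<inter> J) (Pi\<^sub>E (L \<inter> J) A) \<times> prod_emb UNIV (\<lambda>_. M) (L - J) (Pi\<^sub>E (L - J) A)"
      unfolding Int_iff vimage_eq mem_Times_iff e s mrg_def by (simp split: if_splits) blast
  qed
  moreover have "(\<lambda>p. mrg J (fst p) (snd p)) \<in> Q \<Otimes>\<^sub>M Q \<rightarrow>\<^sub>M Q"
    unfolding Q_def by measurable
  ultimately have "emeasure (distr (Q \<Otimes>\<^sub>M Q) Q (\<lambda>p. mrg J (fst p) (snd p))) (prod_emb UNIV (\<lambda>_. M) L (Pi\<^sub>E L A))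
     = (\<Prod>j\<in>L \<inter> J. emeasure M (A j)) * (\<Prod>j\<in>L - J. emeasure M (A j))"
    by (simp add: emeasure_distr m Q.emeasure_pair_measure_Times emb)
  also have "\<dots> = (\<Prod>j\<in>L. emeasure M (A j))"
    using prod.union_disjoint[of "L \<inter> J" "L - J" "\<lambda>j. emeasure M (A j)"] L
    by (simp add: Int_Diff_disjoint Int_Diff_Un)
  finally show "emeasure (distr (PiM UNIV (\<lambda>_. M) \<Otimes>\<^sub>M PiM UNIV (\<lambda>_. M)) (PiM UNIV (\<lambda>_. M)) (\<lambda>p. mrg J (fst p) (snd p)))
     (prod_emb UNIV (\<lambda>_. M) L (Pi\<^sub>E L A)) = (\<Prod>j\<in>L. emeasure M (A j))"
    unfolding Q_def .
qed simp

lemma distr_reindex: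
  assumes "inj \<tau>"
  shows "distr (PiM UNIV (\<lambda>_. M)) (PiM UNIV (\<lambda>_. M)) (\<lambda>x k. x (\<tau> k)) = PiM UNIV (\<lambda>_. M)"
  using distr_PiM_reindex[of UNIV "\<lambda>_. M" \<tau> UNIV] assms prob_space_axioms
  by (simp add: restrict_UNIV)

context
  fixes Q :: "('i \<Rightarrow> 'a) measure"
  defines "Q \<equiv> PiM UNIV (\<lambda>_. M)"
begin

lemma Q_prob: "prob_space Q" unfolding Q_def by (rule prob_space_PiM_UNIV)

lemma measurable_mrg_Q[measurable]: "(\<lambda>p. mrg J (fst p) (snd p)) \<in> Q \<Otimes>\<^sub>M Q \<rightarrow>\<^sub>M Q"
  unfolding Q_def by measurable

lemma sqint_mrg:
  assumes "sqint Q F"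
  shows "sqint (Q \<Otimes>\<^sub>M Q) (\<lambda>p. F (mrg J (fst p) (snd p)))"
    "l2norm (Q \<Otimes>\<^sub>M Q) (\<lambda>p. F (mrg J (fst p) (snd p))) = l2norm Q F"
  using sqint_distr[OF measurable_mrg_Q[of J], of F] assms distr_mrg[of J]
  unfolding Q_def[symmetric] by auto

text \<open>The tower property of conditional expectation, as Fubini's theorem applied to
  \<open>distr_mrg\<close>.\<close>

lemma integral_mrg:
  fixes F :: "('i \<Rightarrow> 'a) \<Rightarrow> real"
  assumes "integrable Q F"
  shows "(\<integral>x. \<integral>y. F (mrg J x y) \<partial>Q \<partial>Q) = (\<integral>x. F x \<partial>Q)"
proof -
  interpret Q: prob_space Q by (rule Q_prob)
  interpret QQ: pair_prob_space Q Q ..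
  have [measurable]: "F \<in> borel_measurable Q" using assms by auto
  have i: "integrable (Q \<Otimes>\<^sub>M Q) (\<lambda>p. F (mrg J (fst p) (snd p)))"
    using assms distr_mrg[of J] integrable_distr[OF measurable_mrg_Q[of J], of F]
    unfolding Q_def[symmetric] by auto
  have "(\<integral>x. F x \<partial>Q) = (\<integral>p. F (mrg J (fst p) (snd p)) \<partial>(Q \<Otimes>\<^sub>M Q))"
    using integral_distr[OF measurable_mrg_Q[of J], of F] distr_mrg[of J]
    unfolding Q_def[symmetric] by auto
  also have "\<dots> = (\<integral>x. \<integral>y. F (mrg J x y) \<partial>Q \<partial>Q)"
    using QQ.integral_fst'[OF i] by simp
  finally show ?thesis ..
qed

lemma avg_measurable[measurable]: "F \<in> borel_measurable Q \<Longrightarrow> avg M J F \<in> borel_measurable Q"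
proof -
  assume [measurable]: "F \<in> borel_measurable Q"
  interpret Q: prob_space Q by (rule Q_prob)
  have [measurable]: "(\<lambda>p. F (mrg J (fst p) (snd p))) \<in> borel_measurable (Q \<Otimes>\<^sub>M Q)" by measurable
  have "(\<lambda>x. \<integral>y. (\<lambda>p. F (mrg J (fst p) (snd p))) (x, y) \<partial>Q) \<in> borel_measurable Q"
    by measurable
  then show ?thesis unfolding avg_def[abs_def] Q_def[symmetric] by simp
qed

lemma avg_sqint:
  assumes "sqint Q F"
  shows "sqint Q (avg M J F)" "l2norm Q (avg M J F) \<le> l2norm Q F"
proof -
  interpret Q: prob_space Q by (rule Q_prob)
  show "sqint Q (avg M J F)" "l2norm Q (avg M J F) \<le> l2norm Q F"
    using Q.sqint_integral_fst[OF Q.sigma_finite_measure_axioms sqint_mrg(1)[OF assms, of J]] sqint_mrg(2)[OF assms, of J]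
    unfolding avg_def[abs_def] Q_def[symmetric] by auto
qed

lemma avg_AE_integrable:
  assumes "sqint Q F"
  shows "AE x in Q. integrable Q (\<lambda>y. F (mrg J x y))"
proof -
  interpret Q: prob_space Q by (rule Q_prob)
  interpret QQ: pair_prob_space Q Q ..
  have "integrable (Q \<Otimes>\<^sub>M Q) (\<lambda>p. F (mrg J (fst p) (snd p)))"
    using sqint_mrg(1)[OF assms, of J] by (rule QQ.P.sqint_integrable)
  from QQ.AE_integrable_fst'[OF this] show ?thesis by simp
qed

text \<open>Inside the integral over the copy, \<open>F x\<close> is constant, so the left side is
  the norm of an average of coupling differences, and averaging is a contraction. This converts the
  coupling assumption into a bound for conditional expectations.\<close>

lemma avg_approx:
  assumes F: "sqint Q F"
  shows "l2norm Q (\<lambda>x. F x - avg M J F x) \<le> l2norm (Q \<Otimes>\<^sub>M Q) (\<lambda>p. F (fst p) - F (mrg J (fst p) (snd p)))"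
proof -
  interpret Q: prob_space Q by (rule Q_prob)
  interpret QQ: pair_prob_space Q Q ..
  have [measurable]: "F \<in> borel_measurable Q" using F by auto
  have f1: "sqint (Q \<Otimes>\<^sub>M Q) (\<lambda>p. F (fst p))"
    using sqint_mrg(1)[OF F, of UNIV] by (simp add: mrg_def)
  have s: "sqint (Q \<Otimes>\<^sub>M Q) (\<lambda>p. F (fst p) - F (mrg J (fst p) (snd p)))"
    by (intro sqint_diff f1 sqint_mrg(1) F)
  have "l2norm Q (\<lambda>x. F x - avg M J F x) = l2norm Q (\<lambda>x. \<integral>y. F x - F (mrg J x y) \<partial>Q)"
  proof (rule l2norm_cong_AE)
    show "AE x in Q. F x - avg M J F x = (\<integral>y. F x - F (mrg J x y) \<partial>Q)"
      using avg_AE_integrable[OF F, of J]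
      by eventually_elim (simp add: avg_def Q_def[symmetric] Q.prob_space)
    have "(\<lambda>x. \<integral>y. (\<lambda>p. F (fst p) - F (mrg J (fst p) (snd p))) (x, y) \<partial>Q) \<in> borel_measurable Q"
      by measurable
    then show "(\<lambda>x. \<integral>y. F x - F (mrg J x y) \<partial>Q) \<in> borel_measurable Q" by simp
  qed auto
  also have "\<dots> \<le> l2norm (Q \<Otimes>\<^sub>M Q) (\<lambda>p. F (fst p) - F (mrg J (fst p) (snd p)))"
    using Q.sqint_integral_fst(2)[OF Q.sigma_finite_measure_axioms s] by simp
  finally show ?thesis .
qed

text \<open>Resampling the coordinates outside \<open>J\<close> leaves \<open>H\<close> unchanged, so the coordinates in
  \<open>K - J\<close> can be integrated out of \<open>F\<close>.\<close>
lemma avg_inner: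
  assumes F: "sqint Q F" and H: "sqint Q H" and d: "depends_on J H"
  shows "(\<integral>x. avg M K F x * H x \<partial>Q) = (\<integral>x. avg M (K \<inter> J) F x * H x \<partial>Q)"
proof -
  interpret Q: prob_space Q by (rule Q_prob)
  have i: "integrable Q (\<lambda>x. avg M K F x * H x)"
    by (rule sqint_integrable_mult[OF avg_sqint(1)[OF F] H])
  have "(\<integral>x. avg M K F x * H x \<partial>Q) = (\<integral>x. \<integral>z. avg M K F (mrg J x z) * H (mrg J x z) \<partial>Q \<partial>Q)"
    using integral_mrg[OF i, of J] by simp
  also have "\<dots> = (\<integral>x. avg M (K \<inter> J) F x * H x \<partial>Q)"
  proof (rule integral_cong_AE)
    have H_eq: "H (mrg J x z) = H x" for x z
      by (rule d[unfolded depends_on_def, rule_format]) (simp add: mrg_def)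
    \<comment> \<open>After both resamplings the coordinates in \<open>K \<inter> J\<close> come
      from \<open>x\<close>, and all others from \<open>mrg K z y\<close>, which is again one
      independent copy.\<close>
    have mm: "mrg K (mrg J x z) y = mrg (K \<inter> J) x (mrg K z y)" for x y z :: "'i \<Rightarrow> 'a"
      by (auto simp: mrg_def fun_eq_iff)
    show "AE x in Q. (\<integral>z. avg M K F (mrg J x z) * H (mrg J x z) \<partial>Q) = avg M (K \<inter> J) F x * H x"
      using avg_AE_integrable[OF F, of "K \<inter> J"]
    proof eventually_elim
      case (elim x)
      have "(\<integral>z. avg M K F (mrg J x z) \<partial>Q) = (\<integral>z. \<integral>y. F (mrg (K \<inter> J) x (mrg K z y)) \<partial>Q \<partial>Q)"
        by (simp add: avg_def mm Q_def)
      also have "\<dots> = avg M (K \<inter> J) F x"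
        using integral_mrg[OF elim, of K] by (simp add: avg_def Q_def)
      finally show ?case by (simp add: H_eq)
    qed
    have [measurable]: "F \<in> borel_measurable Q" "H \<in> borel_measurable Q" using F H by auto
    have "(\<lambda>x. \<integral>z. (\<lambda>p. avg M K F (mrg J (fst p) (snd p)) * H (mrg J (fst p) (snd p))) (x, z) \<partial>Q) \<in> borel_measurable Q"
      by measurable
    then show "(\<lambda>x. \<integral>z. avg M K F (mrg J x z) * H (mrg J x z) \<partial>Q) \<in> borel_measurable Q" by simp
    show "(\<lambda>x. avg M (K \<inter> J) F x * H x) \<in> borel_measurable Q" by measurable
  qed
  finally show ?thesis .
qed

text \<open>Against \<open>H\<close> only the coordinates of \<open>F\<close> in
  \<open>K \<inter> J\<close> matter; with none left, \<open>F\<close> may be replaced by its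
  mean.\<close>

lemma integral_mult_disjoint:
  assumes F: "sqint Q F" and H: "sqint Q H" and d: "depends_on J H" "depends_on K F" "K \<inter> J = {}"
  shows "(\<integral>x. F x * H x \<partial>Q) = (\<integral>x. F x \<partial>Q) * (\<integral>x. H x \<partial>Q)"
  using avg_inner[OF F H d(1), of K] d
  by (simp add: avg_depends[OF d(2) order_refl] avg_empty Q_def)

end
end

section \<open>Sums of shifted functionals of an i.i.d. sequence\<close>

text \<open>Time runs backwards in the argument of \<open>g\<close>: its coordinate \<open>k\<close>
  is the innovation at time \<open>i - k\<close>. Thus \<open>sh g\<close> is a stationary causal
  sequence.\<close>

definition sh :: "((nat \<Rightarrow> 's) \<Rightarrow> real) \<Rightarrow> int \<Rightarrow> (int \<Rightarrow> 's) \<Rightarrow> real" where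
  "sh g i x = g (\<lambda>k. x (i - int k))"

text \<open>The scalar form of the coupling distance in the hypotheses: the innovations at least
  \<open>m\<close> steps old are renewed.\<close>

definition err :: "'s measure \<Rightarrow> ((nat \<Rightarrow> 's) \<Rightarrow> real) \<Rightarrow> nat \<Rightarrow> real" where
  "err P g m = l2norm (PiM UNIV (\<lambda>_. P) \<Otimes>\<^sub>M PiM UNIV (\<lambda>_. P)) (\<lambda>p. g (fst p) - g (mrg {..<m} (fst p) (snd p)))"

text \<open>The increment from \<open>l\<close> to \<open>l + 1\<close> retained innovations is
  compared with \<open>g\<close> at both ends, hence two errors per level; the total runs over the
  levels from \<open>m\<close> on.\<close>

definition tl_err :: "'s measure \<Rightarrow> ((nat \<Rightarrow> 's) \<Rightarrow> real) \<Rightarrow> nat \<Rightarrow> real" where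
  "tl_err P g m = (\<Sum>l. err P g (l + m) + err P g (Suc (l + m)))"

lemma err_nonneg[simp]: "0 \<le> err P g m"
  by (simp add: err_def)

lemma tl_err_nonneg:
  assumes "summable (err P g)" shows "0 \<le> tl_err P g m"
  unfolding tl_err_def using assms
  by (intro suminf_nonneg summable_add summable_ignore_initial_segment) (auto simp: summable_Suc_iff summable_ignore_initial_segment
      intro: summable_ignore_initial_segment[of "\<lambda>n. err P g (Suc n)"])

lemma summable_err_pair:
  assumes "summable (err P g)" shows "summable (\<lambda>l. err P g l + err P g (Suc l))"
  using assms by (intro summable_add) (auto simp: summable_Suc_iff)

lemma tl_err_tendsto:
  assumes "summable (err P g)" shows "tl_err P g \<longlonglongrightarrow> 0"
proof -
  let ?b = "\<lambda>l. err P g l + err P g (Suc l)"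
  have s: "summable ?b" by (rule summable_err_pair[OF assms])
  have "(\<lambda>n. suminf ?b - (\<Sum>l<n. ?b l)) \<longlonglongrightarrow> suminf ?b - suminf ?b"
    using summable_LIMSEQ[OF s] by (intro tendsto_intros)
  then show ?thesis
    using suminf_minus_initial_segment[OF s] unfolding tl_err_def by simp
qed

lemma l2norm_sum_orthogonal:
  assumes fin: "finite I" and s: "\<And>i. i \<in> I \<Longrightarrow> sqint N (D i)"
    and o: "\<And>i j. i \<in> I \<Longrightarrow> j \<in> I \<Longrightarrow> i \<noteq> j \<Longrightarrow> (\<integral>x. D i x * D j x \<partial>N) = 0"
  shows "(l2norm N (\<lambda>x. \<Sum>i\<in>I. D i x))\<^sup>2 = (\<Sum>i\<in>I. (l2norm N (D i))\<^sup>2)"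
proof -
  have "(l2norm N (\<lambda>x. \<Sum>i\<in>I. D i x))\<^sup>2 = (\<integral>x. (\<Sum>i\<in>I. \<Sum>j\<in>I. D i x * D j x) \<partial>N)"
    unfolding l2norm_square by (simp add: power2_eq_square sum_product)
  also have "\<dots> = (\<Sum>i\<in>I. \<Sum>j\<in>I. \<integral>x. D i x * D j x \<partial>N)"
    using s by (simp add: Bochner_Integration.integral_sum sqint_integrable_mult)
  also have "\<dots> = (\<Sum>i\<in>I. \<Sum>j\<in>I. if j = i then (l2norm N (D i))\<^sup>2 else 0)"
    using o by (intro sum.cong refl) (auto simp: l2norm_square, simp add: power2_eq_square)
  also have "\<dots> = (\<Sum>i\<in>I. (l2norm N (D i))\<^sup>2)"
    using fin by simp
  finally show ?thesis .
qed

lemma Cesaro_limit: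
  fixes a :: "nat \<Rightarrow> real"
  assumes "a \<longlonglongrightarrow> L"
  shows "(\<lambda>n. (\<Sum>i<n. a i) / real n) \<longlonglongrightarrow> L"
proof (rule LIMSEQ_I)
  fix e :: real assume e: "0 < e"
  obtain n0 where n0: "\<And>n. n \<ge> n0 \<Longrightarrow> \<bar>a n - L\<bar> < e / 2"
    using LIMSEQ_D[OF assms, of "e / 2"] e by auto
  define C where "C = (\<Sum>i<n0. \<bar>a i - L\<bar>)"
  obtain n1 :: nat where n1: "2 * C / e < real n1" using reals_Archimedean2 by blast
  show "\<exists>no. \<forall>n\<ge>no. norm ((\<Sum>i<n. a i) / real n - L) < e"
  proof (intro exI allI impI)
    fix n assume n: "n \<ge> max (max n0 n1) 1"
    have "(\<Sum>i<n. a i) / real n - L = (\<Sum>i<n. a i - L) / real n"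
      using n by (simp add: sum_subtractf field_simps)
    also have "\<bar>\<dots>\<bar> \<le> (\<Sum>i<n. \<bar>a i - L\<bar>) / real n"
      using sum_abs[of "\<lambda>i. a i - L" "{..<n}"] by (simp add: divide_right_mono)
    also have "(\<Sum>i<n. \<bar>a i - L\<bar>) = C + (\<Sum>i=n0..<n. \<bar>a i - L\<bar>)"
      unfolding C_def using n sum.atLeastLessThan_concat[of 0 n0 n "\<lambda>i. \<bar>a i - L\<bar>"]
      by (simp add: atLeast0LessThan)
    also have "(\<Sum>i=n0..<n. \<bar>a i - L\<bar>) \<le> (\<Sum>i=n0..<n. e / 2)"
      using n0 by (intro sum_mono) (auto intro: less_imp_le)
    also have "\<dots> \<le> real n * (e / 2)" using e by (simp add: mult_right_mono)
    finally have "\<bar>(\<Sum>i<n. a i) / real n - L\<bar> \<le> (C + real n * (e / 2)) / real n"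
      using n by (simp add: divide_right_mono)
    also have "\<dots> = C / real n + e / 2" using n by (simp add: field_simps)
    also have "C / real n < e / 2"
    proof -
      have "2 * C / e < real n" using n1 n by simp
      then show ?thesis using e n by (simp add: field_simps)
    qed
    finally show "norm ((\<Sum>i<n. a i) / real n - L) < e" by simp
  qed
qed

section \<open>Orthogonal increments and mean-square bounds for sums\<close>

context prob_space
begin

abbreviation "Rn \<equiv> PiM (UNIV::nat set) (\<lambda>_. M)"
abbreviation "Qz \<equiv> PiM (UNIV::int set) (\<lambda>_. M)"

lemma measurable_past[measurable]: "(\<lambda>x k. x (i - int k)) \<in> Qz \<rightarrow>\<^sub>M Rn"
  by (intro measurable_PiM_UNIV) measurable

lemma distr_past: "distr Qz Rn (\<lambda>x k. x (i - int k)) = Rn"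
  by (rule distr_reindex) (auto simp: inj_def)

lemma sh_measurable[measurable]: "g \<in> borel_measurable Rn \<Longrightarrow> sh g i \<in> borel_measurable Qz"
  unfolding sh_def[abs_def] by (rule measurable_compose[OF measurable_past])

lemma sqint_sh:
  assumes "sqint Rn g"
  shows "sqint Qz (sh g i)" "l2norm Qz (sh g i) = l2norm Rn g"
  using sqint_distr[OF measurable_past[of i], of g] assms unfolding distr_past sh_def[abs_def] by auto

lemma integral_sh:
  assumes "g \<in> borel_measurable Rn"
  shows "(\<integral>x. sh g i x \<partial>Qz) = (\<integral>x. g x \<partial>Rn)"
  using integral_distr[OF measurable_past[of i], of g] assms unfolding distr_past sh_def[abs_def] by auto

text \<open>Keeping \<open>m\<close> coordinates of the past at time \<open>i\<close> means keeping
  the times in the window of length \<open>m\<close> ending at \<open>i\<close>. The one-sided copy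
  is realised as the past of a two-sided one, so that averages at different times live on one
  space.\<close>

lemma sh_avg:
  assumes [measurable]: "g \<in> borel_measurable Rn" and x: "x \<in> space Qz"
  shows "sh (avg M {..<m} g) i x = avg M {i - int m<..i} (sh g i) x"
proof -
  have sp: "(\<lambda>k. x (i - int k)) \<in> space Rn" using measurable_space[OF measurable_past x] .
  have [measurable]: "(\<lambda>w. g (mrg {..<m} (\<lambda>k. x (i - int k)) w)) \<in> borel_measurable Rn"
    using sp by measurable
  have "sh (avg M {..<m} g) i x = (\<integral>w. g (mrg {..<m} (\<lambda>k. x (i - int k)) w) \<partial>Rn)"
    by (simp add: sh_def avg_def)
  also have "\<dots> = (\<integral>y. g (mrg {..<m} (\<lambda>k. x (i - int k)) (\<lambda>k. y (i - int k))) \<partial>Qz)"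
    using integral_distr[OF measurable_past[of i], of "\<lambda>w. g (mrg {..<m} (\<lambda>k. x (i - int k)) w)"]
    unfolding distr_past by simp
  also have "\<dots> = avg M {i - int m<..i} (sh g i) x"
    unfolding avg_def sh_def
    by (intro Bochner_Integration.integral_cong refl arg_cong[where f=g]) (auto simp: mrg_def fun_eq_iff)
  finally show ?thesis .
qed

lemma depends_on_sh: "depends_on {..i} (sh g i)"
  unfolding depends_on_def sh_def by (auto intro!: arg_cong[where f=g])

lemma depends_on_sh_window:
  assumes "depends_on {..<m} h" shows "depends_on {i - int m<..i} (sh h i)"
  using assms unfolding depends_on_def sh_def by auto

lemma avg_err:
  assumes "sqint Rn g" shows "l2norm Rn (\<lambda>x. g x - avg M {..<m} g x) \<le> err M g m"
  using avg_approx[OF assms] by (simp add: err_def)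

text \<open>The coordinate \<open>i - l\<close> enters the increment at \<open>i\<close> but not the one at \<open>j > i\<close>, and averaging over
  it annihilates the former.\<close>
lemma increment_orthogonal:
  fixes l :: nat
  assumes g: "sqint Rn g" and ij: "i < j"
  defines "D \<equiv> \<lambda>i x. sh (avg M {..<Suc l} g) i x - sh (avg M {..<l} g) i x"
  shows "(\<integral>x. D i x * D j x \<partial>Qz) = 0"
proof -
  have m[measurable]: "g \<in> borel_measurable Rn" using g by auto
  have sD: "sqint Qz (D i)" for i
    unfolding D_def by (intro sqint_diff sqint_sh avg_sqint g)
  have dD: "depends_on {j - int (Suc l)<..j} (D j)"
    unfolding D_def
    by (intro depends_on_diff depends_on_sh_window depends_on_avg
        depends_on_mono[OF depends_on_sh_window[OF depends_on_avg]]) auto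
  have s1: "sqint Qz (avg M K (sh g i))" for K by (intro avg_sqint sqint_sh g)
  have "(\<integral>x. D i x * D j x \<partial>Qz) = (\<integral>x. avg M {i - int (Suc l)<..i} (sh g i) x * D j x - avg M {i - int l<..i} (sh g i) x * D j x \<partial>Qz)"
  proof (rule Bochner_Integration.integral_cong[OF refl])
    fix x assume "x \<in> space Qz"
    from sh_avg[OF m this, of "Suc l" i] sh_avg[OF m this, of l i]
    have "D i x = avg M {i - int (Suc l)<..i} (sh g i) x - avg M {i - int l<..i} (sh g i) x"
      unfolding D_def by simp
    then show "D i x * D j x = avg M {i - int (Suc l)<..i} (sh g i) x * D j x - avg M {i - int l<..i} (sh g i) x * D j x"
      by (simp add: left_diff_distrib)
  qed
  also have "\<dots> = (\<integral>x. avg M {i - int (Suc l)<..i} (sh g i) x * D j x \<partial>Qz) - (\<integral>x. avg M {i - int l<..i} (sh g i) x * D j x \<partial>Qz)"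
    by (intro Bochner_Integration.integral_diff sqint_integrable_mult s1 sD)
  also have "{i - int (Suc l)<..i} \<inter> {j - int (Suc l)<..j} = {i - int l<..i} \<inter> {j - int (Suc l)<..j}"
    using ij by auto
  then have "(\<integral>x. avg M {i - int (Suc l)<..i} (sh g i) x * D j x \<partial>Qz) = (\<integral>x. avg M {i - int l<..i} (sh g i) x * D j x \<partial>Qz)"
    using avg_inner[OF sqint_sh(1)[OF g] sD dD, of "{i - int (Suc l)<..i}" i] avg_inner[OF sqint_sh(1)[OF g] sD dD, of "{i - int l<..i}" i]
    by simp
  finally show ?thesis by simp
qed

text \<open>Orthogonality across times makes the norm of the sum grow only like the square root of
  the number of terms. A single increment is estimated by comparing both truncations with
  \<open>g\<close>.\<close>

lemma l2norm_increment_sum: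
  assumes g: "sqint Rn g" and I: "finite I"
  shows "l2norm Qz (\<lambda>x. \<Sum>i\<in>I. sh (avg M {..<Suc l} g) i x - sh (avg M {..<l} g) i x)
    \<le> sqrt (card I) * (err M g l + err M g (Suc l))"
proof -
  let ?h = "\<lambda>x. avg M {..<Suc l} g x - avg M {..<l} g x"
  have h: "sqint Rn ?h" by (intro sqint_diff avg_sqint g)
  have sh: "sh ?h i x = sh (avg M {..<Suc l} g) i x - sh (avg M {..<l} g) i x" for i x
    by (simp add: sh_def)
  have "(l2norm Qz (\<lambda>x. \<Sum>i\<in>I. sh ?h i x))\<^sup>2 = (\<Sum>i\<in>I. (l2norm Qz (sh ?h i))\<^sup>2)"
  proof (rule l2norm_sum_orthogonal[OF I])
    show "(\<integral>x. sh ?h i x * sh ?h j x \<partial>Qz) = 0" if "i \<noteq> j" for i j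
    proof (cases "i < j")
      case True
      then show ?thesis using increment_orthogonal[OF g, of i j l] by (simp add: sh)
    next
      case False
      then show ?thesis using increment_orthogonal[OF g, of j i l] that by (simp add: sh mult.commute)
    qed
  qed (rule sqint_sh(1)[OF h])
  also have "\<dots> = card I * (l2norm Rn ?h)\<^sup>2"
    by (simp add: sqint_sh(2)[OF h])
  finally have "sqrt ((l2norm Qz (\<lambda>x. \<Sum>i\<in>I. sh ?h i x))\<^sup>2) = sqrt (card I * (l2norm Rn ?h)\<^sup>2)"
    by simp
  then have "l2norm Qz (\<lambda>x. \<Sum>i\<in>I. sh ?h i x) = sqrt (card I) * l2norm Rn ?h"
    by (simp add: real_sqrt_mult)
  also have "l2norm Rn ?h \<le> err M g l + err M g (Suc l)"
  proof -
    have "l2norm Rn ?h = l2norm Rn (\<lambda>x. (g x - avg M {..<l} g x) - (g x - avg M {..<Suc l} g x))" by simp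
    also have "\<dots> \<le> l2norm Rn (\<lambda>x. g x - avg M {..<l} g x) + l2norm Rn (\<lambda>x. g x - avg M {..<Suc l} g x)"
      by (intro l2norm_diff_le sqint_diff g avg_sqint)
    also have "\<dots> \<le> err M g l + err M g (Suc l)"
      by (intro add_mono avg_err g)
    finally show ?thesis .
  qed
  finally show ?thesis by (simp add: sh mult_left_mono)
qed

text \<open>Orthogonality is available only within one level \<open>l\<close>. So the difference is
  telescoped over the levels, with the triangle inequality between levels and orthogonality within
  each.\<close>

lemma l2norm_truncation_sum:
  assumes g: "sqint Rn g" and I: "finite I" and mL: "m \<le> L"
  shows "l2norm Qz (\<lambda>x. \<Sum>i\<in>I. sh (avg M {..<L} g) i x - sh (avg M {..<m} g) i x)
    \<le> sqrt (card I) * (\<Sum>l=m..<L. err M g l + err M g (Suc l))"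
proof -
  have "(\<Sum>i\<in>I. sh (avg M {..<L} g) i x - sh (avg M {..<m} g) i x)
    = (\<Sum>l=m..<L. \<Sum>i\<in>I. sh (avg M {..<Suc l} g) i x - sh (avg M {..<l} g) i x)" for x
    by (subst sum.swap) (intro sum.cong refl sum_Suc_diff'[OF mL, symmetric])
  then have "l2norm Qz (\<lambda>x. \<Sum>i\<in>I. sh (avg M {..<L} g) i x - sh (avg M {..<m} g) i x)
    \<le> (\<Sum>l=m..<L. l2norm Qz (\<lambda>x. \<Sum>i\<in>I. sh (avg M {..<Suc l} g) i x - sh (avg M {..<l} g) i x))"
    by (simp only:) (intro l2norm_sum_le sqint_sum sqint_diff sqint_sh avg_sqint g)
  also have "\<dots> \<le> (\<Sum>l=m..<L. sqrt (card I) * (err M g l + err M g (Suc l)))"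
    by (intro sum_mono l2norm_increment_sum g I)
  finally show ?thesis by (simp add: sum_distrib_left)
qed

lemma sum_err_le_tl:
  assumes sm: "summable (err M g)" and "m \<le> L"
  shows "(\<Sum>l=m..<L. err M g l + err M g (Suc l)) \<le> tl_err M g m"
proof -
  let ?b = "\<lambda>l. err M g l + err M g (Suc l)"
  have "(\<Sum>l=m..<L. ?b l) = (\<Sum>l<L - m. ?b (l + m))"
    using sum.shift_bounds_nat_ivl[of ?b 0 m "L - m"] assms by (simp add: atLeast0LessThan)
  also have "\<dots> \<le> (\<Sum>l. ?b (l + m))"
    using summable_ignore_initial_segment[OF summable_err_pair[OF sm], of m]
    by (intro sum_le_suminf) auto
  finally show ?thesis by (simp add: tl_err_def)
qed

text \<open>Pass through a deeper truncation \<open>L\<close>. Its remainder is bounded crudely,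
  linearly in the number of terms, which is harmless because \<open>I\<close> stays fixed while
  \<open>L\<close> grows.\<close>

lemma l2norm_remainder_sum:
  assumes g: "sqint Rn g" and sm: "summable (err M g)" and I: "finite I"
  shows "l2norm Qz (\<lambda>x. \<Sum>i\<in>I. sh g i x - sh (avg M {..<m} g) i x) \<le> sqrt (card I) * tl_err M g m"
proof (rule LIMSEQ_le_const)
  have "(\<lambda>L. card I * err M g L + sqrt (card I) * tl_err M g m) \<longlonglongrightarrow> real (card I) * 0 + sqrt (card I) * tl_err M g m"
    using summable_LIMSEQ_zero[OF sm] by (intro tendsto_intros)
  then show "(\<lambda>L. card I * err M g L + sqrt (card I) * tl_err M g m) \<longlonglongrightarrow> sqrt (card I) * tl_err M g m" by simp
  show "\<exists>N. \<forall>L\<ge>N. l2norm Qz (\<lambda>x. \<Sum>i\<in>I. sh g i x - sh (avg M {..<m} g) i x) \<le> card I * err M g L + sqrt (card I) * tl_err M g m"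
  proof (intro exI allI impI)
    fix L assume L: "m \<le> L"
    have e: "(\<Sum>i\<in>I. sh g i x - sh (avg M {..<m} g) i x) =
      (\<Sum>i\<in>I. sh g i x - sh (avg M {..<L} g) i x) + (\<Sum>i\<in>I. sh (avg M {..<L} g) i x - sh (avg M {..<m} g) i x)" for x
      by (simp add: sum_subtractf)
    have d: "sqint Rn (\<lambda>x. g x - avg M {..<L} g x)" by (intro sqint_diff g avg_sqint)
    have "l2norm Qz (\<lambda>x. \<Sum>i\<in>I. sh g i x - sh (avg M {..<L} g) i x)
      \<le> (\<Sum>i\<in>I. l2norm Qz (\<lambda>x. sh g i x - sh (avg M {..<L} g) i x))"
      by (intro l2norm_sum_le sqint_sh sqint_diff avg_sqint g)
    also have "\<dots> = (\<Sum>i\<in>I. l2norm Rn (\<lambda>x. g x - avg M {..<L} g x))"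
      using sqint_sh(2)[OF d] by (intro sum.cong refl) (simp add: sh_def[abs_def])
    also have "\<dots> \<le> card I * err M g L"
      using avg_err[OF g] by (simp add: mult_left_mono)
    finally have 1: "l2norm Qz (\<lambda>x. \<Sum>i\<in>I. sh g i x - sh (avg M {..<L} g) i x) \<le> card I * err M g L" .
    have 2: "l2norm Qz (\<lambda>x. \<Sum>i\<in>I. sh (avg M {..<L} g) i x - sh (avg M {..<m} g) i x) \<le> sqrt (card I) * tl_err M g m"
      using l2norm_truncation_sum[OF g I L] sum_err_le_tl[OF sm L]
      by (meson mult_left_mono order_trans real_sqrt_ge_zero of_nat_0_le_iff)
    show "l2norm Qz (\<lambda>x. \<Sum>i\<in>I. sh g i x - sh (avg M {..<m} g) i x) \<le> card I * err M g L + sqrt (card I) * tl_err M g m"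
      unfolding e using 1 2
      by (intro order_trans[OF l2norm_add_le] add_mono sqint_sum sqint_diff sqint_sh avg_sqint g)
  qed
qed

text \<open>With no innovation retained the truncation is the mean, which is 0, so bounds for
  differences from level 0 are bounds for the sums themselves. The constant does not depend on the
  truncation level.\<close>

lemma l2norm_shift_sum:
  assumes g: "sqint Rn g" and sm: "summable (err M g)" and I: "finite I" and mean: "(\<integral>x. g x \<partial>Rn) = 0"
  shows "l2norm Qz (\<lambda>x. \<Sum>i\<in>I. sh g i x) \<le> sqrt (card I) * tl_err M g 0"
    and "l2norm Qz (\<lambda>x. \<Sum>i\<in>I. sh (avg M {..<m} g) i x) \<le> sqrt (card I) * tl_err M g 0"
proof -
  have z: "sh (avg M {..<0} g) i x = 0" for i x
    by (simp add: sh_def avg_empty mean)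
  show "l2norm Qz (\<lambda>x. \<Sum>i\<in>I. sh g i x) \<le> sqrt (card I) * tl_err M g 0"
    using l2norm_remainder_sum[OF g sm I, of 0] by (simp only: z diff_0_right)
  have "l2norm Qz (\<lambda>x. \<Sum>i\<in>I. sh (avg M {..<m} g) i x) \<le> sqrt (card I) * (\<Sum>l=0..<m. err M g l + err M g (Suc l))"
    using l2norm_truncation_sum[OF g I, of 0 m] by (simp only: z diff_0_right le0)
  also have "\<dots> \<le> sqrt (card I) * tl_err M g 0"
    by (intro mult_left_mono sum_err_le_tl sm) auto
  finally show "l2norm Qz (\<lambda>x. \<Sum>i\<in>I. sh (avg M {..<m} g) i x) \<le> sqrt (card I) * tl_err M g 0" .
qed

section \<open>Autocovariances and the long-run variance\<close>

text \<open>Truncated to the innovations at times \<open>1..k\<close>, the second factor has mean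
  zero and is independent of the first, which uses times up to 0. Only the truncation error at level
  \<open>k\<close> remains.\<close>

lemma covariance_bound:
  assumes g: "sqint Rn g" and g': "sqint Rn g'" and mean: "(\<integral>x. g' x \<partial>Rn) = 0"
  shows "\<bar>\<integral>x. sh g 0 x * sh g' (int k) x \<partial>Qz\<bar> \<le> l2norm Rn g * err M g' k"
proof -
  have m[measurable]: "g' \<in> borel_measurable Rn" "g \<in> borel_measurable Rn" using g g' by auto
  define T where "T = sh (avg M {..<k} g') (int k)"
  have sT: "sqint Qz T" unfolding T_def by (intro sqint_sh avg_sqint g')
  note s = sqint_sh(1)[OF g, of 0] sqint_sh(1)[OF g', of "int k"]
  have "(\<integral>x. T x * sh g 0 x \<partial>Qz) = (\<integral>x. avg M {int k - int k<..int k} (sh g' (int k)) x * sh g 0 x \<partial>Qz)"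
    unfolding T_def by (intro Bochner_Integration.integral_cong refl) (simp add: sh_avg)
  also have "\<dots> = (\<integral>x. avg M ({int k - int k<..int k} \<inter> {..0}) (sh g' (int k)) x * sh g 0 x \<partial>Qz)"
    by (rule avg_inner[OF s(2,1) depends_on_sh])
  also have "{int k - int k<..int k} \<inter> {..0} = {}" by auto
  also have "(\<integral>x. avg M {} (sh g' (int k)) x * sh g 0 x \<partial>Qz) = 0"
    by (simp add: avg_empty integral_sh mean)
  finally have 0: "(\<integral>x. T x * sh g 0 x \<partial>Qz) = 0" .
  have "(\<integral>x. sh g 0 x * sh g' (int k) x \<partial>Qz) = (\<integral>x. sh g 0 x * (sh g' (int k) x - T x) + T x * sh g 0 x \<partial>Qz)"
    by (simp add: algebra_simps)
  also have "\<dots> = (\<integral>x. sh g 0 x * (sh g' (int k) x - T x) \<partial>Qz)"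
    using 0 by (subst Bochner_Integration.integral_add) (auto intro!: sqint_integrable_mult sqint_diff s sT)
  also have "\<bar>\<dots>\<bar> \<le> l2norm Qz (sh g 0) * l2norm Qz (\<lambda>x. sh g' (int k) x - T x)"
    by (intro Cauchy_Schwarz_l2norm s sqint_diff sT)
  also have "l2norm Qz (\<lambda>x. sh g' (int k) x - T x) = l2norm Rn (\<lambda>x. g' x - avg M {..<k} g' x)"
    using sqint_sh(2)[OF sqint_diff[OF g' avg_sqint(1)[OF g', of "{..<k}"]], of "int k"] by (simp add: T_def sh_def[abs_def])
  also have "l2norm Qz (sh g 0) * \<dots> \<le> l2norm Rn g * err M g' k"
    unfolding sqint_sh(2)[OF g] by (intro mult_left_mono avg_err g') auto
  finally show ?thesis .
qed

lemma measurable_translate[measurable]: "(\<lambda>x k. x (k + s)) \<in> Qz \<rightarrow>\<^sub>M Qz" for s :: int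
  by (intro measurable_PiM_UNIV) measurable

lemma distr_translate: "distr Qz Qz (\<lambda>x k. x (k + s)) = Qz" for s :: int
  by (rule distr_reindex) (auto simp: inj_def)

lemma sh_translate: "sh g i (\<lambda>k. x (k + s)) = sh g (i + s) x"
  by (simp add: sh_def algebra_simps)

lemma covariance_stationary:
  assumes [measurable]: "g \<in> borel_measurable Rn" "g' \<in> borel_measurable Rn"
  shows "(\<integral>x. sh g i x * sh g' j x \<partial>Qz) = (\<integral>x. sh g 0 x * sh g' (j - i) x \<partial>Qz)"
  using integral_distr[OF measurable_translate[of i], of "\<lambda>x. sh g 0 x * sh g' (j - i) x"]
  unfolding distr_translate by (simp add: sh_translate)

text \<open>The long-run variance; the two one-sided sums of covariances coincide for a scalar
  stationary sequence, hence the factor 2.\<close>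

definition "lrv g = (\<integral>x. sh g 0 x * sh g 0 x \<partial>Qz) + 2 * (\<Sum>k. \<integral>x. sh g 0 x * sh g (int (Suc k)) x \<partial>Qz)"

text \<open>By stationarity, adding the term \<open>N + 1\<close> raises the variance of the sum by
  \<open>\<gamma> 0 + 2 * (\<gamma> 1 + ... + \<gamma> N)\<close>. These increments converge, so the
  normalised variance is a Cesaro mean of a convergent sequence.\<close>

lemma variance_limit:
  assumes g: "sqint Rn g" and sm: "summable (err M g)" and mean: "(\<integral>x. g x \<partial>Rn) = 0"
  shows "(\<lambda>N. (l2norm Qz (\<lambda>x. (\<Sum>i=1..int N. sh g i x) / sqrt N))\<^sup>2) \<longlonglongrightarrow> lrv g"
proof -
  have m[measurable]: "g \<in> borel_measurable Rn" using g by auto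
  define \<gamma> where "\<gamma> k = (\<integral>x. sh g 0 x * sh g (int k) x \<partial>Qz)" for k
  define V where "V N = (\<integral>x. (\<Sum>i=1..int N. sh g i x)\<^sup>2 \<partial>Qz)" for N
  have s: "summable (\<lambda>k. \<gamma> (Suc k))"
  proof (rule summable_comparison_test')
    show "summable (\<lambda>k. l2norm Rn g * err M g (Suc k))"
      using sm by (intro summable_mult) (simp add: summable_Suc_iff)
    show "norm (\<gamma> (Suc k)) \<le> l2norm Rn g * err M g (Suc k)" for k
      unfolding \<gamma>_def real_norm_def by (rule covariance_bound[OF g g mean])
  qed
  have sS: "sqint Qz (\<lambda>x. \<Sum>i=1..int N. sh g i x)" for N by (intro sqint_sum sqint_sh g)
  have rec: "V (Suc N) = V N + (\<gamma> 0 + 2 * (\<Sum>k<N. \<gamma> (Suc k)))" for N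
  proof -
    have e: "{1..int (Suc N)} = insert (int (Suc N)) {1..int N}" by auto
    have "V (Suc N) = (\<integral>x. (\<Sum>i=1..int N. sh g i x)\<^sup>2 + (sh g (int (Suc N)) x * sh g (int (Suc N)) x + 2 * (\<Sum>i=1..int N. sh g i x * sh g (int (Suc N)) x)) \<partial>Qz)"
      unfolding V_def e
      by (intro Bochner_Integration.integral_cong refl)
         (simp add: power2_sum power2_eq_square sum_distrib_right sum_distrib_left algebra_simps)
    also have "\<dots> = V N + ((\<integral>x. sh g (int (Suc N)) x * sh g (int (Suc N)) x \<partial>Qz) + 2 * (\<Sum>i=1..int N. \<integral>x. sh g i x * sh g (int (Suc N)) x \<partial>Qz))"
      unfolding V_def
      by (subst Bochner_Integration.integral_add Bochner_Integration.integral_sum integral_mult_right_zero;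
          (intro sqint_integrable_square[OF sS] Bochner_Integration.integrable_add integrable_mult_right
            Bochner_Integration.integrable_sum sqint_integrable_mult sqint_sh g)?)+ simp
    also have "(\<integral>x. sh g (int (Suc N)) x * sh g (int (Suc N)) x \<partial>Qz) = \<gamma> 0"
      unfolding \<gamma>_def by (subst covariance_stationary) auto
    also have "(\<Sum>i=1..int N. \<integral>x. sh g i x * sh g (int (Suc N)) x \<partial>Qz) = (\<Sum>i=1..int N. \<gamma> (nat (int (Suc N) - i)))"
      unfolding \<gamma>_def by (intro sum.cong refl, subst covariance_stationary) auto
    also have "\<dots> = (\<Sum>k<N. \<gamma> (Suc k))"
      by (rule sum.reindex_bij_witness[of _ "\<lambda>k. int N - int k" "\<lambda>i. N - nat i"]) (auto intro!: arg_cong[where f=\<gamma>])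
    finally show ?thesis .
  qed
  have "V 0 = 0" by (simp add: V_def)
  then have V: "V N = (\<Sum>n<N. \<gamma> 0 + 2 * (\<Sum>k<n. \<gamma> (Suc k)))" for N
    by (induct N) (simp_all add: rec)
  have "(\<lambda>n. \<gamma> 0 + 2 * (\<Sum>k<n. \<gamma> (Suc k))) \<longlonglongrightarrow> \<gamma> 0 + 2 * (\<Sum>k. \<gamma> (Suc k))"
    using summable_LIMSEQ[OF s] by (intro tendsto_intros)
  from Cesaro_limit[OF this] have "(\<lambda>N. V N / real N) \<longlonglongrightarrow> lrv g"
    unfolding V lrv_def \<gamma>_def by simp
  moreover have "V N / real N = (l2norm Qz (\<lambda>x. (\<Sum>i=1..int N. sh g i x) / sqrt N))\<^sup>2" for N
    by (simp add: l2norm_square power_divide V_def)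
  ultimately show ?thesis by simp
qed

end

section \<open>Central limit theorem for shifted functionals\<close>

text \<open>Zero variance is split off, since the sum cannot be standardised then: all partial sums
  vanish in mean square. Otherwise the frequency is rescaled by \<open>\<sigma>\<close>.\<close>

lemma (in prob_space) iid_CLT_char:
  fixes X :: "nat \<Rightarrow> 'a \<Rightarrow> real"
  assumes indep: "indep_vars (\<lambda>i. borel) X UNIV"
    and mean: "\<And>n. expectation (X n) = 0"
    and s: "\<And>n. sqint M (X n)"
    and d: "\<And>n. distr M borel (X n) = distr M borel (X 0)"
  shows "(\<lambda>q. char (distr M borel (\<lambda>x. (\<Sum>r<q. X r x) / sqrt q)) u)
     \<longlonglongrightarrow> complex_of_real (exp (- (u\<^sup>2 * (l2norm M (X 0))\<^sup>2) / 2))"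
proof -
  have [measurable]: "X n \<in> borel_measurable M" for n using s by auto
  define \<sigma> where "\<sigma> = l2norm M (X 0)"
  have \<sigma>: "l2norm M (X n) = \<sigma>" for n
  proof -
    have "l2norm M (X n) = l2norm (distr M borel (X n)) (\<lambda>x. x)" for n
      by (simp add: l2norm_def integral_distr)
    then show ?thesis unfolding \<sigma>_def using d[of n] by metis
  qed
  show ?thesis
  proof (cases "\<sigma> = 0")
    case True
    have "char (distr M borel (\<lambda>x. (\<Sum>r<q. X r x) / sqrt q)) u = 1" for q
    proof -
      have "l2norm M (\<lambda>x. \<Sum>r<q. X r x) \<le> (\<Sum>r<q. l2norm M (X r))"
        by (intro l2norm_sum_le s)
      then have "l2norm M (\<lambda>x. \<Sum>r<q. X r x) = 0" using True \<sigma>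
        by (simp add: antisym[OF _ l2norm_nonneg])
      then have z: "l2norm M (\<lambda>x. (\<Sum>r<q. X r x) / sqrt q - 0) = 0"
        using l2norm_cmult[of M "1 / sqrt q" "\<lambda>x. \<Sum>r<q. X r x"] by simp
      have "cmod (char (distr M borel (\<lambda>x. (\<Sum>r<q. X r x) / sqrt q)) u - char (distr M borel (\<lambda>x. 0)) u)
          \<le> \<bar>u\<bar> * l2norm M (\<lambda>x. (\<Sum>r<q. X r x) / sqrt q - 0)"
        using sqint_cmult[OF sqint_sum[of "{..<q}" M X, OF s], of "1 / sqrt q"]
        by (intro char_diff_le_l2norm prob_space_axioms) auto
      moreover have "char (distr M borel (\<lambda>x. 0)) u = 1"
        by (simp add: char_def integral_distr prob_space del: distr_const)
      ultimately show ?thesis unfolding z by simp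
    qed
    then show ?thesis using True by (simp add: \<sigma>_def)
  next
    case False
    then have pos: "\<sigma> > 0" by (simp add: \<sigma>_def order_less_le)
    have "variance (X n) = \<sigma>\<^sup>2" for n
      by (simp add: mean \<sigma>[of n, symmetric] l2norm_square)
    then have "weak_conv_m (\<lambda>n. distr M borel (\<lambda>x. (\<Sum>i<n. X i x) / sqrt (n * \<sigma>\<^sup>2))) std_normal_distribution"
      using s d by (intro central_limit_theorem_zero_mean[OF indep mean pos]) (auto simp: sqint_def)
    then have "(\<lambda>n. char (distr M borel (\<lambda>x. (\<Sum>i<n. X i x) / sqrt (n * \<sigma>\<^sup>2))) (u * \<sigma>)) \<longlonglongrightarrow> char std_normal_distribution (u * \<sigma>)"
      by (intro levy_continuity1 real_dist_normal_dist) (auto intro!: real_distribution_distr)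
    moreover have "char (distr M borel (\<lambda>x. (\<Sum>i<n. X i x) / sqrt (n * \<sigma>\<^sup>2))) (u * \<sigma>) = char (distr M borel (\<lambda>x. (\<Sum>r<n. X r x) / sqrt n)) u" for n
      using pos unfolding char_def
      by (subst (1 2) integral_distr) (auto simp: real_sqrt_mult field_simps intro!: Bochner_Integration.integral_cong)
    ultimately show ?thesis
      by (simp add: char_std_normal_distribution \<sigma>_def[symmetric] power_mult_distrib)
  qed
qed

section \<open>Independent blocks and m-dependent approximation\<close>

context prob_space
begin

lemma indep_vars_coordinates:
  "prob_space.indep_vars (PiM UNIV (\<lambda>_. M)) (\<lambda>_. M) (\<lambda>i x. x i) (UNIV :: 'i set)"
proof -
  interpret Q: prob_space "PiM (UNIV::'i set) (\<lambda>_. M)" by (rule prob_space_PiM_UNIV)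
  have c: "distr (PiM (UNIV::'i set) (\<lambda>_. M)) M (\<lambda>x. x i) = M" for i
    using distr_PiM_component[of UNIV "\<lambda>_. M" i] prob_space_axioms by simp
  show ?thesis
    by (subst Q.indep_vars_iff_distr_eq_PiM) (auto simp: c restrict_UNIV distr_id)
qed

lemma indep_blocks:
  fixes W :: "nat \<Rightarrow> 'i set"
  assumes B: "\<And>r. B r \<in> borel_measurable (PiM UNIV (\<lambda>_. M))"
    and dep: "\<And>r. depends_on (W r) (B r)" and dj: "disjoint_family W"
  shows "prob_space.indep_vars (PiM (UNIV::'i set) (\<lambda>_. M)) (\<lambda>_. borel) B UNIV"
proof -
  interpret Q: prob_space "PiM (UNIV::'i set) (\<lambda>_. M)" by (rule prob_space_PiM_UNIV)
  \<comment> \<open>\<open>B r\<close> has to become a function of the restricted sequence; the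
    coordinates outside \<open>W r\<close> are filled with an arbitrary point, which does not change
    its value.\<close>
  obtain s0 where s0: "s0 \<in> space M" using not_empty by auto
  define E where "E r z = B r (\<lambda>i. if i \<in> W r then z i else s0)" for r z
  have "Q.indep_vars (\<lambda>r. PiM (W r) (\<lambda>_. M)) (\<lambda>r x. restrict (\<lambda>i. x i) (W r)) UNIV"
    by (rule Q.indep_vars_restrict[OF indep_vars_coordinates]) (use dj in auto)
  then have "Q.indep_vars (\<lambda>_. borel) (\<lambda>r x. E r (restrict (\<lambda>i. x i) (W r))) UNIV"
  proof (rule Q.indep_vars_compose2)
    fix r
    have "(\<lambda>z i. if i \<in> W r then z i else s0) \<in> PiM (W r) (\<lambda>_. M) \<rightarrow>\<^sub>M PiM UNIV (\<lambda>_. M)"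
    proof (rule measurable_PiM_UNIV)
      show "(\<lambda>z. if i \<in> W r then z i else s0) \<in> PiM (W r) (\<lambda>_. M) \<rightarrow>\<^sub>M M" for i
        using s0 by (cases "i \<in> W r") auto
    qed
    from measurable_compose[OF this B[of r]]
    show "E r \<in> borel_measurable (PiM (W r) (\<lambda>_. M))" unfolding E_def[abs_def] .
  qed
  moreover have "E r (restrict (\<lambda>i. x i) (W r)) = B r x" for r x
    unfolding E_def by (rule dep[unfolded depends_on_def, rule_format]) auto
  ultimately show ?thesis by simp
qed

lemma depends_on_sum: "(\<And>i. i \<in> I \<Longrightarrow> depends_on J (F i)) \<Longrightarrow> depends_on J (\<lambda>x. \<Sum>i\<in>I. F i x)"
  unfolding depends_on_def by (auto intro!: sum.cong)

text \<open>Consecutive blocks of length \<open>p - m\<close> are separated by gaps of length \<open>m\<close>, hence independent.\<close>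
lemma mdep_block_CLT:
  assumes h: "sqint Rn h" and dep: "depends_on {..<m} h" and mean: "(\<integral>x. h x \<partial>Rn) = 0" and pm: "m \<le> p"
  defines "B \<equiv> \<lambda>r x. \<Sum>i=int (r * p)+1..int (r * p + (p - m)). sh h i x"
  shows "(\<lambda>q. char (distr Qz borel (\<lambda>x. (\<Sum>r<q. B r x) / sqrt q)) u) \<longlonglongrightarrow>
      complex_of_real (exp (- (u\<^sup>2 * (l2norm Qz (B 0))\<^sup>2) / 2))"
    and "l2norm Qz (\<lambda>x. \<Sum>r<q. B r x) = sqrt q * l2norm Qz (B 0)"
proof -
  interpret Q: prob_space Qz by (rule prob_space_PiM_UNIV)
  have [measurable]: "h \<in> borel_measurable Rn" using h by auto
  have sB: "sqint Qz (B r)" for r unfolding B_def by (intro sqint_sum sqint_sh h)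
  have mB[measurable]: "B r \<in> borel_measurable Qz" for r using sB by auto
  \<comment> \<open>The first term of block \<open>r\<close> reads back to time
    \<open>r * p + 2 - m\<close>, while block \<open>r - 1\<close> ends at \<open>r * p - m\<close>;
    so the windows are disjoint.\<close>
  define W where "W r = {int (r * p) + 1 - int m<..int (r * p + (p - m))}" for r
  have dB: "depends_on (W r) (B r)" for r
    unfolding B_def W_def
    by (intro depends_on_sum depends_on_mono[OF depends_on_sh_window[OF dep]]) auto
  have dj: "W r \<inter> W r' = {}" if "r < r'" for r r'
  proof -
    have "(r + 1) * p \<le> r' * p" using that by (intro mult_right_mono) auto
    then have "int ((r + 1) * p) \<le> int (r' * p)" by (simp only: of_nat_le_iff)
    then have "int (r * p + (p - m)) \<le> int (r' * p) + 1 - int m" using pm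
      by (simp add: of_nat_diff algebra_simps)
    then show ?thesis unfolding W_def by auto
  qed
  have dj': "W r \<inter> W r' = {}" if "r \<noteq> r'" for r r'
    using dj[of r r'] dj[of r' r] that by (cases "r < r'") auto
  have indep: "Q.indep_vars (\<lambda>_. borel) B UNIV"
    by (rule indep_blocks[OF mB dB]) (use dj' in \<open>auto simp: disjoint_family_on_def\<close>)
  \<comment> \<open>Each block is the first one evaluated along a translated sequence, which gives
    identical distribution.\<close>
  have tr: "B r x = B 0 (\<lambda>k. x (k + int (r * p)))" for r x
    unfolding B_def sh_translate
    by (rule sum.reindex_bij_witness[of _ "\<lambda>i. i + int (r * p)" "\<lambda>i. i - int (r * p)"]) auto
  have d: "distr Qz borel (B r) = distr Qz borel (B 0)" for r
  proof -
    have "distr Qz borel (B 0) = distr (distr Qz Qz (\<lambda>x k. x (k + int (r * p)))) borel (B 0)"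
      by (simp add: distr_translate)
    also have "\<dots> = distr Qz borel (B r)"
      by (subst distr_distr) (auto simp: comp_def tr[of r, abs_def])
    finally show ?thesis ..
  qed
  have m0: "(\<integral>x. B r x \<partial>Qz) = 0" for r
    unfolding B_def using Q.sqint_integrable[OF sqint_sh(1)[OF h]]
    by (simp add: Bochner_Integration.integral_sum integral_sh mean)
  show "(\<lambda>q. char (distr Qz borel (\<lambda>x. (\<Sum>r<q. B r x) / sqrt q)) u) \<longlonglongrightarrow>
      complex_of_real (exp (- (u\<^sup>2 * (l2norm Qz (B 0))\<^sup>2) / 2))"
    by (rule Q.iid_CLT_char[OF indep m0 sB d])
  have "l2norm Qz (B r) = l2norm (distr Qz borel (B r)) (\<lambda>x. x)" for r
    by (simp add: l2norm_def integral_distr)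
  then have n: "l2norm Qz (B r) = l2norm Qz (B 0)" for r using d[of r] by simp
  have "(l2norm Qz (\<lambda>x. \<Sum>r<q. B r x))\<^sup>2 = (\<Sum>r<q. (l2norm Qz (B r))\<^sup>2)"
  proof (rule l2norm_sum_orthogonal)
    show "(\<integral>x. B r x * B r' x \<partial>Qz) = 0" if "r \<noteq> r'" for r r'
      using integral_mult_disjoint[OF sB sB dB dB dj'[OF that]] m0 by simp
  qed (auto intro: sB)
  also have "\<dots> = (\<Sum>r<q. (l2norm Qz (B 0))\<^sup>2)"
    by (rule sum.cong[OF refl]) (rule arg_cong[where f="\<lambda>v. v\<^sup>2", OF n])
  also have "\<dots> = q * (l2norm Qz (B 0))\<^sup>2" by simp
  finally have "sqrt ((l2norm Qz (\<lambda>x. \<Sum>r<q. B r x))\<^sup>2) = sqrt (q * (l2norm Qz (B 0))\<^sup>2)" by simp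
  then show "l2norm Qz (\<lambda>x. \<Sum>r<q. B r x) = sqrt q * l2norm Qz (B 0)"
    by (simp add: real_sqrt_mult)
qed

text \<open>The error has two sources. Replacing \<open>g\<close> by its truncation costs
  \<open>tl_err M g m\<close>. The indices outside the blocks number at most \<open>m\<close> for
  each of the at most \<open>N / p\<close> blocks, and fewer than \<open>p\<close> in the incomplete
  last stretch; their share of \<open>N\<close> is at most \<open>m / p + p / N\<close>, and their
  sum has norm of the order of the square root of their number.\<close>

lemma block_approximation:
  fixes g :: "(nat \<Rightarrow> 'a) \<Rightarrow> real" and m p N :: nat
  assumes g: "sqint Rn g" and sm: "summable (err M g)" and mean: "(\<integral>x. g x \<partial>Rn) = 0"
    and pm: "m \<le> p" and p: "0 < p" and N: "0 < N"
  defines "B \<equiv> \<lambda>r x. \<Sum>i=int (r * p)+1..int (r * p + (p - m)). sh (avg M {..<m} g) i x"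
  shows "l2norm Qz (\<lambda>x. (\<Sum>i=1..int N. sh g i x) / sqrt N - (\<Sum>r<N div p. B r x) / sqrt N)
    \<le> tl_err M g m + sqrt (m / p + p / N) * tl_err M g 0"
proof -
  define h where "h = avg M {..<m} g"
  have h: "sqint Rn h" unfolding h_def by (intro avg_sqint g)
  define q where "q = N div p"
  define blk where "blk r = {int (r * p)+1..int (r * p + (p - m))}" for r
  define gap where "gap = {1..int N} - (\<Union>r<q. blk r)"
  have qp: "q * p \<le> N" unfolding q_def by simp
  have sub: "(\<Union>r<q. blk r) \<subseteq> {1..int N}"
  proof -
    have "r * p + (p - m) \<le> N" if "r < q" for r
    proof -
      have "(r + 1) * p \<le> q * p" using that by (intro mult_right_mono) auto
      then show ?thesis using qp by (simp add: algebra_simps)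
    qed
    then have "int (r * p + (p - m)) \<le> int N" if "r < q" for r using that by (simp only: of_nat_le_iff)
    note le = this
    show ?thesis
    proof
      fix i assume "i \<in> (\<Union>r<q. blk r)"
      then obtain r where r: "r < q" "int (r * p) + 1 \<le> i" "i \<le> int (r * p + (p - m))"
        unfolding blk_def by auto
      have "0 \<le> int (r * p)" by (rule of_nat_0_le_iff)
      then have "1 \<le> i" using r(2) by linarith
      then show "i \<in> {1..int N}" using order_trans[OF r(3) le[OF r(1)]] by simp
    qed
  qed
  have dj: "blk r \<inter> blk r' = {}" if "r < r'" for r r'
  proof -
    have "(r + 1) * p \<le> r' * p" using that by (intro mult_right_mono) auto
    then have "r * p + (p - m) \<le> r' * p" using pm by (simp add: algebra_simps)
    then have "int (r * p + (p - m)) < int (r' * p) + 1" by linarith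
    then show ?thesis unfolding blk_def by auto
  qed
  have dj': "blk r \<inter> blk r' = {}" if "r \<noteq> r'" for r r'
    using dj[of r r'] dj[of r' r] that by (cases "r < r'") auto
  have card_U: "card (\<Union>r<q. blk r) = q * (p - m)"
  proof -
    have "card (\<Union>r<q. blk r) = (\<Sum>r<q. card (blk r))"
      using dj' by (intro card_UN_disjoint) (auto simp: blk_def)
    then show ?thesis by (simp add: blk_def)
  qed
  have cg: "card gap = N - q * (p - m)"
    unfolding gap_def using card_Diff_subset[OF finite_subset[OF sub] sub] card_U by simp
  have "real (card gap) \<le> q * m + p"
  proof -
    have "N < q * p + p" unfolding q_def
      using mod_less_divisor[OF p, of N] div_mult_mod_eq[of N p] by linarith
    moreover have "q * (p - m) \<le> N" using qp by (meson diff_le_self mult_le_mono2 order_trans)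
    moreover have "real (q * (p - m)) = q * p - q * m" using pm by (simp add: of_nat_diff algebra_simps)
    ultimately show ?thesis unfolding cg using pm
      by (simp add: of_nat_diff del: of_nat_mult)
  qed
  then have "card gap / N \<le> (q * m + p) / N" by (intro divide_right_mono) auto
  also have "\<dots> \<le> m / p + p / N"
  proof -
    have "real (q * p) \<le> real N" using qp by (simp only: of_nat_le_iff)
    then have "real q / N \<le> 1 / p" using p N by (simp add: field_simps)
    then have "real q / N * m \<le> 1 / p * m" by (intro mult_right_mono) auto
    then show ?thesis by (simp add: add_divide_distrib)
  qed
  finally have gapN: "card gap / N \<le> m / p + p / N" .
  have split: "(\<Sum>i=1..int N. sh h i x) = (\<Sum>r<q. B r x) + (\<Sum>i\<in>gap. sh h i x)" for x
  proof -
    have "(\<Sum>i=1..int N. sh h i x) = (\<Sum>i\<in>(\<Union>r<q. blk r). sh h i x) + (\<Sum>i\<in>gap. sh h i x)"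
      unfolding gap_def using sub by (subst sum.subset_diff[OF sub]) auto
    also have "(\<Sum>i\<in>(\<Union>r<q. blk r). sh h i x) = (\<Sum>r<q. \<Sum>i\<in>blk r. sh h i x)"
      using dj' by (intro sum.UNION_disjoint) (auto simp: blk_def)
    finally show ?thesis by (simp add: B_def blk_def h_def)
  qed
  have e: "(\<Sum>i=1..int N. sh g i x) / sqrt N - (\<Sum>r<N div p. B r x) / sqrt N =
    (1 / sqrt N) * (\<Sum>i=1..int N. sh g i x - sh h i x) + (1 / sqrt N) * (\<Sum>i\<in>gap. sh h i x)" for x
    using split[of x] unfolding q_def[symmetric] by (simp add: sum_subtractf add_divide_distrib diff_divide_distrib)
  have fg: "finite gap" by (simp add: gap_def)
  have "l2norm Qz (\<lambda>x. (\<Sum>i=1..int N. sh g i x) / sqrt N - (\<Sum>r<N div p. B r x) / sqrt N)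
    \<le> l2norm Qz (\<lambda>x. (1 / sqrt N) * (\<Sum>i=1..int N. sh g i x - sh h i x)) + l2norm Qz (\<lambda>x. (1 / sqrt N) * (\<Sum>i\<in>gap. sh h i x))"
    unfolding e by (intro l2norm_add_le sqint_cmult sqint_sum sqint_diff sqint_sh g h)
  also have "\<dots> = (1 / sqrt N) * l2norm Qz (\<lambda>x. \<Sum>i=1..int N. sh g i x - sh h i x) + (1 / sqrt N) * l2norm Qz (\<lambda>x. \<Sum>i\<in>gap. sh h i x)"
    unfolding l2norm_cmult by simp
  also have "\<dots> \<le> (1 / sqrt N) * (sqrt (card {1..int N}) * tl_err M g m) + (1 / sqrt N) * (sqrt (card gap) * tl_err M g 0)"
    unfolding h_def by (intro add_mono mult_left_mono l2norm_remainder_sum l2norm_shift_sum g sm mean fg) auto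
  also have "\<dots> = tl_err M g m + sqrt (card gap / N) * tl_err M g 0"
    using N by (simp add: real_sqrt_divide field_simps)
  also have "\<dots> \<le> tl_err M g m + sqrt (m / p + p / N) * tl_err M g 0"
    using gapN by (intro add_left_mono mult_right_mono tl_err_nonneg sm) auto
  finally show ?thesis .
qed

lemma div_ratio_tendsto:
  assumes p: "0 < (p::nat)"
  shows "(\<lambda>N. real (N div p) / real N) \<longlonglongrightarrow> 1 / real p"
proof (rule tendsto_sandwich)
  have b: "real N / real p - 1 \<le> real (N div p)" "real (N div p) \<le> real N / real p" for N
  proof -
    have "N < (N div p) * p + p"
      using mod_less_divisor[OF p, of N] div_mult_mod_eq[of N p] by linarith
    then have "real N < real ((N div p) * p + p)" by (simp only: of_nat_less_iff)
    then show "real N / real p - 1 \<le> real (N div p)" using p by (simp add: field_simps)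
    have "real ((N div p) * p) \<le> real N" by (simp only: of_nat_le_iff) simp
    then show "real (N div p) \<le> real N / real p" using p by (simp add: field_simps)
  qed
  show "\<forall>\<^sub>F N in sequentially. 1 / real p - 1 / real N \<le> real (N div p) / real N"
    using eventually_gt_at_top[of 0]
  proof eventually_elim
    case (elim N)
    from divide_right_mono[OF b(1)[of N], of "real N"] elim show ?case by (simp add: diff_divide_distrib)
  qed
  show "\<forall>\<^sub>F N in sequentially. real (N div p) / real N \<le> 1 / real p"
    using eventually_gt_at_top[of 0]
  proof eventually_elim
    case (elim N)
    from divide_right_mono[OF b(2)[of N], of "real N"] elim show ?case by simp
  qed
  have "(\<lambda>N. 1 / real p - 1 / real N) \<longlonglongrightarrow> 1 / real p - 0"
    by (intro tendsto_intros lim_1_over_n)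
  then show "(\<lambda>N. 1 / real p - 1 / real N) \<longlonglongrightarrow> 1 / real p" by simp
qed simp

lemma char_scale:
  assumes [measurable]: "X \<in> borel_measurable N"
  shows "char (distr N borel (\<lambda>x. c * X x)) u = char (distr N borel X) (u * c)"
  by (simp add: char_def integral_distr mult_ac)

text \<open>Truncation level \<open>n\<close> and block length \<open>p n\<close> are fixed while
  \<open>N\<close> grows, and \<open>n\<close> is sent to infinity last. The variance of the block
  approximation need not be computed: norms differ by no more than the distance, so the limit
  \<open>b n\<close> is within \<open>\<eta> n\<close> of \<open>\<sigma>\<close>.\<close>

theorem shift_CLT:
  assumes g: "sqint Rn g" and sm: "summable (err M g)" and mean: "(\<integral>x. g x \<partial>Rn) = 0"
  shows "0 \<le> lrv g"
    and "(\<lambda>N. char (distr Qz borel (\<lambda>x. (\<Sum>i=1..int N. sh g i x) / sqrt N)) u)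
      \<longlonglongrightarrow> complex_of_real (exp (- (u\<^sup>2 * lrv g) / 2))"
proof -
  interpret Q: prob_space Qz by (rule prob_space_PiM_UNIV)
  define W where "W N x = (\<Sum>i=1..int N. sh g i x) / sqrt N" for N x
  have sW: "sqint Qz (W N)" for N
    using sqint_cmult[OF sqint_sum[of "{1..int N}" Qz "sh g", OF sqint_sh(1)[OF g]], of "1 / sqrt N"]
    by (simp add: W_def[abs_def])
  have lim: "(\<lambda>N. (l2norm Qz (W N))\<^sup>2) \<longlonglongrightarrow> lrv g"
    using variance_limit[OF g sm mean] unfolding W_def[abs_def] .
  show nonneg: "0 \<le> lrv g"
    by (rule LIMSEQ_le_const[OF lim]) auto
  define \<sigma> where "\<sigma> = sqrt (lrv g)"
  have lim\<sigma>: "(\<lambda>N. l2norm Qz (W N)) \<longlonglongrightarrow> \<sigma>"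
    using tendsto_real_sqrt[OF lim] by (simp add: \<sigma>_def)
  \<comment> \<open>Quadratic block length makes the share \<open>n / p n\<close> of the gaps tend
    to 0.\<close>
  define p where "p n = (n + 1)\<^sup>2" for n :: nat
  have p: "0 < p n" "n \<le> p n" for n by (auto simp: p_def power2_eq_square)
  define B where "B n r x = (\<Sum>i=int (r * p n)+1..int (r * p n + (p n - n)). sh (avg M {..<n} g) i x)" for n r x
  define T where "T n N x = (\<Sum>r<N div p n. B n r x) / sqrt N" for n N x
  define \<eta> where "\<eta> n = tl_err M g n + sqrt (real n / real (p n)) * tl_err M g 0" for n
  define \<eta>N where "\<eta>N n N = tl_err M g n + sqrt (real n / real (p n) + real (p n) / real N) * tl_err M g 0" for n N
  define b where "b n = sqrt (1 / real (p n)) * l2norm Qz (B n 0)" for n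
  have h: "sqint Rn (avg M {..<n} g)" for n by (intro avg_sqint g)
  have hm: "(\<integral>x. avg M {..<n} g x \<partial>Rn) = 0" for n
  proof -
    interpret R: prob_space Rn by (rule prob_space_PiM_UNIV)
    have "(\<integral>x. avg M {..<n} g x \<partial>Rn) = (\<integral>x. g x \<partial>Rn)"
      using integral_mrg[OF R.sqint_integrable[OF g], of "{..<n}"] by (simp add: avg_def)
    then show ?thesis using mean by simp
  qed
  have sB: "sqint Qz (B n r)" for n r unfolding B_def[abs_def] by (intro sqint_sum sqint_sh h)
  have sT: "sqint Qz (T n N)" for n N
    using sqint_cmult[OF sqint_sum[of "{..<N div p n}" Qz "B n", OF sB], of "1 / sqrt N"]
    by (simp add: T_def[abs_def])
  note [measurable] = sqint_measurable[OF sB] sqint_measurable[OF sT] sqint_measurable[OF sW]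
  have \<eta>N: "(\<lambda>N. \<eta>N n N) \<longlonglongrightarrow> \<eta> n" for n
  proof -
    have "(\<lambda>N. \<eta>N n N) \<longlonglongrightarrow> tl_err M g n + sqrt (real n / real (p n) + 0) * tl_err M g 0"
      unfolding \<eta>N_def by (intro tendsto_intros lim_const_over_n)
    then show ?thesis by (simp add: \<eta>_def)
  qed
  have WT: "l2norm Qz (\<lambda>x. W N x - T n N x) \<le> \<eta>N n N" if "0 < N" for n N
    using block_approximation[OF g sm mean p(2) p(1) that] unfolding W_def T_def B_def \<eta>N_def .
  have nT: "l2norm Qz (T n N) = sqrt (real (N div p n) / real N) * l2norm Qz (B n 0)" for n N
  proof -
    have "l2norm Qz (T n N) = (1 / sqrt N) * l2norm Qz (\<lambda>x. \<Sum>r<N div p n. B n r x)"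
      using l2norm_cmult[of Qz "1 / sqrt N" "\<lambda>x. \<Sum>r<N div p n. B n r x"] by (simp add: T_def[abs_def])
    also have "l2norm Qz (\<lambda>x. \<Sum>r<N div p n. B n r x) = sqrt (N div p n) * l2norm Qz (B n 0)"
      using mdep_block_CLT(2)[OF h depends_on_avg hm p(2)] unfolding B_def .
    finally show ?thesis by (simp add: real_sqrt_divide)
  qed
  have nTlim: "(\<lambda>N. l2norm Qz (T n N)) \<longlonglongrightarrow> b n" for n
    unfolding nT b_def by (intro tendsto_intros div_ratio_tendsto p)
  have b\<sigma>: "\<bar>\<sigma> - b n\<bar> \<le> \<eta> n" for n
  proof (rule LIMSEQ_le)
    show "(\<lambda>N. \<bar>l2norm Qz (W N) - l2norm Qz (T n N)\<bar>) \<longlonglongrightarrow> \<bar>\<sigma> - b n\<bar>"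
      by (intro tendsto_intros lim\<sigma> nTlim)
    show "\<exists>N0. \<forall>N\<ge>N0. \<bar>l2norm Qz (W N) - l2norm Qz (T n N)\<bar> \<le> \<eta>N n N"
    proof (intro exI allI impI)
      fix N :: nat assume "1 \<le> N"
      then show "\<bar>l2norm Qz (W N) - l2norm Qz (T n N)\<bar> \<le> \<eta>N n N"
        by (intro order_trans[OF l2norm_diff_ge[OF sW sT] WT]) simp
    qed
  qed (rule \<eta>N)
  have \<eta>: "\<eta> \<longlonglongrightarrow> 0"
  proof -
    have "(\<lambda>n. real n / real (p n)) \<longlonglongrightarrow> 0"
    proof (rule Lim_null_comparison[OF _ LIMSEQ_inverse_real_of_nat])
      have "real n / real (p n) \<le> inverse (real (Suc n))" for n
      proof -
        have "real n / real (p n) \<le> real (Suc n) / (real (Suc n))\<^sup>2"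
          unfolding p_def by (simp add: divide_right_mono del: of_nat_Suc)
        also have "\<dots> = inverse (real (Suc n))"
          by (simp add: power2_eq_square inverse_eq_divide del: of_nat_Suc)
        finally show ?thesis .
      qed
      then show "\<forall>\<^sub>F n in sequentially. norm (real n / real (p n)) \<le> inverse (real (Suc n))"
        by simp
    qed
    then have "\<eta> \<longlonglongrightarrow> 0 + sqrt 0 * tl_err M g 0"
      unfolding \<eta>_def[abs_def] by (intro tendsto_intros tl_err_tendsto sm)
    then show ?thesis by simp
  qed
  have "(\<lambda>n. \<sigma> - b n) \<longlonglongrightarrow> 0"
    by (rule Lim_null_comparison[OF _ \<eta>]) (use b\<sigma> in auto)
  then have blim: "b \<longlonglongrightarrow> \<sigma>"
    using tendsto_diff[OF tendsto_const[of \<sigma>]] by force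
  define E where "E v = complex_of_real (exp (- (u\<^sup>2 * v\<^sup>2) / 2))" for v
  have Elim: "(\<lambda>n. E (b n)) \<longlonglongrightarrow> E \<sigma>"
    unfolding E_def by (intro tendsto_intros blim) auto
  have chT: "(\<lambda>N. char (distr Qz borel (T n N)) u) \<longlonglongrightarrow> E (b n)" for n
  proof -
    define S where "S q x = (\<Sum>r<q. B n r x) / sqrt (real q)" for q x
    have sS: "sqint Qz (S q)" for q
      using sqint_cmult[OF sqint_sum[of "{..<q}" Qz "B n", OF sB], of "1 / sqrt q"]
      by (simp add: S_def[abs_def])
    note [measurable] = sqint_measurable[OF sS]
    have nS: "l2norm Qz (S q) \<le> l2norm Qz (B n 0)" for q
    proof -
      have "l2norm Qz (S q) = (1 / sqrt q) * l2norm Qz (\<lambda>x. \<Sum>r<q. B n r x)"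
        using l2norm_cmult[of Qz "1 / sqrt q" "\<lambda>x. \<Sum>r<q. B n r x"] by (simp add: S_def[abs_def])
      also have "l2norm Qz (\<lambda>x. \<Sum>r<q. B n r x) = sqrt q * l2norm Qz (B n 0)"
        using mdep_block_CLT(2)[OF h depends_on_avg hm p(2)] unfolding B_def .
      finally show ?thesis by (cases "q = 0") auto
    qed
    \<comment> \<open>The block theorem normalises by the number of blocks, the sum by
      \<open>N\<close>; the ratio is a moving factor with limit \<open>c0\<close>.\<close>
    define c where "c N = sqrt (real (N div p n) / real N)" for N
    define c0 where "c0 = sqrt (1 / real (p n))"
    have c: "c \<longlonglongrightarrow> c0"
      unfolding c_def[abs_def] c0_def by (intro tendsto_intros div_ratio_tendsto p)
    have TS: "T n N x = c N * S (N div p n) x" for N x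
      by (simp add: T_def S_def c_def real_sqrt_divide)
    have "(\<lambda>q. char (distr Qz borel (S q)) (u * c0)) \<longlonglongrightarrow> complex_of_real (exp (- ((u * c0)\<^sup>2 * (l2norm Qz (B n 0))\<^sup>2) / 2))"
      using mdep_block_CLT(1)[OF h depends_on_avg hm p(2)] unfolding B_def S_def .
    moreover have "filterlim (\<lambda>N. N div p n) at_top sequentially"
      unfolding filterlim_at_top
    proof
      fix Z
      show "\<forall>\<^sub>F N in sequentially. Z \<le> N div p n"
        using eventually_ge_at_top[of "Z * p n"]
        by eventually_elim (use p(1)[of n] in \<open>simp add: less_eq_div_iff_mult_less_eq\<close>)
    qed
    ultimately have 1: "(\<lambda>N. char (distr Qz borel (S (N div p n))) (u * c0)) \<longlonglongrightarrow> E (b n)"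
      unfolding E_def b_def c0_def[symmetric] by (auto dest: filterlim_compose simp: power_mult_distrib mult_ac)
    \<comment> \<open>Freezing the factor at its limit costs little because the norms of
      \<open>S\<close> are bounded uniformly.\<close>
    have 2: "(\<lambda>N. char (distr Qz borel (T n N)) u - char (distr Qz borel (S (N div p n))) (u * c0)) \<longlonglongrightarrow> 0"
    proof (rule Lim_null_comparison)
      show "(\<lambda>N. \<bar>u\<bar> * (\<bar>c N - c0\<bar> * l2norm Qz (B n 0))) \<longlonglongrightarrow> 0"
        by (intro tendsto_mult_right_zero tendsto_mult_left_zero tendsto_rabs_zero LIM_zero c)
      have "cmod (char (distr Qz borel (T n N)) u - char (distr Qz borel (S (N div p n))) (u * c0)) \<le> \<bar>u\<bar> * (\<bar>c N - c0\<bar> * l2norm Qz (B n 0))" for N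
      proof -
        have d: "T n N x - c0 * S (N div p n) x = (c N - c0) * S (N div p n) x" for x
          by (simp add: TS left_diff_distrib)
        have "cmod (char (distr Qz borel (T n N)) u - char (distr Qz borel (\<lambda>x. c0 * S (N div p n) x)) u)
          \<le> \<bar>u\<bar> * l2norm Qz (\<lambda>x. T n N x - c0 * S (N div p n) x)"
          by (intro char_diff_le_l2norm Q.prob_space_axioms sqint_diff sqint_cmult sS sT) measurable
        also have "\<dots> \<le> \<bar>u\<bar> * (\<bar>c N - c0\<bar> * l2norm Qz (B n 0))"
          unfolding d l2norm_cmult by (intro mult_left_mono nS) auto
        finally show ?thesis by (subst (asm) char_scale) auto
      qed
      then show "\<forall>\<^sub>F N in sequentially. cmod (char (distr Qz borel (T n N)) u - char (distr Qz borel (S (N div p n))) (u * c0))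
         \<le> \<bar>u\<bar> * (\<bar>c N - c0\<bar> * l2norm Qz (B n 0))" by simp
    qed
    from tendsto_add[OF 2 1] show ?thesis by simp
  qed
  have "(\<lambda>N. char (distr Qz borel (W N)) u) \<longlonglongrightarrow> E \<sigma>"
  proof (rule LIMSEQ_I)
    fix e :: real assume e: "0 < e"
    have "\<forall>\<^sub>F n in sequentially. \<bar>u\<bar> * \<eta> n < e / 4"
      using tendsto_mult_right_zero[OF \<eta>, of "\<bar>u\<bar>"] e by (intro order_tendstoD(2)) auto
    moreover have "\<forall>\<^sub>F n in sequentially. norm (E (b n) - E \<sigma>) < e / 4"
      using LIMSEQ_D[OF Elim, of "e / 4"] e unfolding eventually_sequentially by auto
    ultimately obtain n where n: "\<bar>u\<bar> * \<eta> n < e / 4" "norm (E (b n) - E \<sigma>) < e / 4"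
      using eventually_happens[OF eventually_conj] by (metis (mono_tags, lifting) sequentially_bot)
    have "\<forall>\<^sub>F N in sequentially. \<bar>u\<bar> * \<eta>N n N < e / 4"
      using n(1) by (intro order_tendstoD(2)[OF tendsto_mult_left[OF \<eta>N]])
    moreover have "\<forall>\<^sub>F N in sequentially. norm (char (distr Qz borel (T n N)) u - E (b n)) < e / 4"
      using LIMSEQ_D[OF chT, of "e / 4" n] e unfolding eventually_sequentially by auto
    ultimately have "\<forall>\<^sub>F N in sequentially. norm (char (distr Qz borel (W N)) u - E \<sigma>) < e"
      using eventually_gt_at_top[of 0]
    proof eventually_elim
      case (elim N)
      have "cmod (char (distr Qz borel (W N)) u - char (distr Qz borel (T n N)) u) \<le> \<bar>u\<bar> * l2norm Qz (\<lambda>x. W N x - T n N x)"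
        by (intro char_diff_le_l2norm Q.prob_space_axioms sqint_diff sW sT) measurable
      also have "\<dots> \<le> \<bar>u\<bar> * \<eta>N n N"
        using WT[OF elim(3)] by (intro mult_left_mono) auto
      finally have "cmod (char (distr Qz borel (W N)) u - char (distr Qz borel (T n N)) u) < e / 4"
        using elim(1) by simp
      then show ?case using elim(2) n(2) e by norm
    qed
    then show "\<exists>no. \<forall>N\<ge>no. norm (char (distr Qz borel (W N)) u - E \<sigma>) < e"
      by (simp add: eventually_sequentially)
  qed
  then show "(\<lambda>N. char (distr Qz borel (\<lambda>x. (\<Sum>i=1..int N. sh g i x) / sqrt N)) u)
      \<longlonglongrightarrow> complex_of_real (exp (- (u\<^sup>2 * lrv g) / 2))"
    using nonneg by (simp add: W_def[abs_def] E_def \<sigma>_def)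
qed

end

section \<open>The Haar basis of the unit interval\<close>

text \<open>A probability space in its own right, so that product measures and norm inequalities
  apply without carrying indicators.\<close>

definition UI :: "real measure" where "UI = restrict_space lborel {0..1}"

lemma space_UI[simp]: "space UI = {0..1}"
  by (simp add: UI_def space_restrict_space)

lemma sets_UI: "sets UI = sets (restrict_space borel {0..1})"
  by (simp add: UI_def sets_restrict_space)

lemma prob_space_UI: "prob_space UI"
  by (rule prob_spaceI) (simp add: UI_def emeasure_restrict_space space_restrict_space)

interpretation UI: prob_space UI by (rule prob_space_UI)

lemma borel_measurable_UI: "g \<in> borel_measurable borel \<Longrightarrow> g \<in> borel_measurable UI"
  unfolding UI_def by (intro measurable_restrict_space1) simp

lemma measurable_ident_UI: "(\<lambda>t. t) \<in> UI \<rightarrow>\<^sub>M borel" "(\<lambda>t. t) \<in> UI \<rightarrow>\<^sub>M lborel"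
  using borel_measurable_UI[of "\<lambda>t. t"] by simp_all

lemma set_integral_UI: "(LINT t:{0..1}|lborel. (g t :: real)) = (\<integral>t. g t \<partial>UI)"
  unfolding UI_def set_lebesgue_integral_def by (subst integral_restrict_space) auto

lemma set_integrable_UI: "set_integrable lborel {0..1} (g :: real \<Rightarrow> real) \<longleftrightarrow> integrable UI g"
  unfolding UI_def set_integrable_def by (subst integrable_restrict_space) auto

lemma L2_iff: "g \<in> L2 \<longleftrightarrow> g \<in> borel_measurable borel \<and> integrable UI (\<lambda>t. (g t)\<^sup>2)"
  by (simp add: L2_def set_integrable_UI)

lemma L2_sqint: "g \<in> L2 \<Longrightarrow> sqint UI g"
  by (auto simp: L2_iff sqint_def intro: borel_measurable_UI)

lemma L2_I: "g \<in> borel_measurable borel \<Longrightarrow> sqint UI g \<Longrightarrow> g \<in> L2"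
  by (simp add: L2_iff sqint_def)

lemma AE_UI: "(AE t in UI. P t) \<longleftrightarrow> (AE t in lborel. t \<in> {0..1} \<longrightarrow> P t)"
  unfolding UI_def by (rule AE_restrict_space_iff) simp

lemma nn_integral_UI: "(\<integral>\<^sup>+t. g t \<partial>UI) = (\<integral>\<^sup>+t. indicator {0..1} t * g t \<partial>lborel)"
  unfolding UI_def by (subst nn_integral_restrict_space) (auto simp: mult.commute)

lemma measure_UI_ivl:
  assumes "0 \<le> a" "a \<le> b" "b \<le> 1"
  shows "measure UI {a..<b} = b - a"
  using assms unfolding UI_def by (subst measure_restrict_space) auto

section \<open>Dyadic averages and their completeness\<close>

text \<open>Half-open cells split exactly into two cells of the next level. The price is the point
  1, which lies in no cell of number below \<open>2 ^ n\<close> and is null.\<close>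

definition cell :: "nat \<Rightarrow> nat \<Rightarrow> real set" where
  "cell n k = {real k / 2 ^ n ..< real (Suc k) / 2 ^ n}"

definition coef :: "nat \<Rightarrow> nat \<Rightarrow> (real \<Rightarrow> real) \<Rightarrow> real" where
  "coef n k g = (\<integral>t. g t * indicator (cell n k) t \<partial>UI)"

lemma cell_borel[measurable]: "cell n k \<in> sets borel"
  by (simp add: cell_def)

lemma indicator_borel_UI: "A \<in> sets borel \<Longrightarrow> (indicator A :: real \<Rightarrow> real) \<in> borel_measurable UI"
  by (rule borel_measurable_UI) simp

lemma sqint_indicator: "A \<in> sets borel \<Longrightarrow> sqint UI (indicator A)"
proof -
  assume A: "A \<in> sets borel"
  have "integrable UI (\<lambda>t. (indicator A t :: real)\<^sup>2)"
    by (rule UI.integrable_const_bound[where B=1])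
       (auto intro!: AE_I2 borel_measurable_power indicator_borel_UI A split: split_indicator)
  then show ?thesis by (auto simp: sqint_def intro: indicator_borel_UI A)
qed

lemma sqint_times_indicator:
  assumes "sqint UI g" "A \<in> sets borel" shows "sqint UI (\<lambda>t. g t * indicator A t)"
proof (rule sqint_bound(1)[OF assms(1)])
  show "(\<lambda>t. g t * indicator A t) \<in> borel_measurable UI"
    by (intro borel_measurable_times indicator_borel_UI assms sqint_measurable)
  show "AE t in UI. \<bar>g t * indicator A t\<bar> \<le> \<bar>g t\<bar>"
    by (intro AE_I2) (auto split: split_indicator)
qed

lemma integral_indicator_UI: "A \<in> sets borel \<Longrightarrow> (\<integral>t. indicator A t \<partial>UI :: real) = measure UI (A \<inter> {0..1})"
  by (subst Bochner_Integration.integral_indicator) simp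

lemma cell_le_1: "k < 2 ^ n \<Longrightarrow> real (Suc k) / 2 ^ n \<le> 1"
proof -
  assume "k < 2 ^ n"
  then have "Suc k \<le> 2 ^ n" by simp
  then have "real (Suc k) \<le> real (2 ^ n)" by (simp only: of_nat_le_iff)
  then show ?thesis by (simp add: field_simps)
qed

lemma cell_sub: "k < 2 ^ n \<Longrightarrow> cell n k \<subseteq> {0..1}"
proof -
  assume "k < 2 ^ n"
  then have "real (Suc k) / 2 ^ n \<le> 1" by (rule cell_le_1)
  moreover have "0 \<le> real k / 2 ^ n" by simp
  ultimately show ?thesis unfolding cell_def
    by (intro subsetI) (simp only: atLeastLessThan_iff atLeastAtMost_iff, linarith)
qed

lemma coef_const: "k < 2 ^ n \<Longrightarrow> (\<integral>t. indicator (cell n k) t \<partial>UI) = 1 / (2 ^ n :: real)"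
proof -
  assume k: "k < 2 ^ n"
  have "(\<integral>t. indicator (cell n k) t \<partial>UI :: real) = measure UI (cell n k)"
    using cell_sub[OF k] by (simp add: integral_indicator_UI Int_absorb2)
  also have "\<dots> = 1 / 2 ^ n"
    unfolding cell_def using cell_le_1[OF k] by (subst measure_UI_ivl) (auto simp: field_simps)
  finally show ?thesis .
qed

lemma sum_cells:
  assumes "0 \<le> t" "t < 1"
  shows "(\<Sum>k<2 ^ n. indicator (cell n k) t) = (1::real)"
proof -
  define k0 where "k0 = nat \<lfloor>t * 2 ^ n\<rfloor>"
  have pos: "(0::real) < 2 ^ n" by simp
  have k0: "t \<in> cell n k \<longleftrightarrow> k = k0" for k
  proof -
    have "t \<in> cell n k \<longleftrightarrow> real k \<le> t * 2 ^ n \<and> t * 2 ^ n < real k + 1"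
      by (auto simp: cell_def field_simps)
    also have "\<dots> \<longleftrightarrow> \<lfloor>t * 2 ^ n\<rfloor> = int k" by (auto simp: floor_eq_iff)
    also have "\<dots> \<longleftrightarrow> k = k0" unfolding k0_def using assms by auto
    finally show ?thesis .
  qed
  have "k0 < 2 ^ n"
  proof -
    have "t * 2 ^ n < 1 * 2 ^ n" using assms pos by (intro mult_strict_right_mono) auto
    then have "\<lfloor>t * 2 ^ n\<rfloor> < 2 ^ n" by (simp add: floor_less_iff)
    then show ?thesis unfolding k0_def using assms by (simp add: nat_less_iff)
  qed
  then show ?thesis
    by (simp add: indicator_def k0 of_bool_def)
qed

lemma AE_UI_less_1: "AE t in UI. 0 \<le> t \<and> t < 1"
proof -
  have "AE t in lborel. t \<noteq> (1::real)" by (rule AE_lborel_singleton)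
  then show ?thesis unfolding AE_UI by eventually_elim auto
qed

lemma integral_sum_cells:
  assumes i: "integrable UI g"
  shows "(\<Sum>k<2 ^ n. coef n k g) = (\<integral>t. g t \<partial>UI)"
proof -
  have g: "g \<in> borel_measurable UI" using i by auto
  have m: "(\<lambda>t. g t * indicator (cell n k) t) \<in> borel_measurable UI" for k
    by (intro borel_measurable_times indicator_borel_UI g cell_borel)
  have "(\<Sum>k<2 ^ n. coef n k g) = (\<integral>t. (\<Sum>k<2 ^ n. g t * indicator (cell n k) t) \<partial>UI)"
    unfolding coef_def
  proof (rule Bochner_Integration.integral_sum[symmetric])
    show "integrable UI (\<lambda>t. g t * indicator (cell n k) t)" for k
      by (rule Bochner_Integration.integrable_bound[OF i m]) (auto intro!: AE_I2 split: split_indicator)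
  qed
  also have "\<dots> = (\<integral>t. g t \<partial>UI)"
  proof (rule integral_cong_AE)
    show "AE t in UI. (\<Sum>k<2 ^ n. g t * indicator (cell n k) t) = g t"
      using AE_UI_less_1 by eventually_elim (simp add: sum_distrib_left[symmetric] sum_cells)
  qed (intro borel_measurable_sum m g)+
  finally show ?thesis .
qed

text \<open>The squared norm of the projection onto functions constant on the cells of level
  \<open>n\<close>: the mean over a cell is \<open>2 ^ n * coef n k g\<close>, and the cell has mass
  \<open>1 / 2 ^ n\<close>.\<close>

definition dform :: "nat \<Rightarrow> (real \<Rightarrow> real) \<Rightarrow> real" where
  "dform n g = (\<Sum>k<2 ^ n. 2 ^ n * (coef n k g)\<^sup>2)"

text \<open>By Pythagoras, the squared distance of \<open>g\<close> from that projection.\<close>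

definition defect :: "nat \<Rightarrow> (real \<Rightarrow> real) \<Rightarrow> real" where
  "defect n g = (l2norm UI g)\<^sup>2 - dform n g"

lemma coef_integrable: "sqint UI g \<Longrightarrow> integrable UI (\<lambda>t. g t * indicator (cell n k) t)"
  by (rule sqint_integrable_mult[OF _ sqint_indicator]) auto

lemma coef_linear:
  assumes "sqint UI g" "sqint UI h"
  shows "coef n k (\<lambda>t. g t + h t) = coef n k g + coef n k h"
    "coef n k (\<lambda>t. g t - h t) = coef n k g - coef n k h"
  using coef_integrable[OF assms(1)] coef_integrable[OF assms(2)]
  unfolding coef_def by (simp_all add: distrib_right left_diff_distrib)

text \<open>Cauchy-Schwarz on each cell against its indicator, whose squared norm is
  \<open>1 / 2 ^ n\<close>; summation over the cells recovers the squared norm.\<close>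

lemma defect_nonneg:
  assumes g: "sqint UI g"
  shows "0 \<le> defect n g"
proof -
  have "dform n g \<le> (\<Sum>k<2 ^ n. coef n k (\<lambda>t. (g t)\<^sup>2))"
    unfolding dform_def
  proof (rule sum_mono)
    fix k assume "k \<in> {..<2 ^ n :: nat}"
    then have k: "k < 2 ^ n" by simp
    have s: "sqint UI (\<lambda>t. g t * indicator (cell n k) t)"
      by (rule sqint_times_indicator[OF g cell_borel])
    have "\<bar>coef n k g\<bar> = \<bar>\<integral>t. (g t * indicator (cell n k) t) * indicator (cell n k) t \<partial>UI\<bar>"
      unfolding coef_def by (intro arg_cong[where f=abs] Bochner_Integration.integral_cong) (auto split: split_indicator)
    also have "\<dots> \<le> l2norm UI (\<lambda>t. g t * indicator (cell n k) t) * l2norm UI (indicator (cell n k))"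
      by (intro Cauchy_Schwarz_l2norm s sqint_indicator) auto
    finally have "\<bar>coef n k g\<bar>\<^sup>2 \<le> (l2norm UI (\<lambda>t. g t * indicator (cell n k) t) * l2norm UI (indicator (cell n k)))\<^sup>2"
      by (intro power_mono) auto
    also have "\<dots> = (l2norm UI (\<lambda>t. g t * indicator (cell n k) t))\<^sup>2 * (l2norm UI (indicator (cell n k)))\<^sup>2"
      by (simp add: power_mult_distrib)
    also have "(l2norm UI (indicator (cell n k)))\<^sup>2 = (\<integral>t. indicator (cell n k) t \<partial>UI)"
      unfolding l2norm_square by (intro Bochner_Integration.integral_cong) (auto split: split_indicator)
    also have "\<dots> = 1 / 2 ^ n" by (rule coef_const[OF k])
    also have "(l2norm UI (\<lambda>t. g t * indicator (cell n k) t))\<^sup>2 = coef n k (\<lambda>t. (g t)\<^sup>2)"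
      unfolding l2norm_square coef_def by (intro Bochner_Integration.integral_cong) (auto split: split_indicator)
    finally show "2 ^ n * (coef n k g)\<^sup>2 \<le> coef n k (\<lambda>t. (g t)\<^sup>2)"
      by (simp add: field_simps)
  qed
  also have "\<dots> = (l2norm UI g)\<^sup>2"
    unfolding l2norm_square by (rule integral_sum_cells[OF sqint_integrable_square[OF g]])
  finally show ?thesis by (simp add: defect_def)
qed

lemma defect_le: "defect n g \<le> (l2norm UI g)\<^sup>2"
  by (simp add: defect_def dform_def sum_nonneg)

text \<open>Norm and \<open>dform\<close> both satisfy the parallelogram law, so the defect does;
  the defect of the difference is nonnegative and is dropped.\<close>

lemma defect_add:
  assumes g: "sqint UI g" and h: "sqint UI h"
  shows "defect n (\<lambda>t. g t + h t) \<le> 2 * defect n g + 2 * defect n h"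
proof -
  have "(l2norm UI (\<lambda>t. g t + h t))\<^sup>2 + (l2norm UI (\<lambda>t. g t - h t))\<^sup>2 = 2 * (l2norm UI g)\<^sup>2 + 2 * (l2norm UI h)\<^sup>2"
  proof -
    have "(l2norm UI (\<lambda>t. g t + h t))\<^sup>2 + (l2norm UI (\<lambda>t. g t - h t))\<^sup>2 = (\<integral>t. (g t + h t)\<^sup>2 + (g t - h t)\<^sup>2 \<partial>UI)"
      unfolding l2norm_square using sqint_integrable_square[OF sqint_add[OF g h]] sqint_integrable_square[OF sqint_diff[OF g h]] by simp
    also have "\<dots> = (\<integral>t. 2 * (g t)\<^sup>2 + 2 * (h t)\<^sup>2 \<partial>UI)"
      by (intro Bochner_Integration.integral_cong) (auto simp: power2_eq_square algebra_simps)
    also have "\<dots> = 2 * (l2norm UI g)\<^sup>2 + 2 * (l2norm UI h)\<^sup>2"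
      unfolding l2norm_square using sqint_integrable_square[OF g] sqint_integrable_square[OF h] by simp
    finally show ?thesis .
  qed
  moreover have "dform n (\<lambda>t. g t + h t) + dform n (\<lambda>t. g t - h t) = 2 * dform n g + 2 * dform n h"
    unfolding dform_def coef_linear[OF g h] sum_distrib_left sum.distrib[symmetric]
    by (intro sum.cong) (auto simp: power2_eq_square algebra_simps)
  moreover have "p + m = 2 * a + 2 * b \<Longrightarrow> q + r = 2 * c + 2 * d \<Longrightarrow> 0 \<le> m - r \<Longrightarrow>
      p - q \<le> 2 * (a - c) + 2 * (b - d)" for p m a b q r c d :: real
    by argo
  ultimately show ?thesis
    using defect_nonneg[OF sqint_diff[OF g h], of n] unfolding defect_def by blast
qed

text \<open>The defect is dominated by the squared norm and obeys the parallelogram law, so the functions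
  recovered by their dyadic averages form a closed subspace.\<close>
definition good :: "(real \<Rightarrow> real) \<Rightarrow> bool" where
  "good g \<longleftrightarrow> sqint UI g \<and> (\<lambda>n. defect n g) \<longlonglongrightarrow> 0"

lemma goodI:
  assumes g: "sqint UI g" and b: "\<And>n. defect n g \<le> f n" and f: "f \<longlonglongrightarrow> 0"
  shows "good g"
  unfolding good_def
  by (intro conjI g tendsto_sandwich[OF _ _ tendsto_const f]) (use defect_nonneg[OF g] b in auto)

lemma good_add: "good g \<Longrightarrow> good h \<Longrightarrow> good (\<lambda>t. g t + h t)"
  unfolding good_def[of g] good_def[of h]
  by (auto intro!: goodI[OF sqint_add defect_add] tendsto_eq_intros)

lemma good_cmult: "good g \<Longrightarrow> good (\<lambda>t. c * g t)"
proof -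
  assume g: "good g"
  have "coef n k (\<lambda>t. c * g t) = c * coef n k g" for n k
    unfolding coef_def by (simp add: mult.assoc)
  then have "defect n (\<lambda>t. c * g t) = c\<^sup>2 * defect n g" for n
    by (simp add: defect_def dform_def l2norm_cmult power_mult_distrib right_diff_distrib sum_distrib_left mult_ac)
  then show ?thesis using g by (auto simp: good_def intro!: sqint_cmult tendsto_mult_right_zero)
qed

lemma good_0: "good (\<lambda>t. 0)"
  using good_def by (auto simp: defect_def dform_def coef_def)

lemma good_sum: "(\<And>i. i \<in> A \<Longrightarrow> good (f i)) \<Longrightarrow> good (\<lambda>t. \<Sum>i\<in>A. f i t)"
  by (induct A rule: infinite_finite_induct) (auto intro: good_add good_0)

lemma good_closed:
  assumes g: "sqint UI g" and a: "\<And>m. good (G m)" and lim: "(\<lambda>m. l2norm UI (\<lambda>t. g t - G m t)) \<longlonglongrightarrow> 0"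
  shows "good g"
proof -
  have sG: "sqint UI (G m)" for m using a by (auto simp: good_def)
  have "(\<lambda>n. defect n g) \<longlonglongrightarrow> 0"
  proof (rule LIMSEQ_I)
    fix e :: real assume e: "0 < e"
    have "(\<lambda>m. 2 * (l2norm UI (\<lambda>t. g t - G m t))\<^sup>2) \<longlonglongrightarrow> 2 * 0\<^sup>2" by (intro tendsto_intros lim)
    then have "\<forall>\<^sub>F m in sequentially. 2 * (l2norm UI (\<lambda>t. g t - G m t))\<^sup>2 < e / 2"
      by (rule order_tendstoD(2)) (simp add: e)
    then obtain m where m: "2 * (l2norm UI (\<lambda>t. g t - G m t))\<^sup>2 < e / 2"
      by (auto simp: eventually_sequentially)
    have "(\<lambda>n. 2 * defect n (G m)) \<longlonglongrightarrow> 2 * 0" using a[of m] by (intro tendsto_intros) (auto simp: good_def)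
    then have "\<forall>\<^sub>F n in sequentially. 2 * defect n (G m) < e / 2"
      by (rule order_tendstoD(2)) (simp add: e)
    then obtain n0 where n0: "\<And>n. n \<ge> n0 \<Longrightarrow> 2 * defect n (G m) < e / 2"
      by (auto simp: eventually_sequentially)
    have "defect n g < e" if "n \<ge> n0" for n
    proof -
      have "defect n g = defect n (\<lambda>t. G m t + (g t - G m t))" by simp
      also have "\<dots> \<le> 2 * defect n (G m) + 2 * defect n (\<lambda>t. g t - G m t)"
        by (intro defect_add sG sqint_diff g)
      also have "\<dots> \<le> 2 * defect n (G m) + 2 * (l2norm UI (\<lambda>t. g t - G m t))\<^sup>2"
        using defect_le by (intro add_left_mono mult_left_mono) auto
      finally show ?thesis using n0[OF that] m by linarith
    qed
    then show "\<exists>no. \<forall>n\<ge>no. norm (defect n g - 0) < e"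
      using defect_nonneg[OF g] by auto
  qed
  then show ?thesis using g by (simp add: good_def)
qed

text \<open>On a cell lying on one side of \<open>a\<close> the coefficient is 0 or
  \<open>1 / 2 ^ n\<close>, and \<open>c - 2 ^ n * c\<^sup>2\<close> vanishes for both. Only the
  cell containing \<open>a\<close> can contribute, and at most its mass.\<close>

lemma good_atMost: "good (indicator {..a})"
proof (rule goodI)
  show s: "sqint UI (indicator {..a})" by (rule sqint_indicator) simp
  show "(\<lambda>n. 1 / 2 ^ n) \<longlonglongrightarrow> (0::real)"
    using LIMSEQ_divide_realpow_zero[of 2 1] by simp
  fix n
  define c where "c k = coef n k (indicator {..a})" for k
  have c_le: "0 \<le> c k" "c k \<le> 1 / 2 ^ n" if "k < 2 ^ n" for k
  proof -
    show "0 \<le> c k" unfolding c_def coef_def by (intro Bochner_Integration.integral_nonneg) auto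
    have "c k \<le> (\<integral>t. indicator (cell n k) t \<partial>UI)" unfolding c_def coef_def
      by (intro integral_mono coef_integrable s UI.sqint_integrable[OF sqint_indicator] cell_borel) (auto split: split_indicator)
    then show "c k \<le> 1 / 2 ^ n" using coef_const[OF that] by simp
  qed
  have "(l2norm UI (indicator {..a}))\<^sup>2 = (\<integral>t. indicator {..a} t \<partial>UI)"
    unfolding l2norm_square by (intro Bochner_Integration.integral_cong) (auto split: split_indicator)
  also have "\<dots> = (\<Sum>k<2 ^ n. c k)"
    unfolding c_def by (rule integral_sum_cells[symmetric]) (rule UI.sqint_integrable[OF s])
  finally have "defect n (indicator {..a}) = (\<Sum>k<2 ^ n. c k - 2 ^ n * (c k)\<^sup>2)"
    unfolding defect_def dform_def c_def by (simp add: sum_subtractf)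
  \<comment> \<open>For negative \<open>a\<close> the index becomes 0, which merely admits one more
    cell to the bound.\<close>
  also have "\<dots> \<le> (\<Sum>k<2 ^ n. if k = nat \<lfloor>a * 2 ^ n\<rfloor> then 1 / 2 ^ n else 0)"
  proof (rule sum_mono)
    fix k assume "k \<in> {..<2 ^ n :: nat}"
    then have k: "k < 2 ^ n" by simp
    show "c k - 2 ^ n * (c k)\<^sup>2 \<le> (if k = nat \<lfloor>a * 2 ^ n\<rfloor> then 1 / 2 ^ n else 0)"
    proof (cases "k = nat \<lfloor>a * 2 ^ n\<rfloor>")
      case True
      then show ?thesis using c_le[OF k] by (auto intro: order_trans[of _ "c k"])
    next
      case False
      have "\<not> (real k \<le> a * 2 ^ n \<and> a * 2 ^ n < real k + 1)"
      proof
        assume "real k \<le> a * 2 ^ n \<and> a * 2 ^ n < real k + 1"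
        then have "\<lfloor>a * 2 ^ n\<rfloor> = int k" by (simp add: floor_eq_iff)
        then show False using False by simp
      qed
      then consider "a * 2 ^ n < real k" | "real k + 1 \<le> a * 2 ^ n" by linarith
      then have "c k = 0 \<or> c k = 1 / 2 ^ n"
      proof cases
        case 1
        have "a < t" if "t \<in> cell n k" for t
        proof -
          have "real k \<le> t * 2 ^ n" using that by (simp add: cell_def field_simps)
          then have "a * 2 ^ n < t * 2 ^ n" using 1 by linarith
          then show ?thesis by simp
        qed
        then have "c k = (\<integral>t. 0 \<partial>UI)" unfolding c_def coef_def
          by (intro Bochner_Integration.integral_cong refl) (force simp: indicator_def)
        then show ?thesis by simp
      next
        case 2
        have "t \<le> a" if "t \<in> cell n k" for t
        proof -
          have "t * 2 ^ n < real k + 1" using that by (simp add: cell_def field_simps)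
          then have "t * 2 ^ n \<le> a * 2 ^ n" using 2 by linarith
          then show ?thesis by simp
        qed
        then have "c k = (\<integral>t. indicator (cell n k) t \<partial>UI)" unfolding c_def coef_def
          by (intro Bochner_Integration.integral_cong refl) (force simp: indicator_def)
        then show ?thesis using coef_const[OF k] by simp
      qed
      then show ?thesis using False by (auto simp: power2_eq_square)
    qed
  qed
  also have "\<dots> \<le> 1 / 2 ^ n" by simp
  finally show "defect n (indicator {..a}) \<le> 1 / 2 ^ n" .
qed

lemma good_const: "good (\<lambda>t. 1)"
proof -
  have "coef n k (\<lambda>t. 1) = 1 / 2 ^ n" if "k < 2 ^ n" for n k
    using coef_const[OF that] by (simp add: coef_def)
  then have "dform n (\<lambda>t. 1) = 1" for n
    by (simp add: dform_def power2_eq_square)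
  then have "defect n (\<lambda>t. 1) = 0" for n
    by (simp add: defect_def l2norm_square UI.prob_space[unfolded space_UI])
  then show ?thesis by (auto simp: good_def UI.sqint_const)
qed

text \<open>A Dynkin-system argument on half-lines. Disjoint unions are the essential case: the
  finite unions converge in mean square by dominated convergence, and limits of good functions are
  good.\<close>

lemma good_indicator:
  assumes "A \<in> sets borel" shows "good (indicator A)"
proof -
  have "Int_stable (range (\<lambda>a::real. {..a}))"
    by (auto simp: Int_stable_def)
  moreover have "range (\<lambda>a::real. {..a}) \<subseteq> Pow UNIV" by simp
  moreover have "A \<in> sigma_sets UNIV (range (\<lambda>a::real. {..a}))"
    using assms unfolding borel_eq_atMost by simp
  ultimately show ?thesis
  proof (induct rule: sigma_sets_induct_disjoint[consumes 3, case_names basic empty compl union])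
    case (basic A)
    then show ?case using good_atMost by auto
  next
    case empty
    then show ?case using good_0 by simp
  next
    case (compl A)
    have "(indicator (UNIV - A) :: real \<Rightarrow> real) = (\<lambda>t. 1 + (-1) * indicator A t)" by (auto simp: indicator_def fun_eq_iff)
    then show ?case using good_add[OF good_const good_cmult[OF compl(2), of "-1"]] by simp
  next
    case (union A)
    have Ab: "A i \<in> sets borel" for i using union(2) unfolding borel_eq_atMost by auto
    have bU: "(\<Union>i. A i) \<in> sets borel" using Ab by auto
    show ?case
    proof (rule good_closed)
      show "sqint UI (indicator (\<Union>i. A i))" by (rule sqint_indicator[OF bU])
      show "good (\<lambda>t. \<Sum>i<m. indicator (A i) t)" for m by (intro good_sum union(3))
      have eq: "(\<Sum>i<m. indicator (A i) t) = (indicator (\<Union>i<m. A i) t :: real)" for m t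
        by (rule indicator_UN_disjoint[symmetric]) (use union(1) in \<open>auto simp: disjoint_family_on_def\<close>)
      have "(\<lambda>m. l2norm UI (\<lambda>t. indicator (\<Union>i. A i) t - indicator (\<Union>i<m. A i) t)) \<longlonglongrightarrow> sqrt (\<integral>t. 0 \<partial>UI)"
        unfolding l2norm_def
      proof (intro tendsto_real_sqrt integral_dominated_convergence[where w="\<lambda>_. 1"])
        show "AE t in UI. (\<lambda>m. (indicator (\<Union>i. A i) t - indicator (\<Union>i<m. A i) t)\<^sup>2) \<longlonglongrightarrow> (0::real)"
        proof (rule AE_I2)
          fix t
          have "\<forall>\<^sub>F m in sequentially. (indicator (\<Union>i. A i) t - indicator (\<Union>i<m. A i) t)\<^sup>2 = (0::real)"
          proof (cases "t \<in> (\<Union>i. A i)")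
            case True
            then obtain i where "t \<in> A i" by auto
            then show ?thesis by (intro eventually_sequentiallyI[of "Suc i"]) (auto simp: indicator_def)
          qed (auto simp: indicator_def)
          then show "(\<lambda>m. (indicator (\<Union>i. A i) t - indicator (\<Union>i<m. A i) t)\<^sup>2) \<longlonglongrightarrow> (0::real)"
            by (rule tendsto_eventually)
        qed
        show "(\<lambda>t. (indicator (\<Union>i. A i) t - indicator (\<Union>i<m. A i) t)\<^sup>2 :: real) \<in> borel_measurable UI" for m
          by (intro borel_measurable_power borel_measurable_diff indicator_borel_UI bU sets.finite_UN Ab) auto
        show "AE t in UI. norm ((indicator (\<Union>i. A i) t - indicator (\<Union>i<m. A i) t)\<^sup>2 :: real) \<le> 1" for m
          by (intro AE_I2) (auto split: split_indicator)
      qed simp_all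
      then show "(\<lambda>m. l2norm UI (\<lambda>t. indicator (\<Union>i. A i) t - (\<Sum>i<m. indicator (A i) t))) \<longlonglongrightarrow> 0"
        unfolding eq by simp
    qed
  qed
qed

lemma good_all:
  assumes g: "sqint UI g" shows "good g"
proof -
  have [measurable]: "g \<in> borel_measurable UI" using g by auto
  obtain F where F0: "\<forall>i. simple_function UI (F i)" "\<forall>t\<in>space UI. (\<lambda>i. F i t) \<longlonglongrightarrow> g t"
    "\<forall>i. \<forall>t\<in>space UI. dist (F i t) 0 \<le> 2 * dist (g t) 0"
    using borel_measurable_implies_sequence_metric[of g UI 0, OF sqint_measurable[OF g]]
    by (elim exE conjE) (rule that)
  then have F: "\<And>i. simple_function UI (F i)" "\<And>t. t \<in> space UI \<Longrightarrow> (\<lambda>i. F i t) \<longlonglongrightarrow> g t"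
    "\<And>i t. t \<in> space UI \<Longrightarrow> dist (F i t) 0 \<le> 2 * dist (g t) 0"
    by simp_all
  note [measurable] = borel_measurable_simple_function[OF F(1)]
  \<comment> \<open>Goodness is known for indicators of Borel sets, so the simple functions are
    rewritten as combinations of such indicators; the two agree on the interval, which is all that
    \<open>UI\<close> sees.\<close>
  define H where "H i t = (\<Sum>y \<in> F i ` space UI. y * indicator (F i -` {y} \<inter> space UI) t)" for i t
  have HF: "H i t = F i t" if "t \<in> space UI" for i t
    unfolding H_def simple_function_indicator_representation_banach[OF F(1) that, of i]
    by (simp add: mult.commute)
  have gH: "good (H i)" for i
  proof -
    have "F i -` {y} \<inter> space UI \<in> sets borel" for y
    proof -
      have "F i -` {y} \<inter> space UI \<in> sets UI" by (rule simple_functionD(2)[OF F(1)])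
      then have "F i -` {y} \<inter> space UI \<in> (\<inter>) {0..1} ` sets borel"
        unfolding sets_UI sets_restrict_space .
      then obtain B where B: "B \<in> sets borel" "F i -` {y} \<inter> space UI = {0..1} \<inter> B"
        by (rule imageE)
      show ?thesis unfolding B(2) by (rule sets.Int[OF _ B(1)]) simp
    qed
    then show ?thesis unfolding H_def[abs_def] by (intro good_sum good_cmult good_indicator)
  qed
  have [measurable]: "H i \<in> borel_measurable UI" for i
    using gH[of i] by (intro sqint_measurable) (simp add: good_def)
  have "(\<lambda>i. l2norm UI (\<lambda>t. g t - H i t)) \<longlonglongrightarrow> sqrt (\<integral>t. 0 \<partial>UI)"
    unfolding l2norm_def
  \<comment> \<open>The factor 9 is \<open>(1 + 2)\<^sup>2\<close>, from
    \<open>|F i t| \<le> 2 * |g t|\<close>.\<close>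
  proof (intro tendsto_real_sqrt integral_dominated_convergence[where w="\<lambda>t. 9 * (g t)\<^sup>2"])
    show "AE t in UI. (\<lambda>i. (g t - H i t)\<^sup>2) \<longlonglongrightarrow> 0"
    proof (rule AE_I2)
      fix t assume t: "t \<in> space UI"
      have "(\<lambda>i. (g t - F i t)\<^sup>2) \<longlonglongrightarrow> (g t - g t)\<^sup>2" by (intro tendsto_intros F(2) t)
      then show "(\<lambda>i. (g t - H i t)\<^sup>2) \<longlonglongrightarrow> 0" using HF[OF t] by simp
    qed
    show "AE t in UI. norm ((g t - H i t)\<^sup>2) \<le> 9 * (g t)\<^sup>2" for i
    proof (rule AE_I2)
      fix t assume t: "t \<in> space UI"
      have "\<bar>g t - F i t\<bar> \<le> 3 * \<bar>g t\<bar>" using F(3)[OF t, of i] by (simp add: dist_real_def)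
      then have "\<bar>g t - F i t\<bar>\<^sup>2 \<le> (3 * \<bar>g t\<bar>)\<^sup>2" by (intro power_mono) auto
      then show "norm ((g t - H i t)\<^sup>2) \<le> 9 * (g t)\<^sup>2" using HF[OF t] by (simp add: power_mult_distrib)
    qed
  qed (use sqint_integrable_square[OF g] in auto)
  then show ?thesis using good_closed[OF g gH] by simp
qed

section \<open>The Haar system and Parseval's identity\<close>

lemma cell_split: "indicator (cell n k) t = (indicator (cell (Suc n) (2 * k)) t + indicator (cell (Suc n) (Suc (2 * k))) t :: real)"
  by (auto simp: cell_def field_simps indicator_def)

lemma cell_disjoint: "indicator (cell (Suc n) (2 * k)) t * indicator (cell (Suc n) (Suc (2 * k))) t = (0::real)"
  by (auto simp: cell_def field_simps indicator_def)

lemma coef_split: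
  assumes "sqint UI g"
  shows "coef n k g = coef (Suc n) (2 * k) g + coef (Suc n) (Suc (2 * k)) g"
  using coef_integrable[OF assms, of "Suc n"] unfolding coef_def cell_split[of n k] by (simp add: distrib_left)

definition haar_level :: "nat \<Rightarrow> nat" where "haar_level j = (LEAST n. j < 2 ^ Suc n)"

text \<open>For \<open>j = 2 ^ n + k\<close> with \<open>k < 2 ^ n\<close>, the level is
  \<open>n\<close> and the support is \<open>cell n k\<close>; the factor makes the norm 1. A single
  index is used so that expansions are ordinary series.\<close>

definition haar :: "nat \<Rightarrow> real \<Rightarrow> real" where
  "haar j t = (if j = 0 then 1 else
     (let n = haar_level j; k = j - 2 ^ n in
       sqrt (2 ^ n) * (indicator (cell (Suc n) (2 * k)) t - indicator (cell (Suc n) (Suc (2 * k))) t)))"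

lemma haar_level_eq:
  assumes "k < 2 ^ n" shows "haar_level (2 ^ n + k) = n"
  unfolding haar_level_def
proof (rule Least_equality)
  show "2 ^ n + k < 2 ^ Suc n" using assms by simp
  fix y assume "2 ^ n + k < (2::nat) ^ Suc y"
  then have "(2::nat) ^ n < 2 ^ Suc y" by linarith
  then have "n < Suc y" by (rule power_less_imp_less_exp[rotated]) simp
  then show "n \<le> y" by simp
qed

lemma haar_eq:
  assumes "k < 2 ^ n"
  shows "haar (2 ^ n + k) t = sqrt (2 ^ n) * (indicator (cell (Suc n) (2 * k)) t - indicator (cell (Suc n) (Suc (2 * k))) t)"
  unfolding haar_def Let_def haar_level_eq[OF assms] by simp

lemma haar_index:
  fixes j :: nat
  assumes "0 < j" obtains n k where "j = 2 ^ n + k" "k < 2 ^ n"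
proof -
  have ex: "\<exists>n. j < (2::nat) ^ Suc n"
    using less_exp[of j] by (intro exI[of _ j]) (unfold power_Suc, linarith)
  define n where "n = haar_level j"
  have lt: "j < 2 ^ Suc n" unfolding n_def haar_level_def using ex by (rule LeastI_ex)
  have "2 ^ n \<le> j"
  proof (cases n)
    case 0 then show ?thesis using assms by simp
  next
    case (Suc m)
    then have "\<not> j < 2 ^ Suc m" unfolding n_def haar_level_def by (intro not_less_Least) simp
    then show ?thesis using Suc by simp
  qed
  then show ?thesis using that[of n "j - 2 ^ n"] lt by simp
qed

lemma haar_borel[measurable]: "haar j \<in> borel_measurable borel"
  unfolding haar_def[abs_def] Let_def by (cases "j = 0") simp_all

lemma haar_bounded: "\<exists>C. \<forall>t. \<bar>haar j t\<bar> \<le> C"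
proof (cases "j = 0")
  case True then show ?thesis by (intro exI[of _ 1]) (simp add: haar_def)
next
  case False
  then obtain n k where j: "j = 2 ^ n + k" "k < 2 ^ n" using haar_index by (metis gr0I)
  show ?thesis unfolding j(1)
    by (intro exI[of _ "sqrt (2 ^ n)"] allI) (auto simp: haar_eq[OF j(2)] indicator_def)
qed

lemma sqint_haar: "sqint UI (haar j)"
proof -
  obtain C where C: "\<And>t. \<bar>haar j t\<bar> \<le> C" using haar_bounded[of j] by blast
  show ?thesis
    by (rule sqint_bound(1)[OF UI.sqint_const[of C]])
       (auto intro!: borel_measurable_UI AE_I2 simp: order_trans[OF C abs_ge_self])
qed

lemma haar_inner:
  assumes g: "sqint UI g" and k: "k < 2 ^ n"
  shows "(\<integral>t. g t * haar (2 ^ n + k) t \<partial>UI) = sqrt (2 ^ n) * (coef (Suc n) (2 * k) g - coef (Suc n) (Suc (2 * k)) g)"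
proof -
  have "(\<integral>t. g t * haar (2 ^ n + k) t \<partial>UI) =
     (\<integral>t. sqrt (2 ^ n) * (g t * indicator (cell (Suc n) (2 * k)) t - g t * indicator (cell (Suc n) (Suc (2 * k))) t) \<partial>UI)"
    unfolding haar_eq[OF k] by (simp add: algebra_simps)
  also have "\<dots> = sqrt (2 ^ n) * (coef (Suc n) (2 * k) g - coef (Suc n) (Suc (2 * k)) g)"
    unfolding coef_def using coef_integrable[OF g] by simp
  finally show ?thesis .
qed

lemma sum_even_odd: "(\<Sum>k<2 * m. f k) = (\<Sum>k<m. f (2 * k) + f (Suc (2 * k)) :: real)" for m :: nat
  by (induct m) simp_all

text \<open>A cell with half-cell coefficients \<open>a\<close> and \<open>b\<close> carries
  \<open>(a + b)\<^sup>2\<close> from the coarser averages and \<open>(a - b)\<^sup>2\<close> from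
  its Haar function, together \<open>2 * a\<^sup>2 + 2 * b\<^sup>2\<close>, which is the
  contribution of the two finer cells.\<close>

lemma haar_partial_sum:
  assumes g: "sqint UI g"
  shows "(\<Sum>j<2 ^ n. (\<integral>t. g t * haar j t \<partial>UI)\<^sup>2) = dform n g"
proof (induct n)
  case 0
  have "coef 0 0 g = (\<integral>t. g t \<partial>UI)"
    using integral_sum_cells[OF UI.sqint_integrable[OF g], of 0] by simp
  then show ?case by (simp add: dform_def haar_def)
next
  case (Suc n)
  define a where "a k = coef (Suc n) (2 * k) g" for k
  define b where "b k = coef (Suc n) (Suc (2 * k)) g" for k
  have "(\<Sum>j<2 ^ Suc n. (\<integral>t. g t * haar j t \<partial>UI)\<^sup>2)
     = (\<Sum>j<2 ^ n. (\<integral>t. g t * haar j t \<partial>UI)\<^sup>2) + (\<Sum>j=2 ^ n..<2 ^ Suc n. (\<integral>t. g t * haar j t \<partial>UI)\<^sup>2)"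
    using sum.atLeastLessThan_concat[of 0 "2 ^ n" "2 ^ Suc n" "\<lambda>j. (\<integral>t. g t * haar j t \<partial>UI)\<^sup>2"]
    by (simp add: atLeast0LessThan)
  also have "(\<Sum>j=2 ^ n..<2 ^ Suc n. (\<integral>t. g t * haar j t \<partial>UI)\<^sup>2) = (\<Sum>k<2 ^ n. (\<integral>t. g t * haar (2 ^ n + k) t \<partial>UI)\<^sup>2)"
    by (rule sum.reindex_bij_witness[of _ "\<lambda>k. 2 ^ n + k" "\<lambda>j. j - 2 ^ n"]) auto
  also have "\<dots> = (\<Sum>k<2 ^ n. 2 ^ n * (a k - b k)\<^sup>2)"
    by (intro sum.cong refl) (simp add: haar_inner[OF g] a_def b_def power_mult_distrib)
  also have "(\<Sum>j<2 ^ n. (\<integral>t. g t * haar j t \<partial>UI)\<^sup>2) = (\<Sum>k<2 ^ n. 2 ^ n * (a k + b k)\<^sup>2)"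
    unfolding Suc dform_def a_def b_def coef_split[OF g, symmetric] ..
  also have "(\<Sum>k<2 ^ n. 2 ^ n * (a k + b k)\<^sup>2) + (\<Sum>k<2 ^ n. 2 ^ n * (a k - b k)\<^sup>2) = (\<Sum>k<2 ^ n. 2 ^ Suc n * (a k)\<^sup>2 + 2 ^ Suc n * (b k)\<^sup>2)"
    unfolding sum.distrib[symmetric]
    by (intro sum.cong refl) (simp add: power2_eq_square algebra_simps)
  also have "\<dots> = dform (Suc n) g"
    unfolding dform_def a_def b_def power_Suc[of 2 n] by (rule sum_even_odd[symmetric])
  finally show ?case .
qed

text \<open>The partial sums up to \<open>2 ^ n\<close> equal \<open>dform n g\<close>, which
  exhausts the squared norm since every square-integrable function is \<open>good\<close>;
  nonnegative terms allow passing from this subsequence to the whole series.\<close>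

theorem haar_Parseval:
  assumes g: "sqint UI g"
  shows "(\<lambda>j. (\<integral>t. g t * haar j t \<partial>UI)\<^sup>2) sums (l2norm UI g)\<^sup>2"
proof -
  define c where "c j = (\<integral>t. g t * haar j t \<partial>UI)\<^sup>2" for j
  have le: "(\<Sum>j<N. c j) \<le> (l2norm UI g)\<^sup>2" for N
  proof -
    have "(\<Sum>j<N. c j) \<le> (\<Sum>j<2 ^ N. c j)"
      by (intro sum_mono2) (auto simp: c_def intro: less_trans[OF _ less_exp])
    also have "\<dots> \<le> (l2norm UI g)\<^sup>2"
      unfolding c_def haar_partial_sum[OF g] using defect_nonneg[OF g, of N] by (simp add: defect_def)
    finally show ?thesis .
  qed
  have s: "summable c" by (rule summableI_nonneg_bounded[OF _ le]) (simp add: c_def)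
  have "(\<lambda>n. (\<Sum>j<2 ^ n. c j)) \<longlonglongrightarrow> suminf c"
    by (rule LIMSEQ_subseq_LIMSEQ[OF summable_LIMSEQ[OF s], unfolded comp_def])
       (simp add: strict_mono_def)
  moreover have "(\<lambda>n. (\<Sum>j<2 ^ n. c j)) \<longlonglongrightarrow> (l2norm UI g)\<^sup>2"
  proof -
    have "(\<lambda>n. (l2norm UI g)\<^sup>2 - defect n g) \<longlonglongrightarrow> (l2norm UI g)\<^sup>2 - 0"
      using good_all[OF g] by (intro tendsto_intros) (simp add: good_def)
    then show ?thesis unfolding c_def haar_partial_sum[OF g] by (simp add: defect_def)
  qed
  ultimately have "suminf c = (l2norm UI g)\<^sup>2" by (rule LIMSEQ_unique)
  then show ?thesis using s unfolding c_def[symmetric] by (simp add: sums_iff)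
qed

lemma haar_norm: "(\<integral>t. haar j t * haar j t \<partial>UI) = 1"
proof (cases "j = 0")
  case True then show ?thesis by (simp add: haar_def UI.prob_space[unfolded space_UI])
next
  case False
  then obtain n k where j: "j = 2 ^ n + k" "k < 2 ^ n" using haar_index by (metis gr0I)
  have sq: "haar j t * haar j t = 2 ^ n * indicator (cell n k) t" for t
    unfolding j(1) haar_eq[OF j(2)] cell_split[of n k]
    using cell_disjoint[of n k t] by (auto simp: algebra_simps indicator_def)
  show ?thesis unfolding sq using coef_const[OF j(2)] by simp
qed

lemma haar_l2norm: "l2norm UI (haar j) = 1"
  using haar_norm[of j] by (simp add: l2norm_def power2_eq_square)

text \<open>Parseval's identity for \<open>haar i\<close> has its whole mass already in the \<open>i\<close>-th term.\<close>
lemma haar_orthogonal: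
  assumes "i \<noteq> j" shows "(\<integral>t. haar i t * haar j t \<partial>UI) = 0"
proof -
  define c where "c j = (\<integral>t. haar i t * haar j t \<partial>UI)\<^sup>2" for j
  have c: "c sums 1" using haar_Parseval[OF sqint_haar[of i]] unfolding c_def by (simp add: haar_l2norm)
  have "sum c {i, j} \<le> suminf c"
    using sums_summable[OF c] by (intro sum_le_suminf) (auto simp: c_def)
  then have "c i + c j \<le> 1" using assms sums_unique[OF c] by simp
  moreover have "c i = 1" by (simp add: c_def haar_norm)
  ultimately have "c j \<le> 0" by simp
  then show ?thesis by (simp add: c_def)
qed

lemma haar_inner_eq: "(\<integral>t. haar i t * haar j t \<partial>UI) = (if i = j then 1 else 0)"
  by (simp add: haar_norm haar_orthogonal)

section \<open>Laplace transforms, Gaussian vectors and the Cholesky decomposition\<close>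

lemma l2norm_eq_0_imp_AE:
  assumes "sqint N f" "l2norm N f = 0" shows "AE x in N. f x = 0"
proof -
  have "(\<integral>x. (f x)\<^sup>2 \<partial>N) = 0" using assms(2) by (simp add: l2norm_def)
  then have "AE x in N. (f x)\<^sup>2 = 0"
    by (subst (asm) integral_nonneg_eq_0_iff_AE) (auto intro: sqint_integrable_square[OF assms(1)])
  then show ?thesis by simp
qed

text \<open>Truncating at \<open>exp (- y)\<close> keeps the logarithm away from 0, so that the step
  function becomes a continuous function of \<open>exp (- v)\<close> on the closed unit interval.
  Values are unchanged because \<open>cts_step x y\<close> vanishes from \<open>y\<close>
  on.\<close>

lemma cts_step_exp:
  "x < y \<Longrightarrow> cts_step x y (- ln (max (exp (- v)) (exp (- y)))) = cts_step x y v"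
proof (cases "v \<le> y")
  case True
  then show ?thesis by (simp add: max_absorb1)
next
  case False
  assume "x < y"
  then show ?thesis using False by (simp add: max_absorb2 cts_step_def)
qed

text \<open>By the Weierstrass theorem, polynomials in \<open>exp (- x)\<close> approximate the test functions
  \<open>cts_step\<close> uniformly on the half-line, so no tightness argument is needed.\<close>
lemma laplace_imp_weak_conv:
  fixes V :: "nat \<Rightarrow> 'a \<Rightarrow> real" and W :: "'b \<Rightarrow> real"
  assumes M: "prob_space M" and N: "prob_space N"
    and V[measurable]: "\<And>k. V k \<in> borel_measurable M" and W[measurable]: "W \<in> borel_measurable N"
    and V0: "\<And>k x. 0 \<le> V k x" and W0: "\<And>x. 0 \<le> W x"
    and lap: "\<And>n::nat. (\<lambda>k. \<integral>x. exp (- (real n * V k x)) \<partial>M) \<longlonglongrightarrow> (\<integral>x. exp (- (real n * W x)) \<partial>N)"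
  shows "weak_conv_m (\<lambda>k. distr M borel (V k)) (distr N borel W)"
proof (rule integral_cts_step_conv_imp_weak_conv)
  interpret M: prob_space M by fact
  interpret N: prob_space N by fact
  show "real_distribution (distr M borel (V k))" for k by (rule M.real_distribution_distr) simp
  show "real_distribution (distr N borel W)" by (rule N.real_distribution_distr) simp
  fix x y :: real assume xy: "x < y"
  define h where "h w = cts_step x y (- ln (max w (exp (- y))))" for w
  have cs: "continuous_on UNIV (cts_step x y)"
    by (rule uniformly_continuous_imp_continuous[OF cts_step_uniformly_continuous[OF xy]])
  have mpos: "max w (exp (- y)) \<noteq> 0" for w
    using exp_gt_zero[of "- y"] by (simp only: max_def split: if_split) linarith
  have h: "continuous_on {0..1} h"
    unfolding h_def
    by (intro continuous_on_compose2[OF cs] continuous_intros) (auto simp: mpos)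
  have hm[measurable]: "h \<in> borel_measurable borel"
    unfolding h_def
    by (intro borel_measurable_continuous_onI continuous_on_compose2[OF cs] continuous_intros) (auto simp: mpos)
  have hb: "\<bar>h w\<bar> \<le> 1" for w using xy by (auto simp: h_def cts_step_def)
  have cm[measurable]: "cts_step x y \<in> borel_measurable borel"
    by (rule borel_measurable_continuous_onI[OF cs])
  have hV: "cts_step x y v = h (exp (- v))" for v
    unfolding h_def by (rule cts_step_exp[OF xy, symmetric])
  have lim: "(\<lambda>k. \<integral>z. h (exp (- V k z)) \<partial>M) \<longlonglongrightarrow> (\<integral>z. h (exp (- W z)) \<partial>N)"
  proof (rule LIMSEQ_I)
    fix e :: real assume e: "0 < e"
    obtain p where p: "real_polynomial_function p" "\<And>w. w \<in> {0..1} \<Longrightarrow> \<bar>h w - p w\<bar> < e / 4"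
      by (rule Stone_Weierstrass_real_polynomial_function[OF compact_Icc h, of "e / 4"]) (use e in auto)
    obtain a n where an: "p = (\<lambda>w. \<Sum>i\<le>n. a i * w ^ i)"
      using p(1) unfolding real_polynomial_function_iff_sum by blast
    \<comment> \<open>Monomials in \<open>exp (- v)\<close> are exponentials with integer rates,
      which is why Laplace transforms at natural numbers suffice.\<close>
    have pe: "p (exp (- v)) = (\<Sum>i\<le>n. a i * exp (- (real i * v)))" for v
      unfolding an by (simp add: exp_of_nat_mult[symmetric])
    have iM: "integrable M (\<lambda>z. exp (- (real i * V k z)))" for i k
      by (rule M.integrable_const_bound[of _ 1]) (auto simp: V0)
    have iN: "integrable N (\<lambda>z. exp (- (real i * W z)))" for i
      by (rule N.integrable_const_bound[of _ 1]) (auto simp: W0)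
    have ihM: "integrable M (\<lambda>z. h (exp (- V k z)))" for k
      by (rule M.integrable_const_bound[of _ 1]) (auto simp: hb)
    have ihN: "integrable N (\<lambda>z. h (exp (- W z)))"
      by (rule N.integrable_const_bound[of _ 1]) (auto simp: hb)
    have ipM: "integrable M (\<lambda>z. p (exp (- V k z)))" for k unfolding pe using iM by simp
    have ipN: "integrable N (\<lambda>z. p (exp (- W z)))" unfolding pe using iN by simp
    have "(\<lambda>k. \<integral>z. p (exp (- V k z)) \<partial>M) \<longlonglongrightarrow> (\<integral>z. p (exp (- W z)) \<partial>N)"
      unfolding pe using iM iN by (simp, intro tendsto_intros lap)
    then obtain k0 where k0: "\<And>k. k \<ge> k0 \<Longrightarrow> \<bar>(\<integral>z. p (exp (- V k z)) \<partial>M) - (\<integral>z. p (exp (- W z)) \<partial>N)\<bar> < e / 4"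
      using LIMSEQ_D[of _ _ "e / 4"] e by (metis divide_pos_pos real_norm_def zero_less_numeral)
    have dM: "\<bar>(\<integral>z. h (exp (- V k z)) \<partial>M) - (\<integral>z. p (exp (- V k z)) \<partial>M)\<bar> \<le> e / 4" for k
    proof -
      have "\<bar>(\<integral>z. h (exp (- V k z)) \<partial>M) - (\<integral>z. p (exp (- V k z)) \<partial>M)\<bar> = \<bar>\<integral>z. h (exp (- V k z)) - p (exp (- V k z)) \<partial>M\<bar>"
        using ihM ipM by simp
      also have "\<dots> \<le> (\<integral>z. \<bar>h (exp (- V k z)) - p (exp (- V k z))\<bar> \<partial>M)"
        by (rule integral_abs_bound)
      also have "\<dots> \<le> (\<integral>z. e / 4 \<partial>M)"
        using p(2)[of "exp (- V k _)"] V0 by (intro integral_mono integrable_abs Bochner_Integration.integrable_diff ihM ipM) (auto intro: less_imp_le)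
      finally show ?thesis by (simp add: M.prob_space)
    qed
    have dN: "\<bar>(\<integral>z. h (exp (- W z)) \<partial>N) - (\<integral>z. p (exp (- W z)) \<partial>N)\<bar> \<le> e / 4"
    proof -
      have "\<bar>(\<integral>z. h (exp (- W z)) \<partial>N) - (\<integral>z. p (exp (- W z)) \<partial>N)\<bar> = \<bar>\<integral>z. h (exp (- W z)) - p (exp (- W z)) \<partial>N\<bar>"
        using ihN ipN by simp
      also have "\<dots> \<le> (\<integral>z. \<bar>h (exp (- W z)) - p (exp (- W z))\<bar> \<partial>N)"
        by (rule integral_abs_bound)
      also have "\<dots> \<le> (\<integral>z. e / 4 \<partial>N)"
        using p(2)[of "exp (- W _)"] W0 by (intro integral_mono integrable_abs Bochner_Integration.integrable_diff ihN ipN) (auto intro: less_imp_le)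
      finally show ?thesis by (simp add: N.prob_space)
    qed
    show "\<exists>no. \<forall>k\<ge>no. norm ((\<integral>z. h (exp (- V k z)) \<partial>M) - (\<integral>z. h (exp (- W z)) \<partial>N)) < e"
    proof (intro exI allI impI)
      fix k assume "k \<ge> k0"
      from k0[OF this] dM[of k] dN e
      show "norm ((\<integral>z. h (exp (- V k z)) \<partial>M) - (\<integral>z. h (exp (- W z)) \<partial>N)) < e"
        unfolding real_norm_def by argo
    qed
  qed
  then show "(\<lambda>k. integral\<^sup>L (distr M borel (V k)) (cts_step x y)) \<longlonglongrightarrow> integral\<^sup>L (distr N borel W) (cts_step x y)"
    by (simp add: integral_distr hV)
qed

lemma Re_char_distr:
  assumes "prob_space N" and [measurable]: "X \<in> borel_measurable N"
  shows "Re (char (distr N borel X) u) = (\<integral>x. cos (u * X x) \<partial>N)"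
proof -
  interpret prob_space N by fact
  have i: "integrable N (\<lambda>x. iexp (u * X x))"
    by (rule integrable_const_bound[of _ 1]) auto
  have "char (distr N borel X) u = (CLINT x|N. iexp (u * X x))"
    by (simp add: char_def integral_distr)
  then have "Re (char (distr N borel X) u) = (\<integral>x. Re (iexp (u * X x)) \<partial>N)"
    using integral_Re[OF i] by simp
  then show ?thesis by (simp add: Re_exp)
qed

section \<open>Standard Gaussian sequences and random directions\<close>

definition gauss_seq :: "(nat \<Rightarrow> real) measure" where
  "gauss_seq = PiM UNIV (\<lambda>_. std_normal_distribution)"

interpretation std: prob_space std_normal_distribution
  by (rule prob_space_normal_density) simp

interpretation gauss: prob_space gauss_seq
  unfolding gauss_seq_def by (rule std.prob_space_PiM_UNIV)

lemma measurable_gauss_component: "(\<lambda>\<xi>. \<xi> j) \<in> borel_measurable gauss_seq"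
proof -
  have "(\<lambda>\<xi>. \<xi> j) \<in> gauss_seq \<rightarrow>\<^sub>M std_normal_distribution"
    unfolding gauss_seq_def by measurable
  then show ?thesis by (simp cong: measurable_cong_sets)
qed

lemma distr_gauss_component: "distr gauss_seq std_normal_distribution (\<lambda>\<xi>. \<xi> j) = std_normal_distribution"
  unfolding gauss_seq_def
  using distr_PiM_component[of UNIV "\<lambda>_. std_normal_distribution" j] std.prob_space_axioms by simp

lemma integral_gauss_component:
  fixes f :: "real \<Rightarrow> 'b :: {banach, second_countable_topology}"
  assumes "f \<in> borel_measurable borel"
  shows "(\<integral>\<xi>. f (\<xi> j) \<partial>gauss_seq) = (\<integral>x. f x \<partial>std_normal_distribution)"
proof -
  have m: "(\<lambda>\<xi>. \<xi> j) \<in> gauss_seq \<rightarrow>\<^sub>M std_normal_distribution"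
    using measurable_gauss_component by (simp cong: measurable_cong_sets)
  show ?thesis
    using integral_distr[OF m, of f] assms unfolding distr_gauss_component by simp
qed

lemma char_gauss_sum:
  "char (distr gauss_seq borel (\<lambda>\<xi>. \<Sum>j<n. c j * \<xi> j)) u = complex_of_real (exp (- (u\<^sup>2 * (\<Sum>j<n. (c j)\<^sup>2)) / 2))"
proof -
  have "gauss.indep_vars (\<lambda>_. std_normal_distribution) (\<lambda>i x. x i) UNIV"
    using std.indep_vars_coordinates unfolding gauss_seq_def .
  then have "gauss.indep_vars (\<lambda>_. borel) (\<lambda>j \<xi>. c j * \<xi> j) UNIV"
    by (rule gauss.indep_vars_compose2[where Y="\<lambda>j x. c j * x"]) simp
  then have "gauss.indep_vars (\<lambda>_. borel) (\<lambda>j \<xi>. c j * \<xi> j) {..<n}"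
    by (rule gauss.indep_vars_subset) simp
  then have "char (distr gauss_seq borel (\<lambda>\<xi>. \<Sum>j<n. c j * \<xi> j)) u = (\<Prod>j<n. char (distr gauss_seq borel (\<lambda>\<xi>. c j * \<xi> j)) u)"
    by (rule gauss.char_distr_sum)
  also have "\<dots> = (\<Prod>j<n. complex_of_real (exp (- ((u * c j)\<^sup>2) / 2)))"
  proof (rule prod.cong[OF refl])
    fix j
    have "char (distr gauss_seq borel (\<lambda>\<xi>. c j * \<xi> j)) u = (CLINT \<xi>|gauss_seq. iexp (u * c j * \<xi> j))"
      unfolding char_def
      by (subst integral_distr[OF borel_measurable_times[OF borel_measurable_const measurable_gauss_component]]) (auto simp: mult_ac)
    also have "\<dots> = char std_normal_distribution (u * c j)"
      unfolding char_def by (rule integral_gauss_component[of "\<lambda>x. iexp (u * c j * x)"]) simp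
    finally show "char (distr gauss_seq borel (\<lambda>\<xi>. c j * \<xi> j)) u = complex_of_real (exp (- ((u * c j)\<^sup>2) / 2))"
      by (simp add: char_std_normal_distribution)
  qed
  also have "\<dots> = complex_of_real (exp (\<Sum>j<n. - ((u * c j)\<^sup>2) / 2))"
    by (simp add: exp_sum)
  also have "(\<Sum>j<n. - ((u * c j)\<^sup>2) / 2) = - (u\<^sup>2 * (\<Sum>j<n. (c j)\<^sup>2)) / 2"
    by (simp add: power_mult_distrib sum_distrib_left sum_divide_distrib[symmetric] sum_negf)
  finally show ?thesis .
qed

text \<open>Randomising the frequency with a standard Gaussian vector turns Laplace transforms of
  \<open>\<Sum>j<n. V j ^ 2\<close> into averages of one-dimensional characteristic functions.\<close>
lemma gaussian_randomisation:
  fixes V :: "nat \<Rightarrow> 'a \<Rightarrow> real"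
  assumes N: "prob_space N" and V[measurable]: "\<And>j. V j \<in> borel_measurable N" and l: "0 \<le> l"
  shows "(\<integral>x. exp (- (l * (\<Sum>j<n. (V j x)\<^sup>2))) \<partial>N)
    = (\<integral>\<xi>. Re (char (distr N borel (\<lambda>x. \<Sum>j<n. \<xi> j * V j x)) (sqrt (2 * l))) \<partial>gauss_seq)"
proof -
  interpret N: prob_space N by fact
  interpret NG: pair_prob_space N gauss_seq ..
  \<comment> \<open>Chosen so that \<open>u\<^sup>2 / 2 = l\<close>, matching the Gaussian exponent
    with the Laplace exponent.\<close>
  define u where "u = sqrt (2 * l)"
  have u: "u\<^sup>2 = 2 * l" using l by (simp add: u_def)
  have 1: "exp (- (l * (\<Sum>j<n. (V j x)\<^sup>2))) = (\<integral>\<xi>. cos (u * (\<Sum>j<n. \<xi> j * V j x)) \<partial>gauss_seq)" for x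
  proof -
    have "(\<integral>\<xi>. cos (u * (\<Sum>j<n. V j x * \<xi> j)) \<partial>gauss_seq) = Re (char (distr gauss_seq borel (\<lambda>\<xi>. \<Sum>j<n. V j x * \<xi> j)) u)"
      by (rule Re_char_distr[OF gauss.prob_space_axioms, symmetric])
         (intro borel_measurable_sum borel_measurable_times borel_measurable_const measurable_gauss_component)
    then have "(\<integral>\<xi>. cos (u * (\<Sum>j<n. V j x * \<xi> j)) \<partial>gauss_seq) = exp (- (l * (\<Sum>j<n. (V j x)\<^sup>2)))"
      unfolding char_gauss_sum u by simp
    then show ?thesis by (simp add: mult.commute)
  qed
  have m: "(\<lambda>p. cos (u * (\<Sum>j<n. snd p j * V j (fst p)))) \<in> borel_measurable (N \<Otimes>\<^sub>M gauss_seq)"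
    by (intro measurable_compose[OF _ borel_measurable_cos] borel_measurable_times borel_measurable_const borel_measurable_sum
        measurable_compose[OF measurable_snd measurable_gauss_component]
        measurable_compose[OF measurable_fst V])
  have "(\<integral>x. exp (- (l * (\<Sum>j<n. (V j x)\<^sup>2))) \<partial>N) = (\<integral>x. \<integral>\<xi>. cos (u * (\<Sum>j<n. \<xi> j * V j x)) \<partial>gauss_seq \<partial>N)"
    unfolding 1 ..
  also have "\<dots> = (\<integral>\<xi>. \<integral>x. cos (u * (\<Sum>j<n. \<xi> j * V j x)) \<partial>N \<partial>gauss_seq)"
  proof (rule NG.Fubini_integral[symmetric])
    show "integrable (N \<Otimes>\<^sub>M gauss_seq) (\<lambda>(x, \<xi>). cos (u * (\<Sum>j<n. \<xi> j * V j x)))"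
      unfolding split_beta' by (rule NG.P.integrable_const_bound[of _ 1, OF _ m]) (intro AE_I2, simp)
  qed
  also have "\<dots> = (\<integral>\<xi>. Re (char (distr N borel (\<lambda>x. \<Sum>j<n. \<xi> j * V j x)) u) \<partial>gauss_seq)"
    by (intro Bochner_Integration.integral_cong refl Re_char_distr[symmetric] N) auto
  finally show ?thesis by (simp add: u_def)
qed

text \<open>The integrands over the random direction are bounded by 1, so convergence in every fixed
  direction and dominated convergence suffice. This plays the part of the Cramer-Wold
  device.\<close>

lemma char_conv_imp_laplace_conv:
  fixes V :: "nat \<Rightarrow> nat \<Rightarrow> 'a \<Rightarrow> real" and W :: "nat \<Rightarrow> 'b \<Rightarrow> real"
  assumes M: "prob_space M" and N: "prob_space N"
    and V[measurable]: "\<And>k j. V k j \<in> borel_measurable M" and W[measurable]: "\<And>j. W j \<in> borel_measurable N"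
    and l: "0 \<le> l"
    and ch: "\<And>\<xi> u. (\<lambda>k. char (distr M borel (\<lambda>x. \<Sum>j<n. \<xi> j * V k j x)) u)
         \<longlonglongrightarrow> char (distr N borel (\<lambda>x. \<Sum>j<n. \<xi> j * W j x)) u"
  shows "(\<lambda>k. \<integral>x. exp (- (l * (\<Sum>j<n. (V k j x)\<^sup>2))) \<partial>M) \<longlonglongrightarrow> (\<integral>x. exp (- (l * (\<Sum>j<n. (W j x)\<^sup>2))) \<partial>N)"
  unfolding gaussian_randomisation[OF M V l] gaussian_randomisation[OF N W l]
proof (rule integral_dominated_convergence[where w="\<lambda>_. 1"])
  interpret M: prob_space M by fact
  interpret N: prob_space N by fact
  have m: "(\<lambda>\<xi>. Re (char (distr K borel (\<lambda>x. \<Sum>j<n. \<xi> j * U j x)) u)) \<in> borel_measurable gauss_seq"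
    if K: "prob_space K" and [measurable]: "\<And>j. U j \<in> borel_measurable K" for K :: "'c measure" and U :: "nat \<Rightarrow> 'c \<Rightarrow> real" and u
  proof -
    interpret K: prob_space K by fact
    have "(\<lambda>(\<xi>, x). cos (u * (\<Sum>j<n. \<xi> j * U j x))) \<in> borel_measurable (gauss_seq \<Otimes>\<^sub>M K)"
      unfolding split_beta'
      by (intro measurable_compose[OF _ borel_measurable_cos] borel_measurable_times borel_measurable_const borel_measurable_sum
        measurable_compose[OF measurable_fst measurable_gauss_component]
        measurable_compose[OF measurable_snd that(2)])
    then have "(\<lambda>\<xi>. \<integral>x. cos (u * (\<Sum>j<n. \<xi> j * U j x)) \<partial>K) \<in> borel_measurable gauss_seq"
      by (rule K.borel_measurable_lebesgue_integral)
    then show ?thesis by (simp add: Re_char_distr[OF K])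
  qed
  show "(\<lambda>\<xi>. Re (char (distr N borel (\<lambda>x. \<Sum>j<n. \<xi> j * W j x)) (sqrt (2 * l)))) \<in> borel_measurable gauss_seq"
    by (rule m[OF N W])
  show "(\<lambda>\<xi>. Re (char (distr M borel (\<lambda>x. \<Sum>j<n. \<xi> j * V k j x)) (sqrt (2 * l)))) \<in> borel_measurable gauss_seq" for k
    by (rule m[OF M V])
  show "AE \<xi> in gauss_seq. (\<lambda>k. Re (char (distr M borel (\<lambda>x. \<Sum>j<n. \<xi> j * V k j x)) (sqrt (2 * l))))
     \<longlonglongrightarrow> Re (char (distr N borel (\<lambda>x. \<Sum>j<n. \<xi> j * W j x)) (sqrt (2 * l)))"
    by (intro AE_I2 tendsto_Re ch)
  show "AE \<xi> in gauss_seq. norm (Re (char (distr M borel (\<lambda>x. \<Sum>j<n. \<xi> j * V k j x)) (sqrt (2 * l)))) \<le> 1" for k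
  proof (rule AE_I2)
    fix \<xi> :: "nat \<Rightarrow> real"
    interpret D: real_distribution "distr M borel (\<lambda>x. \<Sum>j<n. \<xi> j * V k j x)"
      by (rule M.real_distribution_distr) simp
    show "norm (Re (char (distr M borel (\<lambda>x. \<Sum>j<n. \<xi> j * V k j x)) (sqrt (2 * l)))) \<le> 1"
      unfolding real_norm_def by (rule order_trans[OF abs_Re_le_cmod D.cmod_char_le_1])
  qed
qed simp

section \<open>Positive semidefinite matrices and elimination\<close>

definition psd :: "(nat \<Rightarrow> nat \<Rightarrow> real) \<Rightarrow> bool" where
  "psd C \<longleftrightarrow> (\<forall>j k. C j k = C k j) \<and> (\<forall>A a. finite A \<longrightarrow> 0 \<le> (\<Sum>j\<in>A. \<Sum>k\<in>A. a j * a k * C j k))"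

lemma psd_diag: "psd C \<Longrightarrow> 0 \<le> C n n"
proof -
  assume "psd C"
  then have "0 \<le> (\<Sum>j\<in>{n}. \<Sum>k\<in>{n}. 1 * 1 * C j k)"
    unfolding psd_def by (elim conjE allE[of _ "{n}"] allE[of _ "\<lambda>_. 1"]) simp
  then show ?thesis by simp
qed

lemma psd_form:
  assumes "psd C" "finite A" shows "0 \<le> (\<Sum>j\<in>A. \<Sum>k\<in>A. a j * a k * C j k)"
  using assms unfolding psd_def by blast

lemma psd_sym: "psd C \<Longrightarrow> C j k = C k j"
  unfolding psd_def by blast

lemma psd_null:
  assumes C: "psd C" and z: "C n n = 0" shows "C j n = 0"
proof (cases "j = n")
  case False
  have q: "0 \<le> x\<^sup>2 * C j j + 2 * x * y * C j n" for x y
  proof -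
    define a where "a i = (if i = j then x else y)" for i
    have "0 \<le> (\<Sum>i\<in>{j, n}. \<Sum>k\<in>{j, n}. a i * a k * C i k)" by (rule psd_form[OF C]) simp
    also have "\<dots> = x\<^sup>2 * C j j + 2 * x * y * C j n"
      using False z psd_sym[OF C, of n j] by (simp add: a_def power2_eq_square)
    finally show ?thesis .
  qed
  show ?thesis
  proof (rule ccontr)
    assume nz: "C j n \<noteq> 0"
    \<comment> \<open>With a zero pivot the form is linear in \<open>y\<close>, and this choice
      gives it the value \<open>-1\<close>.\<close>
    from q[of 1 "- (C j j + 1) / (2 * C j n)"] nz show False by (simp add: field_simps)
  qed
qed (use z in simp)

text \<open>Completing the square: the reduced form at \<open>a\<close> is the original form at
  \<open>a\<close> minus the minimising multiple of the unit vector \<open>n\<close>. If the pivot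
  is 0, the quotient is 0 and nothing is subtracted.\<close>

lemma psd_Schur:
  assumes C: "psd C"
  shows "psd (\<lambda>j k. C j k - C j n * C k n / C n n)"
  unfolding psd_def
proof (intro conjI allI impI)
  show "C j k - C j n * C k n / C n n = C k j - C k n * C j n / C n n" for j k
    using psd_sym[OF C, of j k] by (simp add: mult.commute)
  fix A :: "nat set" and a :: "nat \<Rightarrow> real" assume A: "finite A"
  \<comment> \<open>The index \<open>n\<close> must be available for the correction; if it is not in
    \<open>A\<close> it enters with coefficient 0.\<close>
  define B where "B = insert n A"
  have B: "finite B" "n \<in> B" using A by (auto simp: B_def)
  define b where "b j = (if j \<in> A then a j else 0)" for j
  define s where "s = (\<Sum>j\<in>B. b j * C j n)"
  define q where "q = (\<Sum>j\<in>B. \<Sum>k\<in>B. b j * b k * C j k)"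
  have ext: "(\<Sum>j\<in>A. \<Sum>k\<in>A. a j * a k * D j k) = (\<Sum>j\<in>B. \<Sum>k\<in>B. b j * b k * D j k)" for D :: "nat \<Rightarrow> nat \<Rightarrow> real"
  proof -
    have in1: "(\<Sum>k\<in>A. a j * a k * D j k) = (\<Sum>k\<in>B. b j * b k * D j k)" if "j \<in> A" for j
      using A that by (intro sum.mono_neutral_cong_left) (auto simp: B_def b_def)
    show ?thesis
      using A in1 by (intro sum.mono_neutral_cong_left) (auto simp: B_def b_def)
  qed
  have "(\<Sum>j\<in>A. \<Sum>k\<in>A. a j * a k * (C j k - C j n * C k n / C n n)) = q - s * s / C n n"
  proof -
    have "(\<Sum>j\<in>B. \<Sum>k\<in>B. b j * b k * (C j k - C j n * C k n / C n n)) = q - (\<Sum>j\<in>B. \<Sum>k\<in>B. (b j * C j n) * (b k * C k n)) / C n n"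
      unfolding q_def sum_divide_distrib sum_subtractf[symmetric]
      by (intro sum.cong refl) (simp add: algebra_simps)
    then show ?thesis unfolding ext s_def sum_product .
  qed
  also have "0 \<le> q - s * s / C n n"
  proof (cases "C n n = 0")
    case True
    then show ?thesis using psd_form[OF C B(1), of b] by (simp add: q_def)
  next
    case False
    define r where "r = s / C n n"
    define d where "d j = (if j = n then 1 else 0 :: real)" for j
    have "0 \<le> (\<Sum>j\<in>B. \<Sum>k\<in>B. (b j - r * d j) * (b k - r * d k) * C j k)" by (rule psd_form[OF C B(1)])
    also have "\<dots> = (\<Sum>j\<in>B. \<Sum>k\<in>B. b j * b k * C j k - r * (d k * (b j * C j k)) - r * (d j * (b k * C j k)) + r * r * (d j * (d k * C j k)))"
      by (intro sum.cong refl) (simp add: algebra_simps)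
    also have "\<dots> = q - r * (\<Sum>j\<in>B. \<Sum>k\<in>B. d k * (b j * C j k)) - r * (\<Sum>j\<in>B. \<Sum>k\<in>B. d j * (b k * C j k)) + r * r * (\<Sum>j\<in>B. \<Sum>k\<in>B. d j * (d k * C j k))"
      by (simp add: q_def sum.distrib sum_subtractf sum_distrib_left)
    also have "(\<Sum>j\<in>B. \<Sum>k\<in>B. d k * (b j * C j k)) = s"
      using B by (simp add: d_def s_def if_distrib[of "\<lambda>x. x * _"] sum.delta cong: if_cong)
    also have "(\<Sum>j\<in>B. \<Sum>k\<in>B. d j * (b k * C j k)) = s"
      unfolding sum_distrib_left[symmetric]
      using B psd_sym[OF C, of n] by (simp add: d_def s_def if_distrib[of "\<lambda>x. x * _"] sum.delta cong: if_cong)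
    also have "(\<Sum>j\<in>B. \<Sum>k\<in>B. d j * (d k * C j k)) = C n n"
      unfolding sum_distrib_left[symmetric]
      using B by (simp add: d_def if_distrib[of "\<lambda>x. x * _"] sum.delta cong: if_cong)
    also have "q - r * s - r * s + r * r * C n n = q - s * s / C n n"
      using False by (simp add: r_def field_simps)
    finally show ?thesis .
  qed
  finally show "0 \<le> (\<Sum>j\<in>A. \<Sum>k\<in>A. a j * a k * (C j k - C j n * C k n / C n n))" .
qed

text \<open>Symmetric elimination without exchanges: after \<open>n\<close> steps the indices below
  \<open>n\<close> have been eliminated. Division by a zero pivot yields 0, so such a step is
  void.\<close>

fun schur :: "(nat \<Rightarrow> nat \<Rightarrow> real) \<Rightarrow> nat \<Rightarrow> nat \<Rightarrow> nat \<Rightarrow> real" where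
  "schur C 0 j k = C j k"
| "schur C (Suc n) j k = schur C n j k - schur C n j n * schur C n k n / schur C n n n"

lemma psd_schur: "psd C \<Longrightarrow> psd (schur C n)"
proof (induct n)
  case 0
  have "schur C 0 = C" by (auto simp: fun_eq_iff)
  then show ?case using 0 by simp
next
  case (Suc n)
  have "schur C (Suc n) = (\<lambda>j k. schur C n j k - schur C n j n * schur C n k n / schur C n n n)"
    by (auto simp: fun_eq_iff)
  then show ?case using psd_Schur[OF Suc(1)[OF Suc(2)], of n] by simp
qed

text \<open>The step at pivot \<open>n\<close> clears row \<open>n\<close>; for a zero pivot the row
  was already zero by semidefiniteness. Cleared rows stay zero.\<close>

lemma schur_zero:
  assumes C: "psd C" shows "j < n \<Longrightarrow> schur C n j k = 0"
proof (induct n arbitrary: j k)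
  case (Suc n)
  note P = psd_schur[OF C, of n]
  show ?case
  proof (cases "j < n")
    case True then show ?thesis using Suc(1) by simp
  next
    case False
    then have j: "j = n" using Suc(2) by simp
    show ?thesis
    proof (cases "schur C n n n = 0")
      case True
      then show ?thesis using psd_null[OF P True] psd_sym[OF P, of n k] by (simp add: j)
    next
      case False
      then show ?thesis using psd_sym[OF P, of n k] by (simp add: j)
    qed
  qed
qed simp

text \<open>Each product \<open>L j i * L k i\<close> is what elimination step \<open>i\<close>
  subtracts, so the sum telescopes from \<open>C\<close> to a matrix whose row \<open>j\<close> is
  cleared. One and the same \<open>L\<close> serves all \<open>n\<close>, as an infinite sequence of
  coefficients requires.\<close>

lemma Cholesky:
  assumes C: "psd C"
  obtains L where "\<And>j i. j < i \<Longrightarrow> L j i = 0"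
    "\<And>j k n. j < n \<Longrightarrow> C j k = (\<Sum>i<n. L j i * L k i)"
proof
  define L where "L j i = schur C i j i / sqrt (schur C i i i)" for j i
  show "L j i = 0" if "j < i" for j i
    using schur_zero[OF C that] by (simp add: L_def)
  have LL: "L j i * L k i = schur C i j k - schur C (Suc i) j k" for j k i
    using psd_diag[OF psd_schur[OF C, of i], of i] by (simp add: L_def)
  show "C j k = (\<Sum>i<n. L j i * L k i)" if "j < n" for j k n
  proof -
    have "(\<Sum>i<n. L j i * L k i) = schur C 0 j k - schur C n j k"
      unfolding LL by (rule sum_lessThan_telescope')
    then show ?thesis using schur_zero[OF C that] by simp
  qed
qed

section \<open>Functions on product spaces\<close>

lemma sqint_iterated:
  assumes N: "sigma_finite_measure N" and K: "sigma_finite_measure K" and \<Phi>: "sqint (N \<Otimes>\<^sub>M K) \<Phi>"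
  shows "AE x in N. sqint K (\<lambda>t. \<Phi> (x, t))"
    and "sqint N (\<lambda>x. l2norm K (\<lambda>t. \<Phi> (x, t)))"
    and "l2norm N (\<lambda>x. l2norm K (\<lambda>t. \<Phi> (x, t))) = l2norm (N \<Otimes>\<^sub>M K) \<Phi>"
proof -
  interpret N: sigma_finite_measure N by fact
  interpret K: sigma_finite_measure K by fact
  interpret NK: pair_sigma_finite N K ..
  have m: "\<Phi> \<in> borel_measurable (N \<Otimes>\<^sub>M K)" using \<Phi> by auto
  note i = sqint_integrable_square[OF \<Phi>]
  show "AE x in N. sqint K (\<lambda>t. \<Phi> (x, t))"
    using NK.AE_integrable_fst'[OF i] AE_space
  proof eventually_elim
    case (elim x)
    then show ?case using measurable_compose_Pair1[OF _ m, of x] by (simp add: sqint_def)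
  qed
  have i2: "integrable N (\<lambda>x. \<integral>t. (\<Phi> (x, t))\<^sup>2 \<partial>K)"
    using NK.integrable_fst'[OF i] by simp
  have e: "(\<lambda>x. (l2norm K (\<lambda>t. \<Phi> (x, t)))\<^sup>2) = (\<lambda>x. \<integral>t. (\<Phi> (x, t))\<^sup>2 \<partial>K)"
    by (simp add: l2norm_square)
  have "(\<lambda>x. l2norm K (\<lambda>t. \<Phi> (x, t))) \<in> borel_measurable N"
    unfolding l2norm_def using borel_measurable_integrable[OF i2] by simp
  then show "sqint N (\<lambda>x. l2norm K (\<lambda>t. \<Phi> (x, t)))" unfolding sqint_def e using i2 by simp
  show "l2norm N (\<lambda>x. l2norm K (\<lambda>t. \<Phi> (x, t))) = l2norm (N \<Otimes>\<^sub>M K) \<Phi>"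
    unfolding l2norm_def[of N] e l2norm_def[of "N \<Otimes>\<^sub>M K"]
    using NK.integral_fst'[OF i] by simp
qed

lemma sqint_swap:
  assumes N: "sigma_finite_measure N" and K: "sigma_finite_measure K" and \<Phi>: "sqint (N \<Otimes>\<^sub>M K) \<Phi>"
  shows "sqint (K \<Otimes>\<^sub>M N) (\<lambda>p. \<Phi> (snd p, fst p))" "l2norm (K \<Otimes>\<^sub>M N) (\<lambda>p. \<Phi> (snd p, fst p)) = l2norm (N \<Otimes>\<^sub>M K) \<Phi>"
proof -
  interpret N: sigma_finite_measure N by fact
  interpret K: sigma_finite_measure K by fact
  interpret NK: pair_sigma_finite N K ..
  have d: "distr (K \<Otimes>\<^sub>M N) (N \<Otimes>\<^sub>M K) (\<lambda>p. (snd p, fst p)) = N \<Otimes>\<^sub>M K"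
    using NK.distr_pair_swap by (simp add: split_beta')
  have t: "(\<lambda>p. (snd p, fst p)) \<in> K \<Otimes>\<^sub>M N \<rightarrow>\<^sub>M N \<Otimes>\<^sub>M K" by (intro measurable_Pair measurable_fst measurable_snd)
  show "sqint (K \<Otimes>\<^sub>M N) (\<lambda>p. \<Phi> (snd p, fst p))" "l2norm (K \<Otimes>\<^sub>M N) (\<lambda>p. \<Phi> (snd p, fst p)) = l2norm (N \<Otimes>\<^sub>M K) \<Phi>"
    using sqint_distr[OF t, of \<Phi>] \<Phi> unfolding d by auto
qed

lemma sqint_tensor:
  assumes K: "sigma_finite_measure K" and v: "sqint N v" and h: "sqint K h"
  shows "sqint (N \<Otimes>\<^sub>M K) (\<lambda>p. v (fst p) * h (snd p))"
proof -
  interpret K: sigma_finite_measure K by fact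
  have vm: "v \<in> borel_measurable N" and hm: "h \<in> borel_measurable K" using v h by auto
  have m: "(\<lambda>p. v (fst p) * h (snd p)) \<in> borel_measurable (N \<Otimes>\<^sub>M K)"
    by (intro borel_measurable_times measurable_compose[OF measurable_fst vm] measurable_compose[OF measurable_snd hm])
  have "(\<integral>\<^sup>+p. ennreal ((v (fst p) * h (snd p))\<^sup>2) \<partial>(N \<Otimes>\<^sub>M K)) = (\<integral>\<^sup>+x. \<integral>\<^sup>+t. ennreal ((v x * h t)\<^sup>2) \<partial>K \<partial>N)"
    using m by (subst K.nn_integral_fst[symmetric]) auto
  also have "\<dots> = (\<integral>\<^sup>+x. ennreal ((v x)\<^sup>2) * (\<integral>\<^sup>+t. ennreal ((h t)\<^sup>2) \<partial>K) \<partial>N)"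
    by (intro nn_integral_cong) (subst nn_integral_cmult[symmetric], use hm in \<open>auto simp: power_mult_distrib ennreal_mult\<close>)
  also have "\<dots> = ennreal ((l2norm N v)\<^sup>2) * ennreal ((l2norm K h)\<^sup>2)"
    using vm by (simp add: nn_integral_multc nn_integral_square_eq_l2norm[OF v] nn_integral_square_eq_l2norm[OF h])
  also have "\<dots> = ennreal ((l2norm N v * l2norm K h)\<^sup>2)"
    by (simp add: power_mult_distrib ennreal_mult)
  finally show ?thesis by (intro sqint_I_nn(1)[OF m, of "l2norm N v * l2norm K h"]) auto
qed

lemma integral_inner_swap:
  assumes N: "sigma_finite_measure N" and K: "sigma_finite_measure K"
    and B: "sqint (N \<Otimes>\<^sub>M K) (\<lambda>p. B (fst p) (snd p))" and v: "sqint N v" and h: "sqint K h"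
  shows "(\<integral>x. v x * (\<integral>s. B x s * h s \<partial>K) \<partial>N) = (\<integral>s. h s * (\<integral>x. v x * B x s \<partial>N) \<partial>K)"
proof -
  interpret N: sigma_finite_measure N by fact
  interpret K: sigma_finite_measure K by fact
  interpret NK: pair_sigma_finite N K ..
  have i: "integrable (N \<Otimes>\<^sub>M K) (\<lambda>p. B (fst p) (snd p) * (v (fst p) * h (snd p)))"
    by (rule sqint_integrable_mult[OF B sqint_tensor[OF K v h]])
  have "(\<integral>x. v x * (\<integral>s. B x s * h s \<partial>K) \<partial>N) = (\<integral>x. (\<integral>s. B x s * (v x * h s) \<partial>K) \<partial>N)"
    by (intro Bochner_Integration.integral_cong refl)
       (subst integral_mult_right_zero[symmetric], simp add: mult_ac)
  also have "\<dots> = (\<integral>s. (\<integral>x. B x s * (v x * h s) \<partial>N) \<partial>K)"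
    using NK.Fubini_integral[of "\<lambda>x s. B x s * (v x * h s)"] i by (simp add: split_beta')
  also have "\<dots> = (\<integral>s. h s * (\<integral>x. v x * B x s \<partial>N) \<partial>K)"
    by (intro Bochner_Integration.integral_cong refl)
       (subst integral_mult_right_zero[symmetric], simp add: mult_ac)
  finally show ?thesis .
qed

text \<open>Cauchy-Schwarz on almost every section; the norm of the section norms is the norm on the
  product.\<close>

lemma sqint_inner:
  assumes N: "sigma_finite_measure N" and K: "sigma_finite_measure K"
    and B: "sqint (N \<Otimes>\<^sub>M K) (\<lambda>p. B (fst p) (snd p))" and h: "sqint K h"
  shows "sqint N (\<lambda>x. \<integral>s. B x s * h s \<partial>K)" "l2norm N (\<lambda>x. \<integral>s. B x s * h s \<partial>K) \<le> l2norm K h * l2norm (N \<Otimes>\<^sub>M K) (\<lambda>p. B (fst p) (snd p))"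
proof -
  interpret N: sigma_finite_measure N by fact
  interpret K: sigma_finite_measure K by fact
  interpret NK: pair_sigma_finite N K ..
  have Bm: "(\<lambda>p. B (fst p) (snd p)) \<in> borel_measurable (N \<Otimes>\<^sub>M K)" and hm: "h \<in> borel_measurable K" using B h by auto
  have "(\<lambda>p. B (fst p) (snd p) * h (snd p)) \<in> borel_measurable (N \<Otimes>\<^sub>M K)"
    by (intro borel_measurable_times Bm measurable_compose[OF measurable_snd hm])
  then have m: "(\<lambda>x. \<integral>s. B x s * h s \<partial>K) \<in> borel_measurable N"
    by (intro K.borel_measurable_lebesgue_integral) (simp only: split_beta')
  have b: "AE x in N. \<bar>\<integral>s. B x s * h s \<partial>K\<bar> \<le> \<bar>l2norm K h * l2norm K (\<lambda>t. B x t)\<bar>"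
    using sqint_iterated(1)[OF N K B]
  proof eventually_elim
    case (elim x)
    then have "\<bar>\<integral>s. B x s * h s \<partial>K\<bar> \<le> l2norm K (\<lambda>t. B x t) * l2norm K h" by (intro Cauchy_Schwarz_l2norm h) simp
    then show ?case by (simp add: mult.commute abs_mult)
  qed
  have s: "sqint N (\<lambda>x. l2norm K h * l2norm K (\<lambda>t. B x t))"
    using sqint_cmult[OF sqint_iterated(2)[OF N K B], of "l2norm K h"] by simp
  show "sqint N (\<lambda>x. \<integral>s. B x s * h s \<partial>K)" by (rule sqint_bound(1)[OF s m b])
  have "l2norm N (\<lambda>x. \<integral>s. B x s * h s \<partial>K) \<le> l2norm N (\<lambda>x. l2norm K h * l2norm K (\<lambda>t. B x t))"
    by (rule sqint_bound(2)[OF s m b])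
  also have "\<dots> = l2norm K h * l2norm (N \<Otimes>\<^sub>M K) (\<lambda>p. B (fst p) (snd p))"
    using sqint_iterated(3)[OF N K B] by (simp add: l2norm_cmult)
  finally show "l2norm N (\<lambda>x. \<integral>s. B x s * h s \<partial>K) \<le> l2norm K h * l2norm (N \<Otimes>\<^sub>M K) (\<lambda>p. B (fst p) (snd p))" .
qed

lemma sqint_compose_fst:
  assumes N: "sigma_finite_measure N" and K: "sigma_finite_measure K" and T: "T \<in> L \<rightarrow>\<^sub>M N" "distr L N T = N"
    and L: "sigma_finite_measure L"
    and B: "sqint (N \<Otimes>\<^sub>M K) (\<lambda>p. B (fst p) (snd p))"
  shows "sqint (L \<Otimes>\<^sub>M K) (\<lambda>p. B (T (fst p)) (snd p))"
proof -
  interpret N: sigma_finite_measure N by fact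
  interpret K: sigma_finite_measure K by fact
  interpret L: sigma_finite_measure L by fact
  have Bm: "(\<lambda>p. B (fst p) (snd p)) \<in> borel_measurable (N \<Otimes>\<^sub>M K)" using B by auto
  have Tm: "(\<lambda>p. (T (fst p), snd p)) \<in> L \<Otimes>\<^sub>M K \<rightarrow>\<^sub>M N \<Otimes>\<^sub>M K"
    by (intro measurable_Pair measurable_compose[OF measurable_fst T(1)] measurable_snd)
  have m: "(\<lambda>p. B (T (fst p)) (snd p)) \<in> borel_measurable (L \<Otimes>\<^sub>M K)"
    using measurable_compose[OF Tm Bm] by simp
  define J where "J x = (\<integral>\<^sup>+s. ennreal ((B x s)\<^sup>2) \<partial>K)" for x
  have Jm: "J \<in> borel_measurable N" unfolding J_def[abs_def]
    using Bm by (intro K.borel_measurable_nn_integral) (simp add: split_beta')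
  have "(\<integral>\<^sup>+p. ennreal ((B (T (fst p)) (snd p))\<^sup>2) \<partial>(L \<Otimes>\<^sub>M K)) = (\<integral>\<^sup>+x. J (T x) \<partial>L)"
    using m by (subst K.nn_integral_fst[symmetric]) (auto simp: J_def)
  also have "\<dots> = (\<integral>\<^sup>+x. J x \<partial>N)"
    using nn_integral_distr[OF T(1), of J] Jm unfolding T(2) by simp
  also have "\<dots> = (\<integral>\<^sup>+p. ennreal ((B (fst p) (snd p))\<^sup>2) \<partial>(N \<Otimes>\<^sub>M K))"
    using Bm by (subst K.nn_integral_fst[symmetric]) (auto simp: J_def[abs_def])
  also have "\<dots> = ennreal ((l2norm (N \<Otimes>\<^sub>M K) (\<lambda>p. B (fst p) (snd p)))\<^sup>2)"
    by (rule nn_integral_square_eq_l2norm[OF B])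
  finally show ?thesis by (intro sqint_I_nn(1)[OF m]) auto
qed

text \<open>With this reading, Minkowski's inequality for series also applies to square-summable
  sequences indexed by the basis.\<close>

lemma sqint_count_space: "sqint (count_space (UNIV::nat set)) f \<longleftrightarrow> summable (\<lambda>j. (f j)\<^sup>2)"
  by (simp add: sqint_def integrable_count_space_nat_iff)

lemma l2norm_count_space: "summable (\<lambda>j. (f j)\<^sup>2) \<Longrightarrow> l2norm (count_space (UNIV::nat set)) f = sqrt (\<Sum>j. (f j)\<^sup>2)"
  by (simp add: l2norm_def integral_count_space_nat integrable_count_space_nat_iff)

section \<open>Functional Bernoulli shifts\<close>

locale bernoulli_errors = prob_space M for M :: "'a measure" +
  fixes S :: "'s measure" and \<delta> :: "int \<Rightarrow> 'a \<Rightarrow> 's" and f :: "(nat \<Rightarrow> 's) \<Rightarrow> real \<Rightarrow> real"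
    and eps :: "int \<Rightarrow> 'a \<Rightarrow> real \<Rightarrow> real"
  assumes error: "error_assumptions M S \<delta> f eps"
begin

definition P where "P = distr M S (\<delta> 0)"

lemma shift: "bernoulli_shift M S \<delta> f eps"
  using error by (simp add: error_assumptions_def)

lemma \<delta>_indep: "indep_vars (\<lambda>_. S) \<delta> UNIV"
  using shift by (simp add: bernoulli_shift_def)

lemma \<delta>_measurable[measurable]: "\<delta> i \<in> M \<rightarrow>\<^sub>M S"
  using \<delta>_indep by (auto simp: indep_vars_def)

lemma \<delta>_distr: "distr M S (\<delta> i) = P"
  using shift unfolding bernoulli_shift_def P_def by blast

lemma f_measurable: "(\<lambda>(x, t). f x t) \<in> borel_measurable (PiM UNIV (\<lambda>_. S) \<Otimes>\<^sub>M lborel)"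
  using shift by (simp add: bernoulli_shift_def)

lemma sets_P: "sets P = sets S" by (simp add: P_def)

lemma sets_PiM_P: "sets (PiM UNIV (\<lambda>_. P)) = sets (PiM UNIV (\<lambda>_. S))"
  by (intro sets_PiM_cong refl sets_P)

lemma prob_space_P: "prob_space P"
  unfolding P_def by (rule prob_space_distr) simp

end

sublocale bernoulli_errors \<subseteq> P: prob_space P
  by (rule prob_space_P)

context bernoulli_errors
begin

lemma f_L2: "x \<in> space P.Rn \<Longrightarrow> f x \<in> L2"
  using shift sets_eq_imp_space_eq[OF sets_PiM_P] unfolding bernoulli_shift_def by auto

lemma eps_eq: "\<omega> \<in> space M \<Longrightarrow> eps i \<omega> t = sh (\<lambda>x. f x t) i (\<lambda>i. \<delta> i \<omega>)"
  using shift unfolding bernoulli_shift_def sh_def by simp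

lemma prob_Rn: "prob_space P.Rn" and prob_Qz: "prob_space P.Qz"
  by (rule P.prob_space_PiM_UNIV)+

lemma sf_Rn: "sigma_finite_measure P.Rn" and sf_Qz: "sigma_finite_measure P.Qz"
  and sf_UI: "sigma_finite_measure UI" and sf_M: "sigma_finite_measure M"
  and sf_RR: "sigma_finite_measure (P.Rn \<Otimes>\<^sub>M P.Rn)"
proof -
  interpret R: prob_space P.Rn by (rule prob_Rn)
  interpret Q: prob_space P.Qz by (rule prob_Qz)
  interpret RR: pair_prob_space P.Rn P.Rn ..
  show "sigma_finite_measure P.Rn" "sigma_finite_measure P.Qz" "sigma_finite_measure UI" "sigma_finite_measure M"
    "sigma_finite_measure (P.Rn \<Otimes>\<^sub>M P.Rn)"
    by (rule R.sigma_finite_measure_axioms Q.sigma_finite_measure_axioms UI.sigma_finite_measure_axioms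
        sigma_finite_measure_axioms RR.P.sigma_finite_measure_axioms)+
qed

lemma f_pair_measurable: "(\<lambda>p. f (fst p) (snd p)) \<in> borel_measurable (P.Rn \<Otimes>\<^sub>M UI)"
proof -
  have "(\<lambda>p. (fst p, snd p)) \<in> P.Rn \<Otimes>\<^sub>M UI \<rightarrow>\<^sub>M PiM UNIV (\<lambda>_. S) \<Otimes>\<^sub>M lborel"
    by (intro measurable_Pair measurable_compose[OF measurable_fst measurable_ident_sets[OF sets_PiM_P]]
        measurable_compose[OF measurable_snd measurable_ident_UI(2)])
  from measurable_compose[OF this f_measurable] show ?thesis by simp
qed

definition D where "D \<omega> = (\<lambda>i. \<delta> i \<omega>)"

lemma D_measurable: "D \<in> M \<rightarrow>\<^sub>M P.Qz"
  unfolding D_def[abs_def]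
  by (rule measurable_PiM_UNIV) (use \<delta>_measurable sets_P in \<open>simp cong: measurable_cong_sets\<close>)

text \<open>Independence together with equal marginals says that the two-sided innovation sequence
  has the product law; computations on \<open>M\<close> can therefore be moved to
  \<open>Qz\<close>.\<close>

lemma D_distr: "distr M P.Qz D = P.Qz"
proof -
  have "distr M (PiM UNIV (\<lambda>_. S)) (\<lambda>x. \<lambda>i\<in>UNIV. \<delta> i x) = PiM UNIV (\<lambda>i. distr M S (\<delta> i))"
    using \<delta>_indep by (subst indep_vars_iff_distr_eq_PiM[symmetric]) auto
  then have "distr M (PiM UNIV (\<lambda>_. S)) D = P.Qz"
    unfolding \<delta>_distr D_def[abs_def] by (simp add: restrict_UNIV)
  moreover have "distr M (PiM UNIV (\<lambda>_. S)) D = distr M P.Qz D"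
    by (rule distr_cong) (auto simp: sets_PiM_P)
  ultimately show ?thesis by simp
qed

lemma integral_D:
  fixes F :: "(int \<Rightarrow> 's) \<Rightarrow> real"
  assumes "F \<in> borel_measurable P.Qz" shows "(\<integral>\<omega>. F (D \<omega>) \<partial>M) = (\<integral>x. F x \<partial>P.Qz)"
  using integral_distr[OF D_measurable, of F] assms unfolding D_distr by simp

lemma distr_D:
  assumes "F \<in> borel_measurable P.Qz" shows "distr M borel (\<lambda>\<omega>. F (D \<omega>)) = distr P.Qz borel F"
  using distr_distr[OF assms D_measurable] unfolding D_distr by (simp add: comp_def)

lemma sqint_D:
  assumes "sqint P.Qz F" shows "sqint M (\<lambda>\<omega>. F (D \<omega>))" "l2norm M (\<lambda>\<omega>. F (D \<omega>)) = l2norm P.Qz F"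
  using sqint_distr[OF D_measurable, of F] assms unfolding D_distr by auto

lemma past_D_distr: "distr M P.Rn (\<lambda>\<omega> k. D \<omega> (i - int k)) = P.Rn"
  and past_D_measurable: "(\<lambda>\<omega> k. D \<omega> (i - int k)) \<in> M \<rightarrow>\<^sub>M P.Rn"
proof -
  show "(\<lambda>\<omega> k. D \<omega> (i - int k)) \<in> M \<rightarrow>\<^sub>M P.Rn"
    by (rule measurable_compose[OF D_measurable P.measurable_past])
  show "distr M P.Rn (\<lambda>\<omega> k. D \<omega> (i - int k)) = P.Rn"
    using distr_distr[OF P.measurable_past[of i] D_measurable]
    unfolding D_distr P.distr_past by (simp add: comp_def)
qed

lemma eps_D: "\<omega> \<in> space M \<Longrightarrow> eps i \<omega> t = f (\<lambda>k. D \<omega> (i - int k)) t"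
  using eps_eq unfolding sh_def D_def by simp

lemma eps_pair_measurable: "(\<lambda>p. eps i (fst p) (snd p)) \<in> borel_measurable (M \<Otimes>\<^sub>M UI)"
proof -
  have "(\<lambda>p. ((\<lambda>k. D (fst p) (i - int k)), snd p)) \<in> M \<Otimes>\<^sub>M UI \<rightarrow>\<^sub>M P.Rn \<Otimes>\<^sub>M UI"
    by (intro measurable_Pair measurable_compose[OF measurable_fst past_D_measurable] measurable_snd)
  from measurable_compose[OF this f_pair_measurable]
  have m: "(\<lambda>p. f (\<lambda>k. D (fst p) (i - int k)) (snd p)) \<in> borel_measurable (M \<Otimes>\<^sub>M UI)" by simp
  have eq: "eps i (fst p) (snd p) = f (\<lambda>k. D (fst p) (i - int k)) (snd p)" if "p \<in> space (M \<Otimes>\<^sub>M UI)" for p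
    using that by (intro eps_D) (auto simp: space_pair_measure)
  show ?thesis by (subst measurable_cong[OF eq]) (assumption, rule m)
qed

lemma eps_L2: "\<omega> \<in> space M \<Longrightarrow> eps i \<omega> \<in> L2"
proof -
  assume w: "\<omega> \<in> space M"
  have "eps i \<omega> = f (\<lambda>k. D \<omega> (i - int k))" using eps_D[OF w] by auto
  then show ?thesis using f_L2[OF measurable_space[OF past_D_measurable w]] by simp
qed

text \<open>At a fixed time, \<open>eps 0\<close> has the law of \<open>f\<close> under the product
  measure; Tonelli's theorem then turns the second-moment assumption into square integrability on
  the product.\<close>

lemma sqint_f: "sqint (P.Rn \<Otimes>\<^sub>M UI) (\<lambda>p. f (fst p) (snd p))"
proof -
  interpret R: prob_space P.Rn by (rule prob_Rn)
  interpret RU: pair_sigma_finite P.Rn UI ..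
  have fin: "(\<integral>\<^sup>+ t. indicator {0..1} t * (\<integral>\<^sup>+ \<omega>. ennreal ((eps 0 \<omega> t)\<^sup>2) \<partial>M) \<partial>lborel) < \<infinity>"
    using error by (simp add: error_assumptions_def)
  have inner: "(\<integral>\<^sup>+ \<omega>. ennreal ((eps 0 \<omega> t)\<^sup>2) \<partial>M) = (\<integral>\<^sup>+ x. ennreal ((f x t)\<^sup>2) \<partial>P.Rn)" if t: "t \<in> space UI" for t
  proof -
    have "(\<lambda>x. (x, t)) \<in> P.Rn \<rightarrow>\<^sub>M P.Rn \<Otimes>\<^sub>M UI" using t by (intro measurable_Pair2') 
    from measurable_compose[OF this f_pair_measurable] have fm: "(\<lambda>x. f x t) \<in> borel_measurable P.Rn" by simp
    have "(\<integral>\<^sup>+ \<omega>. ennreal ((eps 0 \<omega> t)\<^sup>2) \<partial>M) = (\<integral>\<^sup>+ \<omega>. ennreal ((f (\<lambda>k. D \<omega> (0 - int k)) t)\<^sup>2) \<partial>M)"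
      by (intro nn_integral_cong) (simp add: eps_D)
    also have "\<dots> = (\<integral>\<^sup>+ x. ennreal ((f x t)\<^sup>2) \<partial>distr M P.Rn (\<lambda>\<omega> k. D \<omega> (0 - int k)))"
      by (rule nn_integral_distr[symmetric, OF past_D_measurable]) (use fm in simp)
    finally show ?thesis unfolding past_D_distr .
  qed
  have "(\<integral>\<^sup>+ p. ennreal ((f (fst p) (snd p))\<^sup>2) \<partial>(P.Rn \<Otimes>\<^sub>M UI)) = (\<integral>\<^sup>+ t. \<integral>\<^sup>+ x. ennreal ((f x t)\<^sup>2) \<partial>P.Rn \<partial>UI)"
    using f_pair_measurable by (subst RU.nn_integral_snd[symmetric]) (auto simp: split_beta')
  also have "\<dots> = (\<integral>\<^sup>+ t. (\<integral>\<^sup>+ \<omega>. ennreal ((eps 0 \<omega> t)\<^sup>2) \<partial>M) \<partial>UI)"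
    by (intro nn_integral_cong) (simp add: inner)
  also have "\<dots> < \<infinity>" using fin unfolding nn_integral_UI .
  finally show ?thesis
    unfolding sqint_def using f_pair_measurable
    by (auto intro!: integrableI_nonneg)
qed

text \<open>The coupling difference as a function of a pair of sequences and a time, so that it is a
  single element of an \<open>L^2\<close> space.\<close>

definition \<Phi> where "\<Phi> m q = f (fst (fst q)) (snd q) - f (mrg {..<m} (fst (fst q)) (snd (fst q))) (snd q)"

definition a where "a m = l2norm ((P.Rn \<Otimes>\<^sub>M P.Rn) \<Otimes>\<^sub>M UI) (\<Phi> m)"

lemma sqint_\<Phi>: "sqint ((P.Rn \<Otimes>\<^sub>M P.Rn) \<Otimes>\<^sub>M UI) (\<Phi> m)"
proof -
  interpret R: prob_space P.Rn by (rule prob_Rn)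
  have d1: "distr (P.Rn \<Otimes>\<^sub>M P.Rn) P.Rn (\<lambda>p. mrg J (fst p) (snd p)) = P.Rn" for J
    by (rule P.distr_mrg)
  have m1: "(\<lambda>p. mrg J (fst p) (snd p)) \<in> P.Rn \<Otimes>\<^sub>M P.Rn \<rightarrow>\<^sub>M P.Rn" for J :: "nat set"
    by (rule P.measurable_mrg_Q)
  have "sqint ((P.Rn \<Otimes>\<^sub>M P.Rn) \<Otimes>\<^sub>M UI) (\<lambda>q. f (mrg J (fst (fst q)) (snd (fst q))) (snd q))" for J
    using sqint_compose_fst[OF sf_Rn sf_UI m1 d1 sf_RR sqint_f] by simp
  from sqint_diff[OF this[of UNIV] this[of "{..<m}"]] show ?thesis
    unfolding \<Phi>_def[abs_def] by (simp add: mrg_def[of UNIV])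
qed

text \<open>Tonelli's theorem identifies the iterated integral of the hypothesis with a squared norm
  on one product space, which makes the norm inequalities applicable.\<close>

lemma approx_err_eq: "approx_err P f m = ennreal ((a m)\<^sup>2)"
proof -
  interpret R: prob_space P.Rn by (rule prob_Rn)
  have m: "\<Phi> m \<in> borel_measurable ((P.Rn \<Otimes>\<^sub>M P.Rn) \<Otimes>\<^sub>M UI)" using sqint_\<Phi> by auto
  define H where "H p = (\<integral>\<^sup>+ t. ennreal ((\<Phi> m (p, t))\<^sup>2) \<partial>UI)" for p
  have Hm: "H \<in> borel_measurable (P.Rn \<Otimes>\<^sub>M P.Rn)" unfolding H_def[abs_def]
    by (rule UI.borel_measurable_nn_integral) (use m in \<open>simp add: split_beta'\<close>)
  have "ennreal ((a m)\<^sup>2) = (\<integral>\<^sup>+ q. ennreal ((\<Phi> m q)\<^sup>2) \<partial>((P.Rn \<Otimes>\<^sub>M P.Rn) \<Otimes>\<^sub>M UI))"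
    unfolding a_def by (rule nn_integral_square_eq_l2norm[OF sqint_\<Phi>, symmetric])
  also have "\<dots> = (\<integral>\<^sup>+ p. H p \<partial>(P.Rn \<Otimes>\<^sub>M P.Rn))"
    using m by (subst UI.nn_integral_fst[symmetric]) (auto simp: H_def[abs_def])
  also have "\<dots> = (\<integral>\<^sup>+ x. \<integral>\<^sup>+ y. H (x, y) \<partial>P.Rn \<partial>P.Rn)"
    by (rule R.nn_integral_fst[symmetric, OF Hm])
  also have "\<dots> = approx_err P f m"
    unfolding approx_err_def H_def nn_integral_UI \<Phi>_def mrg_def fst_conv snd_conv lessThan_iff ..
  finally show ?thesis ..
qed

lemma a_nonneg: "0 \<le> a m" by (simp add: a_def)

lemma summable_a: "summable a"
proof -
  have "summable (\<lambda>m. sqrt (enn2real (approx_err P f (Suc m))))"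
    using error unfolding error_assumptions_def P_def by blast
  then have "summable (\<lambda>m. a (Suc m))"
    unfolding approx_err_eq by (simp add: a_nonneg)
  \<comment> \<open>The hypothesis starts at \<open>m = 1\<close>; the term at 0 is just one more
    finite number.\<close>
  then show ?thesis by (simp add: summable_Suc_iff)
qed

text \<open>Norm, and below it coupling error, at a fixed time. The product
  \<open>e t * \<beta> k s\<close> will dominate the covariance kernel at lag \<open>k\<close>, with
  norms summable in \<open>k\<close>.\<close>

definition e where "e t = l2norm P.Rn (\<lambda>x. f x t)"
definition \<beta> where "\<beta> m t = err P (\<lambda>x. f x t) m"

lemma AE_f_sqint: "AE t in UI. sqint P.Rn (\<lambda>x. f x t)" and sqint_e: "sqint UI e"
  using sqint_iterated[OF sf_UI sf_Rn sqint_swap(1)[OF sf_Rn sf_UI sqint_f]] unfolding e_def[abs_def] by simp_all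

lemma sqint_\<beta>: "sqint UI (\<beta> m)" and l2norm_\<beta>: "l2norm UI (\<beta> m) = a m"
  using sqint_iterated(2,3)[OF sf_UI sf_RR sqint_swap(1)[OF sf_RR sf_UI sqint_\<Phi>], of m] sqint_swap(2)[OF sf_RR sf_UI sqint_\<Phi>, of m]
  unfolding \<beta>_def[abs_def] err_def a_def \<Phi>_def[abs_def] by simp_all

lemma f_section_measurable: "t \<in> space UI \<Longrightarrow> (\<lambda>x. f x t) \<in> borel_measurable P.Rn"
proof -
  assume t: "t \<in> space UI"
  have "(\<lambda>x. (x, t)) \<in> P.Rn \<rightarrow>\<^sub>M P.Rn \<Otimes>\<^sub>M UI" using t by (intro measurable_Pair2') 
  from measurable_compose[OF this f_pair_measurable] show ?thesis by simp
qed

lemma eps_integral: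
  assumes "t \<in> space UI" shows "(\<integral>\<omega>. eps 0 \<omega> t \<partial>M) = (\<integral>x. f x t \<partial>P.Rn)"
proof -
  have "(\<integral>\<omega>. eps 0 \<omega> t \<partial>M) = (\<integral>\<omega>. f (\<lambda>k. D \<omega> (0 - int k)) t \<partial>M)"
    by (intro Bochner_Integration.integral_cong refl eps_D)
  also have "\<dots> = (\<integral>x. f x t \<partial>distr M P.Rn (\<lambda>\<omega> k. D \<omega> (0 - int k)))"
    by (rule integral_distr[symmetric, OF past_D_measurable f_section_measurable[OF assms]])
  finally show ?thesis unfolding past_D_distr .
qed

lemma AE_mean_zero: "AE t in UI. (\<integral>x. f x t \<partial>P.Rn) = 0"
proof -
  have "AE t in UI. (\<integral>\<omega>. eps 0 \<omega> t \<partial>M) = 0"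
    using error unfolding error_assumptions_def AE_UI by blast
  then show ?thesis using AE_space by eventually_elim (simp add: eps_integral)
qed

definition g where "g h x = (\<integral>t. f x t * h t \<partial>UI)"

lemma sqint_g: "sqint UI h \<Longrightarrow> sqint P.Rn (g h)"
  unfolding g_def[abs_def] by (rule sqint_inner(1)[OF sf_Rn sf_UI sqint_f])

lemma g_mean:
  assumes h: "sqint UI h" shows "(\<integral>x. g h x \<partial>P.Rn) = 0"
proof -
  interpret R: prob_space P.Rn by (rule prob_Rn)
  have "(\<integral>x. 1 * g h x \<partial>P.Rn) = (\<integral>s. h s * (\<integral>x. 1 * f x s \<partial>P.Rn) \<partial>UI)"
    unfolding g_def by (rule integral_inner_swap[OF sf_Rn sf_UI sqint_f R.sqint_const h])
  also have "\<dots> = (\<integral>s. 0 \<partial>UI)"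
  proof (rule integral_cong_AE)
    show "(\<lambda>s. h s * (\<integral>x. 1 * f x s \<partial>P.Rn)) \<in> borel_measurable UI"
    proof (rule borel_measurable_times)
      show "h \<in> borel_measurable UI" using h by auto
      have "(\<lambda>p. f (snd p) (fst p)) \<in> borel_measurable (UI \<Otimes>\<^sub>M P.Rn)"
        using sqint_swap(1)[OF sf_Rn sf_UI sqint_f] by auto
      then show "(\<lambda>s. \<integral>x. 1 * f x s \<partial>P.Rn) \<in> borel_measurable UI"
        by (intro R.borel_measurable_lebesgue_integral) (simp add: split_beta')
    qed
    show "AE s in UI. h s * (\<integral>x. 1 * f x s \<partial>P.Rn) = 0"
      using AE_mean_zero by eventually_elim simp
  qed simp
  finally show ?thesis by simp
qed

lemma g_diff:
  assumes h: "sqint UI h" and p: "p \<in> space (P.Rn \<Otimes>\<^sub>M P.Rn)"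
  shows "g h (fst p) - g h (mrg {..<m} (fst p) (snd p)) = (\<integral>t. \<Phi> m (p, t) * h t \<partial>UI)"
    and "sqint UI (\<lambda>t. \<Phi> m (p, t))"
proof -
  have "fst p \<in> space P.Rn" using measurable_space[OF measurable_fst p] .
  then have s1: "sqint UI (f (fst p))" by (intro L2_sqint f_L2)
  have "mrg {..<m} (fst p) (snd p) \<in> space P.Rn" using measurable_space[OF P.measurable_mrg_Q p] .
  then have s2: "sqint UI (f (mrg {..<m} (fst p) (snd p)))" by (intro L2_sqint f_L2)
  show "sqint UI (\<lambda>t. \<Phi> m (p, t))" unfolding \<Phi>_def using sqint_diff[OF s1 s2] by simp
  show "g h (fst p) - g h (mrg {..<m} (fst p) (snd p)) = (\<integral>t. \<Phi> m (p, t) * h t \<partial>UI)"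
    unfolding g_def \<Phi>_def
    using sqint_integrable_mult[OF s1 h] sqint_integrable_mult[OF s2 h] by (simp add: left_diff_distrib)
qed

text \<open>The coupling difference of the inner product is the inner product of the coupling
  difference, so Cauchy-Schwarz in time applies. Every direction thus inherits the summability of
  \<open>a\<close>.\<close>

lemma err_g:
  assumes h: "sqint UI h" shows "err P (g h) m \<le> l2norm UI h * a m"
proof -
  have "err P (g h) m = l2norm (P.Rn \<Otimes>\<^sub>M P.Rn) (\<lambda>p. \<integral>t. \<Phi> m (p, t) * h t \<partial>UI)"
    unfolding err_def l2norm_def
    by (intro arg_cong[where f=sqrt] Bochner_Integration.integral_cong refl) (simp only: g_diff(1)[OF h])
  also have "\<dots> \<le> l2norm UI h * l2norm ((P.Rn \<Otimes>\<^sub>M P.Rn) \<Otimes>\<^sub>M UI) (\<lambda>q. \<Phi> m (fst q, snd q))"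
    by (rule sqint_inner(2)[OF sf_RR sf_UI _ h]) (use sqint_\<Phi> in simp)
  finally show ?thesis by (simp add: a_def)
qed

lemma summable_err_g: "sqint UI h \<Longrightarrow> summable (err P (g h))"
  by (rule summable_comparison_test'[OF summable_mult[OF summable_a, of "l2norm UI h"]])
     (use err_g in simp)

definition ip where "ip h i \<omega> = (\<integral>t. eps i \<omega> t * h t \<partial>UI)"

lemma ip_eq: "\<omega> \<in> space M \<Longrightarrow> ip h i \<omega> = sh (g h) i (D \<omega>)"
  by (simp add: ip_def sh_def g_def eps_D)

definition Z where "Z h N \<omega> = (\<Sum>i=1..int N. ip h i \<omega>) / sqrt (real N)"

lemma Z_eq: "\<omega> \<in> space M \<Longrightarrow> Z h N \<omega> = (\<lambda>x. (\<Sum>i=1..int N. sh (g h) i x) / sqrt (real N)) (D \<omega>)"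
  by (simp add: Z_def ip_eq)

lemma sqint_ZQ:
  assumes h: "sqint UI h" shows "sqint P.Qz (\<lambda>x. (\<Sum>i=1..int N. sh (g h) i x) / sqrt (real N))"
  using sqint_cmult[OF sqint_sum[of "{1..int N}" P.Qz "sh (g h)", OF P.sqint_sh(1)[OF sqint_g[OF h]]], of "1 / sqrt (real N)"] by simp

lemma sqint_Z:
  assumes h: "sqint UI h"
  shows "sqint M (Z h N)" "l2norm M (Z h N) = l2norm P.Qz (\<lambda>x. (\<Sum>i=1..int N. sh (g h) i x) / sqrt (real N))"
    "distr M borel (Z h N) = distr P.Qz borel (\<lambda>x. (\<Sum>i=1..int N. sh (g h) i x) / sqrt (real N))"
proof -
  let ?F = "\<lambda>x. (\<Sum>i=1..int N. sh (g h) i x) / sqrt (real N)"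
  note s = sqint_D[OF sqint_ZQ[OF h, of N]]
  have c: "Z h N \<omega> = ?F (D \<omega>)" if "\<omega> \<in> space M" for \<omega> using Z_eq[OF that] by simp
  have m: "Z h N \<in> borel_measurable M \<longleftrightarrow> (\<lambda>\<omega>. ?F (D \<omega>)) \<in> borel_measurable M"
    by (rule measurable_cong[OF c])
  have i: "integrable M (\<lambda>\<omega>. (Z h N \<omega>)\<^sup>2) \<longleftrightarrow> integrable M (\<lambda>\<omega>. (?F (D \<omega>))\<^sup>2)"
    by (rule Bochner_Integration.integrable_cong[OF refl]) (simp only: c)
  show "sqint M (Z h N)" using s(1) unfolding sqint_def m i .
  have "l2norm M (Z h N) = l2norm M (\<lambda>\<omega>. ?F (D \<omega>))"
    unfolding l2norm_def by (intro arg_cong[where f=sqrt] Bochner_Integration.integral_cong refl) (simp only: c)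
  then show "l2norm M (Z h N) = l2norm P.Qz ?F" using s(2) by simp
  have "distr M borel (Z h N) = distr M borel (\<lambda>\<omega>. ?F (D \<omega>))"
    by (rule distr_cong[OF refl refl c])
  then show "distr M borel (Z h N) = distr P.Qz borel ?F"
    using distr_D[OF sqint_measurable[OF sqint_ZQ[OF h, of N]]] by simp
qed

text \<open>Besides the limit law this records a bound by \<open>tl_err\<close> valid for all
  \<open>N\<close>, which later makes the tail over the basis uniform in the sample size.\<close>

lemma CLT_inner:
  assumes h: "sqint UI h"
  shows "0 \<le> P.lrv (g h)"
    and "(\<lambda>N. char (distr M borel (Z h N)) u) \<longlonglongrightarrow> complex_of_real (exp (- (u\<^sup>2 * P.lrv (g h)) / 2))"
    and "(\<lambda>N. (l2norm M (Z h N))\<^sup>2) \<longlonglongrightarrow> P.lrv (g h)"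
    and "l2norm M (Z h N) \<le> tl_err P (g h) 0"
proof -
  note A = sqint_g[OF h] summable_err_g[OF h] g_mean[OF h]
  show "0 \<le> P.lrv (g h)" by (rule P.shift_CLT(1)[OF A])
  show "(\<lambda>N. char (distr M borel (Z h N)) u) \<longlonglongrightarrow> complex_of_real (exp (- (u\<^sup>2 * P.lrv (g h)) / 2))"
    unfolding sqint_Z(3)[OF h] by (rule P.shift_CLT(2)[OF A])
  show "(\<lambda>N. (l2norm M (Z h N))\<^sup>2) \<longlonglongrightarrow> P.lrv (g h)"
    unfolding sqint_Z(2)[OF h] by (rule P.variance_limit[OF A])
  show "l2norm M (Z h N) \<le> tl_err P (g h) 0"
  proof (cases "N = 0")
    case True
    have "Z h 0 = (\<lambda>\<omega>. 0)" by (auto simp: Z_def fun_eq_iff)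
    then show ?thesis using True tl_err_nonneg[OF A(2)] by simp
  next
    case False
    have "l2norm P.Qz (\<lambda>x. \<Sum>i=1..int N. sh (g h) i x) \<le> sqrt (card {1..int N}) * tl_err P (g h) 0"
      by (rule P.l2norm_shift_sum(1)[OF A(1,2) _ A(3)]) simp
    then have "(1 / sqrt (real N)) * l2norm P.Qz (\<lambda>x. \<Sum>i=1..int N. sh (g h) i x) \<le> (1 / sqrt (real N)) * (sqrt (real N) * tl_err P (g h) 0)"
      by (intro mult_left_mono) simp_all
    then show ?thesis
      using l2norm_cmult[of P.Qz "1 / sqrt (real N)" "\<lambda>x. \<Sum>i=1..int N. sh (g h) i x"] False
      unfolding sqint_Z(2)[OF h] by simp
  qed
qed

end

section \<open>Bilinear forms of kernels on the unit square\<close>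

lemma l2norm_tensor:
  assumes N: "sigma_finite_measure N" and K: "sigma_finite_measure K" and v: "sqint N v" and h: "sqint K h"
  shows "l2norm (N \<Otimes>\<^sub>M K) (\<lambda>p. v (fst p) * h (snd p)) = l2norm N v * l2norm K h"
proof -
  have "l2norm (N \<Otimes>\<^sub>M K) (\<lambda>p. v (fst p) * h (snd p)) = l2norm N (\<lambda>x. l2norm K (\<lambda>t. v x * h t))"
    using sqint_iterated(3)[OF N K sqint_tensor[OF K v h]] by simp
  also have "\<dots> = l2norm N (\<lambda>x. l2norm K h * \<bar>v x\<bar>)"
    by (rule arg_cong[where f="l2norm N"]) (simp add: fun_eq_iff l2norm_cmult)
  also have "\<dots> = l2norm N v * l2norm K h" using l2norm_cmult[of N "l2norm K h" "\<lambda>x. \<bar>v x\<bar>"] by simp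
  finally show ?thesis .
qed

lemma sigma_finite_UI: "sigma_finite_measure UI"
  by (rule UI.sigma_finite_measure_axioms)

interpretation UU: pair_prob_space UI UI ..

lemma AE_UI_fst: "(AE t in UI. Q t) \<Longrightarrow> AE p in UI \<Otimes>\<^sub>M UI. Q (fst p)"
  by (rule AE_distrD[OF measurable_fst[of UI UI]]) (subst UI.distr_pair_fst)

lemma AE_UI_snd: "(AE t in UI. Q t) \<Longrightarrow> AE p in UI \<Otimes>\<^sub>M UI. Q (snd p)"
proof -
  assume "AE t in UI. Q t"
  then have "AE p in UI \<Otimes>\<^sub>M UI. Q (fst p)" by (rule AE_UI_fst)
  then have "AE p in distr (UI \<Otimes>\<^sub>M UI) (UI \<Otimes>\<^sub>M UI) (\<lambda>(x, y). (y, x)). Q (fst p)"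
    by (subst UU.distr_pair_swap[symmetric])
  from AE_distrD[OF measurable_pair_swap' this] show ?thesis by (simp add: split_beta')
qed

text \<open>The kernel is integrated over the square, so only its almost-everywhere class
  matters.\<close>

definition kform :: "(real \<Rightarrow> real \<Rightarrow> real) \<Rightarrow> (real \<Rightarrow> real) \<Rightarrow> (real \<Rightarrow> real) \<Rightarrow> real" where
  "kform K h h' = (\<integral>p. K (fst p) (snd p) * (h (fst p) * h' (snd p)) \<partial>(UI \<Otimes>\<^sub>M UI))"

abbreviation sqk :: "(real \<Rightarrow> real \<Rightarrow> real) \<Rightarrow> bool" where
  "sqk K \<equiv> sqint (UI \<Otimes>\<^sub>M UI) (\<lambda>p. K (fst p) (snd p))"

lemma kform_integrable:
  assumes "sqk K" "sqint UI h" "sqint UI h'"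
  shows "integrable (UI \<Otimes>\<^sub>M UI) (\<lambda>p. K (fst p) (snd p) * (h (fst p) * h' (snd p)))"
  by (rule sqint_integrable_mult[OF assms(1) sqint_tensor[OF sigma_finite_UI assms(2,3)]])

lemma kform_iterated:
  assumes "sqk K" "sqint UI h" "sqint UI h'"
  shows "kform K h h' = (\<integral>t. (\<integral>s. K t s * h' s \<partial>UI) * h t \<partial>UI)"
proof -
  have "kform K h h' = (\<integral>t. (\<integral>s. K t s * (h t * h' s) \<partial>UI) \<partial>UI)"
    unfolding kform_def using UU.integral_fst'[OF kform_integrable[OF assms]] by simp
  also have "\<dots> = (\<integral>t. (\<integral>s. K t s * h' s \<partial>UI) * h t \<partial>UI)"
    by (intro Bochner_Integration.integral_cong refl)
       (subst integral_mult_left_zero[symmetric], simp add: mult_ac)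
  finally show ?thesis .
qed

lemma sqk_swap: "sqk K \<Longrightarrow> sqk (\<lambda>t s. K s t)"
  using sqint_swap(1)[OF sigma_finite_UI sigma_finite_UI, of "\<lambda>p. K (fst p) (snd p)"] by simp

lemma kform_swap:
  assumes "sqk K" "sqint UI h" "sqint UI h'" shows "kform (\<lambda>t s. K s t) h h' = kform K h' h"
proof -
  have m: "(\<lambda>p. K (fst p) (snd p) * (h' (fst p) * h (snd p))) \<in> borel_measurable (UI \<Otimes>\<^sub>M UI)"
    using kform_integrable[OF assms(1,3,2)] by (rule borel_measurable_integrable)
  have "kform K h' h = (\<integral>p. K (fst p) (snd p) * (h' (fst p) * h (snd p)) \<partial>distr (UI \<Otimes>\<^sub>M UI) (UI \<Otimes>\<^sub>M UI) (\<lambda>(x, y). (y, x)))"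
    unfolding kform_def UU.distr_pair_swap[symmetric] ..
  also have "\<dots> = kform (\<lambda>t s. K s t) h h'"
    unfolding kform_def by (subst integral_distr[OF measurable_pair_swap' m]) (simp add: split_beta' mult_ac)
  finally show ?thesis ..
qed

lemma kform_add:
  assumes "sqk K" "sqk L" "sqint UI h" "sqint UI h'"
  shows "kform (\<lambda>t s. K t s + L t s) h h' = kform K h h' + kform L h h'"
  unfolding kform_def using kform_integrable[OF assms(1,3,4)] kform_integrable[OF assms(2,3,4)]
  by (simp add: distrib_right)

lemma kform_cmult: "kform (\<lambda>t s. c * K t s) h h' = c * kform K h h'"
  unfolding kform_def by (simp add: mult.assoc)

lemma kform_bound:
  assumes K: "(\<lambda>p. K (fst p) (snd p)) \<in> borel_measurable (UI \<Otimes>\<^sub>M UI)" and u: "sqint UI u" and v: "sqint UI v"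
    and b: "AE p in UI \<Otimes>\<^sub>M UI. \<bar>K (fst p) (snd p)\<bar> \<le> u (fst p) * v (snd p)"
  shows "sqk K" "l2norm (UI \<Otimes>\<^sub>M UI) (\<lambda>p. K (fst p) (snd p)) \<le> l2norm UI u * l2norm UI v"
proof -
  have b': "AE p in UI \<Otimes>\<^sub>M UI. \<bar>K (fst p) (snd p)\<bar> \<le> \<bar>u (fst p) * v (snd p)\<bar>"
    using b by eventually_elim linarith
  show "sqk K" by (rule sqint_bound(1)[OF sqint_tensor[OF sigma_finite_UI u v] K b'])
  show "l2norm (UI \<Otimes>\<^sub>M UI) (\<lambda>p. K (fst p) (snd p)) \<le> l2norm UI u * l2norm UI v"
    using sqint_bound(2)[OF sqint_tensor[OF sigma_finite_UI u v] K b'] l2norm_tensor[OF sigma_finite_UI sigma_finite_UI u v] by simp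
qed

text \<open>Summable norms make the kernel series converge absolutely almost everywhere, and
  Cauchy-Schwarz bounds the integrals of the absolute values, so sum and integral can be
  exchanged.\<close>

lemma kform_suminf:
  assumes K: "\<And>k. sqk (K k)" and s: "summable (\<lambda>k. l2norm (UI \<Otimes>\<^sub>M UI) (\<lambda>p. K k (fst p) (snd p)))"
    and h: "sqint UI h" and h': "sqint UI h'"
  shows "sqk (\<lambda>t s. \<Sum>k. K k t s)" "kform (\<lambda>t s. \<Sum>k. K k t s) h h' = (\<Sum>k. kform (K k) h h')"
proof -
  show "sqk (\<lambda>t s. \<Sum>k. K k t s)" using infinite_Minkowski(2)[OF K s] .
  note T = sqint_tensor[OF sigma_finite_UI h h']
  have ae: "AE p in UI \<Otimes>\<^sub>M UI. summable (\<lambda>k. \<bar>K k (fst p) (snd p)\<bar>)"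
    by (rule infinite_Minkowski(1)[OF K s])
  have "(\<Sum>k. kform (K k) h h') = (\<integral>p. (\<Sum>k. K k (fst p) (snd p) * (h (fst p) * h' (snd p))) \<partial>(UI \<Otimes>\<^sub>M UI))"
    unfolding kform_def
  proof (rule integral_suminf[symmetric])
    show "integrable (UI \<Otimes>\<^sub>M UI) (\<lambda>p. K k (fst p) (snd p) * (h (fst p) * h' (snd p)))" for k
      by (rule kform_integrable[OF K h h'])
    show "AE p in UI \<Otimes>\<^sub>M UI. summable (\<lambda>k. norm (K k (fst p) (snd p) * (h (fst p) * h' (snd p))))"
      using ae by eventually_elim (simp add: abs_mult summable_mult2)
    show "summable (\<lambda>k. \<integral>p. norm (K k (fst p) (snd p) * (h (fst p) * h' (snd p))) \<partial>(UI \<Otimes>\<^sub>M UI))"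
    proof (rule summable_comparison_test'[OF summable_mult2[OF s, of "l2norm UI h * l2norm UI h'"]])
      fix k
      have "\<bar>\<integral>p. \<bar>K k (fst p) (snd p)\<bar> * \<bar>h (fst p) * h' (snd p)\<bar> \<partial>(UI \<Otimes>\<^sub>M UI)\<bar>
        \<le> l2norm (UI \<Otimes>\<^sub>M UI) (\<lambda>p. \<bar>K k (fst p) (snd p)\<bar>) * l2norm (UI \<Otimes>\<^sub>M UI) (\<lambda>p. \<bar>h (fst p) * h' (snd p)\<bar>)"
        by (intro Cauchy_Schwarz_l2norm sqint_abs K T)
      then show "norm (\<integral>p. norm (K k (fst p) (snd p) * (h (fst p) * h' (snd p))) \<partial>(UI \<Otimes>\<^sub>M UI)) \<le> l2norm (UI \<Otimes>\<^sub>M UI) (\<lambda>p. K k (fst p) (snd p)) * (l2norm UI h * l2norm UI h')"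
        unfolding l2norm_abs l2norm_tensor[OF sigma_finite_UI sigma_finite_UI h h'] real_norm_def abs_mult[of "K k _ _"] .
    qed
  qed
  also have "\<dots> = kform (\<lambda>t s. \<Sum>k. K k t s) h h'"
    unfolding kform_def
  proof (rule integral_cong_AE)
    note km = sqint_measurable[OF K] and tm = sqint_measurable[OF T]
    show "(\<lambda>p. \<Sum>k. K k (fst p) (snd p) * (h (fst p) * h' (snd p))) \<in> borel_measurable (UI \<Otimes>\<^sub>M UI)"
      by (intro borel_measurable_suminf borel_measurable_times[OF km tm])
    show "(\<lambda>p. (\<Sum>k. K k (fst p) (snd p)) * (h (fst p) * h' (snd p))) \<in> borel_measurable (UI \<Otimes>\<^sub>M UI)"
      by (intro borel_measurable_times[OF _ tm] borel_measurable_suminf km)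
    show "AE p in UI \<Otimes>\<^sub>M UI. (\<Sum>k. K k (fst p) (snd p) * (h (fst p) * h' (snd p))) = (\<Sum>k. K k (fst p) (snd p)) * (h (fst p) * h' (snd p))"
      using ae
    proof eventually_elim
      case (elim p)
      show ?case by (rule suminf_mult2[symmetric, OF summable_rabs_cancel[OF elim]])
    qed
  qed
  finally show "kform (\<lambda>t s. \<Sum>k. K k t s) h h' = (\<Sum>k. kform (K k) h h')" ..
qed

lemma kernel_measurable:
  assumes N: "sigma_finite_measure N"
    and A: "(\<lambda>p. A (fst p) (snd p)) \<in> borel_measurable (N \<Otimes>\<^sub>M UI)"
    and B: "(\<lambda>p. B (fst p) (snd p)) \<in> borel_measurable (N \<Otimes>\<^sub>M UI)"
  shows "(\<lambda>p. \<integral>\<omega>. A \<omega> (fst p) * B \<omega> (snd p) \<partial>N :: real) \<in> borel_measurable (UI \<Otimes>\<^sub>M UI)"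
proof -
  interpret N: sigma_finite_measure N by fact
  have 1: "(\<lambda>q. (snd q, fst (fst q))) \<in> (UI \<Otimes>\<^sub>M UI) \<Otimes>\<^sub>M N \<rightarrow>\<^sub>M N \<Otimes>\<^sub>M UI"
    by (intro measurable_Pair measurable_snd measurable_compose[OF measurable_fst measurable_fst])
  have 2: "(\<lambda>q. (snd q, snd (fst q))) \<in> (UI \<Otimes>\<^sub>M UI) \<Otimes>\<^sub>M N \<rightarrow>\<^sub>M N \<Otimes>\<^sub>M UI"
    by (intro measurable_Pair measurable_snd measurable_compose[OF measurable_fst measurable_snd])
  have "(\<lambda>q. A (snd q) (fst (fst q)) * B (snd q) (snd (fst q))) \<in> borel_measurable ((UI \<Otimes>\<^sub>M UI) \<Otimes>\<^sub>M N)"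
    using borel_measurable_times[OF measurable_compose[OF 1 A] measurable_compose[OF 2 B]] by simp
  then show ?thesis
    by (intro N.borel_measurable_lebesgue_integral) (simp only: split_beta')
qed

text \<open>Cauchy-Schwarz in the variable of \<open>N\<close> bounds the kernel by a function of
  \<open>t\<close> times a function of \<open>s\<close>, both square integrable.\<close>

lemma kernel_sqk:
  assumes N: "sigma_finite_measure N"
    and A: "sqint (N \<Otimes>\<^sub>M UI) (\<lambda>p. A (fst p) (snd p))" and B: "sqint (N \<Otimes>\<^sub>M UI) (\<lambda>p. B (fst p) (snd p))"
  shows "sqk (\<lambda>t s. \<integral>\<omega>. A \<omega> t * B \<omega> s \<partial>N)"
proof -
  note it = sqint_iterated[OF sigma_finite_UI N sqint_swap(1)[OF N sigma_finite_UI A]]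
    sqint_iterated[OF sigma_finite_UI N sqint_swap(1)[OF N sigma_finite_UI B]]
  have "AE p in UI \<Otimes>\<^sub>M UI. \<bar>\<integral>\<omega>. A \<omega> (fst p) * B \<omega> (snd p) \<partial>N\<bar> \<le> l2norm N (\<lambda>\<omega>. A \<omega> (fst p)) * l2norm N (\<lambda>\<omega>. B \<omega> (snd p))"
    using AE_UI_fst[OF it(1)] AE_UI_snd[OF it(4)]
  proof eventually_elim
    case (elim p)
    then show ?case by (intro Cauchy_Schwarz_l2norm) simp_all
  qed
  then show ?thesis
    using it(2,5) by (intro kform_bound(1)[OF kernel_measurable[OF N]]) (use A B in auto)
qed

text \<open>Fubini twice: once for the inner product with \<open>h\<close> and then, for almost
  every \<open>t\<close>, for the one with \<open>h'\<close>. This expresses covariances of inner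
  products by the covariance kernel.\<close>

lemma integral_inner_inner:
  assumes N: "sigma_finite_measure N"
    and A: "sqint (N \<Otimes>\<^sub>M UI) (\<lambda>p. A (fst p) (snd p))" and B: "sqint (N \<Otimes>\<^sub>M UI) (\<lambda>p. B (fst p) (snd p))"
    and h: "sqint UI h" and h': "sqint UI h'"
  shows "(\<integral>\<omega>. (\<integral>t. A \<omega> t * h t \<partial>UI) * (\<integral>s. B \<omega> s * h' s \<partial>UI) \<partial>N) = kform (\<lambda>t s. \<integral>\<omega>. A \<omega> t * B \<omega> s \<partial>N) h h'"
proof -
  interpret N: sigma_finite_measure N by fact
  define v where "v \<omega> = (\<integral>s. B \<omega> s * h' s \<partial>UI)" for \<omega>
  have sv: "sqint N v" unfolding v_def[abs_def] by (rule sqint_inner(1)[OF N sigma_finite_UI B h'])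
  have Am: "(\<lambda>p. A (fst p) (snd p)) \<in> borel_measurable (N \<Otimes>\<^sub>M UI)"
    and Bm: "(\<lambda>p. B (fst p) (snd p)) \<in> borel_measurable (N \<Otimes>\<^sub>M UI)"
    and hm: "h \<in> borel_measurable UI" and hm': "h' \<in> borel_measurable UI" and vm: "v \<in> borel_measurable N"
    using A B h h' sv by auto
  have "(\<integral>\<omega>. (\<integral>t. A \<omega> t * h t \<partial>UI) * (\<integral>s. B \<omega> s * h' s \<partial>UI) \<partial>N) = (\<integral>\<omega>. v \<omega> * (\<integral>t. A \<omega> t * h t \<partial>UI) \<partial>N)"
    by (simp add: v_def mult.commute)
  also have "\<dots> = (\<integral>t. h t * (\<integral>\<omega>. v \<omega> * A \<omega> t \<partial>N) \<partial>UI)"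
    by (rule integral_inner_swap[OF N sigma_finite_UI A sv h])
  also have "\<dots> = (\<integral>t. (\<integral>s. (\<integral>\<omega>. A \<omega> t * B \<omega> s \<partial>N) * h' s \<partial>UI) * h t \<partial>UI)"
  proof (rule integral_cong_AE)
    have 1: "(\<lambda>q. (snd q, fst q)) \<in> UI \<Otimes>\<^sub>M N \<rightarrow>\<^sub>M N \<Otimes>\<^sub>M UI"
      by (intro measurable_Pair measurable_snd measurable_fst)
    have "(\<lambda>q. v (snd q) * A (snd q) (fst q)) \<in> borel_measurable (UI \<Otimes>\<^sub>M N)"
      using borel_measurable_times[OF measurable_compose[OF measurable_snd vm] measurable_compose[OF 1 Am]] by simp
    then have "(\<lambda>t. \<integral>\<omega>. v \<omega> * A \<omega> t \<partial>N) \<in> borel_measurable UI"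
      by (intro N.borel_measurable_lebesgue_integral) (simp only: split_beta')
    then show "(\<lambda>t. h t * (\<integral>\<omega>. v \<omega> * A \<omega> t \<partial>N)) \<in> borel_measurable UI"
      by (rule borel_measurable_times[OF hm])
    have "(\<lambda>q. (\<integral>\<omega>. A \<omega> (fst q) * B \<omega> (snd q) \<partial>N) * h' (snd q)) \<in> borel_measurable (UI \<Otimes>\<^sub>M UI)"
      by (rule borel_measurable_times[OF kernel_measurable[OF N Am Bm] measurable_compose[OF measurable_snd hm']])
    then have "(\<lambda>t. \<integral>s. (\<integral>\<omega>. A \<omega> t * B \<omega> s \<partial>N) * h' s \<partial>UI) \<in> borel_measurable UI"
      by (intro UI.borel_measurable_lebesgue_integral) (simp only: split_beta')
    then show "(\<lambda>t. (\<integral>s. (\<integral>\<omega>. A \<omega> t * B \<omega> s \<partial>N) * h' s \<partial>UI) * h t) \<in> borel_measurable UI"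
      by (rule borel_measurable_times[OF _ hm])
    have "AE t in UI. sqint N (\<lambda>\<omega>. A \<omega> t)"
      using sqint_iterated(1)[OF sigma_finite_UI N sqint_swap(1)[OF N sigma_finite_UI A]] by simp
    then show "AE t in UI. h t * (\<integral>\<omega>. v \<omega> * A \<omega> t \<partial>N) = (\<integral>s. (\<integral>\<omega>. A \<omega> t * B \<omega> s \<partial>N) * h' s \<partial>UI) * h t"
    proof eventually_elim
      case (elim t)
      have "(\<integral>\<omega>. v \<omega> * A \<omega> t \<partial>N) = (\<integral>\<omega>. A \<omega> t * (\<integral>s. B \<omega> s * h' s \<partial>UI) \<partial>N)"
        by (simp add: v_def mult.commute)
      also have "\<dots> = (\<integral>s. h' s * (\<integral>\<omega>. A \<omega> t * B \<omega> s \<partial>N) \<partial>UI)"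
        by (rule integral_inner_swap[OF N sigma_finite_UI B elim h'])
      finally show ?case by (simp add: mult.commute)
    qed
  qed
  also have "\<dots> = kform (\<lambda>t s. \<integral>\<omega>. A \<omega> t * B \<omega> s \<partial>N) h h'"
    by (rule kform_iterated[OF kernel_sqk[OF N A B] h h', symmetric])
  finally show ?thesis .
qed

section \<open>Haar coordinates and covariance kernel of the errors\<close>

context bernoulli_errors
begin

text \<open>For a fixed pair of sequences, the coupling differences in the directions
  \<open>haar j\<close> are the Haar coefficients of the functional coupling difference. Bessel's
  inequality and integration bound all directions together by the error of the function.\<close>

lemma sum_err_haar:
  "summable (\<lambda>j. (err P (g (haar j)) m)\<^sup>2)" "(\<Sum>j. (err P (g (haar j)) m)\<^sup>2) \<le> (a m)\<^sup>2"
proof -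
  define c where "c j p = (\<integral>t. \<Phi> m (p, t) * haar j t \<partial>UI)" for j p
  have sc: "sqint (P.Rn \<Otimes>\<^sub>M P.Rn) (c j)" for j
    unfolding c_def[abs_def]
    using sqint_inner(1)[OF sf_RR sf_UI _ sqint_haar[of j], of "\<lambda>p t. \<Phi> m (p, t)"] sqint_\<Phi>[of m] by simp
  have e: "(err P (g (haar j)) m)\<^sup>2 = (\<integral>p. (c j p)\<^sup>2 \<partial>(P.Rn \<Otimes>\<^sub>M P.Rn))" for j
    unfolding err_def l2norm_square c_def
    by (intro Bochner_Integration.integral_cong refl) (simp only: g_diff(1)[OF sqint_haar])
  note s\<Phi> = sqint_iterated(2,3)[OF sf_RR sf_UI sqint_\<Phi>[of m]]
  have le: "(\<Sum>j<J. (err P (g (haar j)) m)\<^sup>2) \<le> (a m)\<^sup>2" for J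
  proof -
    have "(\<Sum>j<J. (err P (g (haar j)) m)\<^sup>2) = (\<integral>p. (\<Sum>j<J. (c j p)\<^sup>2) \<partial>(P.Rn \<Otimes>\<^sub>M P.Rn))"
      unfolding e by (rule Bochner_Integration.integral_sum[symmetric]) (rule sqint_integrable_square[OF sc])
    also have "\<dots> \<le> (\<integral>p. (l2norm UI (\<lambda>t. \<Phi> m (p, t)))\<^sup>2 \<partial>(P.Rn \<Otimes>\<^sub>M P.Rn))"
    proof (rule integral_mono)
      show "integrable (P.Rn \<Otimes>\<^sub>M P.Rn) (\<lambda>p. \<Sum>j<J. (c j p)\<^sup>2)"
        by (intro Bochner_Integration.integrable_sum sqint_integrable_square[OF sc])
      show "integrable (P.Rn \<Otimes>\<^sub>M P.Rn) (\<lambda>p. (l2norm UI (\<lambda>t. \<Phi> m (p, t)))\<^sup>2)"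
        by (rule sqint_integrable_square[OF s\<Phi>(1)])
      fix p assume p: "p \<in> space (P.Rn \<Otimes>\<^sub>M P.Rn)"
      note s = haar_Parseval[OF g_diff(2)[OF sqint_haar[of 0] p, of m]]
      have "(\<Sum>j<J. (c j p)\<^sup>2) \<le> (\<Sum>j. (c j p)\<^sup>2)"
        using sums_summable[OF s] unfolding c_def by (intro sum_le_suminf) auto
      then show "(\<Sum>j<J. (c j p)\<^sup>2) \<le> (l2norm UI (\<lambda>t. \<Phi> m (p, t)))\<^sup>2"
        using sums_unique[OF s] unfolding c_def by simp
    qed
    also have "\<dots> = (a m)\<^sup>2"
      unfolding a_def s\<Phi>(2)[symmetric] l2norm_square[of "P.Rn \<Otimes>\<^sub>M P.Rn"] ..
    finally show ?thesis .
  qed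
  show s: "summable (\<lambda>j. (err P (g (haar j)) m)\<^sup>2)"
    by (rule summableI_nonneg_bounded[OF _ le]) simp
  show "(\<Sum>j. (err P (g (haar j)) m)\<^sup>2) \<le> (a m)\<^sup>2"
    by (rule suminf_le_const[OF s le])
qed

text \<open>For each level \<open>l\<close> the errors form a square-summable sequence in
  \<open>j\<close> of norm at most \<open>a l\<close>. Minkowski's inequality puts the sum over
  \<open>l\<close> inside the square, so summability of the \<open>a l\<close> suffices.\<close>

lemma summable_tau: "summable (\<lambda>j. (tl_err P (g (haar j)) 0)\<^sup>2)"
proof -
  let ?C = "count_space (UNIV::nat set)"
  have s: "sqint ?C (\<lambda>j. err P (g (haar j)) l)" for l
    unfolding sqint_count_space by (rule sum_err_haar)
  have n: "l2norm ?C (\<lambda>j. err P (g (haar j)) l) \<le> a l" for l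
    unfolding l2norm_count_space[OF sum_err_haar(1)] using sum_err_haar(2)[of l] a_nonneg[of l]
    by (intro real_le_lsqrt) (auto intro: suminf_nonneg sum_err_haar)
  have "sqint ?C (\<lambda>j. \<Sum>l. err P (g (haar j)) l + err P (g (haar j)) (Suc l))"
  proof (rule infinite_Minkowski(2))
    show "sqint ?C (\<lambda>j. err P (g (haar j)) l + err P (g (haar j)) (Suc l))" for l
      by (intro sqint_add s)
    show "summable (\<lambda>l. l2norm ?C (\<lambda>j. err P (g (haar j)) l + err P (g (haar j)) (Suc l)))"
    proof (rule summable_comparison_test')
      show "summable (\<lambda>l. a l + a (Suc l))"
        using summable_a by (intro summable_add) (auto simp: summable_Suc_iff)
      show "norm (l2norm ?C (\<lambda>j. err P (g (haar j)) l + err P (g (haar j)) (Suc l))) \<le> a l + a (Suc l)" for l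
        using l2norm_add_le[OF s[of l] s[of "Suc l"]] n[of l] n[of "Suc l"] by simp
    qed
  qed
  then show ?thesis unfolding sqint_count_space tl_err_def by simp
qed

definition r where "r k t s = (\<integral>\<omega>. eps 0 \<omega> t * eps (int k) \<omega> s \<partial>M)"
lemma AE_centred: "AE t in UI. sqint P.Rn (\<lambda>x. f x t) \<and> (\<integral>x. f x t \<partial>P.Rn) = 0"
  using AE_f_sqint AE_mean_zero by eventually_elim simp

lemma r_bound:
  assumes t: "sqint P.Rn (\<lambda>x. f x t)" and s: "sqint P.Rn (\<lambda>x. f x s)" "(\<integral>x. f x s \<partial>P.Rn) = 0"
  shows "\<bar>r k t s\<bar> \<le> e t * \<beta> k s"
proof -
  have m: "(\<lambda>x. sh (\<lambda>x. f x t) 0 x * sh (\<lambda>x. f x s) (int k) x) \<in> borel_measurable P.Qz"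
    by (rule borel_measurable_integrable[OF sqint_integrable_mult[OF P.sqint_sh(1)[OF t] P.sqint_sh(1)[OF s(1)]]])
  have "r k t s = (\<integral>\<omega>. sh (\<lambda>x. f x t) 0 (D \<omega>) * sh (\<lambda>x. f x s) (int k) (D \<omega>) \<partial>M)"
    unfolding r_def by (intro Bochner_Integration.integral_cong refl) (simp add: eps_D sh_def)
  also have "\<dots> = (\<integral>x. sh (\<lambda>x. f x t) 0 x * sh (\<lambda>x. f x s) (int k) x \<partial>P.Qz)"
    by (rule integral_D[OF m])
  finally show ?thesis using P.covariance_bound[OF t s, of k] by (simp add: e_def \<beta>_def)
qed

lemma r_measurable: "(\<lambda>p. r k (fst p) (snd p)) \<in> borel_measurable (UI \<Otimes>\<^sub>M UI)"
  unfolding r_def by (rule kernel_measurable[OF sf_M eps_pair_measurable eps_pair_measurable])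

text \<open>The pointwise bound is a product, so the norm is at most the product of the norms, and
  the lag enters through the summable \<open>a k\<close>; hence the kernel series converges in mean
  square.\<close>

lemma r_sqk: "sqk (r k)" "l2norm (UI \<Otimes>\<^sub>M UI) (\<lambda>p. r k (fst p) (snd p)) \<le> l2norm UI e * a k"
proof -
  have b: "AE p in UI \<Otimes>\<^sub>M UI. \<bar>r k (fst p) (snd p)\<bar> \<le> e (fst p) * \<beta> k (snd p)"
    using AE_UI_fst[OF AE_centred] AE_UI_snd[OF AE_centred] by eventually_elim (intro r_bound, simp_all)
  show "sqk (r k)" "l2norm (UI \<Otimes>\<^sub>M UI) (\<lambda>p. r k (fst p) (snd p)) \<le> l2norm UI e * a k"
    using kform_bound[OF r_measurable sqint_e sqint_\<beta> b] by (simp_all add: l2norm_\<beta>)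
qed

lemma sqint_eps: "sqint (M \<Otimes>\<^sub>M UI) (\<lambda>p. eps i (fst p) (snd p))"
proof -
  have s: "sqint (M \<Otimes>\<^sub>M UI) (\<lambda>p. f (\<lambda>k. D (fst p) (i - int k)) (snd p))"
    by (rule sqint_compose_fst[OF sf_Rn sf_UI past_D_measurable past_D_distr sf_M sqint_f])
  show ?thesis
  proof (rule sqint_bound(1)[OF s eps_pair_measurable])
    show "AE p in M \<Otimes>\<^sub>M UI. \<bar>eps i (fst p) (snd p)\<bar> \<le> \<bar>f (\<lambda>k. D (fst p) (i - int k)) (snd p)\<bar>"
    proof (rule AE_I2)
      fix p assume "p \<in> space (M \<Otimes>\<^sub>M UI)"
      then have "fst p \<in> space M" by (auto simp: space_pair_measure)
      then show "\<bar>eps i (fst p) (snd p)\<bar> \<le> \<bar>f (\<lambda>k. D (fst p) (i - int k)) (snd p)\<bar>" by (simp add: eps_D)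
    qed
  qed
qed

lemma covariance_kform:
  assumes h: "sqint UI h"
  shows "(\<integral>\<omega>. ip h 0 \<omega> * ip h (int k) \<omega> \<partial>M) = kform (r k) h h"
  unfolding ip_def r_def[abs_def] by (rule integral_inner_inner[OF sf_M sqint_eps sqint_eps h h])

lemma covariance_sh:
  assumes h: "sqint UI h"
  shows "(\<integral>x. sh (g h) 0 x * sh (g h) (int k) x \<partial>P.Qz) = kform (r k) h h"
proof -
  have m: "(\<lambda>x. sh (g h) 0 x * sh (g h) (int k) x) \<in> borel_measurable P.Qz"
    by (rule borel_measurable_integrable[OF sqint_integrable_mult[OF P.sqint_sh(1) P.sqint_sh(1)]]; rule sqint_g[OF h])
  have "(\<integral>\<omega>. ip h 0 \<omega> * ip h (int k) \<omega> \<partial>M) = (\<integral>\<omega>. sh (g h) 0 (D \<omega>) * sh (g h) (int k) (D \<omega>) \<partial>M)"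
    by (intro Bochner_Integration.integral_cong refl) (simp add: ip_eq)
  also have "\<dots> = (\<integral>x. sh (g h) 0 x * sh (g h) (int k) x \<partial>P.Qz)" by (rule integral_D[OF m])
  finally show ?thesis using covariance_kform[OF h, of k] by simp
qed

lemma lrcov_eq: "lrcov M eps t s = r 0 t s + (\<Sum>k. r (Suc k) t s) + (\<Sum>k. r (Suc k) s t)"
  unfolding lrcov_def r_def by (simp add: add.commute)

lemma lrcov_sym: "lrcov M eps t s = lrcov M eps s t"
  unfolding lrcov_def by (simp add: mult.commute)

lemma tail_kernel:
  shows "sqk (\<lambda>t s. \<Sum>k. r (Suc k) t s)"
    and "sqint UI h \<Longrightarrow> kform (\<lambda>t s. \<Sum>k. r (Suc k) t s) h h = (\<Sum>k. kform (r (Suc k)) h h)"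
proof -
  have s: "summable (\<lambda>k. l2norm (UI \<Otimes>\<^sub>M UI) (\<lambda>p. r (Suc k) (fst p) (snd p)))"
  proof (rule summable_comparison_test')
    show "summable (\<lambda>k. l2norm UI e * a (Suc k))"
      using summable_a by (intro summable_mult) (simp add: summable_Suc_iff)
  qed (use r_sqk(2) in simp)
  show "sqk (\<lambda>t s. \<Sum>k. r (Suc k) t s)"
    by (rule kform_suminf(1)[OF r_sqk(1) s sqint_zero sqint_zero])
  show "sqint UI h \<Longrightarrow> kform (\<lambda>t s. \<Sum>k. r (Suc k) t s) h h = (\<Sum>k. kform (r (Suc k)) h h)"
    by (rule kform_suminf(2)[OF r_sqk(1) s])
qed

lemma lrcov_sqk: "sqk (lrcov M eps)"
  unfolding lrcov_eq by (intro sqint_add r_sqk(1) tail_kernel(1) sqk_swap[OF tail_kernel(1)])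

text \<open>A kernel and its transpose have the same value at \<open>h, h\<close>, so the two
  one-sided sums of the covariance kernel merge into the factor 2 of the scalar long-run
  variance.\<close>

theorem lrv_kform:
  assumes h: "sqint UI h" shows "P.lrv (g h) = kform (lrcov M eps) h h"
proof -
  have "kform (lrcov M eps) h h = kform (r 0) h h + kform (\<lambda>t s. \<Sum>k. r (Suc k) t s) h h + kform (\<lambda>t s. \<Sum>k. r (Suc k) s t) h h"
    unfolding lrcov_eq[abs_def]
    by (simp only: kform_add[OF sqint_add[OF r_sqk(1) tail_kernel(1)] sqk_swap[OF tail_kernel(1)] h h] kform_add[OF r_sqk(1) tail_kernel(1) h h])
  also have "kform (\<lambda>t s. \<Sum>k. r (Suc k) s t) h h = kform (\<lambda>t s. \<Sum>k. r (Suc k) t s) h h"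
    by (rule kform_swap[OF tail_kernel(1) h h])
  finally show ?thesis
    unfolding P.lrv_def tail_kernel(2)[OF h] using covariance_sh[OF h, of 0] covariance_sh[OF h, of "Suc _"] by simp
qed

end

section \<open>Gaussian processes with an integral kernel\<close>

lemma suminf_ennreal_imp_sums:
  assumes "\<And>j. 0 \<le> y j" "0 \<le> x" "(\<Sum>j. ennreal (y j)) = ennreal x"
  shows "y sums x"
proof -
  have s: "summable y" by (rule summable_suminf_not_top) (use assms in auto)
  have "ennreal (suminf y) = ennreal x"
    using suminf_ennreal_eq[OF assms(1) summable_sums[OF s]] assms(3) by simp
  then have "suminf y = x" using assms(1,2) suminf_nonneg[OF s] by simp
  then show ?thesis using summable_sums[OF s] by simp
qed

text \<open>Parseval's identity along almost every path; Tonelli's theorem moves the sum over the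
  basis out of the integral.\<close>

lemma integrated_Parseval:
  assumes N: "sigma_finite_measure N" and X: "sqint (N \<Otimes>\<^sub>M UI) (\<lambda>p. X (fst p) (snd p))"
  shows "(\<lambda>j. (l2norm N (\<lambda>\<omega>. \<integral>t. X \<omega> t * haar j t \<partial>UI))\<^sup>2) sums (l2norm (N \<Otimes>\<^sub>M UI) (\<lambda>p. X (fst p) (snd p)))\<^sup>2"
proof (rule suminf_ennreal_imp_sums)
  define c where "c j \<omega> = (\<integral>t. X \<omega> t * haar j t \<partial>UI)" for j \<omega>
  have sc: "sqint N (c j)" for j unfolding c_def[abs_def] by (rule sqint_inner(1)[OF N sigma_finite_UI X sqint_haar])
  note it = sqint_iterated[OF N sigma_finite_UI X]
  have "(\<Sum>j. ennreal ((l2norm N (c j))\<^sup>2)) = (\<Sum>j. \<integral>\<^sup>+\<omega>. ennreal ((c j \<omega>)\<^sup>2) \<partial>N)"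
    by (simp add: nn_integral_square_eq_l2norm[OF sc])
  also have "\<dots> = (\<integral>\<^sup>+\<omega>. (\<Sum>j. ennreal ((c j \<omega>)\<^sup>2)) \<partial>N)"
    by (rule nn_integral_suminf[symmetric])
       (intro measurable_compose[OF _ measurable_ennreal] borel_measurable_power sqint_measurable[OF sc])
  also have "\<dots> = (\<integral>\<^sup>+\<omega>. ennreal ((l2norm UI (X \<omega>))\<^sup>2) \<partial>N)"
  proof (rule nn_integral_cong_AE)
    show "AE \<omega> in N. (\<Sum>j. ennreal ((c j \<omega>)\<^sup>2)) = ennreal ((l2norm UI (X \<omega>))\<^sup>2)"
      using it(1)
    proof eventually_elim
      case (elim \<omega>)
      have "sqint UI (X \<omega>)" using elim by (simp only: fst_conv snd_conv)
      from suminf_ennreal_eq[OF zero_le_power2 haar_Parseval[OF this]] show ?case unfolding c_def .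
    qed
  qed
  also have "\<dots> = ennreal ((l2norm N (\<lambda>\<omega>. l2norm UI (X \<omega>)))\<^sup>2)"
    using nn_integral_square_eq_l2norm[OF it(2)] by (simp only: fst_conv snd_conv)
  also have "\<dots> = ennreal ((l2norm (N \<Otimes>\<^sub>M UI) (\<lambda>p. X (fst p) (snd p)))\<^sup>2)"
    using it(3) by (simp only: fst_conv snd_conv)
  finally show "(\<Sum>j. ennreal ((l2norm N (\<lambda>\<omega>. \<integral>t. X \<omega> t * haar j t \<partial>UI))\<^sup>2)) = ennreal ((l2norm (N \<Otimes>\<^sub>M UI) (\<lambda>p. X (fst p) (snd p)))\<^sup>2)"
    by (simp add: c_def[abs_def])
qed simp_all

lemma kform_cong_AE:
  assumes "sqk K" "sqk L" "sqint UI h" "sqint UI h'" "AE p in UI \<Otimes>\<^sub>M UI. K (fst p) (snd p) = L (fst p) (snd p)"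
  shows "kform K h h' = kform L h h'"
  unfolding kform_def
proof (rule integral_cong_AE)
  show "AE p in UI \<Otimes>\<^sub>M UI. K (fst p) (snd p) * (h (fst p) * h' (snd p)) = L (fst p) (snd p) * (h (fst p) * h' (snd p))"
    using assms(5) by eventually_elim (simp only:)
qed (rule borel_measurable_integrable[OF kform_integrable[OF assms(1,3,4)]] borel_measurable_integrable[OF kform_integrable[OF assms(2,3,4)]])+

lemma sqint_times_bounded:
  assumes "sqint N X" "h \<in> borel_measurable N" "\<And>t. \<bar>h t\<bar> \<le> c"
  shows "sqint N (\<lambda>t. X t * h t)" "l2norm N (\<lambda>t. X t * h t) \<le> c * l2norm N X"
proof -
  have c: "0 \<le> c" using assms(3)[of undefined] by linarith
  have b: "AE x in N. \<bar>X x * h x\<bar> \<le> \<bar>c * X x\<bar>"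
  proof (rule AE_I2)
    fix x
    show "\<bar>X x * h x\<bar> \<le> \<bar>c * X x\<bar>"
      using mult_right_mono[OF assms(3)[of x], of "\<bar>X x\<bar>"] c by (simp add: abs_mult mult.commute)
  qed
  have m: "(\<lambda>t. X t * h t) \<in> borel_measurable N"
    by (intro borel_measurable_times sqint_measurable[OF assms(1)] assms(2))
  show "sqint N (\<lambda>t. X t * h t)" by (rule sqint_bound(1)[OF sqint_cmult[OF assms(1)] m b])
  show "l2norm N (\<lambda>t. X t * h t) \<le> c * l2norm N X"
    using sqint_bound(2)[OF sqint_cmult[OF assms(1)] m b] c by (simp add: l2norm_cmult)
qed

text \<open>The trace bound is required with one constant for all sets \<open>A\<close>, because the
  process has to be cut off in time by sets that depend on its own variance.\<close>

locale gauss_proc =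
  fixes \<Omega> :: "'b measure" and G :: "'b \<Rightarrow> real \<Rightarrow> real" and d :: "real \<Rightarrow> real \<Rightarrow> real" and C :: real
  assumes gp: "gaussian_process \<Omega> G d" and d: "sqk d"
    and trace: "\<And>A J. A \<in> sets borel \<Longrightarrow>
      (\<Sum>j<J. kform d (\<lambda>t. haar j t * indicator A t) (\<lambda>t. haar j t * indicator A t)) \<le> C"
begin

lemma prob_\<Omega>: "prob_space \<Omega>"
  using gp by (simp add: gaussian_process_def)

end

sublocale gauss_proc \<subseteq> prob_space \<Omega> by (rule prob_\<Omega>)

context gauss_proc
begin

lemma G_measurable: "(\<lambda>p. G (fst p) (snd p)) \<in> borel_measurable (\<Omega> \<Otimes>\<^sub>M UI)"
proof -
  have G: "(\<lambda>(\<omega>, t). G \<omega> t) \<in> borel_measurable (\<Omega> \<Otimes>\<^sub>M lborel)"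
    using gp by (simp add: gaussian_process_def)
  have "(\<lambda>p. (fst p, snd p)) \<in> \<Omega> \<Otimes>\<^sub>M UI \<rightarrow>\<^sub>M \<Omega> \<Otimes>\<^sub>M lborel"
    by (intro measurable_Pair measurable_fst measurable_compose[OF measurable_snd measurable_ident_UI(2)])
  from measurable_compose[OF this G] show ?thesis by simp
qed

lemma G_section_measurable: "t \<in> space UI \<Longrightarrow> (\<lambda>\<omega>. G \<omega> t) \<in> borel_measurable \<Omega>"
proof -
  assume "t \<in> space UI"
  then have "(\<lambda>\<omega>. (\<omega>, t)) \<in> \<Omega> \<rightarrow>\<^sub>M \<Omega> \<Otimes>\<^sub>M UI" by (intro measurable_Pair2')
  from measurable_compose[OF this G_measurable] show ?thesis by simp
qed

lemma gp_comb:
  fixes T w :: "nat \<Rightarrow> real"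
  assumes "\<And>k. k < n \<Longrightarrow> T k \<in> space UI"
  shows "sqint \<Omega> (\<lambda>\<omega>. \<Sum>k<n. w k * G \<omega> (T k))"
    "char (distr \<Omega> borel (\<lambda>\<omega>. \<Sum>k<n. w k * G \<omega> (T k))) u =
      complex_of_real (exp (- (u\<^sup>2 * (l2norm \<Omega> (\<lambda>\<omega>. \<Sum>k<n. w k * G \<omega> (T k)))\<^sup>2) / 2))"
proof -
  have T: "\<forall>k<n. T k \<in> {0..1}" using assms by simp
  have "integrable \<Omega> (\<lambda>\<omega>. (\<Sum>k<n. w k * G \<omega> (T k))\<^sup>2) \<and>
      (\<forall>u. char (distr \<Omega> borel (\<lambda>\<omega>. \<Sum>k<n. w k * G \<omega> (T k))) u =
              complex_of_real (exp (- (u\<^sup>2 * (\<integral>\<omega>. (\<Sum>k<n. w k * G \<omega> (T k))\<^sup>2 \<partial>\<Omega>)) / 2)))"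
    using gp T unfolding gaussian_process_def by blast
  then show "sqint \<Omega> (\<lambda>\<omega>. \<Sum>k<n. w k * G \<omega> (T k))"
    "char (distr \<Omega> borel (\<lambda>\<omega>. \<Sum>k<n. w k * G \<omega> (T k))) u =
      complex_of_real (exp (- (u\<^sup>2 * (l2norm \<Omega> (\<lambda>\<omega>. \<Sum>k<n. w k * G \<omega> (T k)))\<^sup>2) / 2))"
    unfolding sqint_def l2norm_square using G_section_measurable[OF assms]
    by (auto intro!: borel_measurable_sum borel_measurable_times borel_measurable_const)
qed

lemma G_sqint: "t \<in> space UI \<Longrightarrow> sqint \<Omega> (\<lambda>\<omega>. G \<omega> t)"
  using gp_comb(1)[of 1 "\<lambda>_. t" "\<lambda>_. 1"] by simp

text \<open>The actual covariance, meaningful at every pair of times in the interval; agreement with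
  \<open>d\<close> is known only almost everywhere, so its diagonal is treated separately as
  \<open>v\<close>.\<close>

definition K where "K t s = (\<integral>\<omega>. G \<omega> t * G \<omega> s \<partial>\<Omega>)"

lemma K_measurable: "(\<lambda>p. K (fst p) (snd p)) \<in> borel_measurable (UI \<Otimes>\<^sub>M UI)"
  unfolding K_def by (rule kernel_measurable[OF sigma_finite_measure_axioms G_measurable G_measurable])

lemma K_eq_d: "AE p in UI \<Otimes>\<^sub>M UI. K (fst p) (snd p) = d (fst p) (snd p)"
proof (rule UU.AE_pair_measure)
  show "{p \<in> space (UI \<Otimes>\<^sub>M UI). K (fst p) (snd p) = d (fst p) (snd p)} \<in> sets (UI \<Otimes>\<^sub>M UI)"
    by (rule borel_measurable_eq[OF K_measurable sqint_measurable[OF d]])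
  have "AE t in lborel. AE s in lborel. t \<in> {0..1} \<longrightarrow> s \<in> {0..1} \<longrightarrow> (\<integral>\<omega>. G \<omega> t * G \<omega> s \<partial>\<Omega>) = d t s"
    using gp unfolding gaussian_process_def by blast
  then have "AE t in UI. AE s in UI. K t s = d t s"
    unfolding AE_UI K_def by eventually_elim auto
  then show "AE t in UI. AE s in UI. K (fst (t, s)) (snd (t, s)) = d (fst (t, s)) (snd (t, s))" by simp
qed

definition v where "v t = K t t"

lemma v_measurable: "v \<in> borel_measurable UI"
proof -
  have "(\<lambda>t. (t, t)) \<in> UI \<rightarrow>\<^sub>M UI \<Otimes>\<^sub>M UI" by (intro measurable_Pair measurable_ident_sets refl)
  from measurable_compose[OF this K_measurable] show ?thesis unfolding v_def[abs_def] by simp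
qed

definition Ar where "Ar (n::nat) = {t \<in> space UI. v t \<le> real n}"

lemma Ar_borel: "Ar n \<in> sets borel"
proof -
  have "Ar n \<in> sets UI" unfolding Ar_def by (rule borel_measurable_le[OF v_measurable borel_measurable_const])
  then have "Ar n \<in> (\<inter>) {0..1} ` sets borel" unfolding sets_UI sets_restrict_space .
  then obtain B where B: "B \<in> sets borel" "Ar n = {0..1} \<inter> B" by (rule imageE)
  show ?thesis unfolding B(2) by (rule sets.Int[OF _ B(1)]) simp
qed

lemma ind_Ar_pair: "(\<lambda>p. indicator (Ar n) (snd p) :: real) \<in> borel_measurable (\<Omega> \<Otimes>\<^sub>M UI)"
  by (rule measurable_compose[OF measurable_snd indicator_borel_UI[OF Ar_borel]])

lemma nn_square_G: "t \<in> space UI \<Longrightarrow> (\<integral>\<^sup>+\<omega>. ennreal ((G \<omega> t)\<^sup>2) \<partial>\<Omega>) = ennreal (v t)"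
  using nn_integral_square_eq_l2norm[OF G_sqint, of t] unfolding l2norm_square by (simp add: v_def K_def power2_eq_square)

lemma trunc_sqint: "sqint (\<Omega> \<Otimes>\<^sub>M UI) (\<lambda>p. G (fst p) (snd p) * indicator (Ar n) (snd p))"
proof -
  interpret OU: pair_sigma_finite \<Omega> UI ..
  have m: "(\<lambda>p. G (fst p) (snd p) * indicator (Ar n) (snd p)) \<in> borel_measurable (\<Omega> \<Otimes>\<^sub>M UI)"
    by (rule borel_measurable_times[OF G_measurable ind_Ar_pair])
  have "(\<integral>\<^sup>+p. ennreal ((G (fst p) (snd p) * indicator (Ar n) (snd p))\<^sup>2) \<partial>(\<Omega> \<Otimes>\<^sub>M UI)) =
    (\<integral>\<^sup>+t. \<integral>\<^sup>+\<omega>. ennreal ((G \<omega> t * indicator (Ar n) t)\<^sup>2) \<partial>\<Omega> \<partial>UI)"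
    using m by (subst OU.nn_integral_snd[symmetric]) (auto simp: split_beta')
  also have "\<dots> \<le> (\<integral>\<^sup>+t. ennreal ((sqrt (real n))\<^sup>2) \<partial>UI)"
  proof (rule nn_integral_mono)
    fix t assume t: "t \<in> space UI"
    show "(\<integral>\<^sup>+\<omega>. ennreal ((G \<omega> t * indicator (Ar n) t)\<^sup>2) \<partial>\<Omega>) \<le> ennreal ((sqrt (real n))\<^sup>2)"
    proof (cases "t \<in> Ar n")
      case True
      then show ?thesis using nn_square_G[OF t] by (simp add: Ar_def ennreal_leI)
    qed simp
  qed
  also have "\<dots> = ennreal ((sqrt (real n))\<^sup>2)" using UI.emeasure_space_1 by simp
  finally show ?thesis by (rule sqint_I_nn(1)[OF m]) simp
qed

lemma sqint_haar_Ar: "sqint UI (\<lambda>t. haar j t * indicator (Ar n) t)"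
  by (rule sqint_times_indicator[OF sqint_haar Ar_borel])

text \<open>The cut-off passes from the process to the test function. The form ignores null sets of
  the square, so \<open>K\<close> may be replaced by \<open>d\<close> and the trace bound becomes
  available.\<close>

lemma trunc_inner:
  "(l2norm \<Omega> (\<lambda>\<omega>. \<integral>t. G \<omega> t * indicator (Ar n) t * haar j t \<partial>UI))\<^sup>2
    = kform d (\<lambda>t. haar j t * indicator (Ar n) t) (\<lambda>t. haar j t * indicator (Ar n) t)"
proof -
  let ?X = "\<lambda>\<omega> t. G \<omega> t * indicator (Ar n) t"
  let ?i = "\<lambda>t. indicator (Ar n) t :: real"
  have "(l2norm \<Omega> (\<lambda>\<omega>. \<integral>t. ?X \<omega> t * haar j t \<partial>UI))\<^sup>2 = kform (\<lambda>t s. \<integral>\<omega>. ?X \<omega> t * ?X \<omega> s \<partial>\<Omega>) (haar j) (haar j)"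
    unfolding l2norm_square
    by (simp only: power2_eq_square)
       (rule integral_inner_inner[OF sigma_finite_measure_axioms trunc_sqint trunc_sqint sqint_haar sqint_haar])
  also have "\<dots> = (\<integral>p. K (fst p) (snd p) * (haar j (fst p) * ?i (fst p) * (haar j (snd p) * ?i (snd p))) \<partial>(UI \<Otimes>\<^sub>M UI))"
    unfolding kform_def K_def
  proof (rule Bochner_Integration.integral_cong[OF refl])
    fix p
    have "(\<integral>\<omega>. ?X \<omega> (fst p) * ?X \<omega> (snd p) \<partial>\<Omega>) = (\<integral>\<omega>. (?i (fst p) * ?i (snd p)) * (G \<omega> (fst p) * G \<omega> (snd p)) \<partial>\<Omega>)"
      by (simp add: mult_ac)
    also have "\<dots> = (?i (fst p) * ?i (snd p)) * (\<integral>\<omega>. G \<omega> (fst p) * G \<omega> (snd p) \<partial>\<Omega>)"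
      by (rule integral_mult_right_zero)
    finally show "(\<integral>\<omega>. ?X \<omega> (fst p) * ?X \<omega> (snd p) \<partial>\<Omega>) * (haar j (fst p) * haar j (snd p)) =
         (\<integral>\<omega>. G \<omega> (fst p) * G \<omega> (snd p) \<partial>\<Omega>) * (haar j (fst p) * ?i (fst p) * (haar j (snd p) * ?i (snd p)))"
      by (simp add: mult_ac)
  qed
  also have "\<dots> = kform d (\<lambda>t. haar j t * ?i t) (\<lambda>t. haar j t * ?i t)"
    unfolding kform_def
  proof (rule integral_cong_AE)
    note tm = sqint_measurable[OF sqint_tensor[OF sigma_finite_UI sqint_haar_Ar[of j n] sqint_haar_Ar[of j n]]]
    show "(\<lambda>p. K (fst p) (snd p) * (haar j (fst p) * ?i (fst p) * (haar j (snd p) * ?i (snd p)))) \<in> borel_measurable (UI \<Otimes>\<^sub>M UI)"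
      by (rule borel_measurable_times[OF K_measurable tm])
    show "(\<lambda>p. d (fst p) (snd p) * (haar j (fst p) * ?i (fst p) * (haar j (snd p) * ?i (snd p)))) \<in> borel_measurable (UI \<Otimes>\<^sub>M UI)"
      by (rule borel_measurable_times[OF sqint_measurable[OF d] tm])
    show "AE p in UI \<Otimes>\<^sub>M UI. K (fst p) (snd p) * (haar j (fst p) * ?i (fst p) * (haar j (snd p) * ?i (snd p)))
        = d (fst p) (snd p) * (haar j (fst p) * ?i (fst p) * (haar j (snd p) * ?i (snd p)))"
      using K_eq_d by eventually_elim (simp only:)
  qed
  finally show ?thesis .
qed

text \<open>By Parseval the squared norm is the sum of the second moments of the Haar coefficients,
  and every partial sum is a truncated trace.\<close>

lemma trunc_norm: "(l2norm (\<Omega> \<Otimes>\<^sub>M UI) (\<lambda>p. G (fst p) (snd p) * indicator (Ar n) (snd p)))\<^sup>2 \<le> C"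
proof -
  have s: "(\<lambda>j. (l2norm \<Omega> (\<lambda>\<omega>. \<integral>t. G \<omega> t * indicator (Ar n) t * haar j t \<partial>UI))\<^sup>2) sums
     (l2norm (\<Omega> \<Otimes>\<^sub>M UI) (\<lambda>p. G (fst p) (snd p) * indicator (Ar n) (snd p)))\<^sup>2"
    by (rule integrated_Parseval[OF sigma_finite_measure_axioms trunc_sqint])
  show ?thesis
    unfolding sums_unique[OF s]
    by (rule suminf_le_const[OF sums_summable[OF s]]) (unfold trunc_inner, rule trace[OF Ar_borel])
qed

lemma C_nonneg: "0 \<le> C"
  using order_trans[OF zero_le_power2 trunc_norm] .

text \<open>The covariance is prescribed only almost everywhere on the square, which says nothing about the
  variance on the diagonal; it is controlled by the trace, after truncation to \<open>Ar n\<close>.\<close>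
theorem G_sqint_pair: "sqint (\<Omega> \<Otimes>\<^sub>M UI) (\<lambda>p. G (fst p) (snd p))"
proof -
  let ?g = "\<lambda>(n::nat) p. ennreal ((G (fst p) (snd p) * indicator (Ar n) (snd p))\<^sup>2)"
  have gm: "?g n \<in> borel_measurable (\<Omega> \<Otimes>\<^sub>M UI)" for n
    by (intro measurable_compose[OF _ measurable_ennreal] borel_measurable_power sqint_measurable[OF trunc_sqint])
  have mono: "incseq ?g"
    by (auto simp: incseq_def le_fun_def Ar_def power_mult_distrib split: split_indicator intro: order_trans)
  have sup: "(SUP n. ?g n p) = ennreal ((G (fst p) (snd p))\<^sup>2)" if p: "p \<in> space (\<Omega> \<Otimes>\<^sub>M UI)" for p
  proof (rule antisym)
    show "(SUP n. ?g n p) \<le> ennreal ((G (fst p) (snd p))\<^sup>2)"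
      by (rule SUP_least) (auto split: split_indicator)
    have sp: "snd p \<in> space UI" using p by (auto simp: space_pair_measure)
    \<comment> \<open>Every time has a real variance, so the cut-off sets \<open>Ar n\<close>
      exhaust the interval.\<close>
    obtain n :: nat where "v (snd p) \<le> real n" using real_arch_simple by blast
    then have "snd p \<in> Ar n" using sp by (simp add: Ar_def)
    then have "ennreal ((G (fst p) (snd p))\<^sup>2) = ?g n p" by simp
    also have "\<dots> \<le> (SUP n. ?g n p)" by (rule SUP_upper) simp
    finally show "ennreal ((G (fst p) (snd p))\<^sup>2) \<le> (SUP n. ?g n p)" .
  qed
  have "(\<integral>\<^sup>+p. ennreal ((G (fst p) (snd p))\<^sup>2) \<partial>(\<Omega> \<Otimes>\<^sub>M UI)) = (\<integral>\<^sup>+p. (SUP n. ?g n p) \<partial>(\<Omega> \<Otimes>\<^sub>M UI))"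
    by (rule nn_integral_cong) (simp only: sup)
  also have "\<dots> = (SUP n. \<integral>\<^sup>+p. ?g n p \<partial>(\<Omega> \<Otimes>\<^sub>M UI))"
    by (rule nn_integral_monotone_convergence_SUP[OF mono gm])
  also have "\<dots> \<le> ennreal ((sqrt C)\<^sup>2)"
    by (rule SUP_least) (simp only: nn_integral_square_eq_l2norm[OF trunc_sqint], use trunc_norm C_nonneg in \<open>simp add: ennreal_leI\<close>)
  finally show ?thesis by (rule sqint_I_nn(1)[OF G_measurable]) (simp add: C_nonneg)
qed

end

section \<open>Random quadrature and the Gaussian law of inner products\<close>

text \<open>The centred terms at different points are orthogonal, so the variance of the mean is
  that of one term divided by \<open>n\<close>; centring does not increase the norm.\<close>

lemma (in prob_space) sample_mean:
  fixes \<psi> :: "'a \<Rightarrow> real" and n :: nat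
  assumes \<psi>: "sqint M \<psi>" and n: "0 < n"
  shows "sqint (PiM UNIV (\<lambda>_. M)) (\<lambda>T. (\<Sum>k<n. \<psi> (T k)) / n - expectation \<psi>)"
    and "l2norm (PiM (UNIV :: nat set) (\<lambda>_. M)) (\<lambda>T. (\<Sum>k<n. \<psi> (T k)) / n - expectation \<psi>) \<le> l2norm M \<psi> / sqrt n"
proof -
  let ?Q = "PiM (UNIV :: nat set) (\<lambda>_. M)"
  interpret Q: prob_space ?Q by (rule prob_space_PiM_UNIV)
  define \<phi> where "\<phi> x = \<psi> x - expectation \<psi>" for x
  have \<phi>: "sqint M \<phi>" unfolding \<phi>_def[abs_def] by (intro sqint_diff \<psi> sqint_const)
  have \<phi>0: "expectation \<phi> = 0" unfolding \<phi>_def using sqint_integrable[OF \<psi>] by (simp add: prob_space)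
  have cm: "(\<lambda>T. T k) \<in> ?Q \<rightarrow>\<^sub>M M" for k by (rule measurable_component_singleton) simp
  have cd: "distr ?Q M (\<lambda>T. T k) = M" for k
    using distr_PiM_component[of UNIV "\<lambda>_. M" k] prob_space_axioms by simp
  have s: "sqint ?Q (\<lambda>T. \<phi> (T k))" "l2norm ?Q (\<lambda>T. \<phi> (T k)) = l2norm M \<phi>" for k
    using sqint_distr[OF cm[of k], of \<phi>] \<phi> unfolding cd by auto
  have z: "(\<integral>T. \<phi> (T k) \<partial>?Q) = 0" for k
    using integral_distr[OF cm[of k], of \<phi>] \<phi>0 sqint_measurable[OF \<phi>] unfolding cd by simp
  have "(l2norm ?Q (\<lambda>T. \<Sum>k<n. \<phi> (T k)))\<^sup>2 = (\<Sum>k<n. (l2norm ?Q (\<lambda>T. \<phi> (T k)))\<^sup>2)"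
  proof (rule l2norm_sum_orthogonal)
    show "(\<integral>T. \<phi> (T i) * \<phi> (T j) \<partial>?Q) = 0" if "i \<noteq> j" for i j
      using integral_mult_disjoint[OF s(1) s(1), of "{j}" j "{i}" i] that z
      by (auto simp: depends_on_def)
  qed (auto intro: s)
  also have "\<dots> = n * (l2norm M \<phi>)\<^sup>2" unfolding s(2) by simp
  finally have "sqrt ((l2norm ?Q (\<lambda>T. \<Sum>k<n. \<phi> (T k)))\<^sup>2) = sqrt (n * (l2norm M \<phi>)\<^sup>2)" by simp
  then have nS: "l2norm ?Q (\<lambda>T. \<Sum>k<n. \<phi> (T k)) = sqrt n * l2norm M \<phi>" by (simp add: real_sqrt_mult)
  have le: "l2norm M \<phi> \<le> l2norm M \<psi>"
  proof -
    have "(l2norm M \<phi>)\<^sup>2 = (\<integral>x. (\<psi> x)\<^sup>2 - 2 * expectation \<psi> * \<psi> x + (expectation \<psi>)\<^sup>2 \<partial>M)"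
      unfolding l2norm_square \<phi>_def by (intro Bochner_Integration.integral_cong refl) (simp add: power2_diff mult_ac)
    also have "\<dots> = (l2norm M \<psi>)\<^sup>2 - (expectation \<psi>)\<^sup>2"
      using sqint_integrable[OF \<psi>] sqint_integrable_square[OF \<psi>] unfolding l2norm_square
      by (simp add: prob_space power2_eq_square)
    finally have "(l2norm M \<phi>)\<^sup>2 \<le> (l2norm M \<psi>)\<^sup>2" by simp
    then show ?thesis by (rule power2_le_imp_le) simp
  qed
  have eq: "(\<Sum>k<n. \<psi> (T k)) / n - expectation \<psi> = (1 / n) * (\<Sum>k<n. \<phi> (T k))" for T
    using n by (simp add: \<phi>_def sum_subtractf field_simps)
  show "sqint ?Q (\<lambda>T. (\<Sum>k<n. \<psi> (T k)) / n - expectation \<psi>)"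
    unfolding eq by (intro sqint_cmult sqint_sum s)
  have "l2norm ?Q (\<lambda>T. (1 / n) * (\<Sum>k<n. \<phi> (T k))) = (1 / n) * (sqrt n * l2norm M \<phi>)"
    unfolding l2norm_cmult nS by simp
  also have "\<dots> = l2norm M \<phi> / sqrt n"
    using n by (simp add: field_simps)
  also have "\<dots> \<le> l2norm M \<psi> / sqrt n" using le by (simp add: divide_right_mono)
  finally show "l2norm ?Q (\<lambda>T. (\<Sum>k<n. \<psi> (T k)) / n - expectation \<psi>) \<le> l2norm M \<psi> / sqrt n"
    unfolding eq .
qed

context gauss_proc
begin

text \<open>Averaged over independent uniform points, the quadrature error is of order \<open>1 / sqrt n\<close>, so some
  deterministic choice of points is at least as good.\<close>
lemma quadrature_points:
  fixes h :: "real \<Rightarrow> real" and n :: nat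
  assumes hm: "h \<in> borel_measurable UI" and hb: "\<And>t. \<bar>h t\<bar> \<le> c" and n: "0 < n"
  defines "W \<equiv> l2norm (\<Omega> \<Otimes>\<^sub>M UI) (\<lambda>p. G (fst p) (snd p))"
  shows "\<exists>T. (\<forall>k. T k \<in> space UI) \<and>
    l2norm \<Omega> (\<lambda>\<omega>. (\<Sum>k<n. h (T k) / n * G \<omega> (T k)) - (\<integral>t. G \<omega> t * h t \<partial>UI)) \<le> (c * W + 1) / sqrt n"
proof -
  define X where "X \<omega> = (\<integral>t. G \<omega> t * h t \<partial>UI)" for \<omega>
  have c: "0 \<le> c" using hb[of 0] by linarith
  have W: "0 \<le> W" by (simp add: W_def)
  have h: "sqint UI h"
    by (rule sqint_bound(1)[OF UI.sqint_const[of c] hm]) (use hb in \<open>intro AE_I2, simp add: order_trans[OF hb abs_ge_self]\<close>)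
  have sX: "sqint \<Omega> X" unfolding X_def[abs_def]
    by (rule sqint_inner(1)[OF sigma_finite_measure_axioms sigma_finite_UI G_sqint_pair h])
  let ?TT = "PiM (UNIV :: nat set) (\<lambda>_. UI)"
  interpret TT: prob_space ?TT by (rule UI.prob_space_PiM_UNIV)
  interpret OT: pair_prob_space \<Omega> ?TT ..
  define E where "E \<omega> T = (\<Sum>k<n. G \<omega> (T k) * h (T k)) / n - X \<omega>" for \<omega> T
  have cm: "(\<lambda>T. T k) \<in> ?TT \<rightarrow>\<^sub>M UI" for k by (rule measurable_component_singleton) simp
  have Em: "(\<lambda>q. E (fst q) (snd q)) \<in> borel_measurable (\<Omega> \<Otimes>\<^sub>M ?TT)"
  proof -
    have p: "(\<lambda>q. (fst q, snd q k)) \<in> \<Omega> \<Otimes>\<^sub>M ?TT \<rightarrow>\<^sub>M \<Omega> \<Otimes>\<^sub>M UI" for k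
      by (intro measurable_Pair measurable_fst measurable_compose[OF measurable_snd cm])
    have g: "(\<lambda>q. G (fst q) (snd q k)) \<in> borel_measurable (\<Omega> \<Otimes>\<^sub>M ?TT)" for k
      using measurable_compose[OF p G_measurable] by simp
    have hk: "(\<lambda>q. h (snd q k)) \<in> borel_measurable (\<Omega> \<Otimes>\<^sub>M ?TT)" for k
      using measurable_compose[OF measurable_compose[OF measurable_snd cm] hm] .
    show ?thesis unfolding E_def
      by (intro borel_measurable_diff borel_measurable_divide borel_measurable_const borel_measurable_sum
          borel_measurable_times g hk measurable_compose[OF measurable_fst sqint_measurable[OF sX]])
  qed
  have Em2: "(\<lambda>q. ennreal ((E (fst q) (snd q))\<^sup>2)) \<in> borel_measurable (\<Omega> \<Otimes>\<^sub>M ?TT)"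
    by (intro measurable_compose[OF _ measurable_ennreal] borel_measurable_power Em)
  note it = sqint_iterated[OF sigma_finite_measure_axioms sigma_finite_UI G_sqint_pair]
  have "(\<integral>\<^sup>+T. \<integral>\<^sup>+\<omega>. ennreal ((E \<omega> T)\<^sup>2) \<partial>\<Omega> \<partial>?TT) = (\<integral>\<^sup>+\<omega>. \<integral>\<^sup>+T. ennreal ((E \<omega> T)\<^sup>2) \<partial>?TT \<partial>\<Omega>)"
    using OT.Fubini[OF Em2] by (simp only: fst_conv snd_conv)
  also have "\<dots> \<le> (\<integral>\<^sup>+\<omega>. ennreal ((c / sqrt n)\<^sup>2) * ennreal ((l2norm UI (G \<omega>))\<^sup>2) \<partial>\<Omega>)"
  proof (rule nn_integral_mono_AE)
    show "AE \<omega> in \<Omega>. (\<integral>\<^sup>+T. ennreal ((E \<omega> T)\<^sup>2) \<partial>?TT) \<le> ennreal ((c / sqrt n)\<^sup>2) * ennreal ((l2norm UI (G \<omega>))\<^sup>2)"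
      using it(1)
    proof eventually_elim
      case (elim \<omega>)
      have s: "sqint UI (G \<omega>)" using elim by (simp only: fst_conv snd_conv)
      note b = sqint_times_bounded[OF s hm hb]
      note m = UI.sample_mean[OF b(1) n]
      have "l2norm ?TT (\<lambda>T. E \<omega> T) \<le> (c * l2norm UI (G \<omega>)) / sqrt n"
        unfolding E_def X_def using m(2) b(2) by (meson divide_right_mono order_trans real_sqrt_ge_zero of_nat_0_le_iff)
      then have "(l2norm ?TT (\<lambda>T. E \<omega> T))\<^sup>2 \<le> ((c * l2norm UI (G \<omega>)) / sqrt n)\<^sup>2" by (intro power_mono) auto
      also have "\<dots> = (c / sqrt n)\<^sup>2 * (l2norm UI (G \<omega>))\<^sup>2" by (simp add: power_mult_distrib power_divide)
      finally have "ennreal ((l2norm ?TT (\<lambda>T. E \<omega> T))\<^sup>2) \<le> ennreal ((c / sqrt n)\<^sup>2) * ennreal ((l2norm UI (G \<omega>))\<^sup>2)"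
        by (simp add: ennreal_mult[symmetric] ennreal_leI)
      moreover have "sqint ?TT (\<lambda>T. E \<omega> T)" unfolding E_def X_def by (rule m(1))
      ultimately show ?case by (simp add: nn_integral_square_eq_l2norm)
    qed
  qed
  also have "\<dots> = ennreal ((c / sqrt n)\<^sup>2) * (\<integral>\<^sup>+\<omega>. ennreal ((l2norm UI (G \<omega>))\<^sup>2) \<partial>\<Omega>)"
  proof (rule nn_integral_cmult)
    have "(\<lambda>\<omega>. l2norm UI (G \<omega>)) \<in> borel_measurable \<Omega>"
      using sqint_measurable[OF it(2)] by (simp only: fst_conv snd_conv)
    then show "(\<lambda>\<omega>. ennreal ((l2norm UI (G \<omega>))\<^sup>2)) \<in> borel_measurable \<Omega>"
      by (intro measurable_compose[OF _ measurable_ennreal] borel_measurable_power)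
  qed
  also have "(\<integral>\<^sup>+\<omega>. ennreal ((l2norm UI (G \<omega>))\<^sup>2) \<partial>\<Omega>) = ennreal (W\<^sup>2)"
    using nn_integral_square_eq_l2norm[OF it(2)] unfolding it(3) W_def by (simp only: fst_conv snd_conv)
  also have "ennreal ((c / sqrt n)\<^sup>2) * ennreal (W\<^sup>2) = ennreal ((c * W / sqrt n)\<^sup>2)"
    by (simp add: ennreal_mult[symmetric] power_mult_distrib power_divide)
  finally have le: "(\<integral>\<^sup>+T. \<integral>\<^sup>+\<omega>. ennreal ((E \<omega> T)\<^sup>2) \<partial>\<Omega> \<partial>?TT) \<le> ennreal ((c * W / sqrt n)\<^sup>2)" .
  \<comment> \<open>The summand 1 makes the bound strictly larger than the average over
    \<open>T\<close>; if every choice of points exceeded it, so would the average.\<close>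
  have "\<exists>T\<in>space ?TT. (\<integral>\<^sup>+\<omega>. ennreal ((E \<omega> T)\<^sup>2) \<partial>\<Omega>) \<le> ennreal (((c * W + 1) / sqrt n)\<^sup>2)"
  proof (rule ccontr)
    assume "\<not> ?thesis"
    then have "(\<integral>\<^sup>+T. ennreal (((c * W + 1) / sqrt n)\<^sup>2) \<partial>?TT) \<le> (\<integral>\<^sup>+T. \<integral>\<^sup>+\<omega>. ennreal ((E \<omega> T)\<^sup>2) \<partial>\<Omega> \<partial>?TT)"
      by (intro nn_integral_mono) (meson linear)
    then have "ennreal (((c * W + 1) / sqrt n)\<^sup>2) \<le> (\<integral>\<^sup>+T. \<integral>\<^sup>+\<omega>. ennreal ((E \<omega> T)\<^sup>2) \<partial>\<Omega> \<partial>?TT)"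
      using TT.emeasure_space_1 by simp
    from order_trans[OF this le] have "ennreal (((c * W + 1) / sqrt n)\<^sup>2) \<le> ennreal ((c * W / sqrt n)\<^sup>2)" .
    then have "((c * W + 1) / sqrt n)\<^sup>2 \<le> (c * W / sqrt n)\<^sup>2" by simp
    then have "(c * W + 1) / sqrt n \<le> c * W / sqrt n"
      by (rule power2_le_imp_le) (use c W in simp)
    then show False using n by (simp add: field_simps)
  qed
  then obtain T where T: "T \<in> space ?TT" "(\<integral>\<^sup>+\<omega>. ennreal ((E \<omega> T)\<^sup>2) \<partial>\<Omega>) \<le> ennreal (((c * W + 1) / sqrt n)\<^sup>2)" by blast
  have TU: "T k \<in> space UI" for k using T(1) by (auto simp: space_PiM PiE_iff simp del: space_UI)
  have "(\<lambda>\<omega>. (\<omega>, T)) \<in> \<Omega> \<rightarrow>\<^sub>M \<Omega> \<Otimes>\<^sub>M ?TT" using T(1) by (rule measurable_Pair2')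
  from measurable_compose[OF this Em] have "(\<lambda>\<omega>. E \<omega> T) \<in> borel_measurable \<Omega>" by (simp only: fst_conv snd_conv)
  from sqint_I_nn(2)[OF this T(2)] have "l2norm \<Omega> (\<lambda>\<omega>. E \<omega> T) \<le> (c * W + 1) / sqrt n" using c W by simp
  moreover have "E \<omega> T = (\<Sum>k<n. h (T k) / n * G \<omega> (T k)) - X \<omega>" for \<omega>
    unfolding E_def by (simp add: sum_divide_distrib mult.commute)
  ultimately show ?thesis using TU unfolding X_def by auto
qed

text \<open>Quadrature sums are finite linear combinations of process values, hence Gaussian, and
  converge to the inner product in mean square. The variance is identified separately, through the
  covariance kernel.\<close>

theorem gauss_inner:
  fixes h :: "real \<Rightarrow> real"
  assumes hm: "h \<in> borel_measurable UI" and hb: "\<And>t. \<bar>h t\<bar> \<le> c"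
  shows "sqint \<Omega> (\<lambda>\<omega>. \<integral>t. G \<omega> t * h t \<partial>UI)"
    and "char (distr \<Omega> borel (\<lambda>\<omega>. \<integral>t. G \<omega> t * h t \<partial>UI)) u = complex_of_real (exp (- (u\<^sup>2 * kform d h h) / 2))"
proof -
  define X where "X \<omega> = (\<integral>t. G \<omega> t * h t \<partial>UI)" for \<omega>
  have h: "sqint UI h"
    by (rule sqint_bound(1)[OF UI.sqint_const[of c] hm]) (use hb in \<open>intro AE_I2, simp add: order_trans[OF hb abs_ge_self]\<close>)
  have sX: "sqint \<Omega> X" unfolding X_def[abs_def]
    by (rule sqint_inner(1)[OF sigma_finite_measure_axioms sigma_finite_UI G_sqint_pair h])
  then show "sqint \<Omega> (\<lambda>\<omega>. \<integral>t. G \<omega> t * h t \<partial>UI)" unfolding X_def .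
  have nX: "(l2norm \<Omega> X)\<^sup>2 = kform d h h"
  proof -
    have "(l2norm \<Omega> X)\<^sup>2 = kform K h h"
      unfolding l2norm_square X_def K_def[abs_def]
      by (simp only: power2_eq_square)
         (rule integral_inner_inner[OF sigma_finite_measure_axioms G_sqint_pair G_sqint_pair h h])
    also have "\<dots> = kform d h h"
      by (rule kform_cong_AE[OF _ d h h K_eq_d])
         (unfold K_def, rule kernel_sqk[OF sigma_finite_measure_axioms G_sqint_pair G_sqint_pair])
    finally show ?thesis .
  qed
  define W where "W = l2norm (\<Omega> \<Otimes>\<^sub>M UI) (\<lambda>p. G (fst p) (snd p))"
  have "\<forall>n. \<exists>T. (\<forall>k. T k \<in> space UI) \<and>
    l2norm \<Omega> (\<lambda>\<omega>. (\<Sum>k<Suc n. h (T k) / Suc n * G \<omega> (T k)) - X \<omega>) \<le> (c * W + 1) / sqrt (Suc n)"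
    unfolding X_def W_def by (intro allI quadrature_points[OF hm hb]) simp
  from choice[OF this] obtain T where T0: "\<forall>n. (\<forall>k. T n k \<in> space UI) \<and>
    l2norm \<Omega> (\<lambda>\<omega>. (\<Sum>k<Suc n. h (T n k) / Suc n * G \<omega> (T n k)) - X \<omega>) \<le> (c * W + 1) / sqrt (Suc n)"
    by (rule exE)
  have T: "T n k \<in> space UI"
    "l2norm \<Omega> (\<lambda>\<omega>. (\<Sum>k<Suc n. h (T n k) / Suc n * G \<omega> (T n k)) - X \<omega>) \<le> (c * W + 1) / sqrt (Suc n)" for n k
    using T0 by (simp_all only:)
  define Y where "Y n \<omega> = (\<Sum>k<Suc n. h (T n k) / Suc n * G \<omega> (T n k))" for n \<omega>
  have Y: "sqint \<Omega> (Y n)" "char (distr \<Omega> borel (Y n)) u = complex_of_real (exp (- (u\<^sup>2 * (l2norm \<Omega> (Y n))\<^sup>2) / 2))" for n u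
    unfolding Y_def[abs_def] by (rule gp_comb[OF T(1)])+
  have lim: "(\<lambda>n. l2norm \<Omega> (\<lambda>\<omega>. Y n \<omega> - X \<omega>)) \<longlonglongrightarrow> 0"
  proof (rule Lim_null_comparison)
    show "\<forall>\<^sub>F n in sequentially. norm (l2norm \<Omega> (\<lambda>\<omega>. Y n \<omega> - X \<omega>)) \<le> (c * W + 1) * sqrt (inverse (real (Suc n)))"
      using T(2) unfolding Y_def by (simp add: real_sqrt_inverse divide_inverse)
    have "(\<lambda>n. (c * W + 1) * sqrt (inverse (real (Suc n)))) \<longlonglongrightarrow> (c * W + 1) * sqrt 0"
      by (intro tendsto_intros LIMSEQ_inverse_real_of_nat)
    then show "(\<lambda>n. (c * W + 1) * sqrt (inverse (real (Suc n)))) \<longlonglongrightarrow> 0" by simp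
  qed
  have "char (distr \<Omega> borel X) u = complex_of_real (exp (- (u\<^sup>2 * (l2norm \<Omega> X)\<^sup>2) / 2))"
    by (rule gaussian_L2_limit[OF prob_\<Omega> Y(1) sX lim Y(2)])
  then show "char (distr \<Omega> borel (\<lambda>\<omega>. \<integral>t. G \<omega> t * h t \<partial>UI)) u = complex_of_real (exp (- (u\<^sup>2 * kform d h h) / 2))"
    unfolding nX unfolding X_def[abs_def] .
qed

end

section \<open>Existence of the limit process\<close>

lemma haar_complete:
  assumes "sqint UI v" "\<And>j. (\<integral>t. v t * haar j t \<partial>UI) = 0" shows "AE t in UI. v t = 0"
proof (rule l2norm_eq_0_imp_AE[OF assms(1)])
  have "(\<lambda>j. 0) sums (l2norm UI v)\<^sup>2" using haar_Parseval[OF assms(1)] assms(2) by simp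
  from sums_unique2[OF this sums_zero] show "l2norm UI v = 0" by simp
qed

text \<open>For each \<open>k\<close> the inner product with \<open>haar k\<close> in the second
  variable is a function of \<open>t\<close> orthogonal to the whole basis, hence null. As the basis
  is countable, almost every section is orthogonal to all of it at once.\<close>

lemma kernel_eq_0:
  assumes K: "sqk K" and z: "\<And>j k. kform K (haar j) (haar k) = 0"
  shows "AE t in UI. AE s in UI. K t s = 0"
proof -
  define v where "v k t = (\<integral>s. K t s * haar k s \<partial>UI)" for k t
  have sv: "sqint UI (v k)" for k
    unfolding v_def[abs_def] by (rule sqint_inner(1)[OF sigma_finite_UI sigma_finite_UI K sqint_haar])
  have "AE t in UI. v k t = 0" for k
    using z[of _ k] unfolding kform_iterated[OF K sqint_haar sqint_haar] v_def[symmetric] by (rule haar_complete[OF sv])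
  then have "AE t in UI. \<forall>k. v k t = 0" by (simp add: AE_all_countable)
  then show ?thesis using sqint_iterated(1)[OF sigma_finite_UI sigma_finite_UI K]
  proof eventually_elim
    case (elim t)
    have "sqint UI (K t)" using elim(2) by (simp only: fst_conv snd_conv)
    moreover have "(\<integral>s. K t s * haar j s \<partial>UI) = 0" for j using elim(1) by (simp add: v_def)
    ultimately show ?case by (rule haar_complete)
  qed
qed

section \<open>Linear combinations of a standard Gaussian sequence\<close>

lemma gauss_moment: "(\<integral>\<xi>. \<xi> i * \<xi> l \<partial>gauss_seq) = (if i = l then 1 else 0)" "sqint gauss_seq (\<lambda>\<xi>. \<xi> i)"
  "(\<integral>\<xi>. \<xi> i \<partial>gauss_seq) = 0"
proof -
  have i2: "integrable std_normal_distribution (\<lambda>x. x\<^sup>2)" by (rule integrable_std_normal_distribution_moment)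
  have s: "sqint std_normal_distribution (\<lambda>x. x)" unfolding sqint_def using i2 by simp
  have m: "(\<lambda>\<xi>. \<xi> i) \<in> gauss_seq \<rightarrow>\<^sub>M std_normal_distribution" for i
    using measurable_gauss_component by (simp cong: measurable_cong_sets)
  show sg: "sqint gauss_seq (\<lambda>\<xi>. \<xi> i)" for i
    using sqint_distr(1)[OF m[of i], of "\<lambda>x. x"] s unfolding distr_gauss_component by simp
  show z: "(\<integral>\<xi>. \<xi> i \<partial>gauss_seq) = 0" for i
    using integral_gauss_component[of "\<lambda>x. x" i] integral_std_normal_distribution_moment_odd[of 1] by simp
  show "(\<integral>\<xi>. \<xi> i * \<xi> l \<partial>gauss_seq) = (if i = l then 1 else 0)"
  proof (cases "i = l")
    case True
    have "(\<integral>\<xi>. \<xi> l * \<xi> l \<partial>gauss_seq) = (\<integral>x. x * x \<partial>std_normal_distribution)"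
      by (rule integral_gauss_component[of "\<lambda>x. x * x"]) simp
    also have "\<dots> = 1" using std_normal_distribution_even_moments[of 1] by (simp add: power2_eq_square)
    finally show ?thesis using True by simp
  next
    case False
    then show ?thesis
      using std.integral_mult_disjoint[OF sg[of i, unfolded gauss_seq_def] sg[of l, unfolded gauss_seq_def], of "{l}" "{i}"] z[of i]
      by (auto simp: depends_on_def gauss_seq_def)
  qed
qed

lemma gauss_bilinear:
  "(\<integral>\<xi>. (\<Sum>i<n. a i * \<xi> i) * (\<Sum>i<n. b i * \<xi> i) \<partial>gauss_seq) = (\<Sum>i<n. a i * b i)"
proof -
  have "(\<integral>\<xi>. (\<Sum>i<n. a i * \<xi> i) * (\<Sum>i<n. b i * \<xi> i) \<partial>gauss_seq) = (\<integral>\<xi>. (\<Sum>i<n. \<Sum>l<n. (a i * b l) * (\<xi> i * \<xi> l)) \<partial>gauss_seq)"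
    by (simp add: sum_product mult_ac)
  also have "\<dots> = (\<Sum>i<n. \<Sum>l<n. (a i * b l) * (\<integral>\<xi>. \<xi> i * \<xi> l \<partial>gauss_seq))"
    using sqint_integrable_mult[OF gauss_moment(2) gauss_moment(2)] by simp
  also have "\<dots> = (\<Sum>i<n. \<Sum>l<n. if l = i then a i * b i else 0)"
    by (intro sum.cong refl) (simp add: gauss_moment)
  also have "\<dots> = (\<Sum>i<n. a i * b i)" by simp
  finally show ?thesis .
qed

text \<open>A linear space of centred Gaussian variables. Linear combinations of partial sums at
  several times stay in it, so joint normality reduces to the one-dimensional formula.\<close>

definition gauss_lin :: "((nat \<Rightarrow> real) \<Rightarrow> real) \<Rightarrow> bool" where
  "gauss_lin X \<longleftrightarrow> (\<exists>n a. X = (\<lambda>\<xi>. \<Sum>i<n. a i * \<xi> i))"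

lemma gauss_linI: "gauss_lin (\<lambda>\<xi>. \<Sum>i<n. a i * \<xi> i)"
  unfolding gauss_lin_def by blast

lemma gauss_lin_cmult:
  assumes "gauss_lin X" shows "gauss_lin (\<lambda>\<xi>. c * X \<xi>)"
proof -
  obtain n a where "X = (\<lambda>\<xi>. \<Sum>i<n. a i * \<xi> i)" using assms unfolding gauss_lin_def by blast
  then have "(\<lambda>\<xi>. c * X \<xi>) = (\<lambda>\<xi>. \<Sum>i<n. (c * a i) * \<xi> i)" by (simp add: sum_distrib_left mult.assoc)
  then show ?thesis by (simp only: gauss_linI)
qed

lemma gauss_lin_add:
  assumes "gauss_lin X" "gauss_lin Y" shows "gauss_lin (\<lambda>\<xi>. X \<xi> + Y \<xi>)"
proof -
  obtain n a where X: "X = (\<lambda>\<xi>. \<Sum>i<n. a i * \<xi> i)" using assms unfolding gauss_lin_def by blast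
  obtain m b where Y: "Y = (\<lambda>\<xi>. \<Sum>i<m. b i * \<xi> i)" using assms unfolding gauss_lin_def by blast
  \<comment> \<open>Both combinations are padded with zero coefficients to a common length.\<close>
  define N where "N = max n m"
  have ext: "(\<Sum>i<k. f i * \<xi> i) = (\<Sum>i<N. (if i < k then f i else 0) * \<xi> i)" if "k \<le> N" for k and f \<xi> :: "nat \<Rightarrow> real"
    using that by (intro sum.mono_neutral_cong_left) auto
  have "X \<xi> + Y \<xi> = (\<Sum>i<N. ((if i < n then a i else 0) + (if i < m then b i else 0)) * \<xi> i)" for \<xi>
    unfolding X Y ext[of n a \<xi>, unfolded N_def, OF max.cobounded1, folded N_def] ext[of m b \<xi>, unfolded N_def, OF max.cobounded2, folded N_def]
    by (simp add: sum.distrib distrib_right)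
  then show ?thesis by (simp only: gauss_linI)
qed

lemma gauss_lin_zero: "gauss_lin (\<lambda>\<xi>. 0)"
  using gauss_linI[where n=0] by simp

lemma gauss_lin_sum: "(\<And>i. i \<in> A \<Longrightarrow> gauss_lin (X i)) \<Longrightarrow> gauss_lin (\<lambda>\<xi>. \<Sum>i\<in>A. X i \<xi>)"
  by (induct A rule: infinite_finite_induct) (auto intro: gauss_lin_add gauss_lin_zero)

lemma gauss_lin_facts:
  assumes "gauss_lin X"
  shows "sqint gauss_seq X" "(\<integral>\<xi>. X \<xi> \<partial>gauss_seq) = 0"
    "char (distr gauss_seq borel X) u = complex_of_real (exp (- (u\<^sup>2 * (l2norm gauss_seq X)\<^sup>2) / 2))"
proof -
  obtain n a where X: "X = (\<lambda>\<xi>. \<Sum>i<n. a i * \<xi> i)" using assms unfolding gauss_lin_def by blast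
  show "sqint gauss_seq X" unfolding X by (intro sqint_sum sqint_cmult gauss_moment)
  show "(\<integral>\<xi>. X \<xi> \<partial>gauss_seq) = 0"
    unfolding X using gauss.sqint_integrable[OF gauss_moment(2)] by (simp add: gauss_moment)
  have "(l2norm gauss_seq X)\<^sup>2 = (\<Sum>i<n. (a i)\<^sup>2)"
    unfolding l2norm_square X by (simp only: power2_eq_square gauss_bilinear)
  then show "char (distr gauss_seq borel X) u = complex_of_real (exp (- (u\<^sup>2 * (l2norm gauss_seq X)\<^sup>2) / 2))"
    unfolding X char_gauss_sum by simp
qed

lemma kform_sum_sum:
  assumes d: "sqk d" and h: "\<And>j. j \<in> A \<Longrightarrow> sqint UI (h j)"
  shows "kform d (\<lambda>t. \<Sum>j\<in>A. a j * h j t) (\<lambda>t. \<Sum>j\<in>A. a j * h j t) = (\<Sum>j\<in>A. \<Sum>k\<in>A. a j * a k * kform d (h j) (h k))"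
proof -
  have "kform d (\<lambda>t. \<Sum>j\<in>A. a j * h j t) (\<lambda>t. \<Sum>j\<in>A. a j * h j t) =
    (\<integral>p. (\<Sum>j\<in>A. \<Sum>k\<in>A. (a j * a k) * (d (fst p) (snd p) * (h j (fst p) * h k (snd p)))) \<partial>(UI \<Otimes>\<^sub>M UI))"
    unfolding kform_def sum_product
    by (intro Bochner_Integration.integral_cong refl, simp only: sum_distrib_left)
       (intro sum.cong refl, simp only: mult_ac)
  also have "\<dots> = (\<Sum>j\<in>A. \<Sum>k\<in>A. a j * a k * kform d (h j) (h k))"
    unfolding kform_def using kform_integrable[OF d h h] by simp
  finally show ?thesis .
qed

text \<open>The Karhunen-Loeve type series is summed along a subsequence with geometrically decaying remainders:
  it then converges for every \<open>t\<close> in a set \<open>Gd\<close> of full measure, and the process is 0 off \<open>Gd\<close>.\<close>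
theorem gaussian_process_exists:
  assumes d: "sqk d" and sym: "\<And>t s. d t s = d s t" and pos: "\<And>h. sqint UI h \<Longrightarrow> 0 \<le> kform d h h"
    and trace: "\<And>J. (\<Sum>j<J. kform d (haar j) (haar j)) \<le> Tr"
  shows "\<exists>G. gaussian_process gauss_seq G d"
proof -
  define C where "C j k = kform d (haar j) (haar k)" for j k
  have "psd C" unfolding psd_def
  proof (intro conjI allI impI)
    show "C j k = C k j" for j k
    proof -
      have "(\<lambda>t s. d s t) = d" by (rule ext, rule ext, rule sym)
      then show ?thesis using kform_swap[OF d sqint_haar[of j] sqint_haar[of k]] unfolding C_def by simp
    qed
    show "0 \<le> (\<Sum>j\<in>A. \<Sum>k\<in>A. a j * a k * C j k)" for A a
      unfolding C_def kform_sum_sum[OF d sqint_haar, symmetric] by (intro pos sqint_sum sqint_cmult sqint_haar)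
  qed
  from Cholesky[OF this] obtain L where L: "\<And>j i. j < i \<Longrightarrow> L j i = 0"
    "\<And>j k n. j < n \<Longrightarrow> C j k = (\<Sum>i<n. L j i * L k i)" by blast
  \<comment> \<open>The Haar coefficients of the process to be built: the Cholesky factor gives them
    covariance \<open>C\<close>, the matrix of \<open>d\<close> in the Haar basis.\<close>
  define c where "c j \<xi> = (\<Sum>i<Suc j. L j i * \<xi> i)" for j \<xi>
  have clin: "gauss_lin (c j)" for j unfolding c_def[abs_def] by (rule gauss_linI)
  note sc = gauss_lin_facts(1)[OF clin]
  have c_ext: "c j \<xi> = (\<Sum>i<n. L j i * \<xi> i)" if "j < n" for j n \<xi>
    unfolding c_def using that L(1) by (intro sum.mono_neutral_left) auto
  have cc: "(\<integral>\<xi>. c j \<xi> * c k \<xi> \<partial>gauss_seq) = C j k" for j k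
  proof -
    define n where "n = Suc (max j k)"
    have "(\<integral>\<xi>. c j \<xi> * c k \<xi> \<partial>gauss_seq) = (\<Sum>i<n. L j i * L k i)"
      unfolding c_ext[of j n, unfolded n_def, OF le_imp_less_Suc[OF max.cobounded1], folded n_def]
        c_ext[of k n, unfolded n_def, OF le_imp_less_Suc[OF max.cobounded2], folded n_def]
      by (rule gauss_bilinear)
    also have "\<dots> = C j k" by (rule L(2)[symmetric]) (simp add: n_def le_imp_less_Suc)
    finally show ?thesis .
  qed
  have Cnn: "0 \<le> C j j" for j unfolding C_def by (rule pos[OF sqint_haar])
  have sC: "summable (\<lambda>j. C j j)"
    by (rule summableI_nonneg_bounded[OF Cnn trace[folded C_def]])
  have "\<exists>m. (\<Sum>j. C (j + m) (j + m)) \<le> (1 / 4) ^ r" for r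
  proof -
    have "(\<lambda>m. (\<Sum>j. C j j) - (\<Sum>j<m. C j j)) \<longlonglongrightarrow> (\<Sum>j. C j j) - (\<Sum>j. C j j)"
      using summable_LIMSEQ[OF sC] by (intro tendsto_intros)
    then have "(\<lambda>m. \<Sum>j. C (j + m) (j + m)) \<longlonglongrightarrow> 0"
      using suminf_minus_initial_segment[OF sC] by simp
    then have "\<forall>\<^sub>F m in sequentially. (\<Sum>j. C (j + m) (j + m)) < (1 / 4) ^ r"
      by (rule order_tendstoD(2)) simp
    then show ?thesis by (auto simp: eventually_sequentially intro: less_imp_le)
  qed
  then obtain N0 where N0: "\<And>r. (\<Sum>j. C (j + N0 r) (j + N0 r)) \<le> (1 / 4) ^ r" by metis
  \<comment> \<open>The maximum makes the cut points increasing and keeps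
    \<open>N (Suc q) \<ge> N0 q\<close>; adding \<open>q\<close> makes them unbounded.\<close>
  define N where "N r = (case r of 0 \<Rightarrow> 0 | Suc q \<Rightarrow> Max (N0 ` {..q}) + q)" for r
  have NSuc: "N (Suc q) = Max (N0 ` {..q}) + q" for q by (simp add: N_def)
  have Nmono: "N r \<le> N (Suc r)" for r
  proof (cases r)
    case 0 then show ?thesis by (simp add: N_def)
  next
    case (Suc q)
    have "Max (N0 ` {..q}) \<le> Max (N0 ` {..Suc q})" by (intro Max_mono) auto
    then show ?thesis unfolding Suc NSuc by linarith
  qed
  have Ninf: "q \<le> N (Suc q)" for q by (simp add: NSuc)
  define J where "J r = {N r..<N (Suc r)}" for r
  \<comment> \<open>Block \<open>r + 1\<close> starts at \<open>N (Suc r)\<close>, not before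
    \<open>N0 r\<close>, so it lies inside a remainder bounded by
    \<open>(1 / 4) ^ r\<close>.\<close>
  have CJ: "(\<Sum>j\<in>J (Suc r). C j j) \<le> (1 / 4) ^ r" for r
  proof -
    have ge: "N0 r \<le> N (Suc r)" unfolding NSuc by (intro trans_le_add1 Max_ge) auto
    have "(\<Sum>j\<in>J (Suc r). C j j) \<le> (\<Sum>j\<in>{N0 r..<N0 r + N (Suc (Suc r))}. C j j)"
      using ge Cnn unfolding J_def by (intro sum_mono2) auto
    also have "\<dots> = (\<Sum>j<N (Suc (Suc r)). C (j + N0 r) (j + N0 r))"
      using sum.shift_bounds_nat_ivl[of "\<lambda>j. C j j" 0 "N0 r" "N (Suc (Suc r))"] by (simp add: atLeast0LessThan add.commute)
    also have "\<dots> \<le> (\<Sum>j. C (j + N0 r) (j + N0 r))"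
      using summable_ignore_initial_segment[OF sC, of "N0 r"] Cnn by (intro sum_le_suminf) auto
    finally show ?thesis using N0[of r] by simp
  qed
  define \<Delta> where "\<Delta> r \<xi> t = (\<Sum>j\<in>J r. c j \<xi> * haar j t)" for r \<xi> t
  have partial: "(\<Sum>r<m. \<Delta> r \<xi> t) = (\<Sum>j<N m. c j \<xi> * haar j t)" for m \<xi> t
  proof (induct m)
    case 0 show ?case by (simp add: N_def)
  next
    case (Suc m)
    have "(\<Sum>j<N (Suc m). c j \<xi> * haar j t) = (\<Sum>j<N m. c j \<xi> * haar j t) + \<Delta> m \<xi> t"
      unfolding \<Delta>_def J_def using Nmono[of m] by (simp add: sum.atLeastLessThan_concat[of 0, symmetric] atLeast0LessThan[symmetric])
    then show ?case using Suc by simp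
  qed
  have s\<Delta>: "sqint (gauss_seq \<Otimes>\<^sub>M UI) (\<lambda>p. \<Delta> r (fst p) (snd p))" for r
    unfolding \<Delta>_def by (intro sqint_sum sqint_tensor[OF sigma_finite_UI sc sqint_haar])
  have inner: "(\<integral>t. (\<Sum>j\<in>A. c j \<xi> * haar j t) * haar k t \<partial>UI) = (if k \<in> A then c k \<xi> else 0)" if "finite A" for A \<xi> k
  proof -
    have "(\<integral>t. (\<Sum>j\<in>A. c j \<xi> * haar j t) * haar k t \<partial>UI) = (\<integral>t. (\<Sum>j\<in>A. c j \<xi> * (haar j t * haar k t)) \<partial>UI)"
      by (simp add: sum_distrib_right mult.assoc)
    also have "\<dots> = (\<Sum>j\<in>A. c j \<xi> * (\<integral>t. haar j t * haar k t \<partial>UI))"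
      using sqint_integrable_mult[OF sqint_haar sqint_haar] by simp
    also have "\<dots> = (\<Sum>j\<in>A. if j = k then c k \<xi> else 0)"
      by (intro sum.cong refl) (simp add: haar_inner_eq)
    finally show ?thesis using that by simp
  qed
  have n\<Delta>: "(l2norm (gauss_seq \<Otimes>\<^sub>M UI) (\<lambda>p. \<Delta> r (fst p) (snd p)))\<^sup>2 = (\<Sum>j\<in>J r. C j j)" for r
  proof -
    have fJ: "finite (J r)" by (simp add: J_def)
    have "(l2norm gauss_seq (\<lambda>\<xi>. \<integral>t. \<Delta> r \<xi> t * haar j t \<partial>UI))\<^sup>2 = (if j \<in> J r then C j j else 0)" for j
      unfolding \<Delta>_def inner[OF fJ] l2norm_square by (simp add: power2_eq_square cc)
    then have "(\<lambda>j. if j \<in> J r then C j j else 0) sums (l2norm (gauss_seq \<Otimes>\<^sub>M UI) (\<lambda>p. \<Delta> r (fst p) (snd p)))\<^sup>2"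
      using integrated_Parseval[OF gauss.sigma_finite_measure_axioms s\<Delta>[of r]] by simp
    from sums_unique2[OF this sums_If_finite_set[OF fJ]] show ?thesis by simp
  qed
  have sm\<Delta>: "summable (\<lambda>r. l2norm (gauss_seq \<Otimes>\<^sub>M UI) (\<lambda>p. \<Delta> r (fst p) (snd p)))"
  proof -
    have "summable (\<lambda>r. l2norm (gauss_seq \<Otimes>\<^sub>M UI) (\<lambda>p. \<Delta> (Suc r) (fst p) (snd p)))"
    proof (rule summable_comparison_test')
      \<comment> \<open>The bounds \<open>(1 / 4) ^ r\<close> are for squared norms, hence the ratio
        \<open>1 / 2\<close>.\<close>
      show "summable (\<lambda>r. (1 / 2 :: real) ^ r)" by (rule summable_geometric) simp
      fix r
      have "((1 / 2 :: real) ^ r)\<^sup>2 = ((1 / 2)\<^sup>2) ^ r"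
        by (simp only: power_mult[symmetric] mult.commute[of r 2])
      also have "(1 / 2 :: real)\<^sup>2 = 1 / 4" by (simp add: power2_eq_square)
      finally have "((1 / 2 :: real) ^ r)\<^sup>2 = (1 / 4) ^ r" .
      then have "(l2norm (gauss_seq \<Otimes>\<^sub>M UI) (\<lambda>p. \<Delta> (Suc r) (fst p) (snd p)))\<^sup>2 \<le> ((1 / 2) ^ r)\<^sup>2"
        using CJ[of r] by (simp only: n\<Delta>)
      from power2_le_imp_le[OF this]
      show "norm (l2norm (gauss_seq \<Otimes>\<^sub>M UI) (\<lambda>p. \<Delta> (Suc r) (fst p) (snd p))) \<le> (1 / 2) ^ r"
        by simp
    qed
    then show ?thesis
      by (rule summable_Suc_iff[of "\<lambda>r. l2norm (gauss_seq \<Otimes>\<^sub>M UI) (\<lambda>p. \<Delta> r (fst p) (snd p))", THEN iffD1])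
  qed
  define \<rho> where "\<rho> r t = l2norm gauss_seq (\<lambda>\<xi>. \<Delta> r \<xi> t)" for r t
  note it = sqint_iterated[OF sigma_finite_UI gauss.sigma_finite_measure_axioms sqint_swap(1)[OF gauss.sigma_finite_measure_axioms sigma_finite_UI s\<Delta>]]
  have s\<rho>: "sqint UI (\<rho> r)" for r using it(2)[of r] unfolding \<rho>_def[abs_def] by (simp only: fst_conv snd_conv)
  have n\<rho>: "l2norm UI (\<rho> r) = l2norm (gauss_seq \<Otimes>\<^sub>M UI) (\<lambda>p. \<Delta> r (fst p) (snd p))" for r
    using it(3)[of r] sqint_swap(2)[OF gauss.sigma_finite_measure_axioms sigma_finite_UI s\<Delta>[of r]]
    unfolding \<rho>_def[abs_def] by (simp only: fst_conv snd_conv)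
  have \<Delta>lin: "gauss_lin (\<lambda>\<xi>. \<Delta> r \<xi> t)" for r t
    unfolding \<Delta>_def by (intro gauss_lin_sum) (simp only: mult.commute[of "c _ _"], rule gauss_lin_cmult[OF clin])
  have \<Delta>m: "(\<lambda>p. \<Delta> r (fst p) (snd p)) \<in> borel_measurable (gauss_seq \<Otimes>\<^sub>M borel)" for r
    unfolding \<Delta>_def
    by (intro borel_measurable_sum borel_measurable_times measurable_compose[OF measurable_fst sqint_measurable[OF sc]]
        measurable_compose[OF measurable_snd haar_borel])
  have \<rho>m: "\<rho> r \<in> borel_measurable borel" for r
  proof -
    have sw: "(\<lambda>q. (snd q, fst q)) \<in> borel \<Otimes>\<^sub>M gauss_seq \<rightarrow>\<^sub>M gauss_seq \<Otimes>\<^sub>M borel"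
      by (intro measurable_Pair measurable_snd measurable_fst)
    have "(\<lambda>q. (\<Delta> r (snd q) (fst q))\<^sup>2) \<in> borel_measurable (borel \<Otimes>\<^sub>M gauss_seq)"
      using borel_measurable_power[OF measurable_compose[OF sw \<Delta>m]] by (simp only: fst_conv snd_conv)
    then have "(\<lambda>t. \<integral>\<xi>. (\<Delta> r \<xi> t)\<^sup>2 \<partial>gauss_seq) \<in> borel_measurable borel"
      by (intro gauss.borel_measurable_lebesgue_integral) (simp only: split_beta')
    then show ?thesis unfolding \<rho>_def[abs_def] l2norm_def by (rule measurable_compose[OF _ borel_measurable_sqrt])
  qed
  \<comment> \<open>The good times are defined by convergence of the norms at \<open>t\<close>, not
    of the paths. The exceptional set thus does not depend on the sample point, and at each good
    time the series converges in mean square.\<close>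
  define Sg where "Sg t = (\<Sum>r. ennreal (\<rho> r t))" for t
  define Gd where "Gd = {t. Sg t \<noteq> top}"
  have Gdm: "Gd \<in> sets borel"
  proof -
    have "Sg \<in> borel_measurable borel" unfolding Sg_def[abs_def]
      by (intro borel_measurable_suminf_order measurable_compose[OF \<rho>m measurable_ennreal])
    then have "Sg -` (UNIV - {top}) \<inter> space borel \<in> sets borel"
      by (rule measurable_sets) simp
    moreover have "Sg -` (UNIV - {top}) \<inter> space borel = Gd" unfolding Gd_def by auto
    ultimately show ?thesis by (simp only:)
  qed
  have \<rho>nn: "0 \<le> \<rho> r t" for r t by (simp add: \<rho>_def)
  have Gd_sum: "summable (\<lambda>r. \<rho> r t)" if "t \<in> Gd" for t
    by (rule summable_suminf_not_top[OF \<rho>nn], fold Sg_def) (use that in \<open>simp add: Gd_def\<close>)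
  have ae: "AE t in UI. summable (\<lambda>l. \<bar>\<rho> l t\<bar>)"
    by (rule infinite_Minkowski(1)[of UI \<rho>, OF s\<rho>, unfolded n\<rho>, OF sm\<Delta>])
  have AE_Gd: "AE t in UI. t \<in> Gd"
    using ae
  proof eventually_elim
    case (elim t)
    then have "summable (\<lambda>l. \<rho> l t)" by (simp add: \<rho>nn)
    from suminf_ennreal_eq[OF \<rho>nn summable_sums[OF this]] have "Sg t = ennreal (\<Sum>l. \<rho> l t)"
      unfolding Sg_def .
    then show "t \<in> Gd" unfolding Gd_def by simp
  qed
  define G where "G \<xi> t = (if t \<in> Gd then (\<Sum>r. \<Delta> r \<xi> t) else 0)" for \<xi> t
  define X where "X m t \<xi> = (if t \<in> Gd then (\<Sum>r<m. \<Delta> r \<xi> t) else 0)" for m t \<xi>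
  have Xlin: "gauss_lin (X m t)" for m t
    unfolding X_def[abs_def] by (cases "t \<in> Gd") (auto intro: gauss_lin_sum \<Delta>lin gauss_lin_zero)
  have sG: "sqint gauss_seq (\<lambda>\<xi>. G \<xi> t)" for t
  proof (cases "t \<in> Gd")
    case True
    have "summable (\<lambda>r. l2norm gauss_seq (\<lambda>\<xi>. \<Delta> r \<xi> t))" using Gd_sum[OF True] by (simp only: \<rho>_def)
    from infinite_Minkowski(2)[OF gauss_lin_facts(1)[OF \<Delta>lin] this] show ?thesis using True by (simp add: G_def)
  qed (simp add: G_def)
  have XG: "(\<lambda>m. l2norm gauss_seq (\<lambda>\<xi>. X m t \<xi> - G \<xi> t)) \<longlonglongrightarrow> 0" for t
  proof (cases "t \<in> Gd")
    case True
    have "summable (\<lambda>r. l2norm gauss_seq (\<lambda>\<xi>. \<Delta> r \<xi> t))" using Gd_sum[OF True] by (simp only: \<rho>_def)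
    from infinite_Minkowski_tail[OF gauss_lin_facts(1)[OF \<Delta>lin] this] show ?thesis
      using True by (subst l2norm_minus_commute) (simp add: G_def X_def)
  qed (simp add: G_def X_def)
  have comb: "integrable gauss_seq (\<lambda>\<xi>. (\<Sum>k<n. a k * G \<xi> (T k))\<^sup>2) \<and>
        (\<integral>\<xi>. (\<Sum>k<n. a k * G \<xi> (T k)) \<partial>gauss_seq) = 0 \<and>
        (\<forall>u. char (distr gauss_seq borel (\<lambda>\<xi>. \<Sum>k<n. a k * G \<xi> (T k))) u =
              complex_of_real (exp (- (u\<^sup>2 * (\<integral>\<xi>. (\<Sum>k<n. a k * G \<xi> (T k))\<^sup>2 \<partial>gauss_seq)) / 2)))" for n and T a :: "nat \<Rightarrow> real"
  proof -
    define Y where "Y \<xi> = (\<Sum>k<n. a k * G \<xi> (T k))" for \<xi>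
    define Z where "Z m \<xi> = (\<Sum>k<n. a k * X m (T k) \<xi>)" for m \<xi>
    have sY: "sqint gauss_seq Y" unfolding Y_def[abs_def] by (intro sqint_sum sqint_cmult sG)
    have Zlin: "gauss_lin (Z m)" for m unfolding Z_def[abs_def] by (intro gauss_lin_sum gauss_lin_cmult Xlin)
    note Z = gauss_lin_facts[OF Zlin]
    have ZY: "(\<lambda>m. l2norm gauss_seq (\<lambda>\<xi>. Z m \<xi> - Y \<xi>)) \<longlonglongrightarrow> 0"
    proof (rule Lim_null_comparison)
      have "l2norm gauss_seq (\<lambda>\<xi>. Z m \<xi> - Y \<xi>) \<le> (\<Sum>k<n. \<bar>a k\<bar> * l2norm gauss_seq (\<lambda>\<xi>. X m (T k) \<xi> - G \<xi> (T k)))" for m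
      proof -
        have "Z m \<xi> - Y \<xi> = (\<Sum>k<n. a k * (X m (T k) \<xi> - G \<xi> (T k)))" for \<xi>
          by (simp add: Z_def Y_def sum_subtractf right_diff_distrib)
        then have "l2norm gauss_seq (\<lambda>\<xi>. Z m \<xi> - Y \<xi>) \<le> (\<Sum>k<n. l2norm gauss_seq (\<lambda>\<xi>. a k * (X m (T k) \<xi> - G \<xi> (T k))))"
          by (simp only:) (intro l2norm_sum_le sqint_cmult sqint_diff gauss_lin_facts(1)[OF Xlin] sG)
        then show ?thesis by (simp only: l2norm_cmult)
      qed
      then show "\<forall>\<^sub>F m in sequentially. norm (l2norm gauss_seq (\<lambda>\<xi>. Z m \<xi> - Y \<xi>)) \<le> (\<Sum>k<n. \<bar>a k\<bar> * l2norm gauss_seq (\<lambda>\<xi>. X m (T k) \<xi> - G \<xi> (T k)))"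
        by simp
      have "(\<lambda>m. \<Sum>k<n. \<bar>a k\<bar> * l2norm gauss_seq (\<lambda>\<xi>. X m (T k) \<xi> - G \<xi> (T k))) \<longlonglongrightarrow> (\<Sum>k<n. \<bar>a k\<bar> * 0)"
        by (intro tendsto_intros XG)
      then show "(\<lambda>m. \<Sum>k<n. \<bar>a k\<bar> * l2norm gauss_seq (\<lambda>\<xi>. X m (T k) \<xi> - G \<xi> (T k))) \<longlonglongrightarrow> 0" by simp
    qed
    have mean: "(\<integral>\<xi>. Y \<xi> \<partial>gauss_seq) = 0"
    proof -
      have "\<bar>\<integral>\<xi>. Y \<xi> \<partial>gauss_seq\<bar> \<le> l2norm gauss_seq (\<lambda>\<xi>. Z m \<xi> - Y \<xi>)" for m
      proof -
        have "(\<integral>\<xi>. Z m \<xi> - Y \<xi> \<partial>gauss_seq) = - (\<integral>\<xi>. Y \<xi> \<partial>gauss_seq)"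
          using gauss.sqint_integrable[OF Z(1)] gauss.sqint_integrable[OF sY] Z(2) by simp
        then have "\<bar>\<integral>\<xi>. Y \<xi> \<partial>gauss_seq\<bar> \<le> (\<integral>\<xi>. \<bar>Z m \<xi> - Y \<xi>\<bar> \<partial>gauss_seq)"
          using integral_abs_bound[of gauss_seq "\<lambda>\<xi>. Z m \<xi> - Y \<xi>"] by simp
        also have "\<dots> \<le> l2norm gauss_seq (\<lambda>\<xi>. Z m \<xi> - Y \<xi>)"
          by (intro l2norm_abs_int_le gauss.prob_space_axioms sqint_diff Z(1) sY)
        finally show ?thesis .
      qed
      from LIMSEQ_le_const[OF ZY, of "\<bar>\<integral>\<xi>. Y \<xi> \<partial>gauss_seq\<bar>"] this show ?thesis by auto
    qed
    have "char (distr gauss_seq borel Y) u = complex_of_real (exp (- (u\<^sup>2 * (l2norm gauss_seq Y)\<^sup>2) / 2))" for u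
      by (rule gaussian_L2_limit[OF gauss.prob_space_axioms Z(1) sY ZY Z(3)])
    then show ?thesis using sqint_integrable_square[OF sY] mean unfolding l2norm_square Y_def by blast
  qed
  \<comment> \<open>Without the cut-off at \<open>Gd\<close> the process is a plain series on the
    product space; it differs from \<open>G\<close> only at a null set of times, which does not
    affect the covariance almost everywhere.\<close>
  define H where "H \<xi> t = (\<Sum>r. \<Delta> r \<xi> t)" for \<xi> t
  have sH: "sqint (gauss_seq \<Otimes>\<^sub>M UI) (\<lambda>p. H (fst p) (snd p))"
    unfolding H_def by (rule infinite_Minkowski(2)[OF s\<Delta> sm\<Delta>])
  have Hinner: "AE \<xi> in gauss_seq. (\<integral>t. H \<xi> t * haar j t \<partial>UI) = c j \<xi>" for j
  proof -
    define D where "D \<xi> = (\<integral>t. H \<xi> t * haar j t \<partial>UI) - c j \<xi>" for \<xi>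
    have sHj: "sqint gauss_seq (\<lambda>\<xi>. \<integral>t. H \<xi> t * haar j t \<partial>UI)"
      by (rule sqint_inner(1)[OF gauss.sigma_finite_measure_axioms sigma_finite_UI sH sqint_haar])
    have sD: "sqint gauss_seq D" unfolding D_def[abs_def] by (rule sqint_diff[OF sHj sc])
    have Hae: "AE \<xi> in gauss_seq. sqint UI (H \<xi>)"
      using sqint_iterated(1)[OF gauss.sigma_finite_measure_axioms sigma_finite_UI sH] by (simp only: fst_conv snd_conv)
    \<comment> \<open>As soon as the partial sum contains \<open>j\<close>, its inner product with
      \<open>haar j\<close> is exactly \<open>c j\<close>, so the discrepancy is carried by the
      remainder of the series.\<close>
    have "l2norm gauss_seq D \<le> l2norm (gauss_seq \<Otimes>\<^sub>M UI) (\<lambda>p. H (fst p) (snd p) - (\<Sum>r<m. \<Delta> r (fst p) (snd p)))" if m: "Suc j < m" for m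
    proof -
      have jm: "j < N m"
      proof -
        obtain q where q: "m = Suc q" using m by (cases m) auto
        show ?thesis using Ninf[of q] m unfolding q by simp
      qed
      let ?R = "\<lambda>\<xi> t. H \<xi> t - (\<Sum>r<m. \<Delta> r \<xi> t)"
      have sR: "sqint (gauss_seq \<Otimes>\<^sub>M UI) (\<lambda>p. ?R (fst p) (snd p))"
        by (intro sqint_diff sH sqint_sum s\<Delta>)
      have "l2norm gauss_seq D = l2norm gauss_seq (\<lambda>\<xi>. \<integral>t. ?R \<xi> t * haar j t \<partial>UI)"
      proof (rule l2norm_cong_AE[OF sqint_measurable[OF sD]])
        show "(\<lambda>\<xi>. \<integral>t. ?R \<xi> t * haar j t \<partial>UI) \<in> borel_measurable gauss_seq"
          by (rule sqint_measurable[OF sqint_inner(1)[OF gauss.sigma_finite_measure_axioms sigma_finite_UI sR sqint_haar]])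
        show "AE \<xi> in gauss_seq. D \<xi> = (\<integral>t. ?R \<xi> t * haar j t \<partial>UI)"
          using Hae
        proof eventually_elim
          case (elim \<xi>)
          have sP: "sqint UI (\<lambda>t. \<Sum>r<m. \<Delta> r \<xi> t)" unfolding partial by (intro sqint_sum sqint_cmult sqint_haar)
          have "(\<integral>t. (\<Sum>r<m. \<Delta> r \<xi> t) * haar j t \<partial>UI) = c j \<xi>"
            unfolding partial inner[OF finite_lessThan] using jm by simp
          then show ?case unfolding D_def
            using sqint_integrable_mult[OF elim sqint_haar[of j]] sqint_integrable_mult[OF sP sqint_haar[of j]]
            by (simp add: left_diff_distrib)
        qed
      qed
      also have "\<dots> \<le> l2norm UI (haar j) * l2norm (gauss_seq \<Otimes>\<^sub>M UI) (\<lambda>p. ?R (fst p) (snd p))"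
        by (rule sqint_inner(2)[OF gauss.sigma_finite_measure_axioms sigma_finite_UI sR sqint_haar])
      finally show ?thesis by (simp add: haar_l2norm)
    qed
    then have "l2norm gauss_seq D \<le> 0"
      by (intro LIMSEQ_le_const[OF infinite_Minkowski_tail[OF s\<Delta> sm\<Delta>]] exI[of _ "Suc (Suc j)"]) (auto simp: H_def)
    then have "l2norm gauss_seq D = 0" using l2norm_nonneg[of gauss_seq D] by linarith
    from l2norm_eq_0_imp_AE[OF sD this] show ?thesis by eventually_elim (simp add: D_def)
  qed
  have KH: "kform (\<lambda>t s. \<integral>\<xi>. H \<xi> t * H \<xi> s \<partial>gauss_seq) (haar j) (haar k) = C j k" for j k
  proof -
    have "kform (\<lambda>t s. \<integral>\<xi>. H \<xi> t * H \<xi> s \<partial>gauss_seq) (haar j) (haar k) =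
      (\<integral>\<xi>. (\<integral>t. H \<xi> t * haar j t \<partial>UI) * (\<integral>s. H \<xi> s * haar k s \<partial>UI) \<partial>gauss_seq)"
      by (rule integral_inner_inner[OF gauss.sigma_finite_measure_axioms sH sH sqint_haar sqint_haar, symmetric])
    also have "\<dots> = (\<integral>\<xi>. c j \<xi> * c k \<xi> \<partial>gauss_seq)"
    proof (rule integral_cong_AE)
      show "AE \<xi> in gauss_seq. (\<integral>t. H \<xi> t * haar j t \<partial>UI) * (\<integral>s. H \<xi> s * haar k s \<partial>UI) = c j \<xi> * c k \<xi>"
        using Hinner[of j] Hinner[of k] by eventually_elim (simp only:)
    qed (intro borel_measurable_times sqint_measurable[OF sc]
        sqint_measurable[OF sqint_inner(1)[OF gauss.sigma_finite_measure_axioms sigma_finite_UI sH sqint_haar]])+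
    finally show ?thesis by (simp only: cc)
  qed
  let ?KH = "\<lambda>t s. \<integral>\<xi>. H \<xi> t * H \<xi> s \<partial>gauss_seq"
  have sKH: "sqk ?KH" by (rule kernel_sqk[OF gauss.sigma_finite_measure_axioms sH sH])
  \<comment> \<open>Both kernels have the same matrix in the Haar basis, so their difference is
    null.\<close>
  have "AE t in UI. AE s in UI. ?KH t s + (-1) * d t s = 0"
  proof (rule kernel_eq_0)
    show "sqk (\<lambda>t s. ?KH t s + (-1) * d t s)" by (rule sqint_add[OF sKH sqint_cmult[OF d]])
    show "kform (\<lambda>t s. ?KH t s + (-1) * d t s) (haar j) (haar k) = 0" for j k
      using kform_add[OF sKH sqint_cmult[OF d, of "-1"] sqint_haar[of j] sqint_haar[of k]] KH[of j k]
      unfolding kform_cmult C_def by simp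
  qed
  then have "AE t in UI. AE s in UI. (\<integral>\<xi>. G \<xi> t * G \<xi> s \<partial>gauss_seq) = d t s"
    using AE_Gd
  proof eventually_elim
    case (elim t)
    from elim(1) AE_Gd show ?case
    proof eventually_elim
      case (elim s)
      then show ?case using \<open>t \<in> Gd\<close> by (simp add: G_def H_def)
    qed
  qed
  then have cov: "AE t in lborel. AE s in lborel. t \<in> {0..1} \<longrightarrow> s \<in> {0..1} \<longrightarrow> (\<integral>\<xi>. G \<xi> t * G \<xi> s \<partial>gauss_seq) = d t s"
    unfolding AE_UI by eventually_elim auto
  have Gm: "(\<lambda>(\<xi>, t). G \<xi> t) \<in> borel_measurable (gauss_seq \<Otimes>\<^sub>M lborel)"
  proof -
    have 1: "(\<lambda>p. \<Sum>r. \<Delta> r (fst p) (snd p)) \<in> borel_measurable (gauss_seq \<Otimes>\<^sub>M borel)"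
      by (intro borel_measurable_suminf \<Delta>m)
    have 2: "(\<lambda>p. indicator Gd (snd p) :: real) \<in> borel_measurable (gauss_seq \<Otimes>\<^sub>M borel)"
      by (intro measurable_compose[OF measurable_snd] borel_measurable_indicator Gdm)
    have "(\<lambda>(\<xi>, t). G \<xi> t) = (\<lambda>p. (\<Sum>r. \<Delta> r (fst p) (snd p)) * indicator Gd (snd p))"
      by (auto simp: G_def split_beta' fun_eq_iff)
    moreover have "sets (gauss_seq \<Otimes>\<^sub>M lborel) = sets (gauss_seq \<Otimes>\<^sub>M (borel :: real measure))"
      by (rule sets_pair_measure_cong) simp_all
    ultimately show ?thesis
      using borel_measurable_times[OF 1 2] by (simp cong: measurable_cong_sets)
  qed
  show ?thesis
    unfolding gaussian_process_def
    by (intro exI[of _ G] conjI gauss.prob_space_axioms Gm allI impI cov) (use comb in auto)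
qed

section \<open>The two-sample statistic\<close>

text \<open>Its purpose is uniformity: one summable majorant bounds the tails of a whole family of
  series.\<close>

lemma sums_tail_le:
  fixes x T :: "nat \<Rightarrow> real"
  assumes x: "x sums X" and T: "summable T" and le: "\<And>j. x j \<le> T j"
  shows "X - (\<Sum>j<J. x j) \<le> (\<Sum>j. T (j + J))"
proof -
  have "X - (\<Sum>j<J. x j) = (\<Sum>j. x (j + J))"
    using suminf_minus_initial_segment[OF sums_summable[OF x], of J] sums_unique[OF x] by simp
  also have "\<dots> \<le> (\<Sum>j. T (j + J))"
    using summable_ignore_initial_segment[OF sums_summable[OF x], of J] summable_ignore_initial_segment[OF T, of J] le
    by (intro suminf_le) auto
  finally show ?thesis .
qed

text \<open>The error bound does not depend on \<open>k\<close>, which allows the limit in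
  \<open>k\<close> at fixed \<open>J\<close> to be taken before the limit in
  \<open>J\<close>.\<close>

lemma iterated_limit:
  fixes x :: "nat \<Rightarrow> real"
  assumes b: "\<And>J k. \<bar>x k - y J k\<bar> \<le> e J" and e: "e \<longlonglongrightarrow> 0"
    and y: "\<And>J. (\<lambda>k. y J k) \<longlonglongrightarrow> z J" and z: "z \<longlonglongrightarrow> L"
  shows "x \<longlonglongrightarrow> L"
proof (rule LIMSEQ_I)
  fix r :: real assume r: "0 < r"
  have "\<forall>\<^sub>F J in sequentially. e J < r / 3" by (rule order_tendstoD(2)[OF e]) (use r in simp)
  moreover have "\<forall>\<^sub>F J in sequentially. \<bar>z J - L\<bar> < r / 3"
    using LIMSEQ_D[OF z, of "r / 3"] r unfolding eventually_sequentially by auto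
  ultimately have "\<forall>\<^sub>F J in sequentially. e J < r / 3 \<and> \<bar>z J - L\<bar> < r / 3" by (rule eventually_conj)
  then obtain J where J: "e J < r / 3" "\<bar>z J - L\<bar> < r / 3" unfolding eventually_sequentially by blast
  obtain k0 where k0: "\<And>k. k \<ge> k0 \<Longrightarrow> \<bar>y J k - z J\<bar> < r / 3"
    using LIMSEQ_D[OF y[of J], of "r / 3"] r by auto
  show "\<exists>no. \<forall>k\<ge>no. norm (x k - L) < r"
  proof (intro exI allI impI)
    fix k assume "k \<ge> k0"
    from k0[OF this] J b[of k J] show "norm (x k - L) < r" unfolding real_norm_def by linarith
  qed
qed

context bernoulli_errors
begin

definition V where "V N \<omega> t = (\<Sum>i=1..int N. eps i \<omega> t) / sqrt (real N)"

lemma sqint_V: "sqint (M \<Otimes>\<^sub>M UI) (\<lambda>p. V N (fst p) (snd p))"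
  using sqint_cmult[OF sqint_sum[of "{1..int N}" "M \<Otimes>\<^sub>M UI" "\<lambda>i p. eps i (fst p) (snd p)", OF sqint_eps], of "1 / sqrt (real N)"]
  unfolding V_def by simp

lemma V_path:
  assumes w: "\<omega> \<in> space M" shows "sqint UI (V N \<omega>)"
  using sqint_cmult[OF sqint_sum[of "{1..int N}" UI "\<lambda>i. eps i \<omega>", OF L2_sqint[OF eps_L2[OF w]]], of "1 / sqrt (real N)"]
  unfolding V_def[abs_def] by simp

lemma Z_inner:
  assumes w: "\<omega> \<in> space M" and h: "sqint UI h"
  shows "Z h N \<omega> = (\<integral>t. V N \<omega> t * h t \<partial>UI)"
proof -
  have i: "integrable UI (\<lambda>t. eps i \<omega> t * h t)" for i
    by (rule sqint_integrable_mult[OF L2_sqint[OF eps_L2[OF w]] h])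
  have "(\<integral>t. V N \<omega> t * h t \<partial>UI) = (\<integral>t. (1 / sqrt (real N)) * (\<Sum>i=1..int N. eps i \<omega> t * h t) \<partial>UI)"
    unfolding V_def by (simp add: sum_distrib_right)
  also have "\<dots> = Z h N \<omega>"
    unfolding Z_def ip_def using i by (simp add: Bochner_Integration.integral_sum)
  finally show ?thesis ..
qed

definition \<tau> where "\<tau> j = (tl_err P (g (haar j)) 0)\<^sup>2"

lemma \<tau>_bound: "(l2norm M (Z (haar j) N))\<^sup>2 \<le> \<tau> j"
  unfolding \<tau>_def by (intro power_mono CLT_inner(4)[OF sqint_haar]) simp

lemma l2norm_Z_cong: "sqint UI h \<Longrightarrow> l2norm M (\<lambda>\<omega>. \<integral>t. V N \<omega> t * h t \<partial>UI) = l2norm M (Z h N)"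
  unfolding l2norm_def by (intro arg_cong[where f=sqrt] Bochner_Integration.integral_cong refl) (simp only: Z_inner)

lemma V_norm: "(l2norm (M \<Otimes>\<^sub>M UI) (\<lambda>p. V N (fst p) (snd p)))\<^sup>2 \<le> suminf \<tau>"
proof -
  have s: "(\<lambda>j. (l2norm M (Z (haar j) N))\<^sup>2) sums (l2norm (M \<Otimes>\<^sub>M UI) (\<lambda>p. V N (fst p) (snd p)))\<^sup>2"
    using integrated_Parseval[OF sf_M sqint_V[of N]] unfolding l2norm_Z_cong[OF sqint_haar] .
  show ?thesis unfolding sums_unique[OF s]
    by (rule suminf_le[OF \<tau>_bound sums_summable[OF s]]) (unfold \<tau>_def, rule summable_tau)
qed

text \<open>Cutting off to \<open>A\<close> does not increase the norm of \<open>V\<close>, so by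
  Parseval the second moments of the cut-off coefficients sum to at most the bound for
  \<open>V\<close>, whatever the sample size. They converge to the values of the form, and the bound
  passes to the limit.\<close>

lemma trace_bound:
  assumes A: "A \<in> sets borel"
  shows "(\<Sum>j<J. kform (lrcov M eps) (\<lambda>t. haar j t * indicator A t) (\<lambda>t. haar j t * indicator A t)) \<le> suminf \<tau>"
proof (rule LIMSEQ_le_const2)
  have hA: "sqint UI (\<lambda>t. haar j t * indicator A t)" for j by (rule sqint_times_indicator[OF sqint_haar A])
  show "(\<lambda>N. \<Sum>j<J. (l2norm M (Z (\<lambda>t. haar j t * indicator A t) N))\<^sup>2)
     \<longlonglongrightarrow> (\<Sum>j<J. kform (lrcov M eps) (\<lambda>t. haar j t * indicator A t) (\<lambda>t. haar j t * indicator A t))"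
    unfolding lrv_kform[OF hA, symmetric] by (intro tendsto_sum CLT_inner(3)[OF hA])
  have "(\<Sum>j<J. (l2norm M (Z (\<lambda>t. haar j t * indicator A t) N))\<^sup>2) \<le> suminf \<tau>" for N
  proof -
    let ?X = "\<lambda>\<omega> t. V N \<omega> t * indicator A t"
    have m: "(\<lambda>p. indicator A (snd p) :: real) \<in> borel_measurable (M \<Otimes>\<^sub>M UI)"
      by (rule measurable_compose[OF measurable_snd indicator_borel_UI[OF A]])
    have b: "\<bar>indicator A (snd p) :: real\<bar> \<le> 1" for p :: "'a \<times> real" by (simp split: split_indicator)
    note X = sqint_times_bounded[OF sqint_V[of N] m b]
    have e: "l2norm M (\<lambda>\<omega>. \<integral>t. ?X \<omega> t * haar j t \<partial>UI) = l2norm M (Z (\<lambda>t. haar j t * indicator A t) N)" for j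
      unfolding l2norm_Z_cong[OF hA, symmetric] by (simp add: mult_ac)
    have s: "(\<lambda>j. (l2norm M (Z (\<lambda>t. haar j t * indicator A t) N))\<^sup>2) sums (l2norm (M \<Otimes>\<^sub>M UI) (\<lambda>p. ?X (fst p) (snd p)))\<^sup>2"
      using integrated_Parseval[OF sf_M X(1)] unfolding e .
    have "(\<Sum>j<J. (l2norm M (Z (\<lambda>t. haar j t * indicator A t) N))\<^sup>2) \<le> (l2norm (M \<Otimes>\<^sub>M UI) (\<lambda>p. ?X (fst p) (snd p)))\<^sup>2"
      unfolding sums_unique[OF s] by (rule sum_le_suminf[OF sums_summable[OF s]]) auto
    also have "\<dots> \<le> (l2norm (M \<Otimes>\<^sub>M UI) (\<lambda>p. V N (fst p) (snd p)))\<^sup>2"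
      using X(2) by (intro power_mono) auto
    also note V_norm
    finally show ?thesis .
  qed
  then show "\<exists>N0. \<forall>N\<ge>N0. (\<Sum>j<J. (l2norm M (Z (\<lambda>t. haar j t * indicator A t) N))\<^sup>2) \<le> suminf \<tau>" by blast
qed

lemma char_Z_moving:
  assumes h: "sqint UI h" and N: "filterlim N at_top sequentially" and a: "\<alpha> \<longlonglongrightarrow> \<alpha>0"
  shows "(\<lambda>k. char (distr M borel (\<lambda>\<omega>. \<alpha> k * Z h (N k) \<omega>)) u)
     \<longlonglongrightarrow> complex_of_real (exp (- (u\<^sup>2 * (\<alpha>0\<^sup>2 * kform (lrcov M eps) h h)) / 2))"
proof -
  note s = sqint_Z(1)[OF h]
  have m: "Z h n \<in> borel_measurable M" for n by (rule sqint_measurable[OF s])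
  have "(\<lambda>k. char (distr M borel (Z h (N k))) (u * \<alpha>0)) \<longlonglongrightarrow> complex_of_real (exp (- ((u * \<alpha>0)\<^sup>2 * P.lrv (g h)) / 2))"
    by (rule filterlim_compose[OF CLT_inner(2)[OF h] N])
  then have 1: "(\<lambda>k. char (distr M borel (\<lambda>\<omega>. \<alpha>0 * Z h (N k) \<omega>)) u) \<longlonglongrightarrow> complex_of_real (exp (- (u\<^sup>2 * (\<alpha>0\<^sup>2 * kform (lrcov M eps) h h)) / 2))"
    unfolding char_scale[OF m] lrv_kform[OF h] by (simp add: power_mult_distrib mult_ac)
  have 2: "(\<lambda>k. char (distr M borel (\<lambda>\<omega>. \<alpha> k * Z h (N k) \<omega>)) u - char (distr M borel (\<lambda>\<omega>. \<alpha>0 * Z h (N k) \<omega>)) u) \<longlonglongrightarrow> 0"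
  proof (rule Lim_null_comparison)
    show "(\<lambda>k. \<bar>u\<bar> * (\<bar>\<alpha> k - \<alpha>0\<bar> * tl_err P (g h) 0)) \<longlonglongrightarrow> 0"
      by (intro tendsto_mult_right_zero tendsto_mult_left_zero tendsto_rabs_zero LIM_zero a)
    have "cmod (char (distr M borel (\<lambda>\<omega>. \<alpha> k * Z h (N k) \<omega>)) u - char (distr M borel (\<lambda>\<omega>. \<alpha>0 * Z h (N k) \<omega>)) u)
       \<le> \<bar>u\<bar> * (\<bar>\<alpha> k - \<alpha>0\<bar> * tl_err P (g h) 0)" for k
    proof -
      have "cmod (char (distr M borel (\<lambda>\<omega>. \<alpha> k * Z h (N k) \<omega>)) u - char (distr M borel (\<lambda>\<omega>. \<alpha>0 * Z h (N k) \<omega>)) u)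
        \<le> \<bar>u\<bar> * l2norm M (\<lambda>\<omega>. \<alpha> k * Z h (N k) \<omega> - \<alpha>0 * Z h (N k) \<omega>)"
        by (intro char_diff_le_l2norm prob_space_axioms sqint_diff sqint_cmult s borel_measurable_times borel_measurable_const m)
      also have "\<dots> = \<bar>u\<bar> * (\<bar>\<alpha> k - \<alpha>0\<bar> * l2norm M (Z h (N k)))"
        unfolding left_diff_distrib[symmetric] l2norm_cmult ..
      also have "\<dots> \<le> \<bar>u\<bar> * (\<bar>\<alpha> k - \<alpha>0\<bar> * tl_err P (g h) 0)"
        by (intro mult_left_mono CLT_inner(4)[OF h]) auto
      finally show ?thesis .
    qed
    then show "\<forall>\<^sub>F k in sequentially. norm (char (distr M borel (\<lambda>\<omega>. \<alpha> k * Z h (N k) \<omega>)) u - char (distr M borel (\<lambda>\<omega>. \<alpha>0 * Z h (N k) \<omega>)) u)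
       \<le> \<bar>u\<bar> * (\<bar>\<alpha> k - \<alpha>0\<bar> * tl_err P (g h) 0)" by simp
  qed
  from tendsto_add[OF 2 1] show ?thesis by simp
qed

end

context gauss_proc
begin

lemma square_norm_measurable: "(\<lambda>\<omega>. \<integral>t. (G \<omega> t)\<^sup>2 \<partial>UI) \<in> borel_measurable \<Omega>"
proof (rule UI.borel_measurable_lebesgue_integral)
  show "(\<lambda>(\<omega>, t). (G \<omega> t)\<^sup>2) \<in> borel_measurable (\<Omega> \<Otimes>\<^sub>M UI)"
    unfolding split_beta' by (rule borel_measurable_power[OF G_measurable])
qed

lemma limit_laplace:
  assumes l: "0 \<le> l"
  shows "(\<lambda>J. \<integral>\<omega>. exp (- (l * (\<Sum>j<J. (\<integral>t. G \<omega> t * haar j t \<partial>UI)\<^sup>2))) \<partial>\<Omega>) \<longlonglongrightarrow> (\<integral>\<omega>. exp (- (l * (\<integral>t. (G \<omega> t)\<^sup>2 \<partial>UI))) \<partial>\<Omega>)"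
proof (rule integral_dominated_convergence[where w="\<lambda>_. 1"])
  have w: "(\<lambda>\<omega>. \<integral>t. G \<omega> t * haar j t \<partial>UI) \<in> borel_measurable \<Omega>" for j
    by (rule sqint_measurable[OF sqint_inner(1)[OF sigma_finite_measure_axioms sigma_finite_UI G_sqint_pair sqint_haar]])
  show "(\<lambda>\<omega>. exp (- (l * (\<Sum>j<J. (\<integral>t. G \<omega> t * haar j t \<partial>UI)\<^sup>2)))) \<in> borel_measurable \<Omega>" for J
    by (intro measurable_compose[OF _ borel_measurable_exp] borel_measurable_uminus borel_measurable_times
        borel_measurable_const borel_measurable_sum borel_measurable_power w)
  show "(\<lambda>\<omega>. exp (- (l * (\<integral>t. (G \<omega> t)\<^sup>2 \<partial>UI)))) \<in> borel_measurable \<Omega>"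
    by (intro measurable_compose[OF _ borel_measurable_exp] borel_measurable_uminus borel_measurable_times
        borel_measurable_const square_norm_measurable)
  show "AE \<omega> in \<Omega>. (\<lambda>J. exp (- (l * (\<Sum>j<J. (\<integral>t. G \<omega> t * haar j t \<partial>UI)\<^sup>2)))) \<longlonglongrightarrow> exp (- (l * (\<integral>t. (G \<omega> t)\<^sup>2 \<partial>UI)))"
    using sqint_iterated(1)[OF sigma_finite_measure_axioms sigma_finite_UI G_sqint_pair]
  proof eventually_elim
    case (elim \<omega>)
    then have "sqint UI (G \<omega>)" by (simp only: fst_conv snd_conv)
    from haar_Parseval[OF this] have "(\<lambda>J. \<Sum>j<J. (\<integral>t. G \<omega> t * haar j t \<partial>UI)\<^sup>2) \<longlonglongrightarrow> (\<integral>t. (G \<omega> t)\<^sup>2 \<partial>UI)"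
      unfolding sums_def l2norm_square .
    then show ?case by (intro tendsto_intros)
  qed
  show "AE \<omega> in \<Omega>. norm (exp (- (l * (\<Sum>j<J. (\<integral>t. G \<omega> t * haar j t \<partial>UI)\<^sup>2)))) \<le> 1" for J
    using l by (intro AE_I2) (simp add: sum_nonneg)
qed simp

end

section \<open>Combination of the two independent samples\<close>

locale two_sample = A: bernoulli_errors M S \<delta> f eps + B: bernoulli_errors M Ss \<delta>s fs eps_s
  for M :: "'a measure"
    and S :: "'s measure" and \<delta> :: "int \<Rightarrow> 'a \<Rightarrow> 's" and f :: "(nat \<Rightarrow> 's) \<Rightarrow> real \<Rightarrow> real"
    and eps :: "int \<Rightarrow> 'a \<Rightarrow> real \<Rightarrow> real"
    and Ss :: "'t measure" and \<delta>s :: "int \<Rightarrow> 'a \<Rightarrow> 't" and fs :: "(nat \<Rightarrow> 't) \<Rightarrow> real \<Rightarrow> real"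
    and eps_s :: "int \<Rightarrow> 'a \<Rightarrow> real \<Rightarrow> real" +
  fixes \<theta> :: real
  assumes \<theta>: "0 \<le> \<theta>" "\<theta> \<le> 1"
    and indep: "prob_space.indep_var M
           (PiM ({1..} \<times> L2) (\<lambda>_. borel))
           (\<lambda>\<omega>. \<lambda>p\<in>{1..} \<times> L2. LINT t:{0..1}|lborel. eps (fst p) \<omega> t * snd p t)
           (PiM ({1..} \<times> L2) (\<lambda>_. borel))
           (\<lambda>\<omega>. \<lambda>p\<in>{1..} \<times> L2. LINT t:{0..1}|lborel. eps_s (fst p) \<omega> t * snd p t)"
begin

definition d where "d t s = (1 - \<theta>) * lrcov M eps t s + \<theta> * lrcov M eps_s t s"

lemma d_sqk: "sqk d"
  unfolding d_def by (intro sqint_add sqint_cmult A.lrcov_sqk B.lrcov_sqk)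

lemma d_sym: "d t s = d s t"
  unfolding d_def using A.lrcov_sym[of t s] B.lrcov_sym[of t s] by simp

lemma d_kform:
  assumes "sqint UI h"
  shows "kform d h h = (1 - \<theta>) * kform (lrcov M eps) h h + \<theta> * kform (lrcov M eps_s) h h"
  unfolding d_def[abs_def]
  by (subst kform_add[OF sqint_cmult[OF A.lrcov_sqk] sqint_cmult[OF B.lrcov_sqk] assms assms]) (simp only: kform_cmult)

lemma d_nonneg: "sqint UI h \<Longrightarrow> 0 \<le> kform d h h"
  using \<theta> A.CLT_inner(1)[of h] B.CLT_inner(1)[of h] by (simp add: d_kform A.lrv_kform B.lrv_kform)

definition Tr where "Tr = suminf A.\<tau> + suminf B.\<tau>"

lemma summable_\<tau>: "summable A.\<tau>" "summable B.\<tau>"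
  using A.summable_tau B.summable_tau unfolding A.\<tau>_def[abs_def] B.\<tau>_def[abs_def] by blast+

lemma \<tau>_nonneg: "0 \<le> A.\<tau> j" "0 \<le> B.\<tau> j"
  by (simp_all add: A.\<tau>_def B.\<tau>_def)

lemma d_trace:
  assumes E: "E \<in> sets borel"
  shows "(\<Sum>j<J. kform d (\<lambda>t. haar j t * indicator E t) (\<lambda>t. haar j t * indicator E t)) \<le> Tr"
proof -
  have h: "sqint UI (\<lambda>t. haar j t * indicator E t)" for j by (rule sqint_times_indicator[OF sqint_haar E])
  have "(\<Sum>j<J. kform d (\<lambda>t. haar j t * indicator E t) (\<lambda>t. haar j t * indicator E t)) =
    (1 - \<theta>) * (\<Sum>j<J. kform (lrcov M eps) (\<lambda>t. haar j t * indicator E t) (\<lambda>t. haar j t * indicator E t)) +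
    \<theta> * (\<Sum>j<J. kform (lrcov M eps_s) (\<lambda>t. haar j t * indicator E t) (\<lambda>t. haar j t * indicator E t))"
    unfolding d_kform[OF h] sum.distrib sum_distrib_left ..
  also have "\<dots> \<le> (1 - \<theta>) * suminf A.\<tau> + \<theta> * suminf B.\<tau>"
    using \<theta> by (intro add_mono mult_left_mono A.trace_bound[OF E] B.trace_bound[OF E]) auto
  also have "\<dots> \<le> 1 * suminf A.\<tau> + 1 * suminf B.\<tau>"
    using \<theta> by (intro add_mono mult_right_mono suminf_nonneg summable_\<tau> \<tau>_nonneg) auto
  finally show ?thesis by (simp add: Tr_def)
qed

lemma limit_process_exists: "\<exists>G. gaussian_process gauss_seq G d"
  by (rule gaussian_process_exists[OF d_sqk d_sym d_nonneg]) (use d_trace[of UNIV] in simp_all)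

text \<open>Both variables are measurable functions of finitely many members of the two independent
  families, those with second index \<open>h\<close>.\<close>

lemma indep_Z:
  assumes h: "h \<in> L2"
  shows "A.indep_var borel (\<lambda>\<omega>. \<alpha> * A.Z h N \<omega>) borel (\<lambda>\<omega>. \<beta> * B.Z h K \<omega>)"
proof -
  let ?I = "{1::int..} \<times> L2"
  let ?c = "\<lambda>\<gamma> n x. \<gamma> * ((\<Sum>i=1..int n. x (i, h)) / sqrt (real n)) :: real"
  have c: "?c \<gamma> n \<in> borel_measurable (PiM ?I (\<lambda>_. borel))" for \<gamma> n
    by (intro borel_measurable_times borel_measurable_divide borel_measurable_const borel_measurable_sum
        measurable_component_singleton) (use h in auto)
  from A.indep_var_compose[OF indep c[of \<alpha> N] c[of \<beta> K]]
  show ?thesis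
    unfolding comp_def A.Z_def[abs_def] B.Z_def[abs_def] A.ip_def B.ip_def set_integral_UI[symmetric]
    using h by simp
qed

context
  fixes Nk Kk :: "nat \<Rightarrow> nat"
  assumes filt: "filterlim (\<lambda>k. min (Nk k) (Kk k)) at_top sequentially"
    and ratio: "(\<lambda>k. real (Nk k) / (real (Nk k) + real (Kk k))) \<longlonglongrightarrow> \<theta>"
begin

text \<open>With these weights the statistic is, for equal means, the squared norm of the difference
  of the two weighted normalised sums. Each sample carries the share of the other one, hence the
  limit \<open>sqrt (1 - \<theta>)\<close> for the first.\<close>

definition "\<alpha> k = sqrt (real (Kk k) / (real (Nk k) + real (Kk k)))"
definition "\<beta> k = sqrt (real (Nk k) / (real (Nk k) + real (Kk k)))"

lemma Nk_lim: "filterlim Nk at_top sequentially" and Kk_lim: "filterlim Kk at_top sequentially"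
  by (rule filterlim_at_top_mono[OF filt], simp)+

lemma \<alpha>_lim: "\<alpha> \<longlonglongrightarrow> sqrt (1 - \<theta>)" and \<beta>_lim: "\<beta> \<longlonglongrightarrow> sqrt \<theta>"
proof -
  have "\<forall>\<^sub>F k in sequentially. 1 - real (Nk k) / (real (Nk k) + real (Kk k)) = real (Kk k) / (real (Nk k) + real (Kk k))"
    using filterlim_at_top[THEN iffD1, OF Nk_lim, rule_format, of 1]
  proof eventually_elim
    case (elim k)
    then have "real (Nk k) + real (Kk k) > 0" by simp
    then show ?case by (simp add: field_simps)
  qed
  moreover have "(\<lambda>k. 1 - real (Nk k) / (real (Nk k) + real (Kk k))) \<longlonglongrightarrow> 1 - \<theta>" by (intro tendsto_intros ratio)
  ultimately have "(\<lambda>k. real (Kk k) / (real (Nk k) + real (Kk k))) \<longlonglongrightarrow> 1 - \<theta>" by (simp add: tendsto_cong)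
  then show "\<alpha> \<longlonglongrightarrow> sqrt (1 - \<theta>)" unfolding \<alpha>_def by (rule tendsto_real_sqrt)
  show "\<beta> \<longlonglongrightarrow> sqrt \<theta>" unfolding \<beta>_def by (rule tendsto_real_sqrt[OF ratio])
qed

lemma \<alpha>_bounds: "0 \<le> \<alpha> k" "\<alpha> k \<le> 1" "0 \<le> \<beta> k" "\<beta> k \<le> 1"
  by (auto simp: \<alpha>_def \<beta>_def divide_le_eq_1)

definition D where "D k \<omega> t = \<alpha> k * A.V (Nk k) \<omega> t - \<beta> k * B.V (Kk k) \<omega> t"

lemma sqint_D: "sqint (M \<Otimes>\<^sub>M UI) (\<lambda>p. D k (fst p) (snd p))"
  unfolding D_def by (intro sqint_diff sqint_cmult A.sqint_V B.sqint_V)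

lemma D_path: "\<omega> \<in> space M \<Longrightarrow> sqint UI (D k \<omega>)"
  unfolding D_def[abs_def] by (intro sqint_diff sqint_cmult A.V_path B.V_path)

lemma D_inner:
  assumes w: "\<omega> \<in> space M" and h: "sqint UI h"
  shows "(\<integral>t. D k \<omega> t * h t \<partial>UI) = \<alpha> k * A.Z h (Nk k) \<omega> - \<beta> k * B.Z h (Kk k) \<omega>"
proof -
  have "(\<integral>t. D k \<omega> t * h t \<partial>UI) = (\<integral>t. \<alpha> k * (A.V (Nk k) \<omega> t * h t) - \<beta> k * (B.V (Kk k) \<omega> t * h t) \<partial>UI)"
    by (simp add: D_def left_diff_distrib mult.assoc)
  also have "\<dots> = \<alpha> k * A.Z h (Nk k) \<omega> - \<beta> k * B.Z h (Kk k) \<omega>"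
    using sqint_integrable_mult[OF A.V_path[OF w] h] sqint_integrable_mult[OF B.V_path[OF w] h]
    by (simp add: A.Z_inner[OF w h] B.Z_inner[OF w h])
  finally show ?thesis .
qed

definition z where "z k j \<omega> = (\<integral>t. D k \<omega> t * haar j t \<partial>UI)"

lemma sqint_z: "sqint M (z k j)"
  unfolding z_def[abs_def] by (rule sqint_inner(1)[OF A.sf_M A.sf_UI sqint_D sqint_haar])

text \<open>The weights are at most 1 and
  \<open>(a + b)\<^sup>2 \<le> 2 * a\<^sup>2 + 2 * b\<^sup>2\<close>. The bound is the same for all
  \<open>k\<close> and summable in \<open>j\<close>, so it controls the tail of the expansion
  uniformly.\<close>

lemma l2norm_z: "(l2norm M (z k j))\<^sup>2 \<le> 2 * A.\<tau> j + 2 * B.\<tau> j"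
proof -
  let ?a = "l2norm M (A.Z (haar j) (Nk k))" and ?b = "l2norm M (B.Z (haar j) (Kk k))"
  have "l2norm M (z k j) = l2norm M (\<lambda>\<omega>. \<alpha> k * A.Z (haar j) (Nk k) \<omega> - \<beta> k * B.Z (haar j) (Kk k) \<omega>)"
    unfolding l2norm_def z_def
    by (intro arg_cong[where f=sqrt] Bochner_Integration.integral_cong refl) (simp only: D_inner[OF _ sqint_haar])
  also have "\<dots> \<le> l2norm M (\<lambda>\<omega>. \<alpha> k * A.Z (haar j) (Nk k) \<omega>) + l2norm M (\<lambda>\<omega>. \<beta> k * B.Z (haar j) (Kk k) \<omega>)"
    by (intro l2norm_diff_le sqint_cmult A.sqint_Z(1) B.sqint_Z(1) sqint_haar)
  also have "\<dots> \<le> 1 * ?a + 1 * ?b"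
    unfolding l2norm_cmult using \<alpha>_bounds[of k] by (intro add_mono mult_right_mono) auto
  finally have "(l2norm M (z k j))\<^sup>2 \<le> (?a + ?b)\<^sup>2" by (intro power_mono) auto
  also have "\<dots> \<le> 2 * ?a\<^sup>2 + 2 * ?b\<^sup>2"
    using sum_squares_bound[of ?a ?b] by (simp add: power2_sum)
  also have "\<dots> \<le> 2 * A.\<tau> j + 2 * B.\<tau> j"
    using A.\<tau>_bound[of j "Nk k"] B.\<tau>_bound[of j "Kk k"] by simp
  finally show ?thesis .
qed

text \<open>Independence factors the characteristic function, the limits multiply, and the variances
  add with weights \<open>1 - \<theta>\<close> and \<open>\<theta>\<close> to the form of
  \<open>d\<close>. The minus sign disappears in the square.\<close>

lemma char_comb:
  assumes h: "h \<in> L2"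
  shows "(\<lambda>k. char (distr M borel (\<lambda>\<omega>. \<alpha> k * A.Z h (Nk k) \<omega> - \<beta> k * B.Z h (Kk k) \<omega>)) u)
    \<longlonglongrightarrow> complex_of_real (exp (- (u\<^sup>2 * kform d h h) / 2))"
proof -
  note s = L2_sqint[OF h]
  have "(\<lambda>\<omega>. \<alpha> k * A.Z h (Nk k) \<omega> - \<beta> k * B.Z h (Kk k) \<omega>) = (\<lambda>\<omega>. \<alpha> k * A.Z h (Nk k) \<omega> + (- \<beta> k) * B.Z h (Kk k) \<omega>)" for k
    by simp
  then have e: "char (distr M borel (\<lambda>\<omega>. \<alpha> k * A.Z h (Nk k) \<omega> - \<beta> k * B.Z h (Kk k) \<omega>)) u =
    char (distr M borel (\<lambda>\<omega>. \<alpha> k * A.Z h (Nk k) \<omega>)) u * char (distr M borel (\<lambda>\<omega>. (- \<beta> k) * B.Z h (Kk k) \<omega>)) u" for k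
    by (simp only: A.char_distr_add[OF indep_Z[OF h]])
  have "(\<lambda>k. - \<beta> k) \<longlonglongrightarrow> - sqrt \<theta>" by (intro tendsto_intros \<beta>_lim)
  from tendsto_mult[OF A.char_Z_moving[OF s Nk_lim \<alpha>_lim, of u] B.char_Z_moving[OF s Kk_lim this, of u]]
  have "(\<lambda>k. char (distr M borel (\<lambda>\<omega>. \<alpha> k * A.Z h (Nk k) \<omega> - \<beta> k * B.Z h (Kk k) \<omega>)) u) \<longlonglongrightarrow>
    complex_of_real (exp (- (u\<^sup>2 * ((sqrt (1 - \<theta>))\<^sup>2 * kform (lrcov M eps) h h)) / 2)) * complex_of_real (exp (- (u\<^sup>2 * ((- sqrt \<theta>)\<^sup>2 * kform (lrcov M eps_s) h h)) / 2))"
    unfolding e .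
  also have "complex_of_real (exp (- (u\<^sup>2 * ((sqrt (1 - \<theta>))\<^sup>2 * kform (lrcov M eps) h h)) / 2)) * complex_of_real (exp (- (u\<^sup>2 * ((- sqrt \<theta>)\<^sup>2 * kform (lrcov M eps_s) h h)) / 2))
     = complex_of_real (exp (- (u\<^sup>2 * kform d h h) / 2))"
  proof -
    have "- (u\<^sup>2 * kform d h h) / 2 = - (u\<^sup>2 * ((sqrt (1 - \<theta>))\<^sup>2 * kform (lrcov M eps) h h)) / 2 + - (u\<^sup>2 * ((- sqrt \<theta>)\<^sup>2 * kform (lrcov M eps_s) h h)) / 2"
    proof -
      have "(sqrt (1 - \<theta>))\<^sup>2 = 1 - \<theta>" "(- sqrt \<theta>)\<^sup>2 = \<theta>" using \<theta> by simp_all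
      then show ?thesis by (simp only: d_kform[OF s] distrib_left minus_add_distrib add_divide_distrib)
    qed
    then show ?thesis by (simp only: exp_add of_real_mult)
  qed
  finally show ?thesis .
qed

text \<open>Replacing the squared norm by \<open>J\<close> squared coordinates changes the Laplace
  transform by at most \<open>l\<close> times the expectation of the remaining ones, hence by a tail
  of the series of \<open>2 * A.\<tau> j + 2 * B.\<tau> j\<close>, uniformly in
  \<open>k\<close>.\<close>

theorem weak_convergence:
  fixes \<Omega> :: "'b measure"
  assumes gp: "gaussian_process \<Omega> G d"
  shows "weak_conv_m (\<lambda>k. distr M borel (\<lambda>\<omega>. \<integral>t. (D k \<omega> t)\<^sup>2 \<partial>UI)) (distr \<Omega> borel (\<lambda>\<omega>. \<integral>t. (G \<omega> t)\<^sup>2 \<partial>UI))"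
proof -
  \<comment> \<open>The trace bound obtained from the samples is what makes the arbitrary process
    \<open>G\<close> square integrable.\<close>
  interpret gauss_proc \<Omega> G d Tr by unfold_locales (rule gp d_sqk d_trace; assumption?)+
  define w where "w j \<omega> = (\<integral>t. G \<omega> t * haar j t \<partial>UI)" for j \<omega>
  have sw: "sqint \<Omega> (w j)" for j unfolding w_def[abs_def]
    by (rule sqint_inner(1)[OF sigma_finite_measure_axioms sigma_finite_UI G_sqint_pair sqint_haar])
  have Dm: "(\<lambda>\<omega>. \<integral>t. (D k \<omega> t)\<^sup>2 \<partial>UI) \<in> borel_measurable M" for k
  proof (rule UI.borel_measurable_lebesgue_integral)
    show "(\<lambda>(\<omega>, t). (D k \<omega> t)\<^sup>2) \<in> borel_measurable (M \<Otimes>\<^sub>M UI)"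
      unfolding split_beta' by (rule borel_measurable_power[OF sqint_measurable[OF sqint_D]])
  qed
  note zm = sqint_measurable[OF sqint_z] and wm = sqint_measurable[OF sw]
  have sT: "summable (\<lambda>j. 2 * A.\<tau> j + 2 * B.\<tau> j)"
    by (intro summable_add summable_mult summable_\<tau>)
  have chars: "(\<lambda>k. char (distr M borel (\<lambda>\<omega>. \<Sum>j<J. \<xi> j * z k j \<omega>)) u)
     \<longlonglongrightarrow> char (distr \<Omega> borel (\<lambda>\<omega>. \<Sum>j<J. \<xi> j * w j \<omega>)) u" for J \<xi> u
  proof -
    \<comment> \<open>A combination of coordinates is the inner product with one function, which is
      bounded, as the Gaussian side requires, and in \<open>L2\<close>, as the independence
      assumption requires.\<close>
    define h where "h t = (\<Sum>j<J. \<xi> j * haar j t)" for t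
    have hb: "h \<in> borel_measurable borel"
      unfolding h_def[abs_def] by (intro borel_measurable_sum borel_measurable_times borel_measurable_const haar_borel)
    have sh: "sqint UI h" unfolding h_def[abs_def] by (intro sqint_sum sqint_cmult sqint_haar)
    have hL: "h \<in> L2" by (rule L2_I[OF hb sh])
    have "\<forall>j. \<exists>c. \<forall>t. \<bar>haar j t\<bar> \<le> c" using haar_bounded by simp
    from choice[OF this] obtain c where c0: "\<forall>j. \<forall>t. \<bar>haar j t\<bar> \<le> c j" by (rule exE)
    then have c: "\<bar>haar j t\<bar> \<le> c j" for j t by simp
    have hbd: "\<bar>h t\<bar> \<le> (\<Sum>j<J. \<bar>\<xi> j\<bar> * c j)" for t
    proof -
      have "\<bar>h t\<bar> \<le> (\<Sum>j<J. \<bar>\<xi> j * haar j t\<bar>)" unfolding h_def by (rule sum_abs)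
      also have "\<dots> \<le> (\<Sum>j<J. \<bar>\<xi> j\<bar> * c j)" unfolding abs_mult by (intro sum_mono mult_left_mono c) simp
      finally show ?thesis .
    qed
    have lin: "(\<Sum>j<J. \<xi> j * (\<integral>t. x t * haar j t \<partial>UI)) = (\<integral>t. x t * h t \<partial>UI)" if x: "sqint UI x" for x
    proof -
      have "(\<integral>t. x t * h t \<partial>UI) = (\<integral>t. (\<Sum>j<J. \<xi> j * (x t * haar j t)) \<partial>UI)"
        unfolding h_def by (simp add: sum_distrib_left mult_ac)
      also have "\<dots> = (\<Sum>j<J. \<xi> j * (\<integral>t. x t * haar j t \<partial>UI))"
        using sqint_integrable_mult[OF x sqint_haar] by simp
      finally show ?thesis ..
    qed
    have dM: "distr M borel (\<lambda>\<omega>. \<Sum>j<J. \<xi> j * z k j \<omega>) = distr M borel (\<lambda>\<omega>. \<alpha> k * A.Z h (Nk k) \<omega> - \<beta> k * B.Z h (Kk k) \<omega>)" for k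
    proof (rule distr_cong[OF refl refl])
      fix \<omega> assume \<omega>: "\<omega> \<in> space M"
      show "(\<Sum>j<J. \<xi> j * z k j \<omega>) = \<alpha> k * A.Z h (Nk k) \<omega> - \<beta> k * B.Z h (Kk k) \<omega>"
        unfolding z_def lin[OF D_path[OF \<omega>]] by (rule D_inner[OF \<omega> sh])
    qed
    have hU: "h \<in> borel_measurable UI" by (rule sqint_measurable[OF sh])
    have dO: "distr \<Omega> borel (\<lambda>\<omega>. \<Sum>j<J. \<xi> j * w j \<omega>) = distr \<Omega> borel (\<lambda>\<omega>. \<integral>t. G \<omega> t * h t \<partial>UI)"
    proof (rule distr_cong_AE[OF refl refl])
      show "AE \<omega> in \<Omega>. (\<Sum>j<J. \<xi> j * w j \<omega>) = (\<integral>t. G \<omega> t * h t \<partial>UI)"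
        using sqint_iterated(1)[OF sigma_finite_measure_axioms sigma_finite_UI G_sqint_pair]
      proof eventually_elim
        case (elim \<omega>)
        then have "sqint UI (G \<omega>)" by (simp only: fst_conv snd_conv)
        from lin[OF this] show ?case unfolding w_def .
      qed
      show "(\<lambda>\<omega>. \<Sum>j<J. \<xi> j * w j \<omega>) \<in> borel_measurable \<Omega>"
        by (intro borel_measurable_sum borel_measurable_times borel_measurable_const wm)
      show "(\<lambda>\<omega>. \<integral>t. G \<omega> t * h t \<partial>UI) \<in> borel_measurable \<Omega>"
        by (rule sqint_measurable[OF gauss_inner(1)[OF hU hbd]])
    qed
    show ?thesis unfolding dM dO gauss_inner(2)[OF hU hbd] by (rule char_comb[OF hL])
  qed
  show ?thesis
  proof (rule laplace_imp_weak_conv[OF A.prob_space_axioms prob_space_axioms Dm square_norm_measurable])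
    show "0 \<le> (\<integral>t. (D k x t)\<^sup>2 \<partial>UI)" for k x by simp
    show "0 \<le> (\<integral>t. (G x t)\<^sup>2 \<partial>UI)" for x by simp
    fix n :: nat
    define l where "l = real n"
    have l: "0 \<le> l" by (simp add: l_def)
    show "(\<lambda>k. \<integral>x. exp (- (real n * (\<integral>t. (D k x t)\<^sup>2 \<partial>UI))) \<partial>M) \<longlonglongrightarrow> (\<integral>x. exp (- (real n * (\<integral>t. (G x t)\<^sup>2 \<partial>UI))) \<partial>\<Omega>)"
      unfolding l_def[symmetric]
    proof (rule iterated_limit)
      show "(\<lambda>k. \<integral>x. exp (- (l * (\<Sum>j<J. (z k j x)\<^sup>2))) \<partial>M) \<longlonglongrightarrow> (\<integral>x. exp (- (l * (\<Sum>j<J. (w j x)\<^sup>2))) \<partial>\<Omega>)" for J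
        by (rule char_conv_imp_laplace_conv[OF A.prob_space_axioms prob_space_axioms zm wm l chars])
      show "(\<lambda>J. \<integral>x. exp (- (l * (\<Sum>j<J. (w j x)\<^sup>2))) \<partial>\<Omega>) \<longlonglongrightarrow> (\<integral>x. exp (- (l * (\<integral>t. (G x t)\<^sup>2 \<partial>UI))) \<partial>\<Omega>)"
        unfolding w_def by (rule limit_laplace[OF l])
      have "(\<lambda>J. l * ((\<Sum>j. 2 * A.\<tau> j + 2 * B.\<tau> j) - (\<Sum>j<J. 2 * A.\<tau> j + 2 * B.\<tau> j))) \<longlonglongrightarrow> l * ((\<Sum>j. 2 * A.\<tau> j + 2 * B.\<tau> j) - (\<Sum>j. 2 * A.\<tau> j + 2 * B.\<tau> j))"
        by (intro tendsto_intros summable_LIMSEQ[OF sT])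
      then show "(\<lambda>J. l * (\<Sum>j. 2 * A.\<tau> (j + J) + 2 * B.\<tau> (j + J))) \<longlonglongrightarrow> 0"
        unfolding suminf_minus_initial_segment[OF sT] by simp
      fix J k
      define Q where "Q \<omega> = (\<integral>t. (D k \<omega> t)\<^sup>2 \<partial>UI)" for \<omega>
      define R where "R \<omega> = (\<Sum>j<J. (z k j \<omega>)\<^sup>2)" for \<omega>
      have Qm: "Q \<in> borel_measurable M" unfolding Q_def[abs_def] by (rule Dm)
      have Rm: "R \<in> borel_measurable M" unfolding R_def[abs_def]
        by (intro borel_measurable_sum borel_measurable_power zm)
      have R0: "0 \<le> R \<omega>" for \<omega> by (simp add: R_def sum_nonneg)
      have RQ: "R \<omega> \<le> Q \<omega>" if "\<omega> \<in> space M" for \<omega>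
      proof -
        note s = haar_Parseval[OF D_path[OF that, of k]]
        have "R \<omega> \<le> (\<Sum>j. (z k j \<omega>)\<^sup>2)"
          unfolding R_def z_def by (rule sum_le_suminf[OF sums_summable[OF s]]) auto
        also have "\<dots> = Q \<omega>" unfolding z_def Q_def sums_unique[OF s, symmetric] l2norm_square ..
        finally show ?thesis .
      qed
      have iQ: "integrable M Q"
        unfolding Q_def[abs_def] l2norm_square[symmetric]
        using sqint_integrable_square[OF sqint_iterated(2)[OF A.sf_M A.sf_UI sqint_D[of k]]] by (simp only: fst_conv snd_conv)
      have EQ: "(\<integral>\<omega>. Q \<omega> \<partial>M) = (l2norm (M \<Otimes>\<^sub>M UI) (\<lambda>p. D k (fst p) (snd p)))\<^sup>2"
        unfolding sqint_iterated(3)[OF A.sf_M A.sf_UI sqint_D[of k], symmetric] l2norm_square[of M] Q_def l2norm_square[of UI]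
        by (simp only: fst_conv snd_conv)
      have iR: "integrable M R" unfolding R_def[abs_def]
        by (intro Bochner_Integration.integrable_sum sqint_integrable_square[OF sqint_z])
      have ER: "(\<integral>\<omega>. R \<omega> \<partial>M) = (\<Sum>j<J. (l2norm M (z k j))\<^sup>2)"
        unfolding R_def l2norm_square by (rule Bochner_Integration.integral_sum) (rule sqint_integrable_square[OF sqint_z])
      have le: "(\<integral>\<omega>. Q \<omega> \<partial>M) - (\<integral>\<omega>. R \<omega> \<partial>M) \<le> (\<Sum>j. 2 * A.\<tau> (j + J) + 2 * B.\<tau> (j + J))"
      proof -
        have "(\<lambda>j. (l2norm M (z k j))\<^sup>2) sums (l2norm (M \<Otimes>\<^sub>M UI) (\<lambda>p. D k (fst p) (snd p)))\<^sup>2"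
          using integrated_Parseval[OF A.sf_M sqint_D[of k]] unfolding z_def[abs_def] .
        from sums_tail_le[OF this sT l2norm_z] show ?thesis unfolding EQ ER .
      qed
      have ie: "integrable M (\<lambda>\<omega>. exp (- (l * X \<omega>)))" if "X \<in> borel_measurable M" "\<And>\<omega>. \<omega> \<in> space M \<Longrightarrow> 0 \<le> X \<omega>" for X
      proof (rule A.integrable_const_bound[of _ 1])
        show "(\<lambda>\<omega>. exp (- (l * X \<omega>))) \<in> borel_measurable M"
          by (intro measurable_compose[OF _ borel_measurable_exp] borel_measurable_uminus borel_measurable_times borel_measurable_const that)
        show "AE \<omega> in M. norm (exp (- (l * X \<omega>))) \<le> 1" using that(2) l by (intro AE_I2) simp
      qed
      have iQe: "integrable M (\<lambda>\<omega>. exp (- (l * Q \<omega>)))" by (rule ie[OF Qm]) (simp add: Q_def)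
      have iRe: "integrable M (\<lambda>\<omega>. exp (- (l * R \<omega>)))" by (rule ie[OF Rm R0])
      have "\<bar>(\<integral>\<omega>. exp (- (l * Q \<omega>)) \<partial>M) - (\<integral>\<omega>. exp (- (l * R \<omega>)) \<partial>M)\<bar> = \<bar>\<integral>\<omega>. exp (- (l * Q \<omega>)) - exp (- (l * R \<omega>)) \<partial>M\<bar>"
        using iQe iRe by simp
      also have "\<dots> \<le> (\<integral>\<omega>. \<bar>exp (- (l * Q \<omega>)) - exp (- (l * R \<omega>))\<bar> \<partial>M)" by (rule integral_abs_bound)
      also have "\<dots> \<le> (\<integral>\<omega>. l * (Q \<omega> - R \<omega>) \<partial>M)"
      proof (rule integral_mono)
        show "integrable M (\<lambda>\<omega>. \<bar>exp (- (l * Q \<omega>)) - exp (- (l * R \<omega>))\<bar>)" using iQe iRe by simp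
        show "integrable M (\<lambda>\<omega>. l * (Q \<omega> - R \<omega>))" using iQ iR by simp
        fix \<omega> assume \<omega>: "\<omega> \<in> space M"
        \<comment> \<open>For nonnegative \<open>x\<close> and \<open>y\<close>,
          \<open>exp (- x) - exp (- (x + y)) \<le> 1 - exp (- y) \<le> y\<close>.\<close>
        define x where "x = l * R \<omega>"
        define y where "y = l * (Q \<omega> - R \<omega>)"
        have x0: "0 \<le> x" and y0: "0 \<le> y" using l R0 RQ[OF \<omega>] by (simp_all add: x_def y_def)
        have "exp (- (x + y)) = exp (- x) * exp (- y)" by (simp add: exp_add[symmetric])
        then have "exp (- x) - exp (- (x + y)) = exp (- x) * (1 - exp (- y))" by (simp add: algebra_simps)
        also have "\<dots> \<le> 1 * (1 - exp (- y))" using x0 y0 by (intro mult_right_mono) auto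
        also have "\<dots> \<le> y" using exp_ge_add_one_self[of "- y"] by simp
        finally have "exp (- x) - exp (- (x + y)) \<le> y" .
        moreover have "exp (- (x + y)) \<le> exp (- x)" using y0 by simp
        moreover have "l * Q \<omega> = x + y" by (simp add: x_def y_def algebra_simps)
        ultimately show "\<bar>exp (- (l * Q \<omega>)) - exp (- (l * R \<omega>))\<bar> \<le> l * (Q \<omega> - R \<omega>)"
          unfolding x_def[symmetric] y_def[symmetric] by simp
      qed
      also have "\<dots> = l * ((\<integral>\<omega>. Q \<omega> \<partial>M) - (\<integral>\<omega>. R \<omega> \<partial>M))" using iQ iR by simp
      also have "\<dots> \<le> l * (\<Sum>j. 2 * A.\<tau> (j + J) + 2 * B.\<tau> (j + J))" by (rule mult_left_mono[OF le l])
      finally show "\<bar>(\<integral>x. exp (- (l * (\<integral>t. (D k x t)\<^sup>2 \<partial>UI))) \<partial>M) - (\<integral>x. exp (- (l * (\<Sum>j<J. (z k j x)\<^sup>2))) \<partial>M)\<bar>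
          \<le> l * (\<Sum>j. 2 * A.\<tau> (j + J) + 2 * B.\<tau> (j + J))"
        unfolding Q_def R_def .
    qed
  qed
qed

end

end

text \<open>The kernel determines the law of the integral, so the limit is described through an
  arbitrary process with that kernel, and the existence claim keeps this from being vacuous.
  Quantifying over pairs of sequences of sample sizes expresses the joint limit.\<close>

theorem theorem3:
  fixes M :: "'a measure"
    and S :: "'s measure" and \<delta> :: "int \<Rightarrow> 'a \<Rightarrow> 's" and f :: "(nat \<Rightarrow> 's) \<Rightarrow> real \<Rightarrow> real"
    and Ss :: "'t measure" and \<delta>s :: "int \<Rightarrow> 'a \<Rightarrow> 't" and fs :: "(nat \<Rightarrow> 't) \<Rightarrow> real \<Rightarrow> real"
    and eps eps_s :: "int \<Rightarrow> 'a \<Rightarrow> real \<Rightarrow> real"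
    and \<mu> \<mu>s :: "real \<Rightarrow> real"
    and \<theta> :: real
  assumes "prob_space M"
    and "error_assumptions M S \<delta> f eps"
    and "error_assumptions M Ss \<delta>s fs eps_s"
    and "\<mu> \<in> L2" and "\<mu>s \<in> L2"
    and "prob_space.indep_var M
           (PiM ({1..} \<times> L2) (\<lambda>_. borel))
           (\<lambda>\<omega>. \<lambda>p\<in>{1..} \<times> L2. LINT t:{0..1}|lborel. eps (fst p) \<omega> t * snd p t)
           (PiM ({1..} \<times> L2) (\<lambda>_. borel))
           (\<lambda>\<omega>. \<lambda>p\<in>{1..} \<times> L2. LINT t:{0..1}|lborel. eps_s (fst p) \<omega> t * snd p t)"
    and H0: "(LINT t:{0..1}|lborel. (\<mu> t - \<mu>s t)^2) = 0"
    and "0 \<le> \<theta>" and "\<theta> \<le> 1"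
  shows "(\<exists>(\<Omega> :: (nat \<Rightarrow> real) measure) G.
            gaussian_process \<Omega> G (\<lambda>t s. (1 - \<theta>) * lrcov M eps t s + \<theta> * lrcov M eps_s t s)) \<and>
         (\<forall>(\<Omega> :: 'b measure) G.
            gaussian_process \<Omega> G (\<lambda>t s. (1 - \<theta>) * lrcov M eps t s + \<theta> * lrcov M eps_s t s) \<longrightarrow>
            (\<forall>Nk Kk :: nat \<Rightarrow> nat.
               filterlim (\<lambda>k. min (Nk k) (Kk k)) at_top sequentially \<longrightarrow>
               (\<lambda>k. real (Nk k) / (real (Nk k) + real (Kk k))) \<longlonglongrightarrow> \<theta> \<longrightarrow>
               weak_conv_m
                 (\<lambda>k. distr M borel
                    (U_stat (\<lambda>i \<omega> t. \<mu> t + eps i \<omega> t) (\<lambda>j \<omega> t. \<mu>s t + eps_s j \<omega> t) (Nk k) (Kk k)))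
                 (distr \<Omega> borel (\<lambda>\<omega>. LINT t:{0..1}|lborel. (G \<omega> t)^2))))"
proof -
  interpret prob_space M by fact
  interpret two_sample M S \<delta> f eps Ss \<delta>s fs eps_s \<theta>
    by unfold_locales (rule assms)+
  have d: "(\<lambda>t s. (1 - \<theta>) * lrcov M eps t s + \<theta> * lrcov M eps_s t s) = d"
    by (simp add: fun_eq_iff d_def)
  have \<mu>: "sqint UI \<mu>" "sqint UI \<mu>s" using assms(4,5) by (simp_all add: L2_sqint)
  have "l2norm UI (\<lambda>t. \<mu> t - \<mu>s t) = 0" using H0 unfolding set_integral_UI l2norm_def by simp
  from l2norm_eq_0_imp_AE[OF sqint_diff[OF \<mu>] this]
  have \<mu>_eq: "AE t in UI. \<mu> t = \<mu>s t" by eventually_elim simp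
  have conv: "weak_conv_m
                 (\<lambda>k. distr M borel
                    (U_stat (\<lambda>i \<omega> t. \<mu> t + eps i \<omega> t) (\<lambda>j \<omega> t. \<mu>s t + eps_s j \<omega> t) (Nk k) (Kk k)))
                 (distr \<Omega> borel (\<lambda>\<omega>. LINT t:{0..1}|lborel. (G \<omega> t)^2))"
    if gp: "gaussian_process \<Omega> G d"
      and filt: "filterlim (\<lambda>k. min (Nk k) (Kk k)) at_top sequentially"
      and ratio: "(\<lambda>k. real (Nk k) / (real (Nk k) + real (Kk k))) \<longlonglongrightarrow> \<theta>"
    for \<Omega> :: "'b measure" and G and Nk Kk :: "nat \<Rightarrow> nat"
  proof -
    have "U_stat (\<lambda>i \<omega> t. \<mu> t + eps i \<omega> t) (\<lambda>j \<omega> t. \<mu>s t + eps_s j \<omega> t) (Nk k) (Kk k) \<omega>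
       = (\<integral>t. (D Nk Kk k \<omega> t)\<^sup>2 \<partial>UI)" if \<omega>: "\<omega> \<in> space M" for k \<omega>
    proof (cases "Nk k = 0 \<or> Kk k = 0")
      \<comment> \<open>With an empty sample both sides are 0: the factor of the statistic vanishes,
        and so do the empty normalised sum and the weight of the other one.\<close>
      case True
      then show ?thesis
        by (auto simp: U_stat_def D_def[OF filt ratio] \<alpha>_def[OF filt ratio] \<beta>_def[OF filt ratio] A.V_def B.V_def)
    next
      case False
      define N where "N = real (Nk k)"
      define K where "K = real (Kk k)"
      have NK: "0 < N" "0 < K" using False by (auto simp: N_def K_def)
      define x where "x t = (\<Sum>i=1..int (Nk k). eps i \<omega> t)" for t
      define y where "y t = (\<Sum>j=1..int (Kk k). eps_s j \<omega> t)" for t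
      \<comment> \<open>The normalisations combine by
        \<open>sqrt (K / (N + K)) / sqrt N = sqrt (N * K / (N + K)) / N\<close>, and
        symmetrically.\<close>
      have DD: "(D Nk Kk k \<omega> t)\<^sup>2 = N * K / (N + K) * (x t / N - y t / K)\<^sup>2" for t
      proof -
        have "D Nk Kk k \<omega> t = sqrt (N * K / (N + K)) * (x t / N - y t / K)"
        proof -
          have 1: "sqrt (K / (N + K)) * (x t / sqrt N) = sqrt (N * K / (N + K)) * (x t / N)"
            using NK by (simp add: real_sqrt_mult real_sqrt_divide field_simps)
          have 2: "sqrt (N / (N + K)) * (y t / sqrt K) = sqrt (N * K / (N + K)) * (y t / K)"
            using NK by (simp add: real_sqrt_mult real_sqrt_divide field_simps)
          show ?thesis
            unfolding D_def[OF filt ratio] \<alpha>_def[OF filt ratio] \<beta>_def[OF filt ratio] A.V_def B.V_def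
              N_def[symmetric] K_def[symmetric] x_def[symmetric] y_def[symmetric] 1 2 right_diff_distrib ..
        qed
        then show ?thesis using NK by (simp add: power_mult_distrib)
      qed
      have "U_stat (\<lambda>i \<omega> t. \<mu> t + eps i \<omega> t) (\<lambda>j \<omega> t. \<mu>s t + eps_s j \<omega> t) (Nk k) (Kk k) \<omega>
        = N * K / (N + K) * (\<integral>t. ((N * \<mu> t + x t) / N - (K * \<mu>s t + y t) / K)\<^sup>2 \<partial>UI)"
        unfolding U_stat_def set_integral_UI by (simp add: sum.distrib x_def y_def N_def K_def)
      also have "(\<integral>t. ((N * \<mu> t + x t) / N - (K * \<mu>s t + y t) / K)\<^sup>2 \<partial>UI) = (\<integral>t. (x t / N - y t / K)\<^sup>2 \<partial>UI)"
      proof (rule integral_cong_AE)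
        have xm: "x \<in> borel_measurable UI" unfolding x_def[abs_def]
          by (intro borel_measurable_sum sqint_measurable[OF L2_sqint[OF A.eps_L2[OF \<omega>]]])
        have ym: "y \<in> borel_measurable UI" unfolding y_def[abs_def]
          by (intro borel_measurable_sum sqint_measurable[OF L2_sqint[OF B.eps_L2[OF \<omega>]]])
        note mm = sqint_measurable[OF \<mu>(1)] sqint_measurable[OF \<mu>(2)]
        show "(\<lambda>t. ((N * \<mu> t + x t) / N - (K * \<mu>s t + y t) / K)\<^sup>2) \<in> borel_measurable UI"
          by (intro borel_measurable_power borel_measurable_diff borel_measurable_divide borel_measurable_add
              borel_measurable_times borel_measurable_const mm xm ym)
        show "(\<lambda>t. (x t / N - y t / K)\<^sup>2) \<in> borel_measurable UI"
          by (intro borel_measurable_power borel_measurable_diff borel_measurable_divide borel_measurable_const xm ym)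
        show "AE t in UI. ((N * \<mu> t + x t) / N - (K * \<mu>s t + y t) / K)\<^sup>2 = (x t / N - y t / K)\<^sup>2"
          using \<mu>_eq by eventually_elim (use NK in \<open>simp add: add_divide_distrib\<close>)
      qed
      finally show ?thesis unfolding DD by simp
    qed
    then have "distr M borel (U_stat (\<lambda>i \<omega> t. \<mu> t + eps i \<omega> t) (\<lambda>j \<omega> t. \<mu>s t + eps_s j \<omega> t) (Nk k) (Kk k))
       = distr M borel (\<lambda>\<omega>. \<integral>t. (D Nk Kk k \<omega> t)\<^sup>2 \<partial>UI)" for k
      by (rule distr_cong[OF refl refl])
    then show ?thesis
      unfolding set_integral_UI using weak_convergence[OF filt ratio gp] by simp
  qed
  show ?thesis unfolding d using limit_process_exists conv by blast
qed

end
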